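(* (1) In case (1) ($G=G_1$, $V=W$), the map $\alpha_V : G_k\setminus V_k^{\mathrm{ss}}\to \mathfrak{Ex}_2$ is bijective. Moreover, if $x\in V_k^{\mathrm{ss}}$ corresponds to a quadratic extension $k(\alpha)/k$ with $\alpha\notin k$, $\alpha^2\in k$ (i.e. $\alpha_V(G_kx)=k(\alpha)$), then $G_x^0\cong \mathrm{SU}_\alpha(2,1)$ as algebraic groups over $k$. (2) In case (2) ($G=G_1\times\mathrm{GL}(2)$, $V=W\otimes k^2$), $\alpha_V^{-1}(k)$ consists of a single orbit, and if $k(\alpha)/k$ is a quadratic extension with $\alpha\notin k$, $\alpha^2\in k$, then $$\alpha_V^{-1}(k(\alpha))\cong (\mathbb{Z}/2\mathbb{Z})\setminus k^\times/\mathrm{N}_{k(\alpha)/k}(k(\alpha)^\times),$$ where the non-trivial element of $\mathbb{Z}/2\mathbb{Z}$ acts on $k^\times/\mathrm{N}_{k(\alpha)/k}(k(\alpha)^\times)$ by $s\mapsto s^{-1}$. Moreover, if $x\in\alpha_V^{-1}(k(\alpha))$ corresponds to $s\in k^\times$, then $G_x^0/\widetilde T$ is isomorphic over $k$ to the unitary group associated with the Hermitian matrix $\begin{pmatrix}-s&0\\0&1\end{pmatrix}$.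
   Context: $k$ is a field of characteristic zero with algebraic closure $\overline{k}$. $\mathfrak{Ex}_2$ is the set of isomorphism classes of Galois extensions of $k$ that are splitting fields of degree 2 equations (i.e. $k$ itself and the quadratic extensions). $W=k^7$ (column vectors) with standard basis $e_1,\dots,e_7$, $e_{ij}=e_i\wedge e_j$, $e_{ijk}=e_i\wedge e_j\wedge e_k$, and $\overline{w}=e_{234}+e_{567}+e_1\wedge(e_{25}+e_{36}+e_{47})\in\wedge^3W$. $G_1$ is the closed $k$-subgroup of $\mathrm{GL}(7)$ of all $g$ with $g\overline{w}=c(g)\overline{w}$ for some $c(g)\in\mathrm{GL}(1)$. For $x={}^t(x_1,\dots,x_7)$ put $\Delta(x)=x_1^2-4(x_2x_5+x_3x_6+x_4x_7)$; it is a relative invariant for $G_1$. Case (1): $G=G_1$, $V=W$, $V^{\mathrm{ss}}=\{x:\Delta(x)\ne0\}$, base point $w=e_1$. Case (2): $G=G_1\times\mathrm{GL}(2)$, $V=W\otimes k^2$ regarded as the space of linear forms $M(v)=v_1x_1+v_2x_2$ in $v=(v_1,v_2)$ with $x_1,x_2\in W$, and $(g_1,g_2)\in G$ acts by $M(v)\mapsto g_1M(vg_2)$. For $x=(x_1,x_2)\in V$ put $F_x(v)=\Delta(v_1x_1+v_2x_2)$, a binary quadratic form; $V^{\mathrm{ss}}$ is the set of $x$ such that the discriminant of $F_x$ is non-zero. Base point $w=v_1e_2+v_2e_5$. $\widetilde T=\mathrm{Ker}(G\to\mathrm{GL}(V))=\{(t^{-1}I_7,tI_2)\mid t\in\mathrm{GL}(1)\}$.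 In both cases $V^{\mathrm{ss}}_{\overline k}$ is a single $G_{\overline k}$-orbit; $G_x$ is the stabilizer of $x$ and $G_x^0$ its identity component; $G_w/G_w^0$ is the constant group $\mathbb{Z}/2\mathbb{Z}$ (with trivial Galois action). The Galois group acts on the right, $x\mapsto x^\eta$. Definition of $\alpha_V$: for $x\in V_k^{\mathrm{ss}}$ choose $g\in G_{\overline k}$ with $x=gw$; the cocycle $\eta\mapsto g^{-1}g^\eta\in G_{w\overline k}$ composed with $G_w\to G_w/G_w^0\cong\mathbb{Z}/2\mathbb{Z}$ is a homomorphism $\mathrm{Gal}(\overline k/k)\to\mathbb{Z}/2\mathbb{Z}$, and $\alpha_V(G_kx)$ is the fixed field of its kernel. Let $k(\alpha)/k$ be quadratic with $\alpha^2\in k$, $\sigma$ the non-trivial element of $\mathrm{Gal}(k(\alpha)/k)$, ${}^*A={}^tA^\sigma$. For a $k$-algebra $R$, let $R(\alpha)=R\otimes_kk(\alpha)$ with $\sigma$ acting on the second factor. With $\Lambda_3=\mathrm{diag}(1,1,-1)$, $\mathrm{SU}_\alpha(2,1)$ is the $k$-group with $R$-points $\{A\in\mathrm{SL}(3)_{R(\alpha)}\mid A\Lambda_3{}^*A=\Lambda_3\}$. The unitary group associated with a non-degenerate $2\times2$ Hermitian matrix $H$ over $k(\alpha)$ is the $k$-group with $R$-points $\{A\in\mathrm{GL}(2)_{R(\alpha)}\mid AH\,{}^*A=H\}$. The correspondence in (2): let $$h_0=\begin{pmatrix}0&-1&0&0&1&0&0\\ \frac12&\frac12&0&0&\frac12&0&0\\0&0&\frac12&-\frac12&0&-\frac12&-\frac12\\0&0&\frac12&\frac12&0&\frac12&-\frac12\\-\frac12&\frac12&0&0&\frac12&0&0\\0&0&-\frac12&-\frac12&0&\frac12&-\frac12\\0&0&\frac12&-\frac12&0&\frac12&\frac12\end{pmatrix},$$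 $g_{\alpha,1}=\alpha\,\mathrm{diag}(1,\alpha,1,\alpha^{-1},\alpha^{-1},1,\alpha)\,h_0$, $g_{\alpha,2}=\begin{pmatrix}1&1\\\alpha&-\alpha\end{pmatrix}$, $g_\alpha=(g_{\alpha,1},g_{\alpha,2})\in G_{k(\alpha)}$. For $s\in k^\times$ let $w(s)=v_1\left(\frac{1+s}{2}e_3+\frac{1-s}{2}e_4\right)+v_2\left(\frac{1+s}{2}e_6-\frac{1-s}{2}e_7\right)$ and $w_\alpha(s)=g_\alpha w(s)\in V_k^{\mathrm{ss}}$. The bijection in (2) is the one induced by $s\mapsto G_kw_\alpha(s)$, and $x$ corresponds to $s$ if $x\in G_kw_\alpha(s)$. *)

theory Defs
  imports
    "HOL-Analysis.Analysis"
    "HOL-Algebra.Algebraic_Closure_Type"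
    "HOL-Algebra.Generated_Fields"
    "HOL-Algebra.Group_Action"
begin

section \<open>Linear algebraic groups over a field \<open>k\<close> of characteristic zero\<close>

text \<open>
  An affine algebraic \<open>k\<close>-group is given by its group of points over the algebraic closure
  \<open>'k alg_closure\<close> together with a set \<open>coords\<close> of functions generating its coordinate ring over
  \<open>k\<close>. In characteristic zero every algebraic group is smooth, so this loses nothing. The same
  record over \<open>'k\<close> itself is used for groups of \<open>k\<close>-rational points.
\<close>

record ('g, 'a) alg_group = "'g monoid" + coords :: "('g \<Rightarrow> 'a) set"

text \<open>The \<open>C\<close>-algebra of functions generated by \<open>S\<close>, for a subfield \<open>C\<close>.\<close>

inductive_set regular_funs :: "'a::comm_ring_1 set \<Rightarrow> ('g \<Rightarrow> 'a) set \<Rightarrow> ('g \<Rightarrow> 'a) set"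
  for C S where
  const: "c \<in> C \<Longrightarrow> (\<lambda>_. c) \<in> regular_funs C S"
| coord: "f \<in> S \<Longrightarrow> f \<in> regular_funs C S"
| add: "f \<in> regular_funs C S \<Longrightarrow> g \<in> regular_funs C S \<Longrightarrow> (\<lambda>x. f x + g x) \<in> regular_funs C S"
| mult: "f \<in> regular_funs C S \<Longrightarrow> g \<in> regular_funs C S \<Longrightarrow> (\<lambda>x. f x * g x) \<in> regular_funs C S"

definition zariski :: "('g, 'a::field) alg_group \<Rightarrow> 'g topology" where
  "zariski G = topology_generated_by
     {{x \<in> carrier G. f x \<noteq> 0} |f. f \<in> regular_funs UNIV (coords G)}"

definition identity_component :: "('g, 'a::field) alg_group \<Rightarrow> ('g, 'a) alg_group" where
  "identity_component G = G\<lparr>carrier := connected_component_of_set (zariski G) \<one>\<^bsub>G\<^esub>\<rparr>"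

definition stab_group ::
  "('g, 'a) alg_group \<Rightarrow> ('g \<Rightarrow> 'v \<Rightarrow> 'v) \<Rightarrow> 'v \<Rightarrow> ('g, 'a) alg_group" where
  "stab_group G act x = G\<lparr>carrier := stabilizer G act x\<rparr>"

definition prod_group ::
  "('g, 'a) alg_group \<Rightarrow> ('h, 'a) alg_group \<Rightarrow> ('g \<times> 'h, 'a) alg_group" where
  "prod_group G H =
     \<lparr>carrier = carrier G \<times> carrier H,
      monoid.mult = (\<lambda>(g, h) (g', h'). (g \<otimes>\<^bsub>G\<^esub> g', h \<otimes>\<^bsub>H\<^esub> h')),
      one = (\<one>\<^bsub>G\<^esub>, \<one>\<^bsub>H\<^esub>),
      coords = {\<lambda>x. f (fst x) |f. f \<in> coords G} \<union> {\<lambda>x. f (snd x) |f. f \<in> coords H}\<rparr>"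

definition k_regular_map ::
  "('g, 'k::field alg_closure) alg_group \<Rightarrow> ('h, 'k alg_closure) alg_group \<Rightarrow> ('g \<Rightarrow> 'h) \<Rightarrow> bool" where
  "k_regular_map G H f \<longleftrightarrow>
     (\<forall>c \<in> coords H. \<exists>p \<in> regular_funs (range to_ac) (coords G). \<forall>x \<in> carrier G. c (f x) = p x)"

definition k_isomorphic ::
  "('g, 'k::field alg_closure) alg_group \<Rightarrow> ('h, 'k alg_closure) alg_group \<Rightarrow> bool" where
  "k_isomorphic G H \<longleftrightarrow>
     (\<exists>f \<in> iso G H. k_regular_map G H f \<and> k_regular_map H G (inv_into (carrier G) f))"

text \<open>
  The quotient by a closed normal subgroup \<open>N\<close>: the group of cosets, with coordinate ring the
  \<open>N\<close>-invariants of \<open>k[G]\<close>, i.e. the functions whose pullback to \<open>G\<close> is regular over \<open>k\<close>.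
\<close>

definition quotient_group ::
  "('g, 'k::field alg_closure) alg_group \<Rightarrow> 'g set \<Rightarrow> ('g set, 'k alg_closure) alg_group" where
  "quotient_group G N =
     \<lparr>carrier = carrier (G Mod N), monoid.mult = monoid.mult (G Mod N), one = one (G Mod N),
      coords = {F. \<exists>p \<in> regular_funs (range to_ac) (coords G).
                     \<forall>g \<in> carrier G. F (N #>\<^bsub>G\<^esub> g) = p g}\<rparr>"

section \<open>Galois theory and the map \<open>\<alpha>\<^sub>V\<close>\<close>

definition Gal :: "('k::field alg_closure \<Rightarrow> 'k alg_closure) set" where
  "Gal = {\<eta>. bij \<eta> \<and> (\<forall>x y. \<eta> (x + y) = \<eta> x + \<eta> y) \<and> (\<forall>x y. \<eta> (x * y) = \<eta> x * \<eta> y) \<and>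
             (\<forall>c. \<eta> (to_ac c) = to_ac c)}"

definition fixed_field :: "('k::field alg_closure \<Rightarrow> 'k alg_closure) set \<Rightarrow> 'k alg_closure set" where
  "fixed_field S = {z. \<forall>\<eta> \<in> S. \<eta> z = z}"

definition adjoin :: "'k::field alg_closure set \<Rightarrow> 'k alg_closure set" where
  "adjoin S = generate_field ring_of_type_algebra (range to_ac \<union> S)"

text \<open>
  An isomorphism class of Galois extensions of \<open>k\<close> has exactly one member inside the algebraic
  closure, which represents it here.
\<close>

definition Ex2 :: "'k::field alg_closure set set" where
  "Ex2 = {adjoin {z. poly (map_poly to_ac p) z = 0} |p :: 'k poly. Polynomial.degree p = 2}"

text \<open>
  For a group \<open>G\<close> over the algebraic closure acting by \<open>act\<close>, with Galois action \<open>gal\<close> on \<open>G\<close>,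
  base change \<open>bc\<close> from \<open>k\<close>-rational vectors and base point \<open>w\<close>. The set of \<open>\<eta>\<close> below is the
  kernel of the composite of the cocycle \<open>\<eta> \<mapsto> g\<^sup>-\<^sup>1g\<^sup>\<eta>\<close> with \<open>G\<^sub>w \<rightarrow> G\<^sub>w/G\<^sub>w\<^sup>0\<close>; it depends neither
  on the representative \<open>x\<close> of the orbit \<open>Ob\<close> nor on \<open>g\<close>.
\<close>

definition alpha_V ::
  "('g, 'k::field alg_closure) alg_group \<Rightarrow> ('g \<Rightarrow> 'w \<Rightarrow> 'w) \<Rightarrow>
   (('k alg_closure \<Rightarrow> 'k alg_closure) \<Rightarrow> 'g \<Rightarrow> 'g) \<Rightarrow> ('v \<Rightarrow> 'w) \<Rightarrow> 'w \<Rightarrow>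
   'v set \<Rightarrow> 'k alg_closure set" where
  "alpha_V G act gal bc w Ob =
     (let Gw = stab_group G act w; Gw0 = carrier (identity_component Gw) in
      THE L. \<forall>x \<in> Ob. \<forall>g \<in> carrier G. bc x = act g w \<longrightarrow>
        L = fixed_field
              {\<eta> \<in> Gal. Gw0 #>\<^bsub>Gw\<^esub> (inv\<^bsub>G\<^esub> g \<otimes>\<^bsub>G\<^esub> gal \<eta> g) = \<one>\<^bsub>Gw Mod Gw0\<^esub>})"

section \<open>The prehomogeneous vector spaces\<close>

definition GL :: "('a::field ^ 'n ^ 'n, 'a) alg_group" where
  "GL = \<lparr>carrier = {g. invertible g}, monoid.mult = (**), one = mat 1,
         coords = {\<lambda>g. g $ i $ j |i j. True} \<union> {\<lambda>g. inverse (det g)}\<rparr>"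

text \<open>\<open>\<and>\<^sup>3W\<close> is realised as the space of alternating tensors in \<open>W \<otimes> W \<otimes> W\<close> (characteristic zero).\<close>

definition wedge3 :: "'a::comm_ring_1 ^ 7 \<Rightarrow> 'a ^ 7 \<Rightarrow> 'a ^ 7 \<Rightarrow> 'a ^ 7 ^ 7 ^ 7" where
  "wedge3 u v w = (\<chi> i j l. det (vector [vector [u $ i, u $ j, u $ l],
                                         vector [v $ i, v $ j, v $ l],
                                         vector [w $ i, w $ j, w $ l]] :: 'a ^ 3 ^ 3))"

definition wedge3_act :: "'a::comm_ring_1 ^ 7 ^ 7 \<Rightarrow> 'a ^ 7 ^ 7 ^ 7 \<Rightarrow> 'a ^ 7 ^ 7 ^ 7" where
  "wedge3_act g t = (\<chi> i j l. \<Sum>p\<in>UNIV. \<Sum>q\<in>UNIV. \<Sum>r\<in>UNIV.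
                       g $ i $ p * g $ j $ q * g $ l $ r * t $ p $ q $ r)"

definition evec :: "7 \<Rightarrow> 'a::comm_ring_1 ^ 7" where
  "evec i = axis i 1"

definition wbar :: "'a::comm_ring_1 ^ 7 ^ 7 ^ 7" where
  "wbar = wedge3 (evec 2) (evec 3) (evec 4) + wedge3 (evec 5) (evec 6) (evec 7) +
          (wedge3 (evec 1) (evec 2) (evec 5) + wedge3 (evec 1) (evec 3) (evec 6) + wedge3 (evec 1) (evec 4) (evec 7))"

definition G1 :: "('a::field ^ 7 ^ 7, 'a) alg_group" where
  "G1 = GL\<lparr>carrier := {g. invertible g \<and>
             (\<exists>c. c \<noteq> 0 \<and> (\<forall>i j l. wedge3_act g wbar $ i $ j $ l = c * wbar $ i $ j $ l))}\<rparr>"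

definition Delta :: "'a::comm_ring_1 ^ 7 \<Rightarrow> 'a" where
  "Delta x = (x $ 1)^2 - 4 * (x $ 2 * x $ 5 + x $ 3 * x $ 6 + x $ 4 * x $ 7)"

subsection \<open>Case (1)\<close>

definition Vss1 :: "('a::field ^ 7) set" where
  "Vss1 = {x. Delta x \<noteq> 0}"

definition base_change1 :: "'k::field ^ 7 \<Rightarrow> 'k alg_closure ^ 7" where
  "base_change1 x = (\<chi> i. to_ac (x $ i))"

definition alpha1 :: "('k::field ^ 7) set \<Rightarrow> 'k alg_closure set" where
  "alpha1 = alpha_V G1 (*v) map_matrix base_change1 (evec 1)"

subsection \<open>Case (2)\<close>

text \<open>An element \<open>x = (x\<^sub>1, x\<^sub>2)\<close> of \<open>W \<otimes> k\<^sup>2\<close> is given by its components \<open>x $ 1\<close> and \<open>x $ 2\<close>.\<close>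

definition linform :: "'a::field ^ 7 ^ 2 \<Rightarrow> 'a ^ 2 \<Rightarrow> 'a ^ 7" where
  "linform x v = v $ 1 *s x $ 1 + v $ 2 *s x $ 2"

definition G2 :: "(('a::field ^ 7 ^ 7) \<times> ('a ^ 2 ^ 2), 'a) alg_group" where
  "G2 = prod_group G1 GL"

text \<open>\<open>M(v) \<mapsto> g\<^sub>1 M(v g\<^sub>2)\<close>; the components of the new form are its values at \<open>(1,0)\<close> and \<open>(0,1)\<close>.\<close>

definition act2 :: "('a::field ^ 7 ^ 7) \<times> ('a ^ 2 ^ 2) \<Rightarrow> 'a ^ 7 ^ 2 \<Rightarrow> 'a ^ 7 ^ 2" where
  "act2 g x = (\<chi> i. fst g *v linform x (axis i 1 v* snd g))"

definition quad_form :: "'a::field ^ 7 ^ 2 \<Rightarrow> 'a ^ 2 \<Rightarrow> 'a" where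
  "quad_form x v = Delta (linform x v)"

text \<open>The discriminant \<open>B\<^sup>2 - 4AC\<close> of the binary quadratic form \<open>q(v) = Av\<^sub>1\<^sup>2 + Bv\<^sub>1v\<^sub>2 + Cv\<^sub>2\<^sup>2\<close>.\<close>

definition disc :: "('a::field ^ 2 \<Rightarrow> 'a) \<Rightarrow> 'a" where
  "disc q = (let A = q (vector [1, 0]); C = q (vector [0, 1]); B = q (vector [1, 1]) - A - C
             in B^2 - 4 * A * C)"

definition Vss2 :: "('a::field ^ 7 ^ 2) set" where
  "Vss2 = {x. disc (quad_form x) \<noteq> 0}"

definition alpha2 :: "('k::field ^ 7 ^ 2) set \<Rightarrow> 'k alg_closure set" where
  "alpha2 = alpha_V G2 act2 (\<lambda>\<eta> g. (map_matrix \<eta> (fst g), map_matrix \<eta> (snd g)))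
              (map_matrix to_ac) (vector [evec 2, evec 5])"

definition Ttilde :: "(('a::field ^ 7 ^ 7) \<times> ('a ^ 2 ^ 2)) set" where
  "Ttilde = {(mat (inverse t), mat t) |t. t \<noteq> 0}"

section \<open>Unitary groups\<close>

text \<open>
  \<open>R(\<alpha>) = R \<otimes>\<^sub>k k(\<alpha>)\<close> for a \<open>k\<close>-algebra \<open>R\<close>, where \<open>a\<close> is the image in \<open>R\<close> of \<open>\<alpha>\<^sup>2\<close>; the pair \<open>(x, y)\<close>
  stands for \<open>x \<otimes> 1 + y \<otimes> \<alpha>\<close>.
\<close>

definition quad_ring :: "'r::comm_ring_1 \<Rightarrow> ('r \<times> 'r) ring" where
  "quad_ring a =
     \<lparr>carrier = UNIV,
      monoid.mult = (\<lambda>(x, y) (x', y'). (x * x' + a * y * y', x * y' + y * x')),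
      one = (1, 0), ring.zero = (0, 0),
      add = (\<lambda>(x, y) (x', y'). (x + x', y + y'))\<rparr>"

definition quad_conj :: "'r::comm_ring_1 \<times> 'r \<Rightarrow> 'r \<times> 'r" where
  "quad_conj = (\<lambda>(x, y). (x, - y))"

definition qmult :: "'r::comm_ring_1 \<Rightarrow> ('r \<times> 'r) ^ 'n ^ 'n \<Rightarrow> ('r \<times> 'r) ^ 'n ^ 'n \<Rightarrow> ('r \<times> 'r) ^ 'n ^ 'n" where
  "qmult a A B =
     (\<chi> i j. \<Oplus>\<^bsub>quad_ring a\<^esub> l \<in> UNIV. A $ i $ l \<otimes>\<^bsub>quad_ring a\<^esub> B $ l $ j)"

definition qdiag :: "('n \<Rightarrow> 'r::comm_ring_1) \<Rightarrow> ('r \<times> 'r) ^ 'n ^ 'n" where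
  "qdiag d = (\<chi> i j. if i = j then (d i, 0) else (0, 0))"

definition qdet :: "'r::comm_ring_1 \<Rightarrow> ('r \<times> 'r) ^ 'n ^ 'n \<Rightarrow> 'r \<times> 'r" where
  "qdet a A =
     (\<Oplus>\<^bsub>quad_ring a\<^esub> p \<in> {p. p permutes (UNIV :: 'n set)}.
        (let m = (\<Otimes>\<^bsub>quad_ring a\<^esub> i \<in> UNIV. A $ i $ p i)
         in if evenperm p then m else \<ominus>\<^bsub>quad_ring a\<^esub> m))"

definition qadjoint :: "('r::comm_ring_1 \<times> 'r) ^ 'n ^ 'n \<Rightarrow> ('r \<times> 'r) ^ 'n ^ 'n" where
  "qadjoint A = (\<chi> i j. quad_conj (A $ j $ i))"

definition qcoords :: "(('r \<times> 'r) ^ 'n ^ 'n \<Rightarrow> 'r) set" where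
  "qcoords = {\<lambda>A. fst (A $ i $ j) |i j. True} \<union> {\<lambda>A. snd (A $ i $ j) |i j. True}"

definition SU21 :: "'r::comm_ring_1 \<Rightarrow> (('r \<times> 'r) ^ 3 ^ 3, 'r) alg_group" where
  "SU21 a = (let \<Lambda> = qdiag (\<lambda>i. if i = 3 then -1 else 1) in
     \<lparr>carrier = {A. qdet a A = \<one>\<^bsub>quad_ring a\<^esub> \<and> qmult a (qmult a A \<Lambda>) (qadjoint A) = \<Lambda>},
      monoid.mult = qmult a, one = qdiag (\<lambda>_. 1), coords = qcoords\<rparr>)"

text \<open>
  The inverse of \<open>A\<close> is \<open>H (qadjoint A) H\<^sup>-\<^sup>1\<close>, so the entries of \<open>A\<close> generate the coordinate ring and
  no inverse determinant is needed.
\<close>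

definition unitary_group ::
  "'r::comm_ring_1 \<Rightarrow> ('r \<times> 'r) ^ 2 ^ 2 \<Rightarrow> (('r \<times> 'r) ^ 2 ^ 2, 'r) alg_group" where
  "unitary_group a H =
     \<lparr>carrier = {A. (\<exists>B. qmult a A B = qdiag (\<lambda>_. 1) \<and> qmult a B A = qdiag (\<lambda>_. 1)) \<and>
                    qmult a (qmult a A H) (qadjoint A) = H},
      monoid.mult = qmult a, one = qdiag (\<lambda>_. 1), coords = qcoords\<rparr>"

section \<open>The parametrisation of orbits in case (2)\<close>

definition h0 :: "'a::field ^ 7 ^ 7" where
  "h0 = vector
    [vector [0, -1, 0, 0, 1, 0, 0],
     vector [1/2, 1/2, 0, 0, 1/2, 0, 0],
     vector [0, 0, 1/2, -1/2, 0, -1/2, -1/2],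
     vector [0, 0, 1/2, 1/2, 0, 1/2, -1/2],
     vector [-1/2, 1/2, 0, 0, 1/2, 0, 0],
     vector [0, 0, -1/2, -1/2, 0, 1/2, -1/2],
     vector [0, 0, 1/2, -1/2, 0, 1/2, 1/2]]"

definition diag :: "'a::zero ^ 'n \<Rightarrow> 'a ^ 'n ^ 'n" where
  "diag d = (\<chi> i j. if i = j then d $ i else 0)"

definition g_alpha :: "'a::field \<Rightarrow> ('a ^ 7 ^ 7) \<times> ('a ^ 2 ^ 2)" where
  "g_alpha \<alpha> =
     (mat \<alpha> ** diag (vector [1, \<alpha>, 1, inverse \<alpha>, inverse \<alpha>, 1, \<alpha>]) ** h0,
      vector [vector [1, 1], vector [\<alpha>, - \<alpha>]])"

definition w_s :: "'a::field \<Rightarrow> 'a ^ 7 ^ 2" where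
  "w_s s = vector [((1 + s) / 2) *s evec 3 + ((1 - s) / 2) *s evec 4,
                   ((1 + s) / 2) *s evec 6 - ((1 - s) / 2) *s evec 7]"

definition w_alpha :: "'k::field alg_closure \<Rightarrow> 'k \<Rightarrow> 'k alg_closure ^ 7 ^ 2" where
  "w_alpha \<alpha> s = act2 (g_alpha \<alpha>) (w_s (to_ac s))"

definition corresponds :: "'k::field alg_closure \<Rightarrow> 'k ^ 7 ^ 2 \<Rightarrow> 'k \<Rightarrow> bool" where
  "corresponds \<alpha> x s \<longleftrightarrow> (\<exists>y \<in> Vss2. map_matrix to_ac y = w_alpha \<alpha> s \<and> x \<in> orbit G2 act2 y)"

text \<open>\<open>N\<^sub>k\<^sub>(\<^sub>\<alpha>\<^sub>)\<^sub>/\<^sub>k(k(\<alpha>)\<^sup>\<times>)\<close> for \<open>a = \<alpha>\<^sup>2\<close>, the norm of \<open>z\<close> being \<open>z z\<^sup>\<sigma>\<close>.\<close>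

definition norm_group :: "'k::field \<Rightarrow> 'k set" where
  "norm_group a = {n. \<exists>z. z \<noteq> (0, 0) \<and> z \<otimes>\<^bsub>quad_ring a\<^esub> quad_conj z = (n, 0)}"

definition norm_quotient :: "'k::field \<Rightarrow> 'k set monoid" where
  "norm_quotient a = mult_of ring_of_type_algebra Mod norm_group a"

definition norm_coset :: "'k::field \<Rightarrow> 'k \<Rightarrow> 'k set" where
  "norm_coset a s = norm_group a #>\<^bsub>mult_of ring_of_type_algebra\<^esub> s"

text \<open>The orbit of a class under the action of \<open>\<int>/2\<int>\<close> by inversion.\<close>

definition inversion_orbit :: "'k::field \<Rightarrow> 'k set \<Rightarrow> 'k set set" where
  "inversion_orbit a C = {C, inv\<^bsub>norm_quotient a\<^esub> C}"

end

theory Submission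
  imports Defs
begin

no_notation fps_nth (infixl "$" 75)
hide_const (open) up_ring.coeff up_ring.monom Polynomials.degree Polynomials.lead_coeff module.smult

text \<open>
  The trivector determines the quadratic form \<open>\<Delta>\<close> up to a scalar, so \<open>G\<^sub>1\<close> consists of similitudes of
  \<open>\<Delta>\<close> (lemma \<open>scaling_imp_simil\<close>); this is proved on the Lie algebra of the stabilizer of the trivector,
  four elements of which already determine the invariant form. Conversely explicit unipotent elements and
  a copy of \<open>SL(3)\<close> give Witt type theorems over every field of characteristic zero: the isometries in
  \<open>G\<^sub>1\<close> are transitive on the vectors of a given nonzero norm (\<open>linkedI\<close>) and on the orthogonal pairs of
  given nonzero norms (\<open>orthogonal_pair_normal_form\<close>). Hence rational orbits of vectors are classified by
  \<open>\<Delta>(x)\<close> modulo squares, and rational orbits of pairs by the binary form \<open>F\<^sub>x\<close> up to equivalence and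
  square factors.

  The stabilizer of a base point is computed over the closure. It has a subgroup of index two that is
  parametrized by matrices and cut out by a character \<open>\<theta>\<close> with values \<open>1\<close> and \<open>-1\<close>; any two of
  its points lie on a rational curve, so it is the identity component (\<open>stab_evec1_clopen\<close>,
  \<open>stab_pair_clopen\<close>). As \<open>\<theta>\<close> extends to \<open>G\<close>, the homomorphism attached to \<open>x = gw\<close> is
  \<open>\<eta> \<mapsto> \<theta>(g)\<^sup>\<eta>/\<theta>(g)\<close>, and \<open>\<theta>(g)\<^sup>2\<close> is \<open>\<Delta>(x)\<close> for vectors and the discriminant of \<open>F\<^sub>x\<close> up to squares
  for pairs. So \<open>\<alpha>\<^sub>V\<close> adjoins the square root of this number (\<open>alpha_V_eq\<close>, \<open>alpha1_orbit\<close>,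
  \<open>alpha2_orbit\<close>), by Galois theory in the algebraic closure (\<open>Gal_moves\<close>). A pair whose field is \<open>k(\<alpha>)\<close>
  has the binary form \<open>s(x\<^sup>2 - a y\<^sup>2)\<close>, \<open>a = \<alpha>\<^sup>2\<close>, and two such forms give the same orbit exactly when their
  factors differ by a norm.

  For the stabilizers, multiplication by a vector \<open>x\<close> with \<open>\<Delta>(x) = a\<close> makes the complement of \<open>x\<close> a
  three-dimensional space over \<open>k(\<alpha>)\<close> with a hermitian form of diagonal \<open>(1/s, -s, 1)\<close>. In a basis over \<open>k\<close>
  the conjugate of \<open>SL(3)\<close> fixing \<open>x\<close> becomes the special unitary group of this form, acting on six
  coordinates over \<open>k\<close> (\<open>bigm_gmat\<close>). For \<open>s = -1\<close> this is \<open>SU\<^sub>\<alpha>(2,1)\<close>, and all maps are linear in the entries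
  (\<open>stabilizer_SU21\<close>). For pairs the stabilizer modulo scalars is the subgroup of matrices that split off
  the first coordinate, that is, the unitary group of \<open>diag(-s, 1)\<close> bordered by the conjugate of the
  determinant (\<open>stabilizer_unitary\<close>).
\<close>

section \<open>Vectors and matrices of size seven\<close>

lemma exhaust_7:
  fixes x :: 7
  shows "x = 1 \<or> x = 2 \<or> x = 3 \<or> x = 4 \<or> x = 5 \<or> x = 6 \<or> x = 7"
proof (induct x)
  case (of_int z)
  then have "z = 0 \<or> z = 1 \<or> z = 2 \<or> z = 3 \<or> z = 4 \<or> z = 5 \<or> z = 6" by fastforce
  then show ?case by auto
qed

lemma forall_7:
  "(\<forall>i::7. P i) \<longleftrightarrow> P 1 \<and> P 2 \<and> P 3 \<and> P 4 \<and> P 5 \<and> P 6 \<and> P 7"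
  by (metis exhaust_7)

lemma UNIV_7: "UNIV = {1, 2, 3, 4, 5, 6, 7::7}"
  using exhaust_7 by auto

lemma sum_7: "sum f (UNIV::7 set) = f 1 + f 2 + f 3 + f 4 + f 5 + f 6 + f 7"
  unfolding UNIV_7 by (simp add: ac_simps)

lemma vector_7 [simp]:
  "(vector [a,b,c,d,e,f,g] :: 'a::zero^7) $ 1 = a"
  "(vector [a,b,c,d,e,f,g] :: 'a::zero^7) $ 2 = b"
  "(vector [a,b,c,d,e,f,g] :: 'a::zero^7) $ 3 = c"
  "(vector [a,b,c,d,e,f,g] :: 'a::zero^7) $ 4 = d"
  "(vector [a,b,c,d,e,f,g] :: 'a::zero^7) $ 5 = e"
  "(vector [a,b,c,d,e,f,g] :: 'a::zero^7) $ 6 = f"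
  "(vector [a,b,c,d,e,f,g] :: 'a::zero^7) $ 7 = g"
  unfolding vector_def by simp_all

lemma evec_nth: "evec i $ j = (if j = i then 1 else 0)"
  by (simp add: evec_def axis_def)

lemma mv7: "(g *v x) $ i = g$i$1 * x$1 + g$i$2 * x$2 + g$i$3 * x$3 + g$i$4 * x$4
   + g$i$5 * x$5 + g$i$6 * x$6 + g$i$7 * x$7"
  for g :: "'a::comm_ring_1^7^'n"
  by (simp add: matrix_vector_mult_def sum_7)

lemma mm7: "(g ** h) $ i $ j = g$i$1 * h$1$j + g$i$2 * h$2$j + g$i$3 * h$3$j + g$i$4 * h$4$j
   + g$i$5 * h$5$j + g$i$6 * h$6$j + g$i$7 * h$7$j"
  for g :: "'a::comm_ring_1^7^'n"
  by (simp add: matrix_matrix_mult_def sum_7)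

lemma mv_evec: "g *v evec i = column i g"
  for g :: "'a::comm_ring_1^7^7"
  by (simp add: evec_def matrix_vector_mult_def column_def axis_def if_distrib cong: if_cong)

section \<open>The alternating tensor and its symmetries\<close>

lemma wedge3_nth: "wedge3 u v w $ i $ j $ l =
   u$i * v$j * w$l + u$j * v$l * w$i + u$l * v$i * w$j
   - u$i * v$l * w$j - u$j * v$i * w$l - u$l * v$j * w$i"
  by (simp add: wedge3_def det_3)

lemma wedge3_act_add: "wedge3_act g (s + t) = wedge3_act g s + wedge3_act g t"
  by (simp add: wedge3_act_def vec_eq_iff sum.distrib ring_distribs)

lemma sum_prod3:
  fixes a b c :: "'n::finite \<Rightarrow> 'a::comm_ring_1"
  shows "(\<Sum>p\<in>UNIV. \<Sum>q\<in>UNIV. \<Sum>r\<in>UNIV. a p * b q * c r) = sum a UNIV * sum b UNIV * sum c UNIV"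
  by (simp add: mult.assoc flip: sum_distrib_left sum_distrib_right)

lemma wedge3_act_tensor:
  fixes g :: "'a::comm_ring_1^7^7"
  shows "(\<Sum>p\<in>UNIV. \<Sum>q\<in>UNIV. \<Sum>r\<in>UNIV. g$i$p * g$j$q * g$l$r * (u$p * v$q * w$r))
     = (g *v u)$i * (g *v v)$j * (g *v w)$l"
  unfolding matrix_vector_mult_def vec_lambda_beta sum_prod3[symmetric]
  by (intro sum.cong refl) (simp add: ac_simps)

lemma wedge3_act_wedge3:
  fixes g :: "'a::comm_ring_1^7^7"
  shows "wedge3_act g (wedge3 u v w) = wedge3 (g *v u) (g *v v) (g *v w)"
proof -
  have "wedge3_act g (wedge3 u v w) $ i $ j $ l = wedge3 (g *v u) (g *v v) (g *v w) $ i $ j $ l"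
    for i j l
  proof -
    let ?S = "\<lambda>f. \<Sum>p\<in>UNIV. \<Sum>q\<in>UNIV. \<Sum>r\<in>UNIV. g$i$p * g$j$q * g$l$r * f p q r"
    have split: "?S (\<lambda>p q r. u$p * v$q * w$r + u$q * v$r * w$p + u$r * v$p * w$q
        - u$p * v$r * w$q - u$q * v$p * w$r - u$r * v$q * w$p) =
      ?S (\<lambda>p q r. u$p * v$q * w$r) + ?S (\<lambda>p q r. w$p * u$q * v$r) + ?S (\<lambda>p q r. v$p * w$q * u$r)
       - ?S (\<lambda>p q r. u$p * w$q * v$r) - ?S (\<lambda>p q r. v$p * u$q * w$r) - ?S (\<lambda>p q r. w$p * v$q * u$r)"
      unfolding sum.distrib[symmetric] sum_subtractf[symmetric]
      by (intro sum.cong refl) (simp add: algebra_simps)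
    show ?thesis
      unfolding wedge3_act_def vec_lambda_beta wedge3_nth split wedge3_act_tensor
      by (simp add: algebra_simps)
  qed
  then show ?thesis by (simp add: vec_eq_iff)
qed

lemma wbar_nth: "wbar $ i $ j $ k = wedge3 (evec 2) (evec 3) (evec 4) $ i $ j $ k
    + wedge3 (evec 5) (evec 6) (evec 7) $ i $ j $ k + (wedge3 (evec 1) (evec 2) (evec 5) $ i $ j $ k
    + wedge3 (evec 1) (evec 3) (evec 6) $ i $ j $ k + wedge3 (evec 1) (evec 4) (evec 7) $ i $ j $ k)"
  by (simp add: wbar_def)

text \<open>A triple of indices either has a repetition, where both functions vanish, or is a permutation of one of
  the 35 increasing triples.\<close>

lemma alternating_eqI:
  fixes f h :: "7 \<Rightarrow> 7 \<Rightarrow> 7 \<Rightarrow> 'a::field_char_0"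
  assumes f: "\<And>i j k. f i j k = - f j i k" "\<And>i j k. f i j k = - f i k j"
    and h: "\<And>i j k. h i j k = - h j i k" "\<And>i j k. h i j k = - h i k j"
    and eq: "f 1 2 3 = h 1 2 3" "f 1 2 4 = h 1 2 4" "f 1 2 5 = h 1 2 5" "f 1 2 6 = h 1 2 6" "f 1 2 7 = h 1 2 7"
      "f 1 3 4 = h 1 3 4" "f 1 3 5 = h 1 3 5" "f 1 3 6 = h 1 3 6" "f 1 3 7 = h 1 3 7"
      "f 1 4 5 = h 1 4 5" "f 1 4 6 = h 1 4 6" "f 1 4 7 = h 1 4 7"
      "f 1 5 6 = h 1 5 6" "f 1 5 7 = h 1 5 7" "f 1 6 7 = h 1 6 7"
      "f 2 3 4 = h 2 3 4" "f 2 3 5 = h 2 3 5" "f 2 3 6 = h 2 3 6" "f 2 3 7 = h 2 3 7"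
      "f 2 4 5 = h 2 4 5" "f 2 4 6 = h 2 4 6" "f 2 4 7 = h 2 4 7"
      "f 2 5 6 = h 2 5 6" "f 2 5 7 = h 2 5 7" "f 2 6 7 = h 2 6 7"
      "f 3 4 5 = h 3 4 5" "f 3 4 6 = h 3 4 6" "f 3 4 7 = h 3 4 7"
      "f 3 5 6 = h 3 5 6" "f 3 5 7 = h 3 5 7" "f 3 6 7 = h 3 6 7"
      "f 4 5 6 = h 4 5 6" "f 4 5 7 = h 4 5 7" "f 4 6 7 = h 4 6 7" "f 5 6 7 = h 5 6 7"
  shows "f i j k = h i j k"
proof -
  define d where "d i j k = f i j k - h i j k" for i j k
  have d: "d i j k = - d j i k" "d i j k = - d i k j" for i j k
    using f(1)[of i j k] h(1)[of i j k] f(2)[of i j k] h(2)[of i j k] by (simp_all add: d_def)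
  have diag: "d i i k = 0" "d i k k = 0" for i k
  proof -
    have "2 * d i i k = 0" "2 * d i k k = 0"
      using d(1)[of i i k] d(2)[of i k k] by (simp_all add: eq_neg_iff_add_eq_0 flip: mult_2)
    then show "d i i k = 0" "d i k k = 0" by simp_all
  qed
  have diag': "d k i k = 0" for i k using d(1)[of k i k] diag by simp
  have swap: "d j i k = 0" "d i k j = 0" "d j k i = 0" "d k i j = 0" "d k j i = 0" if "d i j k = 0" for i j k
  proof -
    show 1: "d j i k = 0" "d i k j = 0" using that d(1)[of i j k] d(2)[of i j k] by simp_all
    show 2: "d j k i = 0" "d k i j = 0" using 1 d(2)[of j i k] d(1)[of i k j] by simp_all
    show "d k j i = 0" using 2 d(2)[of k i j] by simp
  qed
  have "d 1 2 3 = 0" "d 1 2 4 = 0" "d 1 2 5 = 0" "d 1 2 6 = 0" "d 1 2 7 = 0"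
      "d 1 3 4 = 0" "d 1 3 5 = 0" "d 1 3 6 = 0" "d 1 3 7 = 0"
      "d 1 4 5 = 0" "d 1 4 6 = 0" "d 1 4 7 = 0"
      "d 1 5 6 = 0" "d 1 5 7 = 0" "d 1 6 7 = 0"
      "d 2 3 4 = 0" "d 2 3 5 = 0" "d 2 3 6 = 0" "d 2 3 7 = 0"
      "d 2 4 5 = 0" "d 2 4 6 = 0" "d 2 4 7 = 0"
      "d 2 5 6 = 0" "d 2 5 7 = 0" "d 2 6 7 = 0"
      "d 3 4 5 = 0" "d 3 4 6 = 0" "d 3 4 7 = 0"
      "d 3 5 6 = 0" "d 3 5 7 = 0" "d 3 6 7 = 0"
      "d 4 5 6 = 0" "d 4 5 7 = 0" "d 4 6 7 = 0" "d 5 6 7 = 0"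
    using eq by (simp_all add: d_def)
  note all = this this[THEN swap(1)] this[THEN swap(2)] this[THEN swap(3)] this[THEN swap(4)] this[THEN swap(5)]
  have "\<forall>i j k. d i j k = 0"
    unfolding forall_7 by (intro conjI; (rule diag diag' all))
  then have "d i j k = 0" by blast
  then show ?thesis by (simp add: d_def)
qed

lemma wact_wbar:
  fixes g :: "'a::comm_ring_1^7^7"
  shows "wedge3_act g wbar = wedge3 (column 2 g) (column 3 g) (column 4 g)
     + wedge3 (column 5 g) (column 6 g) (column 7 g) + (wedge3 (column 1 g) (column 2 g) (column 5 g)
     + wedge3 (column 1 g) (column 3 g) (column 6 g) + wedge3 (column 1 g) (column 4 g) (column 7 g))"
  by (simp add: wbar_def wedge3_act_add wedge3_act_wedge3 mv_evec)

text \<open>The images of the basis determine the tensor, and by alternation only 35 components matter.\<close>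

lemma wact_wbarI:
  fixes g :: "'a::field_char_0^7^7"
  defines "D i j k p q r \<equiv> g$i$p * g$j$q * g$k$r + g$j$p * g$k$q * g$i$r + g$k$p * g$i$q * g$j$r
     - g$i$p * g$k$q * g$j$r - g$j$p * g$i$q * g$k$r - g$k$p * g$j$q * g$i$r"
  defines "T i j k \<equiv> D i j k 2 3 4 + D i j k 5 6 7 + (D i j k 1 2 5 + D i j k 1 3 6 + D i j k 1 4 7)"
  assumes "T 1 2 3 = 0" "T 1 2 4 = 0" "T 1 2 5 = c" "T 1 2 6 = 0" "T 1 2 7 = 0"
      "T 1 3 4 = 0" "T 1 3 5 = 0" "T 1 3 6 = c" "T 1 3 7 = 0"
      "T 1 4 5 = 0" "T 1 4 6 = 0" "T 1 4 7 = c"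
      "T 1 5 6 = 0" "T 1 5 7 = 0" "T 1 6 7 = 0"
      "T 2 3 4 = c" "T 2 3 5 = 0" "T 2 3 6 = 0" "T 2 3 7 = 0"
      "T 2 4 5 = 0" "T 2 4 6 = 0" "T 2 4 7 = 0"
      "T 2 5 6 = 0" "T 2 5 7 = 0" "T 2 6 7 = 0"
      "T 3 4 5 = 0" "T 3 4 6 = 0" "T 3 4 7 = 0"
      "T 3 5 6 = 0" "T 3 5 7 = 0" "T 3 6 7 = 0"
      "T 4 5 6 = 0" "T 4 5 7 = 0" "T 4 6 7 = 0" "T 5 6 7 = c"
  shows "wedge3_act g wbar $ i $ j $ k = c * wbar $ i $ j $ k"
proof -
  have T: "wedge3_act g wbar $ i $ j $ k = T i j k" for i j k
    unfolding wact_wbar vector_add_component wedge3_nth column_def vec_lambda_beta T_def D_def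
    by (simp add: algebra_simps)
  show ?thesis
    unfolding T
  proof (rule alternating_eqI[where f = T and h = "\<lambda>i j k. c * wbar $ i $ j $ k"])
    show "T i j k = - T j i k" "T i j k = - T i k j" for i j k
      by (simp_all add: T_def D_def)
    show "c * wbar $ i $ j $ k = - (c * wbar $ j $ i $ k)" for i j k
      unfolding wbar_nth wedge3_nth by (simp add: algebra_simps)
    show "c * wbar $ i $ j $ k = - (c * wbar $ i $ k $ j)" for i j k
      unfolding wbar_nth wedge3_nth by (simp add: algebra_simps)
  qed (simp_all add: assms(3-) wbar_nth wedge3_nth evec_nth)
qed

text \<open>The first condition implies the second for invertible matrices; both multipliers are recorded because the
  characters used below are monomials in them.\<close>

definition simil :: "'a::comm_ring_1^7^7 \<Rightarrow> 'a \<Rightarrow> 'a \<Rightarrow> bool" where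
  "simil g c l \<longleftrightarrow> (\<forall>i j k. wedge3_act g wbar $ i $ j $ k = c * wbar $ i $ j $ k) \<and>
                    (\<forall>x. Delta (g *v x) = l * Delta x)"

text \<open>The exponential of a nilpotent element of the Lie algebra of \<open>G\<^sub>2\<close>; it carries
  \<open>e\<^sub>1\<close> to \<open>e\<^sub>1 + a e\<^sub>2 + b e\<^sub>3 + c e\<^sub>4\<close>.\<close>

definition up_shear :: "'a::comm_ring_1 \<Rightarrow> 'a \<Rightarrow> 'a \<Rightarrow> 'a^7^7" where
  "up_shear a b c = vector [
     vector [1, 0, 0, 0, 2*a, 2*b, 2*c],
     vector [a, 1, 0, 0, a*a, a*b, a*c],
     vector [b, 0, 1, 0, b*a, b*b, b*c],
     vector [c, 0, 0, 1, c*a, c*b, c*c],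
     vector [0, 0, -c, b, 1, 0, 0],
     vector [0, c, 0, -a, 0, 1, 0],
     vector [0, -b, a, 0, 0, 0, 1]]"

lemma simil_up_shear: "simil (up_shear a b c :: 'a::field_char_0^7^7) 1 1"
  unfolding simil_def
proof (intro conjI allI)
  show "Delta (up_shear a b c *v x) = 1 * Delta x" for x
    by (simp add: Delta_def mv7 up_shear_def power2_eq_square algebra_simps)
  show "wedge3_act (up_shear a b c :: 'a^7^7) wbar $ i $ j $ k = 1 * wbar $ i $ j $ k" for i j k
    by (rule wact_wbarI; unfold up_shear_def vector_7; simp add: algebra_simps)
qed

definition down_shear :: "'a::comm_ring_1 \<Rightarrow> 'a \<Rightarrow> 'a \<Rightarrow> 'a^7^7" where
  "down_shear a b c = vector [
     vector [1, 2*a, 2*b, 2*c, 0, 0, 0],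
     vector [0, 1, 0, 0, 0, c, -b],
     vector [0, 0, 1, 0, -c, 0, a],
     vector [0, 0, 0, 1, b, -a, 0],
     vector [a, a*a, a*b, a*c, 1, 0, 0],
     vector [b, b*a, b*b, b*c, 0, 1, 0],
     vector [c, c*a, c*b, c*c, 0, 0, 1]]"

lemma simil_down_shear: "simil (down_shear a b c :: 'a::field_char_0^7^7) 1 1"
  unfolding simil_def
proof (intro conjI allI)
  show "Delta (down_shear a b c *v x) = 1 * Delta x" for x
    by (simp add: Delta_def mv7 down_shear_def power2_eq_square algebra_simps)
  show "wedge3_act (down_shear a b c :: 'a^7^7) wbar $ i $ j $ k = 1 * wbar $ i $ j $ k" for i j k
    by (rule wact_wbarI; unfold down_shear_def vector_7; simp add: algebra_simps)
qed

text \<open>The subgroup \<open>SL(3)\<close> of \<open>G\<^sub>2\<close> arises for \<open>D\<close> the inverse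
  transpose of \<open>A\<close>.\<close>

definition block :: "'a::comm_ring_1^3^3 \<Rightarrow> 'a^3^3 \<Rightarrow> 'a^7^7" where
  "block A D = vector [
     vector [1, 0, 0, 0, 0, 0, 0],
     vector [0, A$1$1, A$1$2, A$1$3, 0, 0, 0],
     vector [0, A$2$1, A$2$2, A$2$3, 0, 0, 0],
     vector [0, A$3$1, A$3$2, A$3$3, 0, 0, 0],
     vector [0, 0, 0, 0, D$1$1, D$1$2, D$1$3],
     vector [0, 0, 0, 0, D$2$1, D$2$2, D$2$3],
     vector [0, 0, 0, 0, D$3$1, D$3$2, D$3$3]]"

text \<open>The pairing of the two triples of basis vectors is preserved because the second block is dual to the
  first, and their volume forms because the determinant is one.\<close>

lemma simil_block:
  fixes A D :: "'a::field_char_0^3^3"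
  assumes AD: "A ** transpose D = mat 1" and A: "det A = 1"
  shows "simil (block A D) 1 1"
proof -
  have DA: "transpose D ** A = mat 1" using AD matrix_left_right_inverse by blast
  have "det A * det D = 1" using arg_cong[OF AD, of det] by (simp add: det_mul)
  then have D: "det D = 1" using A by simp
  have rows: "(\<Sum>k\<in>UNIV. A$i$k * D$j$k) = (if i = j then 1 else 0)" for i j
    using arg_cong[OF AD, of "\<lambda>M. M$i$j"] by (simp add: matrix_matrix_mult_def transpose_def mat_def)
  have cols: "(\<Sum>k\<in>UNIV. D$k$i * A$k$j) = (if i = j then 1 else 0)" for i j
    using arg_cong[OF DA, of "\<lambda>M. M$i$j"] by (simp add: matrix_matrix_mult_def transpose_def mat_def)
  note R = rows[of 1 1] rows[of 1 2] rows[of 1 3] rows[of 2 1] rows[of 2 2] rows[of 2 3]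
    rows[of 3 1] rows[of 3 2] rows[of 3 3]
  note C = cols[of 1 1] cols[of 1 2] cols[of 1 3] cols[of 2 1] cols[of 2 2] cols[of 2 3]
    cols[of 3 1] cols[of 3 2] cols[of 3 3]
  note R' = R[unfolded sum_3, simplified] and C' = C[unfolded sum_3, simplified]
  note R'' = R'[simplified algebra_simps] and A'' = A[unfolded det_3, simplified algebra_simps]
    and D'' = D[unfolded det_3, simplified algebra_simps]
  show ?thesis
    unfolding simil_def
  proof (intro conjI allI)
    show "Delta (block A D *v x) = 1 * Delta x" for x
    proof -
      have "Delta (block A D *v x) = (x$1)^2 - 4 * (
          x$2 * x$5 * (D$1$1 * A$1$1 + D$2$1 * A$2$1 + D$3$1 * A$3$1)
        + x$3 * x$5 * (D$1$1 * A$1$2 + D$2$1 * A$2$2 + D$3$1 * A$3$2)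
        + x$4 * x$5 * (D$1$1 * A$1$3 + D$2$1 * A$2$3 + D$3$1 * A$3$3)
        + x$2 * x$6 * (D$1$2 * A$1$1 + D$2$2 * A$2$1 + D$3$2 * A$3$1)
        + x$3 * x$6 * (D$1$2 * A$1$2 + D$2$2 * A$2$2 + D$3$2 * A$3$2)
        + x$4 * x$6 * (D$1$2 * A$1$3 + D$2$2 * A$2$3 + D$3$2 * A$3$3)
        + x$2 * x$7 * (D$1$3 * A$1$1 + D$2$3 * A$2$1 + D$3$3 * A$3$1)
        + x$3 * x$7 * (D$1$3 * A$1$2 + D$2$3 * A$2$2 + D$3$3 * A$3$2)
        + x$4 * x$7 * (D$1$3 * A$1$3 + D$2$3 * A$2$3 + D$3$3 * A$3$3))"
        by (simp add: Delta_def mv7 block_def algebra_simps)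
      then show ?thesis by (simp only: C') (simp add: Delta_def)
    qed
    show "wedge3_act (block A D) wbar $ i $ j $ k = 1 * wbar $ i $ j $ k" for i j k
      by (rule wact_wbarI; unfold block_def vector_7; simp add: algebra_simps R'' A'' D'')
  qed
qed

section \<open>The group of similitudes\<close>

definition bil :: "'a::comm_ring_1^7 \<Rightarrow> 'a^7 \<Rightarrow> 'a" where
  "bil x y = 2 * x$1 * y$1 - 4 * (x$2 * y$5 + x$5 * y$2 + x$3 * y$6 + x$6 * y$3 + x$4 * y$7 + x$7 * y$4)"

lemma bil_polar: "bil x y = Delta (x + y) - Delta x - Delta y"
  by (simp add: bil_def Delta_def power2_eq_square algebra_simps)

lemma bil_add: "bil (x + y) z = bil x z + bil y z" "bil x (y + z) = bil x y + bil x z"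
  and bil_scale: "bil (c *s x) z = c * bil x z" "bil x (c *s z) = c * bil x z"
  by (simp_all add: bil_def algebra_simps)

lemma bil_commute: "bil x y = bil y x"
  by (simp add: bil_def algebra_simps)

lemma bil_self: "bil x x = 2 * Delta x"
  by (simp add: bil_def Delta_def power2_eq_square algebra_simps)

lemma Delta_add: "Delta (x + y) = Delta x + bil x y + Delta y"
  by (simp add: bil_polar)

lemma Delta_scale: "Delta (c *s x) = c\<^sup>2 * Delta x"
  by (simp add: Delta_def power2_eq_square algebra_simps)

lemma simil_bil: "simil g c l \<Longrightarrow> bil (g *v x) (g *v y) = l * bil x y"
  by (simp add: bil_polar simil_def right_diff_distrib flip: matrix_vector_right_distrib)

lemma simil_Delta: "simil g c l \<Longrightarrow> Delta (g *v x) = l * Delta x"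
  by (simp add: simil_def)

lemma Delta_evec1: "Delta (evec 1) = 1"
  by (simp add: Delta_def evec_nth)

lemma column_mult: "column j (g ** h) = g *v column j h"
  by (simp add: column_def matrix_matrix_mult_def matrix_vector_mult_def vec_eq_iff)

lemma wedge3_act_mult_wbar: "wedge3_act (g ** h) wbar = wedge3_act g (wedge3_act h wbar)"
  for g h :: "'a::comm_ring_1^7^7"
  by (simp add: wact_wbar wedge3_act_add wedge3_act_wedge3 column_mult)

lemma wedge3_act_scale:
  assumes "\<And>i j k. t $ i $ j $ k = c * u $ i $ j $ k"
  shows "wedge3_act g t $ i $ j $ k = c * wedge3_act g u $ i $ j $ k"
  by (simp add: wedge3_act_def assms sum_distrib_left ac_simps)

lemma wedge3_act_one: "wedge3_act (mat 1) t = t" for t :: "'a::comm_ring_1^7^7^7"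
proof -
  have pull: "(\<Sum>r\<in>UNIV. if P then f r else 0) = (if P then sum f UNIV else 0)"
    for P and f :: "7 \<Rightarrow> 'a" by simp
  show ?thesis
    by (simp add: wedge3_act_def mat_def vec_eq_iff if_distrib[of "\<lambda>x. x * _"] pull cong: if_cong)
qed

lemma simil_mult:
  assumes "simil g c l" "simil h c' l'"
  shows "simil (g ** h) (c * c') (l * l')"
proof -
  have "wedge3_act (g ** h) wbar $ i $ j $ k = c * c' * wbar $ i $ j $ k" for i j k
    using wedge3_act_scale[of "wedge3_act h wbar" c' wbar g] assms
    by (simp add: simil_def wedge3_act_mult_wbar)
  then show ?thesis
    using assms by (simp add: simil_def flip: matrix_vector_mul_assoc)
qed

lemma simil_one: "simil (mat 1) 1 1"
  by (simp add: simil_def wedge3_act_one)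

lemma simil_scalar: "simil (mat t) (t^3) (t\<^sup>2)" for t :: "'a::comm_ring_1"
proof -
  have m: "mat t *v x = t *s x" for x :: "'a^7"
    by (simp add: mat_def matrix_vector_mult_def vec_eq_iff if_distrib[of "\<lambda>x. x * _"] cong: if_cong)
  have "wedge3_act (mat t) wbar $ i $ j $ k = t^3 * wbar $ i $ j $ k" for i j k
    unfolding wbar_def wedge3_act_add wedge3_act_wedge3 vector_add_component m wedge3_nth
    by (simp add: algebra_simps power3_eq_cube)
  then show ?thesis by (simp add: simil_def m Delta_scale)
qed

lemma simil_invertible:
  fixes g :: "'a::field_char_0^7^7"
  assumes "simil g c l" "l \<noteq> 0"
  shows "invertible g"
proof -
  have "x = 0" if "g *v x = 0" for x
  proof -
    have z: "bil x y = 0" for y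
      using simil_bil[OF assms(1), of x y] that assms(2) by (simp add: bil_def)
    show ?thesis
      using z[of "evec 1"] z[of "evec 2"] z[of "evec 3"] z[of "evec 4"] z[of "evec 5"]
        z[of "evec 6"] z[of "evec 7"]
      by (simp add: bil_def evec_nth vec_eq_iff forall_7)
  qed
  then show ?thesis
    by (simp add: invertible_left_inverse matrix_left_invertible_ker)
qed

lemma simil_inverse:
  fixes g h :: "'a::field_char_0^7^7"
  assumes g: "simil g c l" and "c \<noteq> 0" "l \<noteq> 0" and gh: "g ** h = mat 1"
  shows "simil h (inverse c) (inverse l)"
proof -
  have hg: "h ** g = mat 1" using gh matrix_left_right_inverse by blast
  have "wbar = wedge3_act h (wedge3_act g wbar)"
    by (simp add: wedge3_act_one hg flip: wedge3_act_mult_wbar)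
  then have w: "wbar $ i $ j $ k = c * wedge3_act h wbar $ i $ j $ k" for i j k
    using wedge3_act_scale[of "wedge3_act g wbar" c wbar h i j k] g by (simp add: simil_def)
  have d: "Delta x = l * Delta (h *v x)" for x
    using simil_Delta[OF g, of "h *v x"] by (simp add: matrix_vector_mul_assoc gh)
  show ?thesis
    unfolding simil_def
  proof (intro conjI allI)
    show "wedge3_act h wbar $ i $ j $ k = inverse c * wbar $ i $ j $ k" for i j k
      by (subst w[of i j k]) (simp add: assms(2))
    show "Delta (h *v x) = inverse l * Delta x" for x
      by (subst d[of x]) (simp add: assms(3))
  qed
qed

section \<open>Every element of \<open>G\<^sub>1\<close> is a similitude\<close>

text \<open>The derivative of the action of the general linear group on tensors.\<close>

definition lie_act :: "'a::comm_ring_1^7^7 \<Rightarrow> 'a^7^7^7 \<Rightarrow> 'a^7^7^7" where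
  "lie_act A t = (\<chi> i j k. \<Sum>p\<in>UNIV. A$i$p * t$p$j$k + A$j$p * t$i$p$k + A$k$p * t$i$j$p)"

lemma lie_act_add: "lie_act A (s + t) = lie_act A s + lie_act A t"
  by (simp add: lie_act_def vec_eq_iff algebra_simps sum.distrib)

lemma lie_act_wedge3:
  "lie_act A (wedge3 u v w) = wedge3 (A *v u) v w + wedge3 u (A *v v) w + wedge3 u v (A *v w)"
proof -
  have "lie_act A (wedge3 u v w) $ i $ j $ k
     = (wedge3 (A *v u) v w + wedge3 u (A *v v) w + wedge3 u v (A *v w)) $ i $ j $ k" for i j k
    unfolding lie_act_def vec_lambda_beta vector_add_component wedge3_nth matrix_vector_mult_def
    by (simp add: sum_distrib_left sum_distrib_right sum.distrib sum_subtractf algebra_simps)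
  then show ?thesis by (simp add: vec_eq_iff)
qed

lemma lie_act_conj:
  assumes "g ** A = B ** g"
  shows "lie_act B (wedge3_act g wbar) = wedge3_act g (lie_act A wbar)"
proof -
  have "B *v (g *v x) = g *v (A *v x)" for x
    by (simp add: matrix_vector_mul_assoc assms)
  then show ?thesis
    by (simp add: wbar_def wedge3_act_add wedge3_act_wedge3 lie_act_add lie_act_wedge3)
qed

lemma lie_wbar_eval: "lie_act A wbar $ i $ j $ k =
   (\<Sum>p\<in>UNIV. A$i$p * wbar$p$j$k) + (\<Sum>p\<in>UNIV. A$j$p * wbar$i$p$k) + (\<Sum>p\<in>UNIV. A$k$p * wbar$i$j$p)"
  by (simp add: lie_act_def sum.distrib)

lemma scaled_diff_zero: "3 * (x - y) = 0 \<Longrightarrow> x = y" for x y :: "'a::field_char_0"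
  by simp

text \<open>The hypothesis is a system of linear equations in the entries of \<open>A\<close>, from which the entries
  of the skewness condition are obtained as linear combinations.\<close>

lemma lie_stabilizer_skew:
  fixes A :: "'a::field_char_0^7^7"
  assumes "lie_act A wbar = 0"
  shows "bil (A *v x) y + bil x (A *v y) = 0"
proof -
  have eq: "lie_act A wbar $ i $ j $ k = 0" for i j k
    using assms by simp
  note lie_wbar_eval = lie_wbar_eval sum_7 wbar_nth wedge3_nth evec_nth
  have e123: "A$1$4 + A$3$5 - A$2$6 = 0"
    using eq[of 1 2 3] by (simp add: lie_wbar_eval algebra_simps)
  have e124: "A$4$5 - A$1$3 - A$2$7 = 0"
    using eq[of 1 2 4] by (simp add: lie_wbar_eval algebra_simps)
  have e125: "A$1$1 + A$2$2 + A$5$5 = 0"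
    using eq[of 1 2 5] by (simp add: lie_wbar_eval algebra_simps)
  have e126: "A$2$3 + A$6$5 = 0"
    using eq[of 1 2 6] by (simp add: lie_wbar_eval algebra_simps)
  have e127: "A$2$4 + A$7$5 = 0"
    using eq[of 1 2 7] by (simp add: lie_wbar_eval algebra_simps)
  have e134: "A$1$2 + A$4$6 - A$3$7 = 0"
    using eq[of 1 3 4] by (simp add: lie_wbar_eval algebra_simps)
  have e135: "A$3$2 + A$5$6 = 0"
    using eq[of 1 3 5] by (simp add: lie_wbar_eval algebra_simps)
  have e136: "A$1$1 + A$3$3 + A$6$6 = 0"
    using eq[of 1 3 6] by (simp add: lie_wbar_eval algebra_simps)
  have e137: "A$3$4 + A$7$6 = 0"
    using eq[of 1 3 7] by (simp add: lie_wbar_eval algebra_simps)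
  have e145: "A$4$2 + A$5$7 = 0"
    using eq[of 1 4 5] by (simp add: lie_wbar_eval algebra_simps)
  have e146: "A$4$3 + A$6$7 = 0"
    using eq[of 1 4 6] by (simp add: lie_wbar_eval algebra_simps)
  have e147: "A$1$1 + A$4$4 + A$7$7 = 0"
    using eq[of 1 4 7] by (simp add: lie_wbar_eval algebra_simps)
  have e156: "A$5$3 + A$1$7 - A$6$2 = 0"
    using eq[of 1 5 6] by (simp add: lie_wbar_eval algebra_simps)
  have e157: "A$5$4 - A$7$2 - A$1$6 = 0"
    using eq[of 1 5 7] by (simp add: lie_wbar_eval algebra_simps)
  have e167: "A$6$4 + A$1$5 - A$7$3 = 0"
    using eq[of 1 6 7] by (simp add: lie_wbar_eval algebra_simps)
  have e234: "A$2$2 + A$3$3 + A$4$4 = 0"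
    using eq[of 2 3 4] by (simp add: lie_wbar_eval algebra_simps)
  have e235: "A$5$4 - A$3$1 = 0"
    using eq[of 2 3 5] by (simp add: lie_wbar_eval algebra_simps)
  have e236: "A$2$1 + A$6$4 = 0"
    using eq[of 2 3 6] by (simp add: lie_wbar_eval algebra_simps)
  have e237: "A$7$4 = 0"
    using eq[of 2 3 7] by (simp add: lie_wbar_eval algebra_simps)
  have e245: "- A$4$1 - A$5$3 = 0"
    using eq[of 2 4 5] by (simp add: lie_wbar_eval algebra_simps)
  have e246: "- A$6$3 = 0"
    using eq[of 2 4 6] by (simp add: lie_wbar_eval algebra_simps)
  have e247: "A$2$1 - A$7$3 = 0"
    using eq[of 2 4 7] by (simp add: lie_wbar_eval algebra_simps)
  have e256: "A$6$1 + A$2$7 = 0"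
    using eq[of 2 5 6] by (simp add: lie_wbar_eval algebra_simps)
  have e257: "A$7$1 - A$2$6 = 0"
    using eq[of 2 5 7] by (simp add: lie_wbar_eval algebra_simps)
  have e267: "A$2$5 = 0"
    using eq[of 2 6 7] by (simp add: lie_wbar_eval algebra_simps)
  have e345: "A$5$2 = 0"
    using eq[of 3 4 5] by (simp add: lie_wbar_eval algebra_simps)
  have e346: "A$6$2 - A$4$1 = 0"
    using eq[of 3 4 6] by (simp add: lie_wbar_eval algebra_simps)
  have e347: "A$3$1 + A$7$2 = 0"
    using eq[of 3 4 7] by (simp add: lie_wbar_eval algebra_simps)
  have e356: "A$3$7 - A$5$1 = 0"
    using eq[of 3 5 6] by (simp add: lie_wbar_eval algebra_simps)
  have e357: "- A$3$6 = 0"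
    using eq[of 3 5 7] by (simp add: lie_wbar_eval algebra_simps)
  have e367: "A$7$1 + A$3$5 = 0"
    using eq[of 3 6 7] by (simp add: lie_wbar_eval algebra_simps)
  have e456: "A$4$7 = 0"
    using eq[of 4 5 6] by (simp add: lie_wbar_eval algebra_simps)
  have e457: "- A$5$1 - A$4$6 = 0"
    using eq[of 4 5 7] by (simp add: lie_wbar_eval algebra_simps)
  have e467: "A$4$5 - A$6$1 = 0"
    using eq[of 4 6 7] by (simp add: lie_wbar_eval algebra_simps)
  have e567: "A$5$5 + A$6$6 + A$7$7 = 0"
    using eq[of 5 6 7] by (simp add: lie_wbar_eval algebra_simps)
  have "3 * (A$1$2 - (2 * A$5$1)) = 3 * (A$1$2 + A$4$6 - A$3$7) + 3 * (A$3$7 - A$5$1) + 3 * (- A$5$1 - A$4$6)" by (simp add: algebra_simps)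
  then have r12: "A$1$2 = 2 * A$5$1" by - (rule scaled_diff_zero, simp only: e134 e356 e457 mult_zero_right add_0_left)
  have "3 * (A$1$3 - (2 * A$6$1)) = (- 3) * (A$4$5 - A$1$3 - A$2$7) + (- 3) * (A$6$1 + A$2$7) + 3 * (A$4$5 - A$6$1)" by (simp add: algebra_simps)
  then have r13: "A$1$3 = 2 * A$6$1" by - (rule scaled_diff_zero, simp only: e124 e256 e467 mult_zero_right add_0_left)
  have "3 * (A$1$4 - (2 * A$7$1)) = 3 * (A$1$4 + A$3$5 - A$2$6) + (- 3) * (A$7$1 - A$2$6) + (- 3) * (A$7$1 + A$3$5)" by (simp add: algebra_simps)
  then have r14: "A$1$4 = 2 * A$7$1" by - (rule scaled_diff_zero, simp only: e123 e257 e367 mult_zero_right add_0_left)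
  have "3 * (A$1$5 - (2 * A$2$1)) = 3 * (A$6$4 + A$1$5 - A$7$3) + (- 3) * (A$2$1 + A$6$4) + (- 3) * (A$2$1 - A$7$3)" by (simp add: algebra_simps)
  then have r15: "A$1$5 = 2 * A$2$1" by - (rule scaled_diff_zero, simp only: e167 e236 e247 mult_zero_right add_0_left)
  have "3 * (A$1$6 - (2 * A$3$1)) = (- 3) * (A$5$4 - A$7$2 - A$1$6) + 3 * (A$5$4 - A$3$1) + (- 3) * (A$3$1 + A$7$2)" by (simp add: algebra_simps)
  then have r16: "A$1$6 = 2 * A$3$1" by - (rule scaled_diff_zero, simp only: e157 e235 e347 mult_zero_right add_0_left)
  have "3 * (A$1$7 - (2 * A$4$1)) = 3 * (A$5$3 + A$1$7 - A$6$2) + 3 * (- A$4$1 - A$5$3) + 3 * (A$6$2 - A$4$1)" by (simp add: algebra_simps)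
  then have r17: "A$1$7 = 2 * A$4$1" by - (rule scaled_diff_zero, simp only: e156 e245 e346 mult_zero_right add_0_left)
  have "3 * (A$2$5 - (0)) = 3 * (A$2$5)" by (simp add: algebra_simps)
  then have r25: "A$2$5 = 0" by - (rule scaled_diff_zero, simp only: e267 mult_zero_right add_0_left)
  have "3 * (A$3$6 - (0)) = (- 3) * (- A$3$6)" by (simp add: algebra_simps)
  then have r36: "A$3$6 = 0" by - (rule scaled_diff_zero, simp only: e357 mult_zero_right add_0_left)
  have "3 * (A$4$7 - (0)) = 3 * (A$4$7)" by (simp add: algebra_simps)
  then have r47: "A$4$7 = 0" by - (rule scaled_diff_zero, simp only: e456 mult_zero_right add_0_left)
  have "3 * (A$5$2 - (0)) = 3 * (A$5$2)" by (simp add: algebra_simps)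
  then have r52: "A$5$2 = 0" by - (rule scaled_diff_zero, simp only: e345 mult_zero_right add_0_left)
  have "3 * (A$6$3 - (0)) = (- 3) * (- A$6$3)" by (simp add: algebra_simps)
  then have r63: "A$6$3 = 0" by - (rule scaled_diff_zero, simp only: e246 mult_zero_right add_0_left)
  have "3 * (A$7$4 - (0)) = 3 * (A$7$4)" by (simp add: algebra_simps)
  then have r74: "A$7$4 = 0" by - (rule scaled_diff_zero, simp only: e237 mult_zero_right add_0_left)
  have "3 * (A$5$3 - (- A$4$1)) = (- 3) * (- A$4$1 - A$5$3)" by (simp add: algebra_simps)
  then have r53: "A$5$3 = - A$4$1" by - (rule scaled_diff_zero, simp only: e245 mult_zero_right add_0_left)
  have "3 * (A$6$2 - (A$4$1)) = 3 * (A$6$2 - A$4$1)" by (simp add: algebra_simps)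
  then have r62: "A$6$2 = A$4$1" by - (rule scaled_diff_zero, simp only: e346 mult_zero_right add_0_left)
  have "3 * (A$5$4 - (A$3$1)) = 3 * (A$5$4 - A$3$1)" by (simp add: algebra_simps)
  then have r54: "A$5$4 = A$3$1" by - (rule scaled_diff_zero, simp only: e235 mult_zero_right add_0_left)
  have "3 * (A$7$2 - (- A$3$1)) = 3 * (A$3$1 + A$7$2)" by (simp add: algebra_simps)
  then have r72: "A$7$2 = - A$3$1" by - (rule scaled_diff_zero, simp only: e347 mult_zero_right add_0_left)
  have "3 * (A$6$4 - (- A$2$1)) = 3 * (A$2$1 + A$6$4)" by (simp add: algebra_simps)
  then have r64: "A$6$4 = - A$2$1" by - (rule scaled_diff_zero, simp only: e236 mult_zero_right add_0_left)
  have "3 * (A$7$3 - (A$2$1)) = (- 3) * (A$2$1 - A$7$3)" by (simp add: algebra_simps)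
  then have r73: "A$7$3 = A$2$1" by - (rule scaled_diff_zero, simp only: e247 mult_zero_right add_0_left)
  have "3 * (A$2$6 - (A$7$1)) = (- 3) * (A$7$1 - A$2$6)" by (simp add: algebra_simps)
  then have r26: "A$2$6 = A$7$1" by - (rule scaled_diff_zero, simp only: e257 mult_zero_right add_0_left)
  have "3 * (A$3$5 - (- A$7$1)) = 3 * (A$7$1 + A$3$5)" by (simp add: algebra_simps)
  then have r35: "A$3$5 = - A$7$1" by - (rule scaled_diff_zero, simp only: e367 mult_zero_right add_0_left)
  have "3 * (A$2$7 - (- A$6$1)) = 3 * (A$6$1 + A$2$7)" by (simp add: algebra_simps)
  then have r27: "A$2$7 = - A$6$1" by - (rule scaled_diff_zero, simp only: e256 mult_zero_right add_0_left)
  have "3 * (A$4$5 - (A$6$1)) = 3 * (A$4$5 - A$6$1)" by (simp add: algebra_simps)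
  then have r45: "A$4$5 = A$6$1" by - (rule scaled_diff_zero, simp only: e467 mult_zero_right add_0_left)
  have "3 * (A$3$7 - (A$5$1)) = 3 * (A$3$7 - A$5$1)" by (simp add: algebra_simps)
  then have r37: "A$3$7 = A$5$1" by - (rule scaled_diff_zero, simp only: e356 mult_zero_right add_0_left)
  have "3 * (A$4$6 - (- A$5$1)) = (- 3) * (- A$5$1 - A$4$6)" by (simp add: algebra_simps)
  then have r46: "A$4$6 = - A$5$1" by - (rule scaled_diff_zero, simp only: e457 mult_zero_right add_0_left)
  have "3 * (A$5$6 - (- A$3$2)) = 3 * (A$3$2 + A$5$6)" by (simp add: algebra_simps)
  then have r56: "A$5$6 = - A$3$2" by - (rule scaled_diff_zero, simp only: e135 mult_zero_right add_0_left)
  have "3 * (A$5$7 - (- A$4$2)) = 3 * (A$4$2 + A$5$7)" by (simp add: algebra_simps)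
  then have r57: "A$5$7 = - A$4$2" by - (rule scaled_diff_zero, simp only: e145 mult_zero_right add_0_left)
  have "3 * (A$6$5 - (- A$2$3)) = 3 * (A$2$3 + A$6$5)" by (simp add: algebra_simps)
  then have r65: "A$6$5 = - A$2$3" by - (rule scaled_diff_zero, simp only: e126 mult_zero_right add_0_left)
  have "3 * (A$6$7 - (- A$4$3)) = 3 * (A$4$3 + A$6$7)" by (simp add: algebra_simps)
  then have r67: "A$6$7 = - A$4$3" by - (rule scaled_diff_zero, simp only: e146 mult_zero_right add_0_left)
  have "3 * (A$7$5 - (- A$2$4)) = 3 * (A$2$4 + A$7$5)" by (simp add: algebra_simps)
  then have r75: "A$7$5 = - A$2$4" by - (rule scaled_diff_zero, simp only: e127 mult_zero_right add_0_left)
  have "3 * (A$7$6 - (- A$3$4)) = 3 * (A$3$4 + A$7$6)" by (simp add: algebra_simps)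
  then have r76: "A$7$6 = - A$3$4" by - (rule scaled_diff_zero, simp only: e137 mult_zero_right add_0_left)
  have "3 * (A$1$1 - (0)) = 1 * (A$1$1 + A$2$2 + A$5$5) + 1 * (A$1$1 + A$3$3 + A$6$6) + 1 * (A$1$1 + A$4$4 + A$7$7) + (- 1) * (A$2$2 + A$3$3 + A$4$4) + (- 1) * (A$5$5 + A$6$6 + A$7$7)" by (simp add: algebra_simps)
  then have r11: "A$1$1 = 0" by - (rule scaled_diff_zero, simp only: e125 e136 e147 e234 e567 mult_zero_right add_0_left)
  have "3 * (A$5$5 - (- A$2$2)) = 2 * (A$1$1 + A$2$2 + A$5$5) + (- 1) * (A$1$1 + A$3$3 + A$6$6) + (- 1) * (A$1$1 + A$4$4 + A$7$7) + 1 * (A$2$2 + A$3$3 + A$4$4) + 1 * (A$5$5 + A$6$6 + A$7$7)" by (simp add: algebra_simps)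
  then have r55: "A$5$5 = - A$2$2" by - (rule scaled_diff_zero, simp only: e125 e136 e147 e234 e567 mult_zero_right add_0_left)
  have "3 * (A$6$6 - (- A$3$3)) = (- 1) * (A$1$1 + A$2$2 + A$5$5) + 2 * (A$1$1 + A$3$3 + A$6$6) + (- 1) * (A$1$1 + A$4$4 + A$7$7) + 1 * (A$2$2 + A$3$3 + A$4$4) + 1 * (A$5$5 + A$6$6 + A$7$7)" by (simp add: algebra_simps)
  then have r66: "A$6$6 = - A$3$3" by - (rule scaled_diff_zero, simp only: e125 e136 e147 e234 e567 mult_zero_right add_0_left)
  have "3 * (A$7$7 - (- A$4$4)) = (- 1) * (A$1$1 + A$2$2 + A$5$5) + (- 1) * (A$1$1 + A$3$3 + A$6$6) + 2 * (A$1$1 + A$4$4 + A$7$7) + 1 * (A$2$2 + A$3$3 + A$4$4) + 1 * (A$5$5 + A$6$6 + A$7$7)" by (simp add: algebra_simps)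
  then have r77: "A$7$7 = - A$4$4" by - (rule scaled_diff_zero, simp only: e125 e136 e147 e234 e567 mult_zero_right add_0_left)
  note r = r12 r13 r14 r15 r16 r17 r25 r36 r47 r52 r63 r74 r53 r62 r54 r72 r64 r73 r26 r35 r27 r45 r37 r46 r56 r57 r65 r67 r75 r76 r11 r55 r66 r77
  show ?thesis
    by (simp add: bil_def mv7 r algebra_simps)
qed

text \<open>Conjugation by \<open>g \<in> G\<^sub>1\<close> preserves the Lie algebra of the stabilizer of the tensor, so the
  pulled back form is invariant under it as well.\<close>

lemma lie_pullback:
  fixes g :: "'a::field_char_0^7^7"
  assumes "invertible g" "c \<noteq> 0" and g: "\<And>i j k. wedge3_act g wbar $ i $ j $ k = c * wbar $ i $ j $ k"
    and A: "lie_act A wbar = 0"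
  shows "bil (g *v (A *v x)) (g *v y) + bil (g *v x) (g *v (A *v y)) = 0"
proof -
  obtain h where h: "g ** h = mat 1" "h ** g = mat 1"
    using assms(1) by (auto simp: invertible_def)
  define B where "B = g ** A ** h"
  have Bg: "g ** A = B ** g"
    by (simp add: B_def h flip: matrix_mul_assoc)
  have "lie_act B (wedge3_act g wbar) $ i $ j $ k = c * lie_act B wbar $ i $ j $ k" for i j k
    unfolding lie_act_def vec_lambda_beta g sum_distrib_left
    by (intro sum.cong refl) (simp add: algebra_simps)
  moreover have "lie_act B (wedge3_act g wbar) $ i $ j $ k = 0" for i j k
    unfolding lie_act_conj[OF Bg] A by (simp add: wedge3_act_def)
  ultimately have "lie_act B wbar = 0"
    using assms(2) by (simp add: vec_eq_iff)
  from lie_stabilizer_skew[OF this, of "g *v x" "g *v y"] show ?thesis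
    by (simp add: matrix_vector_mul_assoc Bg)
qed

text \<open>A torus element with distinct weights and three root vectors. An invariant symmetric form pairs only
  opposite weights, by the first, and the remaining four values are tied together by the others.\<close>

definition lie_diag :: "'a::comm_ring_1^7^7" where
  "lie_diag = diag (vector [0, 1, 2, -3, -1, -2, 3])"

definition lie_root :: "7 \<Rightarrow> 7 \<Rightarrow> 7 \<Rightarrow> 7 \<Rightarrow> 'a::comm_ring_1^7^7" where
  "lie_root i j k l = (\<chi> p q. if p = i \<and> q = j then 1 else if p = k \<and> q = l then -1 else 0)"

definition lie_short :: "'a::comm_ring_1^7^7" where
  "lie_short = vector [vector [0,0,0,0,2,0,0], vector [1,0,0,0,0,0,0], 0, 0, 0,
     vector [0,0,0,-1,0,0,0], vector [0,0,1,0,0,0,0]]"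

lemma lie_diag_evec: "lie_diag *v evec i = vector [0, 1, 2, -3, -1, -2, 3] $ i *s evec i"
  by (simp add: lie_diag_def diag_def vec_eq_iff evec_nth matrix_vector_mult_def
      if_distrib[of "\<lambda>x. x * _"] cong: if_cong)

lemma lie_root_mv: "i \<noteq> k \<Longrightarrow> lie_root i j k l *v x = x$j *s evec i - x$l *s evec k"
  by (auto simp: lie_root_def matrix_vector_mult_def vec_eq_iff evec_nth if_distrib[of "\<lambda>x. x * _"] cong: if_cong)

lemma lie_short_evec:
  "lie_short *v evec 1 = evec 2" "lie_short *v evec 2 = 0" "lie_short *v evec 3 = evec 7"
  "lie_short *v evec 4 = (-1) *s evec 6" "lie_short *v evec 5 = 2 *s evec 1"
  "lie_short *v evec 6 = 0" "lie_short *v evec 7 = 0"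
  by (simp_all add: lie_short_def vec_eq_iff forall_7 mv7 evec_nth)

lemma wedge3_zero: "wedge3 0 v w = 0" "wedge3 u 0 w = 0" "wedge3 u v 0 = 0"
  by (simp_all add: vec_eq_iff wedge3_nth)

lemma wedge3_scale:
  "wedge3 (c *s u) v w $ i $ j $ k = c * wedge3 u v w $ i $ j $ k"
  "wedge3 u (c *s v) w $ i $ j $ k = c * wedge3 u v w $ i $ j $ k"
  "wedge3 u v (c *s w) $ i $ j $ k = c * wedge3 u v w $ i $ j $ k"
  by (simp_all add: wedge3_nth algebra_simps)

lemma lie_acts:
  "lie_act lie_diag (wbar :: 'a::comm_ring_1^7^7^7) = 0"
  "lie_act (lie_root 2 3 6 5) (wbar :: 'a^7^7^7) = 0"
  "lie_act (lie_root 2 4 7 5) (wbar :: 'a^7^7^7) = 0"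
  "lie_act lie_short (wbar :: 'a^7^7^7) = 0"
proof -
  have "lie_act lie_diag (wbar :: 'a^7^7^7) $ i $ j $ k = 0" for i j k
    unfolding wbar_def lie_act_add lie_act_wedge3 vector_add_component lie_diag_evec wedge3_scale
    by (simp add: algebra_simps)
  then show "lie_act lie_diag (wbar :: 'a^7^7^7) = 0" by (simp add: vec_eq_iff)
  have "lie_act lie_short (wbar :: 'a^7^7^7) $ i $ j $ k = 0" for i j k
    unfolding wbar_def lie_act_add lie_act_wedge3 vector_add_component lie_short_evec wedge3_scale wedge3_zero
    by (simp add: wedge3_nth algebra_simps)
  then show "lie_act lie_short (wbar :: 'a^7^7^7) = 0" by (simp add: vec_eq_iff)
  have "lie_act (lie_root 2 3 6 5) (wbar :: 'a^7^7^7) $ i $ j $ k = 0" for i j k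
    unfolding wbar_def lie_act_add lie_act_wedge3 vector_add_component
    by (simp add: lie_root_mv wedge3_nth evec_nth algebra_simps)
  then show "lie_act (lie_root 2 3 6 5) (wbar :: 'a^7^7^7) = 0" by (simp add: vec_eq_iff)
  have "lie_act (lie_root 2 4 7 5) (wbar :: 'a^7^7^7) $ i $ j $ k = 0" for i j k
    unfolding wbar_def lie_act_add lie_act_wedge3 vector_add_component
    by (simp add: lie_root_mv wedge3_nth evec_nth algebra_simps)
  then show "lie_act (lie_root 2 4 7 5) (wbar :: 'a^7^7^7) = 0" by (simp add: vec_eq_iff)
qed

lemma vec7_basis: "x = x$1 *s evec 1 + x$2 *s evec 2 + x$3 *s evec 3 + x$4 *s evec 4
    + x$5 *s evec 5 + x$6 *s evec 6 + x$7 *s evec 7" for x :: "'a::comm_ring_1^7"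
  by (simp add: vec_eq_iff forall_7 evec_nth)

text \<open>The pullback of \<open>\<Delta>\<close> under \<open>g\<close> is again invariant under the four elements
  above, hence a multiple of \<open>\<Delta>\<close>.\<close>

lemma scaling_imp_simil:
  fixes g :: "'a::field_char_0^7^7"
  assumes inv: "invertible g" and c: "c \<noteq> 0" and g: "\<And>i j k. wedge3_act g wbar $ i $ j $ k = c * wbar $ i $ j $ k"
  shows "\<exists>l. l \<noteq> 0 \<and> simil g c l"
proof -
  define P where "P i j = bil (g *v evec i) (g *v evec j)" for i j
  note pull = lie_pullback[OF inv c g]
  have wt: "(vector [0, 1, 2, -3, -1, -2, 3] $ i + vector [0, 1, 2, -3, -1, -2, 3] $ j) * P i j = 0" for i j
    using pull[OF lie_acts(1), of "evec i" "evec j"]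
    by (simp add: lie_diag_evec vector_scalar_commute bil_scale P_def ring_distribs)
  have z: "P 1 j = 0 \<and> P j 1 = 0" if "j \<noteq> 1" for j
    using that wt[of 1 j] wt[of j 1] exhaust_7[of j] by auto
  have w0: "P i j = 0" if "vector [0, 1, 2, -3, -1, -2, 3] $ i + vector [0, 1, 2, -3, -1, -2, 3 :: 'a] $ j \<noteq> 0" for i j
    using wt[of i j] that by simp
  have P0: "P 2 2 = 0" "P 2 3 = 0" "P 2 4 = 0" "P 2 6 = 0" "P 2 7 = 0"
    "P 3 2 = 0" "P 3 3 = 0" "P 3 4 = 0" "P 3 5 = 0" "P 3 7 = 0"
    "P 4 2 = 0" "P 4 3 = 0" "P 4 4 = 0" "P 4 5 = 0" "P 4 6 = 0"
    "P 5 3 = 0" "P 5 4 = 0" "P 5 5 = 0" "P 5 6 = 0" "P 5 7 = 0"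
    "P 6 2 = 0" "P 6 4 = 0" "P 6 5 = 0" "P 6 6 = 0" "P 6 7 = 0"
    "P 7 2 = 0" "P 7 3 = 0" "P 7 5 = 0" "P 7 6 = 0" "P 7 7 = 0"
    by (rule w0; simp)+
  have r1: "P 2 5 - P 3 6 = 0"
    using pull[OF lie_acts(2), of "evec 3" "evec 5"]
    by (simp add: lie_root_mv evec_nth P_def bil_def algebra_simps matrix_vector_mult_diff_distrib mv7)
  have r2: "P 2 5 - P 4 7 = 0"
    using pull[OF lie_acts(3), of "evec 4" "evec 5"]
    by (simp add: lie_root_mv evec_nth P_def bil_def algebra_simps matrix_vector_mult_diff_distrib mv7)
  have r3: "P 2 5 + 2 * P 1 1 = 0"
    using pull[OF lie_acts(4), of "evec 1" "evec 5"]
    by (simp add: lie_short_evec vector_scalar_commute bil_scale P_def)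
  have sym: "P i j = P j i" for i j by (simp add: P_def bil_commute)
  define l where "l = Delta (g *v evec 1)"
  have P11: "P 1 1 = 2 * l" by (simp add: P_def l_def bil_self)
  have P25: "P 2 5 = - 4 * l" using r3 P11 by (simp add: eq_neg_iff_add_eq_0)
  have P36: "P 3 6 = - 4 * l" and P47: "P 4 7 = - 4 * l" using r1 r2 P25 by simp_all
  have "2 * Delta (g *v x) = 2 * (l * Delta x)" for x
  proof -
    have "2 * Delta (g *v x) = bil (g *v x) (g *v x)" by (simp add: bil_self)
    also have "\<dots> = (x$1)\<^sup>2 * P 1 1 + 2 * (x$2 * x$5 * P 2 5 + x$3 * x$6 * P 3 6 + x$4 * x$7 * P 4 7)"
      apply (subst (1 2) vec7_basis[of x])
      apply (simp only: matrix_vector_right_distrib vector_scalar_commute bil_add bil_scale flip: P_def)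
      apply (simp add: P0 z sym[of 5 2] sym[of 6 3] sym[of 7 4] power2_eq_square algebra_simps)
      done
    also have "\<dots> = 2 * (l * Delta x)"
      by (simp add: P11 P25 P36 P47 Delta_def algebra_simps)
    finally show ?thesis .
  qed
  then have D: "Delta (g *v x) = l * Delta x" for x by simp
  moreover have "l \<noteq> 0"
  proof
    assume "l = 0"
    obtain h where "g ** h = mat 1" using inv by (auto simp: invertible_def)
    then have "Delta (evec 1 :: 'a^7) = l * Delta (h *v evec 1)"
      using D[of "h *v evec 1"] by (simp add: matrix_vector_mul_assoc)
    then show False by (simp add: \<open>l = 0\<close> Delta_evec1)
  qed
  ultimately show ?thesis using g by (auto simp: simil_def)
qed

lemma G1_iff: "g \<in> carrier G1 \<longleftrightarrow> (\<exists>c l. c \<noteq> 0 \<and> l \<noteq> 0 \<and> simil g c l)"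
  for g :: "'a::field_char_0^7^7"
proof
  assume "g \<in> carrier G1"
  then show "\<exists>c l. c \<noteq> 0 \<and> l \<noteq> 0 \<and> simil g c l"
    using scaling_imp_simil[of g] by (auto simp: G1_def)
next
  assume "\<exists>c l. c \<noteq> 0 \<and> l \<noteq> 0 \<and> simil g c l"
  then show "g \<in> carrier G1"
    using simil_invertible[of g] by (auto simp: G1_def simil_def)
qed

definition gram :: "'a::comm_ring_1^7^7" where
  "gram = (\<chi> i j. bil (evec i) (evec j))"

lemma gram_vector: "gram = vector [vector [2,0,0,0,0,0,0], vector [0,0,0,0,-4,0,0], vector [0,0,0,0,0,-4,0],
   vector [0,0,0,0,0,0,-4], vector [0,-4,0,0,0,0,0], vector [0,0,-4,0,0,0,0], vector [0,0,0,-4,0,0,0]]"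
  by (simp add: gram_def vec_eq_iff forall_7 bil_def evec_nth)

lemma simil_gram:
  assumes "simil g c l"
  shows "transpose g ** gram ** g = mat l ** gram"
proof -
  have "(transpose g ** gram ** g) $ i $ j = bil (column i g) (column j g)" for i j
    by (simp add: mm7 gram_vector transpose_def bil_def column_def algebra_simps)
  moreover have "(mat l ** gram) $ i $ j = l * bil (evec i) (evec j)" for i j
    by (simp add: matrix_matrix_mult_def mat_def gram_def if_distrib[of "\<lambda>x. x * _"] cong: if_cong)
  ultimately show ?thesis
    using simil_bil[OF assms] by (simp add: vec_eq_iff flip: mv_evec)
qed

text \<open>The multiplier of the quadratic form is a square, because seven is odd.\<close>

lemma simil_det:
  fixes g :: "'a::field_char_0^7^7"
  assumes "simil g c l"
  shows "(det g)\<^sup>2 = l ^ 7"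
proof -
  let ?I = "vector [vector [1/2,0,0,0,0,0,0], vector [0,0,0,0,-1/4,0,0], vector [0,0,0,0,0,-1/4,0],
   vector [0,0,0,0,0,0,-1/4], vector [0,-1/4,0,0,0,0,0], vector [0,0,-1/4,0,0,0,0], vector [0,0,0,-1/4,0,0,0]] :: 'a^7^7"
  have "gram ** ?I = mat 1"
    by (simp add: gram_vector vec_eq_iff forall_7 mm7 mat_def)
  from arg_cong[OF this, of det] have "det (gram :: 'a^7^7) * det ?I = 1" by (simp only: det_mul det_I)
  then have "det (gram :: 'a^7^7) \<noteq> 0" by auto
  moreover have "det (mat l :: 'a^7^7) = l ^ 7"
    by (subst det_diagonal) (simp_all add: mat_def)
  ultimately show ?thesis
    using arg_cong[OF simil_gram[OF assms], of det]
    by (simp add: det_mul power2_eq_square)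
qed

lemma simil_multiplier_square:
  fixes g :: "'a::field_char_0^7^7"
  assumes "simil g c l" "l \<noteq> 0"
  shows "l = (det g / l ^ 3)\<^sup>2"
  using simil_det[OF assms(1)] assms(2)
  by (simp add: power_divide field_simps eval_nat_numeral)

section \<open>Normal forms of vectors and of orthogonal pairs\<close>

definition special :: "'a::comm_ring_1^7^7 \<Rightarrow> bool" where
  "special g \<longleftrightarrow> simil g 1 1"

lemma special_mult: "special g \<Longrightarrow> special h \<Longrightarrow> special (g ** h)"
  using simil_mult[of g 1 1 h 1 1] by (simp add: special_def)

lemma special_one: "special (mat 1)"
  by (simp add: special_def simil_one)

lemma special_inverse:
  fixes g :: "'a::field_char_0^7^7"
  assumes "special g"
  obtains h where "special h" "g ** h = mat 1" "h ** g = mat 1"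
proof -
  obtain h where h: "g ** h = mat 1" "h ** g = mat 1"
    using simil_invertible[of g 1 1] assms by (auto simp: special_def invertible_def)
  moreover have "special h"
    using simil_inverse[OF _ _ _ h(1), of 1 1] assms by (simp add: special_def)
  ultimately show ?thesis using that by blast
qed

lemma special_Delta: "special g \<Longrightarrow> Delta (g *v x) = Delta x"
  and special_bil: "special g \<Longrightarrow> bil (g *v x) (g *v y) = bil x y"
  using simil_Delta[of g 1 1 x] simil_bil[of g 1 1 x y] by (simp_all add: special_def)

lemma special_up_shear: "special (up_shear a b c :: 'a::field_char_0^7^7)"
  and special_down_shear: "special (down_shear a b c :: 'a::field_char_0^7^7)"
  by (simp_all add: special_def simil_up_shear simil_down_shear)

lemma special_block:
  fixes A D :: "'a::field_char_0^3^3"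
  shows "A ** transpose D = mat 1 \<Longrightarrow> det A = 1 \<Longrightarrow> special (block A D)"
  by (simp add: special_def simil_block)

text \<open>Vectors are written as triples consisting of a scalar and two vectors of length three.\<close>

definition v7 :: "'a \<Rightarrow> 'a \<Rightarrow> 'a \<Rightarrow> 'a \<Rightarrow> 'a \<Rightarrow> 'a \<Rightarrow> 'a \<Rightarrow> 'a::comm_ring_1^7" where
  "v7 a b c d e f g = vector [a, b, c, d, e, f, g]"

lemma v7_nth [simp]:
  "v7 a b c d e f g $ 1 = a" "v7 a b c d e f g $ 2 = b" "v7 a b c d e f g $ 3 = c"
  "v7 a b c d e f g $ 4 = d" "v7 a b c d e f g $ 5 = e" "v7 a b c d e f g $ 6 = f"
  "v7 a b c d e f g $ 7 = g"
  by (simp_all add: v7_def)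

lemma vec7_eq_iff: "x = y \<longleftrightarrow> x$1 = y$1 \<and> x$2 = y$2 \<and> x$3 = y$3 \<and> x$4 = y$4 \<and> x$5 = y$5
    \<and> x$6 = y$6 \<and> x$7 = y$7" for x y :: "'a^7"
  by (simp add: vec_eq_iff forall_7)

definition norm_vec1 :: "'a::field \<Rightarrow> 'a^7" where
  "norm_vec1 d = v7 0 1 0 0 (- d / 4) 0 0"

definition norm_vec2 :: "'a::field \<Rightarrow> 'a^7" where
  "norm_vec2 d = v7 0 0 1 0 0 (- d / 4) 0"

definition linked :: "'a::comm_ring_1^7 \<Rightarrow> 'a^7 \<Rightarrow> bool" where
  "linked x y \<longleftrightarrow> (\<exists>g. special g \<and> g *v x = y)"

lemma linked_trans: "linked x y \<Longrightarrow> linked y z \<Longrightarrow> linked x z"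
  unfolding linked_def by (metis matrix_vector_mul_assoc special_mult)

lemma linked_sym: "linked x y \<Longrightarrow> linked y x" for x y :: "'a::field_char_0^7"
  unfolding linked_def by (metis matrix_vector_mul_assoc matrix_vector_mul_lid special_inverse)

lemma linked_Delta: "linked x y \<Longrightarrow> Delta y = Delta x"
  by (auto simp: linked_def special_Delta)

text \<open>Matrices of determinant one carrying a vector \<open>u\<close> and a covector \<open>v\<close> with \<open>v(u) \<noteq> 0\<close> to multiples
  of the first basis vectors.\<close>

lemma block_normalize:
  fixes u1 u2 u3 v1 v2 v3 :: "'a::field_char_0"
  assumes d: "u1 * v1 + u2 * v2 + u3 * v3 = d" "d \<noteq> 0"
  shows "\<exists>g. special g \<and> g *v v7 0 u1 u2 u3 v1 v2 v3 = v7 0 1 0 0 d 0 0"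
proof -
  have "\<exists>b2 b3 c2 c3 e2 e3. b2 * v1 + c2 * v2 + e2 * v3 = 0 \<and> b3 * v1 + c3 * v2 + e3 * v3 = 0
      \<and> c2 * e3 - e2 * c3 = v1 / d \<and> e2 * b3 - b2 * e3 = v2 / d \<and> b2 * c3 - c2 * b3 = v3 / d"
  proof -
    have "v1 \<noteq> 0 \<or> v2 \<noteq> 0 \<or> v3 \<noteq> 0" using d by auto
    then consider "v1 \<noteq> 0" | "v2 \<noteq> 0" | "v3 \<noteq> 0" by blast
    then show ?thesis
    proof cases
      case 1
      then show ?thesis using d(2)
        by - (rule exI[of _ "- v2 / v1"], rule exI[of _ "- v3 / d"], rule exI[of _ 1], rule exI[of _ 0], rule exI[of _ 0], rule exI[of _ "v1 / d"], simp add: field_simps)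
    next
      case 2
      then show ?thesis using d(2)
        by - (rule exI[of _ 0], rule exI[of _ "v2 / d"], rule exI[of _ "- v3 / v2"], rule exI[of _ "- v1 / d"], rule exI[of _ 1], rule exI[of _ 0], simp add: field_simps)
    next
      case 3
      then show ?thesis using d(2)
        by - (rule exI[of _ 1], rule exI[of _ 0], rule exI[of _ 0], rule exI[of _ "v3 / d"], rule exI[of _ "- v1 / v3"], rule exI[of _ "- v2 / d"], simp add: field_simps)
    qed
  qed
  then obtain b2 b3 c2 c3 e2 e3 where
    o: "b2 * v1 + c2 * v2 + e2 * v3 = 0" "b3 * v1 + c3 * v2 + e3 * v3 = 0"
    and cr: "c2 * e3 - e2 * c3 = v1 / d" "e2 * b3 - b2 * e3 = v2 / d" "b2 * c3 - c2 * b3 = v3 / d"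
    by blast
  define B :: "'a^3^3" where
    "B = vector [vector [u1, b2, b3], vector [u2, c2, c3], vector [u3, e2, e3]]"
  have "det B = u1 * (c2 * e3 - e2 * c3) + u2 * (e2 * b3 - b2 * e3) + u3 * (b2 * c3 - c2 * b3)"
    by (simp add: det_3 B_def algebra_simps)
  also have "\<dots> = 1"
    unfolding cr using d by (simp add: field_simps)
  finally have detB: "det B = 1" .
  then obtain A where A: "A ** B = mat 1" "B ** A = mat 1"
    using invertible_det_nz[of B] by (auto simp: invertible_def)
  have "det A * det B = 1" using arg_cong[OF A(1), of det] by (simp add: det_mul)
  then have detA: "det A = 1" using detB by simp
  have sp: "special (block A (transpose B))"
    by (rule special_block) (use A detA in simp_all)
  have "column 1 (A ** B) = A *v column 1 B" by (simp add: column_def matrix_matrix_mult_def matrix_vector_mult_def vec_eq_iff)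
  then have Au: "A *v vector [u1, u2, u3] = vector [1, 0, 0]"
    unfolding A(1) by (simp add: column_def B_def mat_def vec_eq_iff forall_3 matrix_vector_mult_def sum_3)
  have "block A (transpose B) *v v7 0 u1 u2 u3 v1 v2 v3 = v7 0 1 0 0 d 0 0"
    using Au o d(1)
    by (simp add: vec7_eq_iff mv7 block_def B_def transpose_def vec_eq_iff forall_3 matrix_vector_mult_def sum_3 sum_7 algebra_simps)
  then show ?thesis using sp by blast
qed

text \<open>The vector is moved by shears until its first coordinate vanishes, and then by \<open>SL(3)\<close>.\<close>

lemma linked_norm_vec1:
  fixes x :: "'a::field_char_0^7"
  assumes "Delta x \<noteq> 0"
  shows "linked x (norm_vec1 (Delta x))"
proof -
  have step1: "\<exists>y. linked x y \<and> (y$2 \<noteq> 0 \<or> y$3 \<noteq> 0 \<or> y$4 \<noteq> 0)"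
  proof (cases "x$2 \<noteq> 0 \<or> x$3 \<noteq> 0 \<or> x$4 \<noteq> 0")
    case True
    then show ?thesis
      using special_one matrix_vector_mul_lid[of x] unfolding linked_def by blast
  next
    case False
    then have x1: "x$1 \<noteq> 0" using assms by (auto simp: Delta_def)
    have "\<exists>a b c. (a \<noteq> 0 \<or> b \<noteq> 0 \<or> c \<noteq> 0) \<and> a * x$5 + b * x$6 + c * x$7 = 0"
    proof (cases "x$5 = 0")
      case True
      then show ?thesis by - (rule exI[of _ 1], rule exI[of _ 0], auto)
    next
      case False
      then show ?thesis by - (rule exI[of _ "- x$6"], rule exI[of _ "x$5"], rule exI[of _ 0], auto)
    qed
    then obtain a b c where abc: "a \<noteq> 0 \<or> b \<noteq> 0 \<or> c \<noteq> 0" "a * x$5 + b * x$6 + c * x$7 = 0" by blast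
    let ?y = "up_shear a b c *v x"
    have "?y$2 = a * (x$1 + (a * x$5 + b * x$6 + c * x$7))" "?y$3 = b * (x$1 + (a * x$5 + b * x$6 + c * x$7))"
      "?y$4 = c * (x$1 + (a * x$5 + b * x$6 + c * x$7))"
      using False by (simp_all add: up_shear_def mv7 algebra_simps)
    then have "?y$2 \<noteq> 0 \<or> ?y$3 \<noteq> 0 \<or> ?y$4 \<noteq> 0" using abc x1 by simp
    moreover have "linked x ?y" unfolding linked_def using special_up_shear by blast
    ultimately show ?thesis by blast
  qed
  then obtain y where y: "linked x y" "y$2 \<noteq> 0 \<or> y$3 \<noteq> 0 \<or> y$4 \<noteq> 0" by blast
  have "\<exists>a b c. 2 * (a * y$2 + b * y$3 + c * y$4) = - y$1"
  proof -
    consider "y$2 \<noteq> 0" | "y$3 \<noteq> 0" | "y$4 \<noteq> 0" using y(2) by blast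
    then show ?thesis
    proof cases
      case 1
      then show ?thesis by - (rule exI[of _ "- y$1 / (2 * y$2)"], rule exI[of _ 0], simp)
    next
      case 2
      then show ?thesis by - (rule exI[of _ 0], rule exI[of _ "- y$1 / (2 * y$3)"], simp)
    next
      case 3
      then show ?thesis by - (rule exI[of _ 0], rule exI[of _ 0], rule exI[of _ "- y$1 / (2 * y$4)"], simp)
    qed
  qed
  then obtain a b c where abc: "2 * (a * y$2 + b * y$3 + c * y$4) = - y$1" by blast
  let ?z = "down_shear a b c *v y"
  have "?z$1 = y$1 + 2 * (a * y$2 + b * y$3 + c * y$4)" by (simp add: down_shear_def mv7 algebra_simps)
  then have z1: "?z$1 = 0" using abc by simp
  have yz: "linked y ?z" unfolding linked_def using special_down_shear by blast
  have D: "Delta ?z = Delta x" using linked_Delta[OF y(1)] linked_Delta[OF yz] by simp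
  have zv: "?z = v7 0 (?z$2) (?z$3) (?z$4) (?z$5) (?z$6) (?z$7)"
    using z1 by (simp add: vec7_eq_iff)
  have e: "?z$2 * ?z$5 + ?z$3 * ?z$6 + ?z$4 * ?z$7 = - Delta x / 4"
    using D z1 by (simp add: Delta_def field_simps)
  have "linked ?z (norm_vec1 (Delta x))"
    unfolding linked_def norm_vec1_def using block_normalize[OF e] zv assms by simp
  then show ?thesis using y(1) yz linked_trans by blast
qed

lemma linkedI: "Delta x = Delta y \<Longrightarrow> Delta x \<noteq> 0 \<Longrightarrow> linked x y" for x y :: "'a::field_char_0^7"
  by (metis linked_norm_vec1 linked_sym linked_trans)

text \<open>The subgroup fixing the first normal form acts on the orthogonal complement.\<close>

definition pair_linked :: "'a::field \<Rightarrow> 'a^7 \<Rightarrow> 'a^7 \<Rightarrow> bool" where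
  "pair_linked d x y \<longleftrightarrow> (\<exists>g. special g \<and> g *v norm_vec1 d = norm_vec1 d \<and> g *v x = y)"

lemma pair_linked_trans: "pair_linked d x y \<Longrightarrow> pair_linked d y z \<Longrightarrow> pair_linked d x z"
  unfolding pair_linked_def by (metis matrix_vector_mul_assoc special_mult)

lemma pair_linked_refl: "pair_linked d x x"
  unfolding pair_linked_def by (metis special_one matrix_vector_mul_lid)

lemma pair_linked_Delta: "pair_linked d x y \<Longrightarrow> Delta y = Delta x \<and> bil (norm_vec1 d) y = bil (norm_vec1 d) x"
  unfolding pair_linked_def by (metis special_Delta special_bil)

text \<open>An up shear moves the normal form only in its last components; a transvection moves it back.\<close>

definition transvect :: "'a::field \<Rightarrow> 'a \<Rightarrow> 'a \<Rightarrow> 'a^7^7" where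
  "transvect d b c = block
      (vector [vector [1, - 4 * c / d, 4 * b / d], vector [0, 1, 0], vector [0, 0, 1]])
      (vector [vector [1, 0, 0], vector [4 * c / d, 1, 0], vector [- 4 * b / d, 0, 1]])
    ** up_shear 0 b c"

lemma transvect_mv:
  "transvect d b c *v x = v7 (x$1 + 2 * (b * x$6 + c * x$7))
     (x$2 - 4 / d * (c * x$3 - b * x$4))
     (x$3 + b * x$1 + b * (b * x$6 + c * x$7)) (x$4 + c * x$1 + c * (b * x$6 + c * x$7))
     (x$5 + b * x$4 - c * x$3)
     (x$6 + c * x$2 + 4 * c / d * (x$5 + b * x$4 - c * x$3))
     (x$7 - b * x$2 - 4 * b / d * (x$5 + b * x$4 - c * x$3))" for x :: "'a::field_char_0^7"
  by (simp add: transvect_def vec7_eq_iff block_def up_shear_def mv7 algebra_simps flip: matrix_vector_mul_assoc)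

lemma pair_linked_transvect:
  fixes x :: "'a::field_char_0^7"
  assumes "d \<noteq> 0"
  shows "pair_linked d x (transvect d b c *v x)"
proof -
  have "special (transvect d b c)"
    unfolding transvect_def
    by (intro special_mult special_up_shear special_block)
      (simp_all add: vec_eq_iff forall_3 matrix_matrix_mult_def sum_3 transpose_def mat_def det_3)
  moreover have "transvect d b c *v norm_vec1 d = norm_vec1 d"
    using assms by (simp add: transvect_mv norm_vec1_def vec7_eq_iff)
  ultimately show ?thesis unfolding pair_linked_def by blast
qed

lemma pair_linked_norm_vec2:
  fixes x :: "'a::field_char_0^7"
  assumes d: "d \<noteq> 0" and e: "Delta x \<noteq> 0" and orth: "bil (norm_vec1 d) x = 0"
  shows "pair_linked d x (norm_vec2 (Delta x))"
proof -
  have x5: "y$5 = d / 4 * y$2" if "pair_linked d x y" for y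
  proof -
    have "bil (norm_vec1 d) y = 0" using pair_linked_Delta[OF that] orth by simp
    then show ?thesis by (simp add: bil_def norm_vec1_def field_simps)
  qed
  have De: "(y$1)\<^sup>2 - d * (y$2)\<^sup>2 - 4 * (y$3 * y$6 + y$4 * y$7) = Delta x" if "pair_linked d x y" for y
    using pair_linked_Delta[OF that] x5[OF that] by (simp add: Delta_def power2_eq_square algebra_simps)
  have step1: "\<exists>y. pair_linked d x y \<and> (y$3 \<noteq> 0 \<or> y$4 \<noteq> 0 \<or> y$6 \<noteq> 0 \<or> y$7 \<noteq> 0)"
  proof (cases "x$3 \<noteq> 0 \<or> x$4 \<noteq> 0 \<or> x$6 \<noteq> 0 \<or> x$7 \<noteq> 0")
    case True
    then show ?thesis using pair_linked_refl by blast
  next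
    case False
    let ?y = "transvect d 1 0 *v x"
    have yy: "?y$3 = x$1" "?y$7 = - 2 * x$2"
      using False x5[OF pair_linked_refl] d by (simp_all add: transvect_mv field_simps)
    have "x$1 \<noteq> 0 \<or> x$2 \<noteq> 0" using De[OF pair_linked_refl] False e by auto
    then show ?thesis
      using pair_linked_transvect[OF d, of x 1 0] yy by (intro exI[of _ ?y]) auto
  qed
  then obtain y where y: "pair_linked d x y" and y0: "y$3 \<noteq> 0 \<or> y$4 \<noteq> 0 \<or> y$6 \<noteq> 0 \<or> y$7 \<noteq> 0" by blast
  have step2: "\<exists>z. pair_linked d x z \<and> z$3 * z$6 + z$4 * z$7 \<noteq> 0"
  proof (rule ccontr)
    assume none: "\<not> (\<exists>z. pair_linked d x z \<and> z$3 * z$6 + z$4 * z$7 \<noteq> 0)"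
    have f: "(y$1 + 2 * (b * y$6 + c * y$7))\<^sup>2 - d * (y$2 - 4 / d * (c * y$3 - b * y$4))\<^sup>2 = Delta x" for b c
    proof -
      let ?z = "transvect d b c *v y"
      have pl: "pair_linked d x ?z" using y pair_linked_transvect[OF d] pair_linked_trans by blast
      then have z0: "?z$3 * ?z$6 + ?z$4 * ?z$7 = 0" using none by blast
      have "(?z$1)\<^sup>2 - d * (?z$2)\<^sup>2 - 4 * 0 = Delta x" using De[OF pl] unfolding z0 .
      then show ?thesis by (simp add: transvect_mv)
    qed
    have f0: "(y$1)\<^sup>2 - d * (y$2)\<^sup>2 = Delta x" using f[of 0 0] by simp
    have q: "4 * (b * y$6 + c * y$7)\<^sup>2 - 16 / d * (c * y$3 - b * y$4)\<^sup>2 = 0"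
      and l: "y$1 * (b * y$6 + c * y$7) + 2 * y$2 * (c * y$3 - b * y$4) = 0" for b c
    proof -
      define P Q where "P = b * y$6 + c * y$7" and "Q = c * y$3 - b * y$4"
      have 1: "(y$1 + 2 * P)\<^sup>2 - d * (y$2 - 4 / d * Q)\<^sup>2 = Delta x" using f[of b c] by (simp add: P_def Q_def)
      have 2: "(y$1 - 2 * P)\<^sup>2 - d * (y$2 + 4 / d * Q)\<^sup>2 = Delta x"
        using f[of "- b" "- c"] by (simp add: P_def Q_def algebra_simps)
      have "2 * (4 * P\<^sup>2 - 16 / d * Q\<^sup>2) = ((y$1 + 2 * P)\<^sup>2 - d * (y$2 - 4 / d * Q)\<^sup>2)
         + ((y$1 - 2 * P)\<^sup>2 - d * (y$2 + 4 / d * Q)\<^sup>2) - 2 * ((y$1)\<^sup>2 - d * (y$2)\<^sup>2)"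
        using d by (simp add: field_simps power2_eq_square)
      also have "\<dots> = 0" unfolding 1 2 f0 by simp
      finally have "4 * P\<^sup>2 - 16 / d * Q\<^sup>2 = 0" by (subst (asm) mult_eq_0_iff) simp
      then show "4 * (b * y$6 + c * y$7)\<^sup>2 - 16 / d * (c * y$3 - b * y$4)\<^sup>2 = 0"
        by (simp only: P_def Q_def)
      have "8 * (y$1 * P + 2 * y$2 * Q) = ((y$1 + 2 * P)\<^sup>2 - d * (y$2 - 4 / d * Q)\<^sup>2)
         - ((y$1 - 2 * P)\<^sup>2 - d * (y$2 + 4 / d * Q)\<^sup>2)"
        using d by (simp add: field_simps power2_eq_square)
      also have "\<dots> = 0" unfolding 1 2 by simp
      finally have "y$1 * P + 2 * y$2 * Q = 0" by (subst (asm) mult_eq_0_iff) simp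
      then show "y$1 * (b * y$6 + c * y$7) + 2 * y$2 * (c * y$3 - b * y$4) = 0"
        by (simp only: P_def Q_def)
    qed
    have contra: False if "4 * P\<^sup>2 - 16 / d * Q\<^sup>2 = 0" "y$1 * P + 2 * y$2 * Q = 0" "P \<noteq> 0 \<or> Q \<noteq> 0" for P Q
    proof -
      have dP: "d * P\<^sup>2 = 4 * Q\<^sup>2" using that(1) d by (simp add: field_simps)
      have "P \<noteq> 0" using that(3) dP d by auto
      have "y$1 * P = - 2 * y$2 * Q" using that(2) by (simp add: eq_neg_iff_add_eq_0)
      from arg_cong[OF this, of "\<lambda>t. t\<^sup>2"] have "(y$1)\<^sup>2 * P\<^sup>2 = 4 * (y$2)\<^sup>2 * Q\<^sup>2"
        by (simp add: power2_eq_square algebra_simps)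
      then have "(y$1)\<^sup>2 * P\<^sup>2 = d * (y$2)\<^sup>2 * P\<^sup>2" using dP by (simp add: algebra_simps)
      then have "(y$1)\<^sup>2 - d * (y$2)\<^sup>2 = 0" using \<open>P \<noteq> 0\<close> by simp
      then show False using f0 e by simp
    qed
    show False
      using contra[of "y$6" "- y$4"] contra[of "y$7" "y$3"] q[of 1 0] q[of 0 1] l[of 1 0] l[of 0 1] y0
      by auto
  qed
  then obtain z where z: "pair_linked d x z" and n: "z$3 * z$6 + z$4 * z$7 \<noteq> 0" by blast
  define N where "N = z$3 * z$6 + z$4 * z$7"
  have N: "N \<noteq> 0" using n by (simp add: N_def)
  \<comment> \<open>the unique shear parameters that remove the first two coordinates\<close>
  define b c where "b = (- z$1 / 2 * z$3 - z$7 * (d / 4 * z$2)) / N"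
    and "c = (- z$1 / 2 * z$4 + z$6 * (d / 4 * z$2)) / N"
  have "N * (b * z$6 + c * z$7) = N * (- z$1 / 2)"
    using N by (simp add: b_def c_def field_simps) (simp add: N_def algebra_simps)
  then have 1: "b * z$6 + c * z$7 = - z$1 / 2" using mult_left_cancel[OF N] by blast
  have "N * (c * z$3 - b * z$4) = N * (d / 4 * z$2)"
    using N by (simp add: b_def c_def field_simps) (simp add: N_def algebra_simps)
  then have 2: "c * z$3 - b * z$4 = d / 4 * z$2" using mult_left_cancel[OF N] by blast
  let ?t = "transvect d b c *v z"
  have t: "pair_linked d x ?t" using z pair_linked_transvect[OF d] pair_linked_trans by blast
  have t12: "?t$1 = 0" "?t$2 = 0" by (simp_all add: transvect_mv 1 2 d)
  have t5: "?t$5 = 0" using x5[OF t] t12 by simp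
  define p q r s where "p = ?t$3" and "q = ?t$4" and "r = ?t$6" and "s = ?t$7"
  have tv: "?t = v7 0 0 p q 0 r s" by (simp add: vec7_eq_iff t12 t5 p_def q_def r_def s_def)
  have "- (4 * (p * r + q * s)) = Delta x"
    using De[OF t] t12 by (simp add: p_def q_def r_def s_def)
  then have m: "p * r + q * s = - Delta x / 4"
    by (simp flip: \<open>- (4 * (p * r + q * s)) = Delta x\<close>)
  define m where "m = - Delta x / 4"
  have m0: "m \<noteq> 0" using e by (simp add: m_def)
  have mm: "p * r + q * s = m" using m by (simp add: m_def)
  let ?A = "vector [vector [1, 0, 0], vector [0, r / m, s / m], vector [0, - q, p]] :: 'a^3^3"
  let ?D = "vector [vector [1, 0, 0], vector [0, p, q], vector [0, - s / m, r / m]] :: 'a^3^3"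
  have "special (block ?A ?D)"
    by (rule special_block)
      (use m0 mm in \<open>simp_all add: vec_eq_iff forall_3 matrix_matrix_mult_def sum_3 transpose_def mat_def det_3 field_simps\<close>)
  moreover have "block ?A ?D *v norm_vec1 d = norm_vec1 d"
    by (simp add: vec7_eq_iff mv7 block_def norm_vec1_def)
  moreover have "block ?A ?D *v ?t = norm_vec2 (Delta x)"
    unfolding tv using mm m0
    by (simp add: vec7_eq_iff mv7 block_def norm_vec2_def field_simps flip: m_def) (simp add: m_def)
  ultimately have "pair_linked d ?t (norm_vec2 (Delta x))" unfolding pair_linked_def by blast
  then show ?thesis using t pair_linked_trans by blast
qed

lemma orthogonal_pair_normal_form:
  fixes x y :: "'a::field_char_0^7"
  assumes "Delta x \<noteq> 0" "Delta y \<noteq> 0" "bil x y = 0"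
  shows "\<exists>g. special g \<and> g *v x = norm_vec1 (Delta x) \<and> g *v y = norm_vec2 (Delta y)"
proof -
  obtain g where g: "special g" "g *v x = norm_vec1 (Delta x)"
    using linked_norm_vec1[OF assms(1)] by (auto simp: linked_def)
  have "bil (norm_vec1 (Delta x)) (g *v y) = 0" "Delta (g *v y) = Delta y"
    using special_bil[OF g(1), of x y] special_Delta[OF g(1), of y] g(2) assms(3) by simp_all
  then obtain h where h: "special h" "h *v norm_vec1 (Delta x) = norm_vec1 (Delta x)" "h *v (g *v y) = norm_vec2 (Delta y)"
    using pair_linked_norm_vec2[OF assms(1), of "g *v y"] assms(2) by (auto simp: pair_linked_def)
  show ?thesis
    using g h special_mult[OF h(1) g(1)] by (intro exI[of _ "h ** g"]) (simp flip: matrix_vector_mul_assoc)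
qed

section \<open>Automorphisms of the algebraic closure\<close>

text \<open>Ring homomorphisms over \<open>K\<close> on subrings of the field, given by their graphs so that they are
  ordered by inclusion.\<close>

definition partial_hom :: "'a::field set \<Rightarrow> ('a \<times> 'a) set \<Rightarrow> bool" where
  "partial_hom K H \<longleftrightarrow> (\<forall>c\<in>K. (c, c) \<in> H) \<and>
     (\<forall>x y x' y'. (x, y) \<in> H \<longrightarrow> (x', y') \<in> H \<longrightarrow> (x + x', y + y') \<in> H \<and> (x * x', y * y') \<in> H) \<and>
     (\<forall>y. (0, y) \<in> H \<longrightarrow> y = 0)"

definition pair_polys :: "('a::field \<times> 'a) set \<Rightarrow> ('a poly \<times> 'a poly) set" where
  "pair_polys H = {(p, q). \<forall>i. (coeff p i, coeff q i) \<in> H}"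

context
  fixes K :: "'k::field_char_0 alg_closure set" and H
  assumes ph: "partial_hom K H" and K: "range to_ac \<subseteq> K"
begin

lemma ph_const: "(to_ac c, to_ac c) \<in> H"
  using ph K by (auto simp: partial_hom_def)

lemma ph_add: "(x, y) \<in> H \<Longrightarrow> (x', y') \<in> H \<Longrightarrow> (x + x', y + y') \<in> H"
  and ph_mult: "(x, y) \<in> H \<Longrightarrow> (x', y') \<in> H \<Longrightarrow> (x * x', y * y') \<in> H"
  and ph_zero: "(0, y) \<in> H \<Longrightarrow> y = 0"
  using ph by (auto simp: partial_hom_def)

lemma ph_0: "(0, 0) \<in> H" and ph_1: "(1, 1) \<in> H"
  using ph_const[of 0] ph_const[of 1] by auto

lemma ph_uminus: "(x, y) \<in> H \<Longrightarrow> (- x, - y) \<in> H"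
  using ph_mult[OF ph_const[of "-1"]] by simp

lemma ph_diff: "(x, y) \<in> H \<Longrightarrow> (x', y') \<in> H \<Longrightarrow> (x - x', y - y') \<in> H"
  using ph_add[OF _ ph_uminus] by fastforce

lemma ph_unique: "(x, y) \<in> H \<Longrightarrow> (x, y') \<in> H \<Longrightarrow> y = y'"
  using ph_diff[of x y x y'] ph_zero by force

lemma ph_poly: "(x, y) \<in> H \<Longrightarrow>
   (poly (map_poly to_ac p) x, poly (map_poly to_ac p) y) \<in> H"
proof (induction p)
  case 0
  then show ?case by (simp add: ph_0)
next
  case (pCons a p)
  then show ?case
    using ph_add[OF ph_const[of a] ph_mult[OF pCons(3) pCons(2)[OF pCons(3)]]]
    by (simp add: map_poly_pCons)
qed

text \<open>From an algebraic equation of \<open>x\<close>, after division by a power of \<open>x\<close> that makes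
  the constant term nonzero.\<close>

lemma algebraic_unit:
  fixes x :: "'k alg_closure"
  assumes "x \<noteq> 0"
  shows "\<exists>r c. c \<noteq> 0 \<and> x * poly (map_poly to_ac r) x = to_ac c"
proof -
  have "p \<noteq> 0 \<Longrightarrow> poly (map_poly to_ac p) x = 0 \<Longrightarrow>
     \<exists>r c. c \<noteq> 0 \<and> x * poly (map_poly to_ac r) x = to_ac c" for p :: "'k poly"
  proof (induction p)
    case 0
    then show ?case by simp
  next
    case (pCons a p)
    show ?case
    proof (cases "a = 0")
      case True
      then show ?thesis using pCons assms by (auto simp: map_poly_pCons)
    next
      case False
      then have "x * poly (map_poly to_ac p) x = to_ac (- a)"
        using pCons(4) by (simp add: map_poly_pCons eq_neg_iff_add_eq_0 add.commute)
      then show ?thesis using False by (metis neg_equal_0_iff_equal)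
    qed
  qed
  then show ?thesis using alg_closure_algebraic[of x] by metis
qed

text \<open>Every subring of the closure that contains \<open>k\<close> is a field, and so is the graph of a homomorphism
  defined on it.\<close>

lemma ph_inverse:
  assumes "(x, y) \<in> H"
  shows "(inverse x, inverse y) \<in> H"
proof (cases "x = 0")
  case True
  moreover have "y = 0" using assms True ph_zero by blast
  ultimately show ?thesis using ph_0 by simp
next
  case False
  then obtain r c where c: "c \<noteq> 0" and r: "x * poly (map_poly to_ac r) x = to_ac c"
    using algebraic_unit by blast
  let ?r = "poly (map_poly to_ac r)"
  have "(x * ?r x, y * ?r y) \<in> H"
    using assms ph_mult ph_poly by blast
  then have ry: "y * ?r y = to_ac c"
    using ph_unique[OF _ ph_const] r by simp
  have "(?r x * to_ac (inverse c), ?r y * to_ac (inverse c)) \<in> H"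
    using ph_mult[OF ph_poly[OF assms] ph_const] by blast
  moreover have "?r x * to_ac (inverse c) = inverse x"
    using r c False by (metis inverse_unique mult.assoc to_ac_1 to_ac_mult right_inverse)
  moreover have "?r y * to_ac (inverse c) = inverse y"
    using ry c by (metis inverse_unique mult.assoc to_ac_1 to_ac_mult right_inverse)
  ultimately show ?thesis by simp
qed

lemma pp_fst_zero: "(0, q) \<in> pair_polys H \<Longrightarrow> q = 0"
  by (auto simp: pair_polys_def poly_eq_iff intro: ph_zero)

lemma pp_diff:
  "(p, q) \<in> pair_polys H \<Longrightarrow> (p', q') \<in> pair_polys H \<Longrightarrow> (p - p', q - q') \<in> pair_polys H"
  by (auto simp: pair_polys_def intro: ph_diff)

lemma pp_add:
  "(p, q) \<in> pair_polys H \<Longrightarrow> (p', q') \<in> pair_polys H \<Longrightarrow> (p + p', q + q') \<in> pair_polys H"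
  by (auto simp: pair_polys_def intro: ph_add)

lemma ph_sum: "finite A \<Longrightarrow> (\<And>i. i \<in> A \<Longrightarrow> (f i, g i) \<in> H) \<Longrightarrow> (sum f A, sum g A) \<in> H"
  by (induction A rule: finite_induct) (auto intro: ph_add ph_0)

lemma pp_mult:
  "(p, q) \<in> pair_polys H \<Longrightarrow> (p', q') \<in> pair_polys H \<Longrightarrow> (p * p', q * q') \<in> pair_polys H"
  by (auto simp: pair_polys_def coeff_mult intro!: ph_sum ph_mult)

lemma pp_monom: "(c, d) \<in> H \<Longrightarrow> (monom c n, monom d n) \<in> pair_polys H"
  by (auto simp: pair_polys_def ph_0)

lemma pp_minimal:
  fixes z :: "'k alg_closure"
  obtains m m' where "(m, m') \<in> pair_polys H" "lead_coeff m = 1" "poly m z = 0"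
    "\<And>p q. (p, q) \<in> pair_polys H \<Longrightarrow> p \<noteq> 0 \<Longrightarrow> poly p z = 0 \<Longrightarrow> degree m \<le> degree p"
    "degree m' = degree m" "lead_coeff m' = 1" "degree m > 0"
proof -
  let ?P = "\<lambda>p. \<exists>q. (p, q) \<in> pair_polys H \<and> p \<noteq> 0 \<and> poly p z = 0"
  obtain p0 :: "'k poly" where p0: "p0 \<noteq> 0" "poly (map_poly to_ac p0) z = 0"
    using alg_closure_algebraic .
  have "(map_poly to_ac p0, map_poly to_ac p0) \<in> pair_polys H"
    by (auto simp: pair_polys_def coeff_map_poly ph_const)
  moreover have "map_poly to_ac p0 \<noteq> 0"
    using p0 by (simp add: map_poly_eq_0_iff)
  ultimately have "?P (map_poly to_ac p0)" using p0 by blast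
  then obtain n where n: "?P n" "\<And>p. ?P p \<Longrightarrow> degree n \<le> degree p"
    using ex_has_least_nat[of ?P _ degree] by blast
  then obtain n' where n': "(n, n') \<in> pair_polys H" "n \<noteq> 0" "poly n z = 0" by blast
  let ?c = "lead_coeff n" and ?d = "coeff n' (degree n)"
  have cd: "(inverse ?c, inverse ?d) \<in> H"
    using n' by (auto simp: pair_polys_def intro: ph_inverse)
  define m where "m = monom (inverse ?c) 0 * n"
  define m' where "m' = monom (inverse ?d) 0 * n'"
  have mm: "(m, m') \<in> pair_polys H"
    unfolding m_def m'_def by (intro pp_mult pp_monom cd n')
  have m: "m = smult (inverse ?c) n"
    by (simp add: m_def monom_0)
  have lm: "lead_coeff m = 1" and dm: "degree m = degree n" and zm: "poly m z = 0"
    using n' by (simp_all add: m)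
  have "(coeff m i, coeff m' i) \<in> H" for i using mm by (auto simp: pair_polys_def)
  then have c1: "coeff m' (degree m) = 1" and c2: "i > degree m \<Longrightarrow> coeff m' i = 0" for i
    using lm ph_unique ph_1 ph_zero by (metis, metis coeff_eq_0)
  have dm': "degree m' = degree m"
    by (intro antisym degree_le allI impI le_degree) (use c1 c2 in auto)
  have "degree m > 0"
  proof (rule ccontr)
    assume "\<not> degree m > 0"
    then obtain a where "m = [:a:]" by (metis degree_eq_zeroE gr0I)
    then show False using lm zm by simp
  qed
  then show ?thesis using that[OF mm lm zm _ dm'] c1 n(2) dm dm' by auto
qed

lemma pp_divisibility:
  assumes mm: "(m, m') \<in> pair_polys H" "lead_coeff m = 1" "degree m > 0"
    and min: "\<And>p q. (p, q) \<in> pair_polys H \<Longrightarrow> p \<noteq> 0 \<Longrightarrow> poly p z = 0 \<Longrightarrow> degree m \<le> degree p"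
    and z: "poly m z = 0" "poly m' z' = 0"
  shows "(p, q) \<in> pair_polys H \<Longrightarrow> poly p z = 0 \<Longrightarrow> poly q z' = 0"
proof (induction "degree p" arbitrary: p q rule: less_induct)
  case less
  show ?case
  proof (cases "p = 0")
    case True
    then have "q = 0" using less(2) pp_fst_zero by blast
    then show ?thesis by simp
  next
    case False
    let ?n = "degree p" and ?k = "degree p - degree m"
    have le: "degree m \<le> ?n" using min less False by blast
    define c d where "c = coeff p ?n" and "d = coeff q ?n"
    have cd: "(c, d) \<in> H" using less(2) by (auto simp: pair_polys_def c_def d_def)
    define p1 q1 where "p1 = p - monom c ?k * m" and "q1 = q - monom d ?k * m'"
    have pq1: "(p1, q1) \<in> pair_polys H"
      unfolding p1_def q1_def by (intro pp_diff pp_mult pp_monom less(2) cd mm)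
    have pz: "poly p1 z = 0" by (simp add: p1_def less(3) z)
    have "coeff p1 ?n = 0"
      using le mm(2) by (simp add: p1_def coeff_monom_mult c_def)
    moreover have "degree (monom c ?k * m) \<le> ?n"
      using le degree_mult_le[of "monom c ?k" m] degree_monom_le[of c ?k] by linarith
    then have "degree p1 \<le> ?n"
      unfolding p1_def by (rule degree_diff_le[OF order_refl])
    ultimately have "p1 = 0 \<or> degree p1 < ?n"
      by (metis le_neq_implies_less leading_coeff_0_iff)
    then have "poly q1 z' = 0"
    proof
      assume "p1 = 0"
      then have "q1 = 0" using pq1 pp_fst_zero by blast
      then show ?thesis by simp
    qed (rule less(1)[OF _ pq1 pz])
    then show ?thesis by (simp add: q1_def z)
  qed
qed

text \<open>The extension sends the value of a polynomial at \<open>z\<close> to the value of its image at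
  \<open>z'\<close>. It is well defined because the polynomials over the domain that vanish at \<open>z\<close> are
  divisible by the minimal one.\<close>

lemma ph_extend:
  assumes mm: "(m, m') \<in> pair_polys H" "lead_coeff m = 1" "degree m > 0"
    and min: "\<And>p q. (p, q) \<in> pair_polys H \<Longrightarrow> p \<noteq> 0 \<Longrightarrow> poly p z = 0 \<Longrightarrow> degree m \<le> degree p"
    and z: "poly m z = 0" "poly m' z' = 0"
  shows "\<exists>H'. partial_hom K H' \<and> H \<subseteq> H' \<and> (z, z') \<in> H'"
proof -
  let ?H = "{(poly p z, poly q z') |p q. (p, q) \<in> pair_polys H}"
  have sub: "(x, y) \<in> H \<Longrightarrow> (x, y) \<in> ?H" for x y
    using pp_monom[of x y 0] by (force simp: monom_0)
  have "partial_hom K ?H"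
    unfolding partial_hom_def
  proof (intro conjI allI impI ballI)
    show "(c, c) \<in> ?H" if "c \<in> K" for c
      using that ph by (intro sub) (simp add: partial_hom_def)
  next
    fix x y x' y' assume "(x, y) \<in> ?H" "(x', y') \<in> ?H"
    then obtain p q p' q' where *: "(p, q) \<in> pair_polys H" "(p', q') \<in> pair_polys H"
      "x = poly p z" "y = poly q z'" "x' = poly p' z" "y' = poly q' z'" by auto
    show "(x + x', y + y') \<in> ?H"
      using pp_add[OF *(1,2)] *(3-6) by (force simp flip: poly_add)
    show "(x * x', y * y') \<in> ?H"
      using pp_mult[OF *(1,2)] *(3-6) by (force simp flip: poly_mult)
  next
    fix y assume "(0, y) \<in> ?H"
    then show "y = 0"
      using pp_divisibility[OF mm _ z] min by auto
  qed
  moreover have "(monom 1 1, monom 1 1) \<in> pair_polys H"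
    by (intro pp_monom ph_1)
  then have "(z, z') \<in> ?H" by (force simp: poly_monom)
  ultimately show ?thesis using sub by (intro exI[of _ ?H]) auto
qed

end

text \<open>Zorn's lemma: a maximal graph is total, since the image of a minimal polynomial always has a root in the
  closure.\<close>

lemma partial_hom_maximal:
  fixes K :: "'k::field_char_0 alg_closure set"
  assumes ph: "partial_hom K H0" and K: "range to_ac \<subseteq> K"
  shows "\<exists>H. partial_hom K H \<and> H0 \<subseteq> H \<and> (\<forall>x. \<exists>y. (x, y) \<in> H)"
proof -
  let ?A = "{H. partial_hom K H \<and> H0 \<subseteq> H}"
  have chain: "\<Union>C \<in> ?A" if C: "C \<noteq> {}" "subset.chain ?A C" for C
  proof -
    have CA: "C \<subseteq> ?A" and tot: "\<And>x y. x \<in> C \<Longrightarrow> y \<in> C \<Longrightarrow> x \<subseteq> y \<or> y \<subseteq> x"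
      using C(2) by (auto simp: subset_chain_def)
    have "partial_hom K (\<Union>C)"
      unfolding partial_hom_def
    proof (intro conjI allI impI ballI)
      show "(c, c) \<in> \<Union>C" if "c \<in> K" for c
        using CA C(1) that by (fastforce simp: partial_hom_def)
    next
      fix x y x' y' assume "(x, y) \<in> \<Union>C" "(x', y') \<in> \<Union>C"
      then obtain H where "H \<in> C" "(x, y) \<in> H" "(x', y') \<in> H"
        using tot by (meson UnionE subsetD)
      then have "(x + x', y + y') \<in> H \<and> (x * x', y * y') \<in> H"
        using CA by (auto simp: partial_hom_def)
      then show "(x + x', y + y') \<in> \<Union>C" "(x * x', y * y') \<in> \<Union>C"
        using \<open>H \<in> C\<close> by auto
    next
      show "y = 0" if "(0, y) \<in> \<Union>C" for y
        using CA that by (auto simp: partial_hom_def)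
    qed
    then show ?thesis using C(1) CA by blast
  qed
  obtain H where H: "partial_hom K H" "H0 \<subseteq> H"
    and max: "\<And>H'. partial_hom K H' \<Longrightarrow> H \<subseteq> H' \<Longrightarrow> H' = H"
  proof -
    have "?A \<noteq> {}" using ph by blast
    then have "\<exists>M\<in>?A. \<forall>N\<in>?A. M \<subseteq> N \<longrightarrow> N = M"
      by (rule subset_Zorn_nonempty) (rule chain)
    then show ?thesis using that by auto
  qed
  have "\<exists>y. (x, y) \<in> H" for x
  proof -
    obtain m m' where m: "(m, m') \<in> pair_polys H" "lead_coeff m = 1" "poly m x = 0"
      "\<And>p q. (p, q) \<in> pair_polys H \<Longrightarrow> p \<noteq> 0 \<Longrightarrow> poly p x = 0 \<Longrightarrow> degree m \<le> degree p"
      "degree m' = degree m" "lead_coeff m' = 1" "degree m > 0"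
      using pp_minimal[OF H(1) K] by metis
    obtain y where y: "poly m' y = 0"
      using alg_closed_imp_poly_has_root[of m'] m by auto
    have "\<exists>H'. partial_hom K H' \<and> H \<subseteq> H' \<and> (x, y) \<in> H'"
      by (rule ph_extend[OF H(1) K m(1) m(2) m(7) _ m(3) y]) (rule m(4))
    then show ?thesis using max by blast
  qed
  then show ?thesis using H by blast
qed

text \<open>Surjectivity holds because an injective map permutes the finite set of roots of a polynomial over
  \<open>k\<close>.\<close>

lemma total_partial_hom_Gal:
  fixes K :: "'k::field_char_0 alg_closure set"
  assumes ph: "partial_hom K H" and K: "range to_ac \<subseteq> K" and tot: "\<forall>x. \<exists>y. (x, y) \<in> H"
  shows "\<exists>\<eta>\<in>Gal. \<forall>x. (x, \<eta> x) \<in> H"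
proof -
  obtain \<eta> where \<eta>: "\<And>x. (x, \<eta> x) \<in> H" using tot by metis
  have eq: "\<eta> x = y" if "(x, y) \<in> H" for x y
    using ph_unique[OF ph K \<eta> that] .
  have add: "\<eta> (x + y) = \<eta> x + \<eta> y" and mult: "\<eta> (x * y) = \<eta> x * \<eta> y" for x y
    by (rule eq, intro ph_add[OF ph K] ph_mult[OF ph K] \<eta>)+
  have const: "\<eta> (to_ac c) = to_ac c" for c
    by (rule eq[OF ph_const[OF ph K]])
  have inj: "inj \<eta>"
  proof (rule injI)
    fix x y assume xy: "\<eta> x = \<eta> y"
    have "(x - y, \<eta> x - \<eta> y) \<in> H" by (intro ph_diff[OF ph K] \<eta>)
    then have *: "\<eta> (x - y) = 0" using xy eq by force
    show "x = y"
    proof (rule ccontr)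
      assume "x \<noteq> y"
      then have "\<eta> ((x - y) * inverse (x - y)) = 1"
        using const[of 1] by simp
      then show False using * by (simp add: mult)
    qed
  qed
  have poly: "poly (map_poly to_ac p) (\<eta> x) = \<eta> (poly (map_poly to_ac p) x)" for p x
    using eq[OF ph_poly[OF ph K \<eta>]] by simp
  have "surj \<eta>"
  unfolding surj_def
  proof
    show "\<exists>x. w = \<eta> x" for w
    proof -
      obtain p :: "'k poly" where p: "p \<noteq> 0" "poly (map_poly to_ac p) w = 0"
        using alg_closure_algebraic .
      let ?R = "{x. poly (map_poly to_ac p) x = 0}"
      have "finite ?R" using p(1) by (intro poly_roots_finite) (simp add: map_poly_eq_0_iff)
      moreover have "\<eta> ` ?R \<subseteq> ?R" using poly const[of 0] by auto
      moreover have "inj_on \<eta> ?R" using inj by (rule inj_on_subset) simp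
      ultimately have "\<eta> ` ?R = ?R" by (rule endo_inj_surj)
      then show ?thesis using p(2) by blast
    qed
  qed
  then have "\<eta> \<in> Gal" using inj add mult const by (auto simp: Gal_def bij_def)
  then show ?thesis using \<eta> by blast
qed

text \<open>In characteristic zero the minimal polynomial of \<open>z\<close> over \<open>K\<close> is separable and
  of degree at least two, so \<open>z\<close> can be sent to another root.\<close>

lemma Gal_moves:
  fixes K :: "'k::field_char_0 alg_closure set"
  assumes K: "range to_ac \<subseteq> K" "\<And>x y. x \<in> K \<Longrightarrow> y \<in> K \<Longrightarrow> x + y \<in> K"
      "\<And>x y. x \<in> K \<Longrightarrow> y \<in> K \<Longrightarrow> x * y \<in> K"
    and z: "z \<notin> K"
  shows "\<exists>\<eta>\<in>Gal. (\<forall>c\<in>K. \<eta> c = c) \<and> \<eta> z \<noteq> z"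
proof -
  have ph: "partial_hom K (Id_on K)"
    using K by (auto simp: partial_hom_def)
  obtain m m' where m: "(m, m') \<in> pair_polys (Id_on K)" "lead_coeff m = 1" "poly m z = 0"
      "\<And>p q. (p, q) \<in> pair_polys (Id_on K) \<Longrightarrow> p \<noteq> 0 \<Longrightarrow> poly p z = 0 \<Longrightarrow> degree m \<le> degree p"
      "degree m' = degree m" "lead_coeff m' = 1" "degree m > 0"
    using pp_minimal[OF ph K(1)] by metis
  have mm: "m' = m" and coeff: "coeff m i \<in> K" for i
    using m(1) by (auto simp: pair_polys_def poly_eq_iff)
  have "(pderiv m, pderiv m) \<in> pair_polys (Id_on K)"
  proof -
    have "of_nat n \<in> K" for n using K(1) by (metis range_eqI subsetD to_ac_of_nat)
    then show ?thesis using coeff K(3) by (auto simp: pair_polys_def coeff_pderiv simp del: of_nat_Suc)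
  qed
  moreover have "pderiv m \<noteq> 0" "degree (pderiv m) < degree m"
    using m(7) by (auto simp: pderiv_eq_0_iff degree_pderiv)
  ultimately have dz: "poly (pderiv m) z \<noteq> 0" using m(4) by fastforce
  obtain r where r: "m = [:-z, 1:] * r" using m(3) by (metis dvdE poly_eq_0_iff_dvd)
  have rz: "poly r z \<noteq> 0" using dz unfolding r pderiv_mult by (simp add: pderiv_pCons)
  have r0: "r \<noteq> 0" using rz by auto
  have "degree m = Suc (degree r)" unfolding r using r0 by (subst degree_mult_eq) auto
  have "degree r \<noteq> 0"
  proof
    assume "degree r = 0"
    then obtain b where b: "r = [:b:]" by (metis degree_eq_zeroE)
    with m(2) have "b = 1" unfolding r lead_coeff_mult by simp
    then have "coeff m 0 = - z" by (simp add: r b)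
    then have "- z \<in> K" using coeff by metis
    moreover have "-1 \<in> K" using K(1) by (metis range_eqI subsetD to_ac_1 to_ac_minus)
    ultimately have "-1 * - z \<in> K" using K(3) by blast
    then show False using z by simp
  qed
  moreover have "lead_coeff r = 1" using m(2) unfolding r lead_coeff_mult by simp
  ultimately obtain z' where z': "poly r z' = 0" using alg_closed_imp_poly_has_root[of r] by auto
  have "poly m' z' = 0" by (simp add: mm r z')
  then have "\<exists>H'. partial_hom K H' \<and> Id_on K \<subseteq> H' \<and> (z, z') \<in> H'"
    by (intro ph_extend[OF ph K(1) m(1) m(2) m(7) _ m(3)] m(4))
  then obtain H' where H': "partial_hom K H'" "(z, z') \<in> H'" by blast
  obtain H where H: "partial_hom K H" "H' \<subseteq> H" "\<forall>x. \<exists>y. (x, y) \<in> H"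
    using partial_hom_maximal[OF H'(1) K(1)] by blast
  obtain \<eta> where \<eta>: "\<eta> \<in> Gal" "\<And>x. (x, \<eta> x) \<in> H"
    using total_partial_hom_Gal[OF H(1) K(1) H(3)] by blast
  have "\<eta> z = z'" using ph_unique[OF H(1) K(1) \<eta>(2)] H'(2) H(2) by blast
  moreover have "z' \<noteq> z" using z' rz by auto
  moreover have "\<eta> c = c" if "c \<in> K" for c
    using ph_unique[OF H(1) K(1) \<eta>(2)] H(1) that by (auto simp: partial_hom_def)
  ultimately show ?thesis using \<eta>(1) by blast
qed

section \<open>Quadratic extensions\<close>

lemma ring_of_type_algebra_simps:
  "carrier (ring_of_type_algebra :: 'a::comm_ring_1 ring) = UNIV"
  "monoid.mult (ring_of_type_algebra :: 'a ring) = (*)"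
  "monoid.one (ring_of_type_algebra :: 'a ring) = 1"
  "ring.zero (ring_of_type_algebra :: 'a ring) = 0"
  "ring.add (ring_of_type_algebra :: 'a ring) = (+)"
  by (simp_all add: ring_of_type_algebra_def fun_eq_iff)

lemma ring_of_type_algebra_inv:
  assumes "(x::'a::field) \<noteq> 0"
  shows "m_inv ring_of_type_algebra x = inverse x"
proof -
  interpret field "ring_of_type_algebra :: 'a ring" by (rule field_from_type_algebra)
  show ?thesis
    by (rule comm_inv_char) (use assms in \<open>auto simp: ring_of_type_algebra_simps\<close>)
qed

lemma ring_of_type_algebra_minus:
  "a_inv ring_of_type_algebra (x::'a::field) = - x"
proof -
  interpret field "ring_of_type_algebra :: 'a ring" by (rule field_from_type_algebra)
  have "- x \<oplus>\<^bsub>ring_of_type_algebra\<^esub> x = \<zero>\<^bsub>ring_of_type_algebra\<^esub>"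
    by (simp add: ring_of_type_algebra_simps)
  then show ?thesis
    by (intro minus_equality) (auto simp: ring_of_type_algebra_simps)
qed

lemma adjoin_minimal:
  assumes "range to_ac \<subseteq> E" "S \<subseteq> E" "\<And>x y. x \<in> E \<Longrightarrow> y \<in> E \<Longrightarrow> x + y \<in> E"
    "\<And>x y. x \<in> E \<Longrightarrow> y \<in> E \<Longrightarrow> x * y \<in> E" "\<And>x. x \<in> E \<Longrightarrow> inverse x \<in> E"
  shows "adjoin (S :: 'k::field alg_closure set) \<subseteq> E"
proof
  fix x assume "x \<in> adjoin S"
  then show "x \<in> E"
    unfolding adjoin_def
  proof induction
    case one
    show ?case using assms(1) by (metis range_eqI subsetD to_ac_1 ring_of_type_algebra_simps(3))
  next
    case (incl h)
    then show ?case using assms by auto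
  next
    case (a_inv h)
    have "to_ac (-1) \<in> E" using assms(1) by blast
    then have "to_ac (-1) * h \<in> E" using a_inv assms(4) by blast
    then show ?case by (simp add: ring_of_type_algebra_minus)
  next
    case (m_inv h)
    then show ?case using assms(5) by (simp add: ring_of_type_algebra_inv ring_of_type_algebra_simps)
  qed (use assms in \<open>auto simp: ring_of_type_algebra_simps\<close>)
qed

lemma adjoin_props:
  fixes S :: "'k::field alg_closure set"
  shows "to_ac c \<in> adjoin S" "x \<in> S \<Longrightarrow> x \<in> adjoin S"
    "x \<in> adjoin S \<Longrightarrow> y \<in> adjoin S \<Longrightarrow> x + y \<in> adjoin S"
    "x \<in> adjoin S \<Longrightarrow> y \<in> adjoin S \<Longrightarrow> x * y \<in> adjoin S"
    "x \<in> adjoin S \<Longrightarrow> inverse x \<in> adjoin S"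
proof -
  show "to_ac c \<in> adjoin S" "x \<in> S \<Longrightarrow> x \<in> adjoin S"
    by (auto simp: adjoin_def intro: generate_field.incl)
  show "x \<in> adjoin S \<Longrightarrow> y \<in> adjoin S \<Longrightarrow> x + y \<in> adjoin S"
    "x \<in> adjoin S \<Longrightarrow> y \<in> adjoin S \<Longrightarrow> x * y \<in> adjoin S"
    using generate_field.eng_add[of x "ring_of_type_algebra" _ y]
      generate_field.eng_mult[of x "ring_of_type_algebra" _ y]
    by (auto simp: adjoin_def ring_of_type_algebra_simps)
  show "x \<in> adjoin S \<Longrightarrow> inverse x \<in> adjoin S"
    using generate_field.m_inv[of x "ring_of_type_algebra"] ring_of_type_algebra_inv[of x]
    by (cases "x = 0") (auto simp: adjoin_def ring_of_type_algebra_simps)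
qed

lemma adjoin_sqrt:
  fixes t :: "'k::field_char_0 alg_closure"
  assumes "t\<^sup>2 = to_ac d"
  shows "adjoin {t} = {to_ac x + to_ac y * t |x y. True}"
proof
  let ?E = "{to_ac x + to_ac y * t |x y. True}"
  have tt: "t * t = to_ac d" using assms by (simp add: power2_eq_square)
  have "t \<in> adjoin {t}" by (rule adjoin_props) simp
  then show "?E \<subseteq> adjoin {t}" by (auto intro!: adjoin_props(1,3,4))
  show "adjoin {t} \<subseteq> ?E"
  proof (cases "t \<in> range to_ac")
    case True
    then obtain r where r: "t = to_ac r" by blast
    have *: "to_ac c \<in> ?E" for c by (rule CollectI, rule exI[of _ c], rule exI[of _ 0]) simp
    have "adjoin {t} \<subseteq> range to_ac"
      by (rule adjoin_minimal) (auto simp: r simp flip: to_ac_add to_ac_mult to_ac_inverse)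
    then show ?thesis using * by blast
  next
    case False
    show ?thesis
    proof (rule adjoin_minimal)
      have "to_ac c \<in> ?E" for c by (rule CollectI, rule exI[of _ c], rule exI[of _ 0]) simp
      then show "range to_ac \<subseteq> ?E" by blast
      have "to_ac 0 + to_ac 1 * t \<in> ?E" by blast
      then have "t \<in> ?E" by (simp only: to_ac_0 to_ac_1 add_0 mult_1)
      then show "{t} \<subseteq> ?E" by blast
    next
      fix x y assume "x \<in> ?E" "y \<in> ?E"
      then obtain a b c e where *: "x = to_ac a + to_ac b * t" "y = to_ac c + to_ac e * t" by blast
      have "x + y = to_ac (a + c) + to_ac (b + e) * t" by (simp add: * algebra_simps)
      then show "x + y \<in> ?E" by blast
      have "x * y = to_ac a * to_ac c + to_ac b * to_ac e * (t * t) + (to_ac a * to_ac e + to_ac b * to_ac c) * t"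
        by (simp add: * algebra_simps)
      then have "x * y = to_ac (a * c + b * e * d) + to_ac (a * e + b * c) * t"
        by (simp add: tt)
      then show "x * y \<in> ?E" by blast
    next
      fix x assume "x \<in> ?E"
      then obtain a b where x: "x = to_ac a + to_ac b * t" by blast
      define n where "n = a * a - b * b * d"
      have mul: "x * (to_ac a - to_ac b * t) = to_ac n"
        by (simp add: x n_def algebra_simps flip: tt)
      show "inverse x \<in> ?E"
      proof (cases "x = 0")
        case True
        then show ?thesis by (auto intro!: exI[of _ 0])
      next
        case x0: False
        have "to_ac a - to_ac b * t \<noteq> 0"
        proof
          assume 0: "to_ac a - to_ac b * t = 0"
          show False
          proof (cases "b = 0")
            case True then show False using 0 x0 x by simp
          next
            case b: False
            then have "t = to_ac (a / b)" using 0 by (simp add: field_simps)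
            then show False using False by blast
          qed
        qed
        then have "n \<noteq> 0" using mul x0 by (metis mult_eq_0_iff to_ac_eq_0_iff)
        then have "x * (to_ac (a / n) + to_ac (- b / n) * t) = 1"
          using mul by (simp add: field_simps)
        then have "inverse x = to_ac (a / n) + to_ac (- b / n) * t" by (rule inverse_unique)
        then show ?thesis by blast
      qed
    qed
  qed
qed

lemma adjoin_rational: "t \<in> range to_ac \<Longrightarrow> adjoin {t} = range to_ac"
  for t :: "'k::field_char_0 alg_closure"
proof -
  assume "t \<in> range to_ac"
  then have "adjoin {t} \<subseteq> range to_ac"
    by (intro adjoin_minimal) (auto simp flip: to_ac_add to_ac_mult to_ac_inverse)
  then show ?thesis using adjoin_props(1) by blast
qed

lemma fixed_field_sqrt:
  fixes t :: "'k::field_char_0 alg_closure"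
  assumes "t\<^sup>2 = to_ac d"
  shows "fixed_field {\<eta>\<in>Gal. \<eta> t = t} = adjoin {t}"
proof
  show "adjoin {t} \<subseteq> fixed_field {\<eta>\<in>Gal. \<eta> t = t}"
    unfolding adjoin_sqrt[OF assms] by (auto simp: fixed_field_def Gal_def)
  show "fixed_field {\<eta>\<in>Gal. \<eta> t = t} \<subseteq> adjoin {t}"
  proof
    fix z assume z: "z \<in> fixed_field {\<eta>\<in>Gal. \<eta> t = t}"
    show "z \<in> adjoin {t}"
    proof (rule ccontr)
      assume "z \<notin> adjoin {t}"
      then have "\<exists>\<eta>\<in>Gal. (\<forall>c\<in>adjoin {t}. \<eta> c = c) \<and> \<eta> z \<noteq> z"
        by (intro Gal_moves) (auto intro: adjoin_props(1,3,4))
      then obtain \<eta> where "\<eta> \<in> Gal" "\<forall>c\<in>adjoin {t}. \<eta> c = c" "\<eta> z \<noteq> z" by blast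
      moreover have "t \<in> adjoin {t}" by (rule adjoin_props) simp
      ultimately show False using z by (auto simp: fixed_field_def)
    qed
  qed
qed

lemma adjoin_sqrt_eq_iff:
  fixes t u :: "'k::field_char_0 alg_closure"
  assumes t: "t\<^sup>2 = to_ac d" and u: "u\<^sup>2 = to_ac e" and "u \<noteq> 0" "t \<noteq> 0"
  shows "adjoin {t} = adjoin {u} \<longleftrightarrow> (\<exists>r. u = to_ac r * t)"
proof
  assume eq: "adjoin {t} = adjoin {u}"
  show "\<exists>r. u = to_ac r * t"
  proof (cases "t \<in> range to_ac")
    case True
    then obtain q where q: "t = to_ac q" by blast
    have "u \<in> range to_ac" using adjoin_rational[OF True] eq adjoin_props(2)[of u "{u}"] by auto
    then obtain p where "u = to_ac p" by blast
    then show ?thesis using q assms(4) by (intro exI[of _ "p / q"]) auto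
  next
    case False
    have "u \<in> adjoin {t}" using eq adjoin_props(2)[of u "{u}"] by auto
    then obtain x y where xy: "u = to_ac x + to_ac y * t" by (auto simp: adjoin_sqrt[OF t])
    have "to_ac (2 * x * y) * t = to_ac (e - x\<^sup>2 - y\<^sup>2 * d)"
      using u unfolding xy by (simp add: power2_eq_square algebra_simps flip: t)
    then have *: "t = to_ac ((e - x\<^sup>2 - y\<^sup>2 * d) / (2 * x * y))" if "x * y \<noteq> 0"
      using that by (simp add: field_simps)
    have "x * y = 0"
      using * False by blast
    moreover have "y \<noteq> 0"
    proof
      assume "y = 0"
      then have "adjoin {u} = range to_ac" using xy by (intro adjoin_rational) auto
      then show False using False eq adjoin_props(2)[of t "{t}"] by auto
    qed
    ultimately show ?thesis using xy by auto
  qed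
next
  assume "\<exists>r. u = to_ac r * t"
  then obtain r where r: "u = to_ac r * t" by blast
  then have r0: "r \<noteq> 0" using assms(3) by auto
  have *: "to_ac x + to_ac y * u = to_ac x + to_ac (y * r) * t" for x y by (simp add: r)
  have **: "to_ac x + to_ac y * t = to_ac x + to_ac (y / r) * u" for x y using r0 by (simp add: r)
  show "adjoin {t} = adjoin {u}"
    unfolding adjoin_sqrt[OF t] adjoin_sqrt[OF u] using * ** by blast
qed

lemma alg_closure_sqrt: "\<exists>t :: 'k::field alg_closure. t\<^sup>2 = z"
proof -
  let ?p = "[:- z, 0, 1:]"
  have "lead_coeff ?p = 1" "degree ?p > 0" by auto
  then obtain t where "poly ?p t = 0" using alg_closed_imp_poly_has_root by blast
  then show ?thesis by (intro exI[of _ t]) (simp add: power2_eq_square)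
qed

text \<open>By completing the square in a polynomial of degree two.\<close>

lemma Ex2_eq: "(Ex2 :: 'k::field_char_0 alg_closure set set) = {adjoin {t} |t d. d \<noteq> 0 \<and> t\<^sup>2 = to_ac d}"
proof (rule subset_antisym; rule subsetI)
  fix E :: "'k alg_closure set"
  assume "E \<in> Ex2"
  then obtain p :: "'k poly" where p: "degree p = 2" "E = adjoin {z. poly (map_poly to_ac p) z = 0}"
    by (auto simp: Ex2_def)
  define a b c where "a = coeff p 2" and "b = coeff p 1" and "c = coeff p 0"
  have abc: "p = [:c, b, a:]"
    by (rule poly_eqI)
      (auto simp: a_def b_def c_def coeff_pCons coeff_eq_0 p(1) numeral_2_eq_2 split: nat.splits)
  have a: "a \<noteq> 0" using p(1) leading_coeff_0_iff[of p] by (auto simp: a_def)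
  define d where "d = b\<^sup>2 - 4 * a * c"
  obtain t where t: "t\<^sup>2 = to_ac d" using alg_closure_sqrt by blast
  have root: "poly (map_poly to_ac p) z = 0 \<longleftrightarrow> (to_ac (2 * a) * z + to_ac b)\<^sup>2 = t\<^sup>2" for z
  proof -
    have "(to_ac (2 * a) * z + to_ac b)\<^sup>2 - t\<^sup>2 = 4 * to_ac a * poly (map_poly to_ac p) z"
      unfolding t d_def abc by (simp add: map_poly_pCons power2_eq_square algebra_simps)
    then show ?thesis using a by auto
  qed
  have tr: "to_ac (2 * a) * z + to_ac b = u \<longleftrightarrow> z = to_ac (- b / (2 * a)) + to_ac (1 / (2 * a)) * u" for z u
    using a by (auto simp: field_simps)
  have roots: "{z. poly (map_poly to_ac p) z = 0} =
      {to_ac (- b / (2 * a)) + to_ac (1 / (2 * a)) * t, to_ac (- b / (2 * a)) + to_ac (1 / (2 * a)) * - t}" (is "?R = {?u, ?v}")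
    by (auto simp only: root power2_eq_iff tr)
  have E: "E = adjoin {t}"
  proof
    show "E \<subseteq> adjoin {t}"
      unfolding p(2) roots
    proof (rule adjoin_minimal)
      have t: "t \<in> adjoin {t}" by (rule adjoin_props) simp
      have "to_ac (-1) * t \<in> adjoin {t}" by (intro adjoin_props(4) adjoin_props(1) t)
      then have "- t \<in> adjoin {t}" by simp
      then have "?u \<in> adjoin {t}" "?v \<in> adjoin {t}"
        using t by (blast intro: adjoin_props(1,3,4))+
      then show "{?u, ?v} \<subseteq> adjoin {t}" by blast
    qed (auto intro: adjoin_props)
    show "adjoin {t} \<subseteq> E"
    proof (rule adjoin_minimal)
      have "to_ac (2 * a) * ?u + to_ac b \<in> E"
        unfolding p(2) roots by (intro adjoin_props) auto
      moreover have "to_ac (2 * a) * ?u + to_ac b = t" by (subst tr) simp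
      ultimately show "{t} \<subseteq> E" by simp
    qed (auto simp: p(2) intro: adjoin_props)
  qed
  show "E \<in> {adjoin {t} |t d. d \<noteq> 0 \<and> t\<^sup>2 = to_ac d}"
  proof (cases "d = 0")
    case True
    then have "t = 0" using t by simp
    moreover have "(0 :: 'k alg_closure) \<in> range to_ac" "(1 :: 'k alg_closure) \<in> range to_ac"
      by (auto intro: range_eqI[of _ _ 0] range_eqI[of _ _ 1])
    ultimately have "E = adjoin {1}" using E by (simp add: adjoin_rational)
    then show ?thesis by (auto intro!: exI[of _ 1])
  next
    case False
    then show ?thesis using E t by blast
  qed
next
  fix E :: "'k alg_closure set"
  assume "E \<in> {adjoin {t} |t d. d \<noteq> 0 \<and> t\<^sup>2 = to_ac d}"
  then obtain t d where t: "d \<noteq> 0" "t\<^sup>2 = to_ac d" "E = adjoin {t}" by blast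
  let ?p = "[:- d, 0, 1:]"
  have roots: "{z. poly (map_poly to_ac ?p) z = 0} = {t, - t}"
  proof -
    have tt: "t * t = to_ac d" using t(2) by (simp add: power2_eq_square)
    have "poly (map_poly to_ac ?p) z = 0 \<longleftrightarrow> z\<^sup>2 = t\<^sup>2" for z
      by (simp add: map_poly_pCons power2_eq_square tt)
    then show ?thesis by (auto simp: power2_eq_iff)
  qed
  have "adjoin {t, - t} = adjoin {t}"
  proof
    have "to_ac (-1) * t \<in> adjoin {t}" by (intro adjoin_props) auto
    then show "adjoin {t, - t} \<subseteq> adjoin {t}"
      by (intro adjoin_minimal) (auto intro: adjoin_props)
    show "adjoin {t} \<subseteq> adjoin {t, - t}"
      by (intro adjoin_minimal) (auto intro: adjoin_props)
  qed
  then have "E = adjoin {z. poly (map_poly to_ac ?p) z = 0}" using roots t by simp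
  moreover have "degree ?p = 2" by simp
  ultimately show "E \<in> Ex2" unfolding Ex2_def by blast
qed

section \<open>Regular functions and the Zariski topology\<close>

lemma regular_funs_subst:
  assumes "f \<in> regular_funs C S"
    and "\<And>c. c \<in> S \<Longrightarrow> \<exists>p\<in>regular_funs C S'. \<forall>x\<in>A. c (\<phi> x) = p x"
  shows "\<exists>p\<in>regular_funs C S'. \<forall>x\<in>A. f (\<phi> x) = p x"
  using assms(1)
proof induction
  case (const c)
  then show ?case by (intro bexI[OF _ regular_funs.const]) auto
next
  case (coord f)
  then show ?case by (rule assms(2))
next
  case (add f g)
  then obtain p q where "p \<in> regular_funs C S'" "\<forall>x\<in>A. f (\<phi> x) = p x"
    "q \<in> regular_funs C S'" "\<forall>x\<in>A. g (\<phi> x) = q x" by blast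
  then show ?case by (intro bexI[OF _ regular_funs.add[of p C S' q]]) auto
next
  case (mult f g)
  then obtain p q where "p \<in> regular_funs C S'" "\<forall>x\<in>A. f (\<phi> x) = p x"
    "q \<in> regular_funs C S'" "\<forall>x\<in>A. g (\<phi> x) = q x" by blast
  then show ?case by (intro bexI[OF _ regular_funs.mult[of p C S' q]]) auto
qed

lemma regular_funs_sum:
  assumes "0 \<in> C" "finite I" "\<And>i. i \<in> I \<Longrightarrow> f i \<in> regular_funs C S"
  shows "(\<lambda>x. \<Sum>i\<in>I. f i x) \<in> regular_funs C S"
  using assms(2,3)
proof (induction I rule: finite_induct)
  case empty
  then show ?case using regular_funs.const[OF assms(1)] by simp
next
  case (insert i I)
  then show ?case using regular_funs.add[of "f i" C S "\<lambda>x. \<Sum>i\<in>I. f i x"] by simp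
qed

lemma regular_funs_prod:
  assumes "1 \<in> C" "finite I" "\<And>i. i \<in> I \<Longrightarrow> f i \<in> regular_funs C S"
  shows "(\<lambda>x. \<Prod>i\<in>I. f i x) \<in> regular_funs C S"
  using assms(2,3)
proof (induction I rule: finite_induct)
  case empty
  then show ?case using regular_funs.const[OF assms(1)] by simp
next
  case (insert i I)
  then show ?case using regular_funs.mult[of "f i" C S "\<lambda>x. \<Prod>i\<in>I. f i x"] by simp
qed

lemma regular_funs_power:
  assumes "1 \<in> C" "f \<in> regular_funs C S"
  shows "(\<lambda>x. f x ^ n) \<in> regular_funs C S"
proof (induction n)
  case 0
  then show ?case using regular_funs.const[OF assms(1)] by simp
next
  case (Suc n)
  then show ?case using regular_funs.mult[OF assms(2)] by simp
qed

lemma regular_funs_scale: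
  assumes "c \<in> C" "f \<in> regular_funs C S"
  shows "(\<lambda>x. c * f x) \<in> regular_funs C S"
  using regular_funs.mult[OF regular_funs.const[OF assms(1)] assms(2)] by simp

lemma regular_funs_uminus:
  assumes "-1 \<in> C" "f \<in> regular_funs C S"
  shows "(\<lambda>x. - f x) \<in> regular_funs C S"
  using regular_funs_scale[OF assms] by simp

lemma regular_funs_diff:
  assumes "-1 \<in> C" "f \<in> regular_funs C S" "g \<in> regular_funs C S"
  shows "(\<lambda>x. f x - g x) \<in> regular_funs C S"
  using regular_funs.add[OF assms(2) regular_funs_uminus[OF assms(1,3)]] by simp

lemma regular_funs_det:
  fixes M :: "'g \<Rightarrow> 'a::comm_ring_1^'n^'n"
  assumes "0 \<in> C" "1 \<in> C" "-1 \<in> C" "\<And>i j. (\<lambda>x. M x $ i $ j) \<in> regular_funs C S"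
  shows "(\<lambda>x. det (M x)) \<in> regular_funs C S"
proof -
  have "(of_int (sign p) :: 'a) \<in> C" for p :: "'n \<Rightarrow> 'n"
    using assms by (cases p rule: sign_cases) auto
  then show ?thesis
    unfolding det_def
    by (intro regular_funs_sum regular_funs_scale regular_funs_prod assms) auto
qed

lemma range_to_ac_consts: "0 \<in> range to_ac" "1 \<in> range to_ac" "-1 \<in> range to_ac"
  by (auto intro: range_eqI[of _ _ 0] range_eqI[of _ _ 1] range_eqI[of _ _ "-1"])

lemma topspace_zariski: "topspace (zariski G) = carrier G"
proof -
  have "(\<lambda>_. 1) \<in> regular_funs UNIV (coords G)" by (rule regular_funs.const) simp
  then have "\<exists>f\<in>regular_funs UNIV (coords G). carrier G = {x \<in> carrier G. f x \<noteq> 0}"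
    by (rule bexI[rotated]) auto
  then show ?thesis
    unfolding zariski_def topology_generated_by_topspace by blast
qed

lemma openin_zariski_basic:
  "f \<in> regular_funs UNIV (coords G) \<Longrightarrow> openin (zariski G) {x \<in> carrier G. f x \<noteq> 0}"
  unfolding zariski_def by (rule topology_generated_by_Basis) blast

lemma openin_zariskiD:
  assumes "openin (zariski G) U" "x \<in> U"
  shows "\<exists>f\<in>regular_funs UNIV (coords G). f x \<noteq> 0 \<and> {y \<in> carrier G. f y \<noteq> 0} \<subseteq> U"
proof -
  have "generate_topology_on {{x \<in> carrier G. f x \<noteq> 0} |f. f \<in> regular_funs UNIV (coords G)} U"
    using assms(1) by (simp add: zariski_def openin_topology_generated_by_iff)
  then show ?thesis
    using assms(2)
  proof (induction arbitrary: x)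
    case Empty
    then show ?case by simp
  next
    case (Int a b)
    then have "x \<in> a" "x \<in> b" by auto
    obtain f where "f \<in> regular_funs UNIV (coords G)" "f x \<noteq> 0" "{y \<in> carrier G. f y \<noteq> 0} \<subseteq> a"
      using Int.IH(1)[OF \<open>x \<in> a\<close>] by blast
    moreover obtain g where
      "g \<in> regular_funs UNIV (coords G)" "g x \<noteq> 0" "{y \<in> carrier G. g y \<noteq> 0} \<subseteq> b"
      using Int.IH(2)[OF \<open>x \<in> b\<close>] by blast
    ultimately
    show ?case by (intro bexI[OF _ regular_funs.mult[of f UNIV "coords G" g]]) auto
  next
    case (UN K)
    from UN.prems obtain k where k: "k \<in> K" "x \<in> k" by auto
    obtain f where "f \<in> regular_funs UNIV (coords G)" "f x \<noteq> 0" "{y \<in> carrier G. f y \<noteq> 0} \<subseteq> k"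
      using UN.IH[OF k] by blast
    then show ?case using k(1) by (intro bexI[of _ f]) auto
  next
    case (Basis s)
    then show ?case by blast
  qed
qed

text \<open>Regular functions along the curve are polynomials in the parameter divided by powers of \<open>D\<close>; the roots
  of \<open>D\<close> are excluded, so that the values there do not matter.\<close>

definition rational_curve :: "('g \<Rightarrow> 'a::field) set \<Rightarrow> 'a poly \<Rightarrow> ('a \<Rightarrow> 'g) \<Rightarrow> bool" where
  "rational_curve S D \<gamma> \<longleftrightarrow>
     (\<forall>f\<in>S. \<exists>P n. \<forall>t. poly D t \<noteq> 0 \<longrightarrow> f (\<gamma> t) * poly D t ^ n = poly P t)"

lemma rational_curve_regular:
  assumes "rational_curve S D \<gamma>" "f \<in> regular_funs UNIV S"
  shows "\<exists>P n. \<forall>t. poly D t \<noteq> 0 \<longrightarrow> f (\<gamma> t) * poly D t ^ n = poly P t"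
  using assms(2)
proof induction
  case (const c)
  show ?case by (rule exI[of _ "[:c:]"], rule exI[of _ 0]) simp
next
  case (coord f)
  then show ?case using assms(1) by (simp add: rational_curve_def)
next
  case (add f g)
  then obtain P n Q m where
    *: "\<And>t. poly D t \<noteq> 0 \<Longrightarrow> f (\<gamma> t) * poly D t ^ n = poly P t"
       "\<And>t. poly D t \<noteq> 0 \<Longrightarrow> g (\<gamma> t) * poly D t ^ m = poly Q t" by blast
  show ?case
    by (rule exI[of _ "P * D ^ m + Q * D ^ n"], rule exI[of _ "n + m"])
      (simp add: *[symmetric] power_add algebra_simps)
next
  case (mult f g)
  then obtain P n Q m where
    *: "\<And>t. poly D t \<noteq> 0 \<Longrightarrow> f (\<gamma> t) * poly D t ^ n = poly P t"
       "\<And>t. poly D t \<noteq> 0 \<Longrightarrow> g (\<gamma> t) * poly D t ^ m = poly Q t" by blast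
  show ?case
    by (rule exI[of _ "P * Q"], rule exI[of _ "n + m"])
      (simp add: *[symmetric] power_add algebra_simps)
qed

definition curve_connected :: "('g, 'a::field) alg_group \<Rightarrow> 'g set \<Rightarrow> bool" where
  "curve_connected G C \<longleftrightarrow> C \<subseteq> carrier G \<and> (\<forall>a\<in>C. \<forall>b\<in>C. \<exists>D \<gamma>. poly D 0 \<noteq> 0 \<and> poly D 1 \<noteq> 0 \<and>
      \<gamma> 0 = a \<and> \<gamma> 1 = b \<and> rational_curve (coords G) D \<gamma> \<and> (\<forall>t. poly D t \<noteq> 0 \<longrightarrow> \<gamma> t \<in> C))"

text \<open>A separation of the set would give two nonzero polynomials in the parameter of a curve whose product
  vanishes wherever the denominator does not.\<close>

lemma curve_connected_connectedin:
  fixes G :: "('g, 'a::field_char_0) alg_group"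
  assumes "curve_connected G C"
  shows "connectedin (zariski G) C"
  unfolding connectedin topspace_zariski
proof (intro conjI notI)
  show "C \<subseteq> carrier G" using assms by (simp add: curve_connected_def)
  assume "\<exists>E1 E2. openin (zariski G) E1 \<and> openin (zariski G) E2 \<and> C \<subseteq> E1 \<union> E2 \<and>
    E1 \<inter> E2 \<inter> C = {} \<and> E1 \<inter> C \<noteq> {} \<and> E2 \<inter> C \<noteq> {}"
  then obtain U V a b where UV: "openin (zariski G) U" "openin (zariski G) V" "U \<inter> V \<inter> C = {}"
    and ab: "a \<in> U" "a \<in> C" "b \<in> V" "b \<in> C" by blast
  obtain f where f: "f \<in> regular_funs UNIV (coords G)" "f a \<noteq> 0" "{y \<in> carrier G. f y \<noteq> 0} \<subseteq> U"
    using openin_zariskiD[OF UV(1) ab(1)] by blast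
  obtain h where h: "h \<in> regular_funs UNIV (coords G)" "h b \<noteq> 0" "{y \<in> carrier G. h y \<noteq> 0} \<subseteq> V"
    using openin_zariskiD[OF UV(2) ab(3)] by blast
  obtain D \<gamma> where D: "poly D 0 \<noteq> 0" "poly D 1 \<noteq> 0" "\<gamma> 0 = a" "\<gamma> 1 = b"
    and \<gamma>: "rational_curve (coords G) D \<gamma>" "\<And>t. poly D t \<noteq> 0 \<Longrightarrow> \<gamma> t \<in> C"
    using assms ab unfolding curve_connected_def by blast
  obtain P n where P: "\<And>t. poly D t \<noteq> 0 \<Longrightarrow> f (\<gamma> t) * poly D t ^ n = poly P t"
    using rational_curve_regular[OF \<gamma>(1) f(1)] by blast
  obtain Q m where Q: "\<And>t. poly D t \<noteq> 0 \<Longrightarrow> h (\<gamma> t) * poly D t ^ m = poly Q t"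
    using rational_curve_regular[OF \<gamma>(1) h(1)] by blast
  have "poly P 0 \<noteq> 0" "poly Q 1 \<noteq> 0" using P[of 0] Q[of 1] D f h by auto
  then have "D * P * Q \<noteq> 0" using D by auto
  then have "finite {t. poly (D * P * Q) t = 0}" by (rule poly_roots_finite)
  then obtain t where "poly (D * P * Q) t \<noteq> 0"
    using infinite_UNIV_char_0 ex_new_if_finite[where 'a = 'a] by blast
  then have "poly D t \<noteq> 0" "f (\<gamma> t) \<noteq> 0" "h (\<gamma> t) \<noteq> 0" using P[of t] Q[of t] by auto
  then have "\<gamma> t \<in> U \<inter> V \<inter> C" using \<gamma>(2) f(3) h(3) assms by (auto simp: curve_connected_def)
  then show False using UV(3) by blast
qed

text \<open>A certificate for being the identity component: the set is connected by curves, and both it and its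
  complement are defined by the nonvanishing of one regular function.\<close>

definition clopen_part :: "('g, 'a::field) alg_group \<Rightarrow> 'g set \<Rightarrow> bool" where
  "clopen_part G C \<longleftrightarrow> \<one>\<^bsub>G\<^esub> \<in> C \<and> curve_connected G C \<and>
     (\<exists>f\<in>regular_funs UNIV (coords G). \<exists>h\<in>regular_funs UNIV (coords G).
        \<forall>x\<in>carrier G. (x \<in> C \<longleftrightarrow> f x \<noteq> 0) \<and> (x \<notin> C \<longleftrightarrow> h x \<noteq> 0))"

lemma clopen_part_identity_component:
  fixes G :: "('g, 'a::field_char_0) alg_group"
  assumes "clopen_part G C"
  shows "identity_component G = G\<lparr>carrier := C\<rparr>"
proof -
  obtain f h where f: "f \<in> regular_funs UNIV (coords G)" and h: "h \<in> regular_funs UNIV (coords G)"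
    and fh: "\<And>x. x \<in> carrier G \<Longrightarrow> (x \<in> C \<longleftrightarrow> f x \<noteq> 0) \<and> (x \<notin> C \<longleftrightarrow> h x \<noteq> 0)"
    and C: "\<one>\<^bsub>G\<^esub> \<in> C" "curve_connected G C" "C \<subseteq> carrier G"
    using assms unfolding clopen_part_def curve_connected_def by blast
  let ?X = "zariski G"
  have con: "connectedin ?X C" by (rule curve_connected_connectedin[OF C(2)])
  have o1: "openin ?X C"
  proof -
    have "C = {x \<in> carrier G. f x \<noteq> 0}" using C(3) fh by blast
    then show ?thesis using openin_zariski_basic[OF f] by simp
  qed
  have o2: "openin ?X (carrier G - C)"
  proof -
    have "carrier G - C = {x \<in> carrier G. h x \<noteq> 0}" using fh by blast
    then show ?thesis using openin_zariski_basic[OF h] by simp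
  qed
  have "connected_component_of_set ?X \<one>\<^bsub>G\<^esub> = C"
  proof (rule subset_antisym; rule subsetI)
    fix x assume "x \<in> connected_component_of_set ?X \<one>\<^bsub>G\<^esub>"
    then obtain T where T: "connectedin ?X T" "\<one>\<^bsub>G\<^esub> \<in> T" "x \<in> T"
      by (auto simp: connected_component_of_def)
    show "x \<in> C"
    proof (rule ccontr)
      assume "x \<notin> C"
      moreover have "T \<subseteq> carrier G" using T(1) connectedin_subset_topspace topspace_zariski by metis
      ultimately have "openin ?X C \<and> openin ?X (carrier G - C) \<and> T \<subseteq> C \<union> (carrier G - C) \<and>
          C \<inter> (carrier G - C) \<inter> T = {} \<and> C \<inter> T \<noteq> {} \<and> (carrier G - C) \<inter> T \<noteq> {}"
        using T C o1 o2 by blast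
      then show False using T(1) unfolding connectedin by blast
    qed
  next
    fix x assume "x \<in> C"
    then show "x \<in> connected_component_of_set ?X \<one>\<^bsub>G\<^esub>"
      using con C(1) by (auto simp: connected_component_of_def)
  qed
  then show ?thesis by (simp add: identity_component_def)
qed

text \<open>Used for conjugation, which carries the stabilizer of one point to that of another point of its orbit.\<close>

lemma clopen_part_transport:
  assumes C: "clopen_part G C"
    and bij: "\<phi> ` carrier G \<subseteq> carrier H" "\<psi> ` carrier H \<subseteq> carrier G"
      "\<And>x. x \<in> carrier G \<Longrightarrow> \<psi> (\<phi> x) = x" "\<And>y. y \<in> carrier H \<Longrightarrow> \<phi> (\<psi> y) = y"
    and one: "\<phi> \<one>\<^bsub>G\<^esub> = \<one>\<^bsub>H\<^esub>"
    and reg: "\<And>c. c \<in> coords H \<Longrightarrow> \<exists>p\<in>regular_funs UNIV (coords G). \<forall>x\<in>carrier G. c (\<phi> x) = p x"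
      "\<And>c. c \<in> coords G \<Longrightarrow> \<exists>p\<in>regular_funs UNIV (coords H). \<forall>x\<in>carrier H. c (\<psi> x) = p x"
  shows "clopen_part H (\<phi> ` C)"
proof -
  have CG: "C \<subseteq> carrier G" and cc: "curve_connected G C" using C by (auto simp: clopen_part_def curve_connected_def)
  have cH: "curve_connected H (\<phi> ` C)"
    unfolding curve_connected_def
  proof (intro conjI ballI)
    show "\<phi> ` C \<subseteq> carrier H" using CG bij(1) by blast
    fix a' b' assume "a' \<in> \<phi> ` C" "b' \<in> \<phi> ` C"
    then obtain a b where ab: "a \<in> C" "b \<in> C" "a' = \<phi> a" "b' = \<phi> b" by blast
    then obtain D \<gamma> where D: "poly D 0 \<noteq> 0" "poly D 1 \<noteq> 0" "\<gamma> 0 = a" "\<gamma> 1 = b"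
      and \<gamma>: "rational_curve (coords G) D \<gamma>" "\<And>t. poly D t \<noteq> 0 \<Longrightarrow> \<gamma> t \<in> C"
      using cc unfolding curve_connected_def by blast
    have "rational_curve (coords H) D (\<phi> \<circ> \<gamma>)"
      unfolding rational_curve_def
    proof
      fix c assume "c \<in> coords H"
      then obtain p where p: "p \<in> regular_funs UNIV (coords G)" "\<And>x. x \<in> carrier G \<Longrightarrow> c (\<phi> x) = p x"
        using reg(1) by blast
      obtain P n where "\<forall>t. poly D t \<noteq> 0 \<longrightarrow> p (\<gamma> t) * poly D t ^ n = poly P t"
        using rational_curve_regular[OF \<gamma>(1) p(1)] by blast
      then show "\<exists>P n. \<forall>t. poly D t \<noteq> 0 \<longrightarrow> c ((\<phi> \<circ> \<gamma>) t) * poly D t ^ n = poly P t"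
        using p(2) \<gamma>(2) CG by (intro exI[of _ P] exI[of _ n]) (simp add: subset_eq)
    qed
    then show "\<exists>D \<gamma>. poly D 0 \<noteq> 0 \<and> poly D 1 \<noteq> 0 \<and> \<gamma> 0 = a' \<and> \<gamma> 1 = b' \<and>
        rational_curve (coords H) D \<gamma> \<and> (\<forall>t. poly D t \<noteq> 0 \<longrightarrow> \<gamma> t \<in> \<phi> ` C)"
      using D \<gamma>(2) ab by (intro exI[of _ D] exI[of _ "\<phi> \<circ> \<gamma>"]) auto
  qed
  obtain f h where f: "f \<in> regular_funs UNIV (coords G)" and h: "h \<in> regular_funs UNIV (coords G)"
    and fh: "\<And>x. x \<in> carrier G \<Longrightarrow> (x \<in> C \<longleftrightarrow> f x \<noteq> 0) \<and> (x \<notin> C \<longleftrightarrow> h x \<noteq> 0)"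
    using C unfolding clopen_part_def by blast
  have "\<exists>p\<in>regular_funs UNIV (coords H). \<forall>x\<in>carrier H. f (\<psi> x) = p x"
    by (rule regular_funs_subst[OF f]) (rule reg(2))
  then obtain f' where f': "f' \<in> regular_funs UNIV (coords H)" "\<forall>x\<in>carrier H. f (\<psi> x) = f' x" by blast
  have "\<exists>p\<in>regular_funs UNIV (coords H). \<forall>x\<in>carrier H. h (\<psi> x) = p x"
    by (rule regular_funs_subst[OF h]) (rule reg(2))
  then obtain h' where h': "h' \<in> regular_funs UNIV (coords H)" "\<forall>x\<in>carrier H. h (\<psi> x) = h' x" by blast
  have fh': "(x \<in> \<phi> ` C \<longleftrightarrow> f' x \<noteq> 0) \<and> (x \<notin> \<phi> ` C \<longleftrightarrow> h' x \<noteq> 0)" if x: "x \<in> carrier H" for x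
  proof -
    have "\<psi> x \<in> carrier G" using bij(2) x by blast
    moreover have "x \<in> \<phi> ` C \<longleftrightarrow> \<psi> x \<in> C"
    proof
      assume "x \<in> \<phi> ` C"
      then obtain y where "y \<in> C" "x = \<phi> y" by blast
      then show "\<psi> x \<in> C" using bij(3) CG by auto
    next
      assume "\<psi> x \<in> C"
      then show "x \<in> \<phi> ` C" using bij(4)[OF x] by (metis imageI)
    qed
    ultimately show ?thesis using fh[of "\<psi> x"] f'(2) h'(2) x by auto
  qed
  have "\<one>\<^bsub>G\<^esub> \<in> C" using C unfolding clopen_part_def by blast
  then have "\<one>\<^bsub>H\<^esub> \<in> \<phi> ` C" using one by (metis imageI)
  moreover have "\<exists>f\<in>regular_funs UNIV (coords H). \<exists>h\<in>regular_funs UNIV (coords H).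
      \<forall>x\<in>carrier H. (x \<in> \<phi> ` C \<longleftrightarrow> f x \<noteq> 0) \<and> (x \<notin> \<phi> ` C \<longleftrightarrow> h x \<noteq> 0)"
    by (rule bexI[OF _ f'(1)], rule bexI[OF _ h'(1)], rule ballI, rule fh')
  ultimately show ?thesis
    unfolding clopen_part_def using cH by (intro conjI)
qed

lemma k_isomorphicI:
  assumes "f \<in> iso G H" "k_regular_map G H f" "k_regular_map H G h"
    "\<And>x. x \<in> carrier G \<Longrightarrow> h (f x) = x"
  shows "k_isomorphic G H"
proof -
  have bij: "bij_betw f (carrier G) (carrier H)" using assms(1) by (simp add: iso_def)
  have eq: "inv_into (carrier G) f y = h y" if "y \<in> carrier H" for y
  proof -
    have "y \<in> f ` carrier G" using that bij by (simp add: bij_betw_def)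
    then obtain x where "x \<in> carrier G" "y = f x" by (rule imageE)
    then show ?thesis using assms(4) by (simp add: inv_into_f_f[OF bij_betw_imp_inj_on[OF bij]])
  qed
  have "k_regular_map H G (inv_into (carrier G) f)"
    using assms(3) unfolding k_regular_map_def by (simp only: eq cong: ball_cong) simp
  then show ?thesis using assms(1,2) unfolding k_isomorphic_def by (intro bexI[of _ f] conjI)
qed

section \<open>Groups of matrices\<close>

lemma G1_simps: "monoid.mult G1 = (**)" "\<one>\<^bsub>G1\<^esub> = mat 1"
  "coords G1 = {\<lambda>g. g $ i $ j |i j. True} \<union> {\<lambda>g. inverse (det g)}"
  by (simp_all add: G1_def GL_def)

lemma G1_inverse:
  fixes g :: "'a::field_char_0^7^7"
  assumes "g \<in> carrier G1"
  obtains h where "h \<in> carrier G1" "g ** h = mat 1" "h ** g = mat 1"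
proof -
  obtain c l where cl: "c \<noteq> 0" "l \<noteq> 0" "simil g c l" using assms by (auto simp: G1_iff)
  then obtain h where h: "g ** h = mat 1" "h ** g = mat 1"
    using simil_invertible[of g c l] by (auto simp: invertible_def)
  have sh: "simil h (inverse c) (inverse l)" by (rule simil_inverse[OF cl(3,1,2) h(1)])
  have "h \<in> carrier G1"
    unfolding G1_iff by (rule exI[of _ "inverse c"], rule exI[of _ "inverse l"]) (simp add: cl sh)
  then show ?thesis using h that by blast
qed

lemma G1_mult_closed: "g \<in> carrier G1 \<Longrightarrow> h \<in> carrier G1 \<Longrightarrow> g ** h \<in> carrier G1"
  for g h :: "'a::field_char_0^7^7"
  unfolding G1_iff by (metis mult_eq_0_iff simil_mult)

lemma special_G1: "special g \<Longrightarrow> g \<in> carrier G1" for g :: "'a::field_char_0^7^7"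
  unfolding G1_iff special_def by (metis zero_neq_one)

lemma scalar_G1: "t \<noteq> 0 \<Longrightarrow> mat t \<in> carrier G1" for t :: "'a::field_char_0"
  unfolding G1_iff using simil_scalar[of t] by (metis power_not_zero)

lemma G1_group: "group (G1 :: ('a::field_char_0^7^7, 'a) alg_group)"
proof (rule groupI)
  show "\<one>\<^bsub>G1\<^esub> \<in> carrier (G1 :: ('a^7^7, 'a) alg_group)"
    using special_G1[OF special_one] by (simp add: G1_simps)
  show "\<exists>y\<in>carrier G1. y \<otimes>\<^bsub>G1\<^esub> x = \<one>\<^bsub>G1\<^esub>" if "x \<in> carrier (G1 :: ('a^7^7, 'a) alg_group)" for x
    using G1_inverse[OF that] by (auto simp: G1_simps)
qed (auto simp: G1_simps G1_mult_closed matrix_mul_assoc)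

lemma GL_simps: "monoid.mult GL = (**)" "\<one>\<^bsub>GL\<^esub> = mat 1" "carrier GL = {g. invertible g}"
  "coords GL = {\<lambda>g. g $ i $ j |i j. True} \<union> {\<lambda>g. inverse (det g)}"
  by (simp_all add: GL_def)

lemma G2_simps:
  "monoid.mult G2 = (\<lambda>(g, h) (g', h'). (g ** g', h ** h'))" "\<one>\<^bsub>G2\<^esub> = (mat 1, mat 1)"
  "carrier G2 = carrier G1 \<times> {g. invertible g}"
  "coords G2 = {\<lambda>x. f (fst x) |f. f \<in> coords G1} \<union> {\<lambda>x. f (snd x) |f. f \<in> coords GL}"
  by (simp_all add: G2_def prod_group_def G1_simps GL_simps)

lemma G2_group: "group (G2 :: (('a::field_char_0^7^7) \<times> ('a^2^2), 'a) alg_group)"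
proof (rule groupI)
  show "\<exists>y\<in>carrier G2. y \<otimes>\<^bsub>G2\<^esub> x = \<one>\<^bsub>G2\<^esub>"
    if x: "x \<in> carrier (G2 :: (('a^7^7) \<times> ('a^2^2), 'a) alg_group)" for x
  proof -
    obtain g h where gh: "x = (g, h)" "g \<in> carrier G1" "invertible h" using x by (auto simp: G2_simps)
    obtain g' where "g' \<in> carrier G1" "g' ** g = mat 1" using G1_inverse[OF gh(2)] by blast
    moreover obtain h' where "invertible h'" "h' ** h = mat 1" using gh(3) unfolding invertible_def by blast
    ultimately show ?thesis by (intro bexI[of _ "(g', h')"]) (auto simp: G2_simps gh)
  qed
  show "\<one>\<^bsub>G2\<^esub> \<in> carrier (G2 :: (('a^7^7) \<times> ('a^2^2), 'a) alg_group)"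
    using special_G1[OF special_one] by (auto simp: G2_simps invertible_def intro: exI[of _ "mat 1"])
qed (auto simp: G2_simps G1_mult_closed matrix_mul_assoc invertible_mult)

subsection \<open>The multiplier\<close>

text \<open>The character of \<open>G\<^sub>1\<close> that restricts to the identity on scalar matrices.\<close>

definition chi :: "'a::field^7^7 \<Rightarrow> 'a" where
  "chi g = wedge3_act g wbar $ 2 $ 3 $ 4 / Delta (g *v evec 1)"

lemma chi_simil: "simil g c l \<Longrightarrow> chi g = c / l"
  by (simp add: chi_def simil_def Delta_evec1) (simp add: wbar_nth wedge3_nth evec_nth)

lemma chi_mult: "g \<in> carrier G1 \<Longrightarrow> h \<in> carrier G1 \<Longrightarrow> chi (g ** h) = chi g * chi h"
  for g h :: "'a::field_char_0^7^7"
  unfolding G1_iff by (metis chi_simil simil_mult times_divide_times_eq)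

lemma chi_nonzero: "g \<in> carrier G1 \<Longrightarrow> chi g \<noteq> 0" for g :: "'a::field_char_0^7^7"
  unfolding G1_iff by (auto simp: chi_simil)

lemma chi_special: "special g \<Longrightarrow> chi g = 1"
  by (simp add: special_def chi_simil)

lemma chi_scalar: "t \<noteq> 0 \<Longrightarrow> chi (mat t) = t" for t :: "'a::field_char_0"
  using chi_simil[OF simil_scalar[of t]] by (simp add: power2_eq_square power3_eq_cube)

lemma mat_mv: "mat t *v x = t *s x" for x :: "'a::comm_ring_1^'n"
  by (simp add: mat_def matrix_vector_mult_def vec_eq_iff if_distrib[of "\<lambda>x. x * _"] cong: if_cong)

lemma mat_mult_commute: "mat t ** g = g ** mat t" for g :: "'a::comm_ring_1^'n^'n"
  by (simp add: mat_def matrix_matrix_mult_def vec_eq_iff if_distrib[of "\<lambda>x. x * _"]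
      if_distrib[of "\<lambda>x. _ * x"] mult.commute cong: if_cong)

lemma mat_mult_mat: "mat s ** mat t = (mat (s * t) :: 'a::comm_ring_1^'n^'n)"
  by (simp add: mat_def matrix_matrix_mult_def vec_eq_iff if_distrib[of "\<lambda>x. x * _"]
      cong: if_cong)

subsection \<open>The stabilizer of a vector\<close>

definition cof3 :: "'a::comm_ring_1^3^3 \<Rightarrow> 'a^3^3" where
  "cof3 A = vector [
     vector [A$2$2*A$3$3 - A$2$3*A$3$2, A$2$3*A$3$1 - A$2$1*A$3$3, A$2$1*A$3$2 - A$2$2*A$3$1],
     vector [A$3$2*A$1$3 - A$3$3*A$1$2, A$3$3*A$1$1 - A$3$1*A$1$3, A$3$1*A$1$2 - A$3$2*A$1$1],
     vector [A$1$2*A$2$3 - A$1$3*A$2$2, A$1$3*A$2$1 - A$1$1*A$2$3, A$1$1*A$2$2 - A$1$2*A$2$1]]"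

lemma cof3_mult: "A ** transpose (cof3 A) = mat (det A)"
  by (simp add: vec_eq_iff forall_3 matrix_matrix_mult_def sum_3 transpose_def cof3_def mat_def det_3 algebra_simps)

lemma cof3_unique:
  fixes A D :: "'a::field^3^3"
  assumes "A ** transpose D = mat 1" "det A = 1"
  shows "D = cof3 A"
proof -
  have "transpose D ** A = mat 1" using assms(1) matrix_left_right_inverse by blast
  then have "transpose D = transpose D ** (A ** transpose (cof3 A))"
    by (simp add: cof3_mult assms(2))
  also have "\<dots> = transpose (cof3 A)"
    using \<open>transpose D ** A = mat 1\<close> by (simp add: matrix_mul_assoc)
  finally show ?thesis by (metis transpose_transpose)
qed

definition sl3 :: "'a::field^3^3 \<Rightarrow> 'a^7^7" where
  "sl3 A = block A (cof3 A)"

lemma special_sl3: "det A = 1 \<Longrightarrow> special (sl3 A)" for A :: "'a::field_char_0^3^3"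
  unfolding sl3_def by (rule special_block) (simp_all add: cof3_mult)

lemma block_evec1: "block A D *v evec 1 = evec 1"
  by (simp add: vec7_eq_iff mv7 block_def evec_nth)

lemma block_mult: "block A D ** block A' D' = block (A ** A') (D ** D')"
  by (simp add: vec_eq_iff forall_7 block_def matrix_matrix_mult_def sum_3 sum_7)

lemma block_one: "block (mat 1) (mat 1) = mat 1"
  by (simp add: vec_eq_iff forall_7 block_def mat_def)

text \<open>The two eigenspaces of the tensor contracted with \<open>e\<^sub>1\<close> are either preserved or exchanged.\<close>

lemma stabilizer_evec1:
  fixes g :: "'a::field_char_0^7^7"
  assumes g: "simil g c l" and c: "c \<noteq> 0" and fix1: "g *v evec 1 = evec 1"
  shows "l = 1" "c = 1 \<or> c = -1" "c = 1 \<Longrightarrow> \<exists>A. det A = 1 \<and> g = sl3 A"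
proof -
  show l: "l = 1" using simil_Delta[OF g, of "evec 1"] by (simp add: fix1 Delta_evec1)
  have col1: "g$i$1 = (if i = 1 then 1 else 0)" for i
    using fix1 by (auto simp: mv_evec column_def vec_eq_iff evec_nth)
  have row1: "g$1$j = (if j = 1 then 1 else 0)" for j
    using simil_bil[OF g, of "evec j" "evec 1"] l
    by (simp add: fix1 mv_evec bil_def column_def evec_nth col1 split: if_splits)
  define J :: "'a^7^7" where "J = (\<chi> j k. wbar $ 1 $ j $ k)"
  have J: "g ** J ** transpose g = mat c ** J"
  proof -
    have "(g ** J ** transpose g) $ j $ k = wedge3_act g wbar $ 1 $ j $ k" for j k
    proof -
      have "wedge3_act g wbar $ 1 $ j $ k =
          (\<Sum>p\<in>(UNIV::7 set). if p = 1 then \<Sum>q\<in>UNIV. \<Sum>r\<in>UNIV. g$j$q * g$k$r * wbar$1$q$r else 0)"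
        unfolding wedge3_act_def vec_lambda_beta by (rule sum.cong[OF refl]) (simp add: row1)
      also have "\<dots> = (\<Sum>q\<in>UNIV. \<Sum>r\<in>UNIV. g$j$q * g$k$r * wbar$1$q$r)" by simp
      also have "\<dots> = (\<Sum>r\<in>UNIV. \<Sum>q\<in>UNIV. g$j$q * wbar$1$q$r * g$k$r)"
        by (subst sum.swap) (intro sum.cong refl, simp add: ac_simps)
      also have "\<dots> = (g ** J ** transpose g) $ j $ k"
        by (simp add: matrix_matrix_mult_def transpose_def J_def sum_distrib_right)
      finally show ?thesis by simp
    qed
    moreover have "(mat c ** J) $ j $ k = c * wbar $ 1 $ j $ k" for j k
      by (simp add: matrix_matrix_mult_def mat_def J_def if_distrib[of "\<lambda>x. x * _"] cong: if_cong)
    ultimately show ?thesis using g by (simp add: vec_eq_iff simil_def)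
  qed
  obtain h where h: "g ** h = mat 1" "h ** g = mat 1"
    using simil_invertible[OF g] l by (auto simp: invertible_def)
  have th: "transpose g ** transpose h = mat 1" "transpose h ** transpose g = mat 1"
    using h by (simp_all flip: matrix_transpose_mul)
  have gr: "transpose g ** gram ** g = gram" using simil_gram[OF g] l by simp
  have "transpose h ** gram = transpose h ** (transpose g ** gram ** g)" by (simp add: gr)
  also have "\<dots> = gram ** g" by (simp add: matrix_mul_assoc th)
  finally have hg: "transpose h ** gram = gram ** g" .
  have "g ** J = g ** J ** (transpose g ** transpose h)" by (simp add: th)
  also have "\<dots> = mat c ** J ** transpose h" by (simp add: matrix_mul_assoc J)
  finally have "g ** J ** gram = mat c ** J ** (transpose h ** gram)" by (simp add: matrix_mul_assoc)
  then have gE: "g ** (J ** gram) = mat c ** ((J ** gram) ** g)" by (simp add: hg matrix_mul_assoc)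
  define e :: "'a^7" where "e = vector [0, -4, -4, -4, 4, 4, 4]"
  have E: "J ** gram = diag e"
    by (simp add: vec_eq_iff forall_7 mm7 J_def gram_vector diag_def e_def) (simp add: wbar_nth wedge3_nth evec_nth)
  have comm: "g$i$j * e$j = c * (e$i * g$i$j)" for i j
    using arg_cong[OF gE, of "\<lambda>M. M$i$j"] unfolding E
    by (simp add: matrix_matrix_mult_def diag_def mat_def if_distrib[of "\<lambda>x. x * _"]
        if_distrib[of "\<lambda>x. _ * x"] cong: if_cong)
  have "\<exists>i. g$i$2 \<noteq> 0"
  proof (rule ccontr)
    assume "\<not> (\<exists>i. g$i$2 \<noteq> 0)"
    then show False
      using simil_bil[OF g, of "evec 2" "evec 5"] l by (simp add: mv_evec bil_def column_def evec_nth)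
  qed
  then obtain i where i: "g$i$2 \<noteq> 0" by blast
  have e2: "e$2 = -4" by (simp add: e_def)
  have "g$i$2 * (-4) = g$i$2 * (c * e$i)" using comm[of i 2] unfolding e2 by (simp only: ac_simps)
  then have "-4 = c * e$i" using mult_left_cancel[OF i] by blast
  then show c1: "c = 1 \<or> c = -1"
    using exhaust_7[of i] by (auto simp: e_def)
  assume cc: "c = 1"
  have z: "g$i$j = 0" if "e$j \<noteq> e$i" for i j
    using comm[of i j] that cc by simp
  define A D :: "'a^3^3" where
    "A = vector [vector [g$2$2, g$2$3, g$2$4], vector [g$3$2, g$3$3, g$3$4], vector [g$4$2, g$4$3, g$4$4]]"
    and "D = vector [vector [g$5$5, g$5$6, g$5$7], vector [g$6$5, g$6$6, g$6$7], vector [g$7$5, g$7$6, g$7$7]]"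
  have z0: "g$2$5 = 0" "g$2$6 = 0" "g$2$7 = 0" "g$3$5 = 0" "g$3$6 = 0" "g$3$7 = 0"
    "g$4$5 = 0" "g$4$6 = 0" "g$4$7 = 0" "g$5$2 = 0" "g$5$3 = 0" "g$5$4 = 0"
    "g$6$2 = 0" "g$6$3 = 0" "g$6$4 = 0" "g$7$2 = 0" "g$7$3 = 0" "g$7$4 = 0"
    by (rule z, simp add: e_def)+
  have gb: "g = block A D"
    by (simp add: vec_eq_iff forall_7 block_def A_def D_def z0 row1 col1)
  have w: "wedge3_act (block A D) wbar $ i $ j $ k = wbar $ i $ j $ k" for i j k
    using g cc gb by (simp add: simil_def)
  have "det A = 1"
    using w[of 2 3 4] by (simp add: wact_wbar wedge3_nth column_def block_def wbar_nth evec_nth det_3 algebra_simps)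
  moreover have "A ** transpose D = mat 1"
    using w[of 1 2 5] w[of 1 2 6] w[of 1 2 7] w[of 1 3 5] w[of 1 3 6] w[of 1 3 7] w[of 1 4 5] w[of 1 4 6] w[of 1 4 7]
    by (simp add: wact_wbar wedge3_nth column_def block_def wbar_nth evec_nth
        vec_eq_iff forall_3 matrix_matrix_mult_def sum_3 transpose_def mat_def algebra_simps)
  ultimately show "\<exists>A. det A = 1 \<and> g = sl3 A"
    using cof3_unique[of A D] gb by (auto simp: sl3_def)
qed

text \<open>Up to a scalar matrix and a special matrix \<open>g\<close> fixes \<open>e\<^sub>1\<close>, and there the
  character has the values \<open>1\<close> and \<open>-1\<close> only.\<close>

lemma chi_square:
  fixes g :: "'k::field_char_0 alg_closure^7^7"
  assumes "g \<in> carrier G1"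
  shows "(chi g)\<^sup>2 = Delta (g *v evec 1)"
proof -
  obtain c l where cl: "c \<noteq> 0" "l \<noteq> 0" "simil g c l" using assms by (auto simp: G1_iff)
  obtain r where r: "r\<^sup>2 = l" using alg_closure_sqrt by blast
  have r0: "r \<noteq> 0" using r cl by auto
  have D: "Delta (g *v evec 1) = l" using simil_Delta[OF cl(3), of "evec 1"] by (simp add: Delta_evec1)
  have "linked (r *s evec 1) (g *v evec 1)"
    by (rule linkedI) (use r cl D in \<open>simp_all add: Delta_scale Delta_evec1\<close>)
  then obtain h where h: "special h" "h *v (r *s evec 1) = g *v evec 1" by (auto simp: linked_def)
  define m where "m = h ** mat r"
  have m: "m \<in> carrier G1" "chi m = r" "m *v evec 1 = g *v evec 1"
    using special_G1[OF h(1)] scalar_G1[OF r0] chi_special[OF h(1)] chi_scalar[OF r0] h(2)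
    by (simp_all add: m_def G1_mult_closed chi_mult mat_mv flip: matrix_vector_mul_assoc)
  obtain n where n: "n \<in> carrier G1" "m ** n = mat 1" "n ** m = mat 1" using G1_inverse[OF m(1)] .
  define s where "s = n ** g"
  have s: "s \<in> carrier G1" "s *v evec 1 = evec 1"
    using n assms by (simp_all add: s_def G1_mult_closed) (metis m(3) matrix_vector_mul_assoc matrix_vector_mul_lid)
  have g: "g = m ** s" by (simp add: s_def matrix_mul_assoc n)
  obtain c' l' where s': "c' \<noteq> 0" "simil s c' l'" using s(1) by (auto simp: G1_iff)
  have "chi s = 1 \<or> chi s = -1"
    using stabilizer_evec1[OF s'(2,1) s(2)] chi_simil[OF s'(2)] by auto
  then have "(chi s)\<^sup>2 = 1" by auto
  then show ?thesis
    using chi_mult[OF m(1) s(1)] r by (simp add: g power_mult_distrib m(2)) (simp add: D flip: g)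
qed

section \<open>Field homomorphisms acting on coordinates\<close>

definition field_hom :: "('a::field_char_0 \<Rightarrow> 'b::field_char_0) \<Rightarrow> bool" where
  "field_hom \<eta> \<longleftrightarrow> \<eta> 1 = 1 \<and> (\<forall>x y. \<eta> (x + y) = \<eta> x + \<eta> y) \<and> (\<forall>x y. \<eta> (x * y) = \<eta> x * \<eta> y)"

lemma field_hom_to_ac: "field_hom to_ac"
  by (simp add: field_hom_def)

lemma field_hom_Gal:
  assumes "\<eta> \<in> Gal"
  shows "field_hom \<eta>"
proof -
  have "\<eta> (to_ac 1) = to_ac 1" using assms unfolding Gal_def by blast
  then show ?thesis using assms by (simp add: field_hom_def Gal_def)
qed

context
  fixes \<eta> :: "'a::field_char_0 \<Rightarrow> 'b::field_char_0"
  assumes fh: "field_hom \<eta>"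
begin

lemma fh_add: "\<eta> (x + y) = \<eta> x + \<eta> y" and fh_mult: "\<eta> (x * y) = \<eta> x * \<eta> y" and fh_1: "\<eta> 1 = 1"
  using fh by (auto simp: field_hom_def)

lemma fh_0: "\<eta> 0 = 0" using fh_add[of 0 0] by simp

lemma fh_uminus: "\<eta> (- x) = - \<eta> x"
  using fh_add[of x "- x"] by (simp add: fh_0 eq_neg_iff_add_eq_0 add.commute)

lemma fh_diff: "\<eta> (x - y) = \<eta> x - \<eta> y"
  using fh_add[of x "- y"] by (simp add: fh_uminus)

lemma fh_sum: "\<eta> (sum f A) = (\<Sum>i\<in>A. \<eta> (f i))"
  by (induction A rule: infinite_finite_induct) (auto simp: fh_0 fh_add)

lemma fh_of_nat: "\<eta> (of_nat n) = of_nat n"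
  by (induction n) (auto simp: fh_0 fh_add fh_1)

lemma fh_numeral: "\<eta> (numeral n) = numeral n"
  using fh_of_nat[of "numeral n"] by simp

lemma fh_nonzero: "x \<noteq> 0 \<Longrightarrow> \<eta> x \<noteq> 0"
  using fh_mult[of x "inverse x"] fh_1 by auto

lemma fh_divide: "\<eta> (x / y) = \<eta> x / \<eta> y"
proof (cases "y = 0")
  case False
  then show ?thesis using fh_mult[of "x / y" y] fh_nonzero[OF False] by (simp add: field_simps)
qed (simp add: fh_0)

lemma map_matrix_nth: "map_matrix \<eta> A $ i $ j = \<eta> (A $ i $ j)"
  by (simp add: map_matrix_def)

lemma map_matrix_mult: "map_matrix \<eta> (A ** B) = map_matrix \<eta> A ** map_matrix \<eta> B"
  by (simp add: vec_eq_iff map_matrix_nth matrix_matrix_mult_def fh_sum fh_mult)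

lemma map_matrix_one: "map_matrix \<eta> (mat 1) = mat 1"
  by (simp add: vec_eq_iff map_matrix_nth mat_def fh_0 fh_1)

lemma map_matrix_mv: "map_matrix \<eta> A *v (\<chi> i. \<eta> (x $ i)) = (\<chi> i. \<eta> ((A *v x) $ i))"
  by (simp add: vec_eq_iff map_matrix_nth matrix_vector_mult_def fh_sum fh_mult)

lemma map_matrix_invertible: "invertible A \<Longrightarrow> invertible (map_matrix \<eta> A)"
  for A :: "'a^'n^'n"
proof -
  assume "invertible A"
  then obtain B where "A ** B = mat 1" by (auto simp: invertible_def)
  then have "map_matrix \<eta> A ** map_matrix \<eta> B = mat 1" by (simp add: map_matrix_one flip: map_matrix_mult)
  then show ?thesis by (auto simp: invertible_right_inverse)
qed

lemma map_wbar: "\<eta> (wbar $ i $ j $ k) = wbar $ i $ j $ k"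
  by (simp add: wbar_nth wedge3_nth evec_nth fh_0 fh_1 fh_add fh_diff fh_mult if_distrib[of \<eta>])

lemma map_wact: "wedge3_act (map_matrix \<eta> g) wbar $ i $ j $ k = \<eta> (wedge3_act g wbar $ i $ j $ k)"
  by (simp add: wedge3_act_def fh_sum fh_mult map_wbar map_matrix_nth)

lemma map_Delta: "Delta (\<chi> i. \<eta> (x $ i)) = \<eta> (Delta x)"
  by (simp add: Delta_def fh_diff fh_add fh_mult fh_numeral power2_eq_square)

lemma map_evec: "(\<chi> j. \<eta> (evec i $ j)) = evec i"
  by (simp add: vec_eq_iff evec_nth fh_0 fh_1)

lemma map_G1:
  assumes "g \<in> carrier G1"
  shows "map_matrix \<eta> g \<in> carrier G1" "chi (map_matrix \<eta> g) = \<eta> (chi g)"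
proof -
  obtain c where "invertible g" "c \<noteq> 0" "\<And>i j k. wedge3_act g wbar $ i $ j $ k = c * wbar $ i $ j $ k"
    using assms by (auto simp: G1_def)
  then show "map_matrix \<eta> g \<in> carrier G1"
    by (auto simp: G1_def map_wact fh_mult map_wbar fh_nonzero intro!: map_matrix_invertible exI[of _ "\<eta> c"])
  show "chi (map_matrix \<eta> g) = \<eta> (chi g)"
    using map_matrix_mv[of g "evec 1"] by (simp add: chi_def map_wact fh_divide map_evec map_Delta)
qed

end

section \<open>The field attached to an orbit\<close>

lemma stab_group_simps: "carrier (stab_group G act x) = {g \<in> carrier G. act g x = x}"
  "monoid.mult (stab_group G act x) = monoid.mult G" "\<one>\<^bsub>stab_group G act x\<^esub> = \<one>\<^bsub>G\<^esub>"
  "coords (stab_group G act x) = coords G"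
  by (simp_all add: stab_group_def stabilizer_def)

text \<open>If a character \<open>\<theta>\<close> of \<open>G\<close> cuts out the identity component of the stabilizer of the base point,
  the homomorphism defined by an orbit is \<open>\<eta> \<mapsto> \<theta>(g)\<^sup>\<eta>/\<theta>(g)\<close>, a Kummer character.\<close>

lemma alpha_V_eq:
  fixes G :: "('g, 'k::field_char_0 alg_closure) alg_group" and \<theta> :: "'g \<Rightarrow> 'k alg_closure"
  assumes G: "group G"
    and act: "\<And>g h v. g \<in> carrier G \<Longrightarrow> h \<in> carrier G \<Longrightarrow> act (g \<otimes>\<^bsub>G\<^esub> h) v = act g (act h v)"
      "\<And>v. act \<one>\<^bsub>G\<^esub> v = v"
    and \<theta>: "\<And>g h. g \<in> carrier G \<Longrightarrow> h \<in> carrier G \<Longrightarrow> \<theta> (g \<otimes>\<^bsub>G\<^esub> h) = \<theta> g * \<theta> h"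
      "\<And>g. g \<in> carrier G \<Longrightarrow> \<theta> g \<noteq> 0"
    and comp: "carrier (identity_component (stab_group G act w)) = {g \<in> carrier G. act g w = w \<and> \<theta> g = 1}"
    and gal: "\<And>\<eta> g. \<eta> \<in> Gal \<Longrightarrow> g \<in> carrier G \<Longrightarrow> gal \<eta> g \<in> carrier G \<and> \<theta> (gal \<eta> g) = \<eta> (\<theta> g)"
      "\<And>\<eta> g x. \<eta> \<in> Gal \<Longrightarrow> g \<in> carrier G \<Longrightarrow> bc x = act g w \<Longrightarrow> act (gal \<eta> g) w = bc x"
    and L: "\<And>x g. x \<in> Ob \<Longrightarrow> g \<in> carrier G \<Longrightarrow> bc x = act g w \<Longrightarrow> adjoin {\<theta> g} = L \<and> (\<theta> g)\<^sup>2 \<in> range to_ac"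
    and ex: "\<exists>x\<in>Ob. \<exists>g\<in>carrier G. bc x = act g w"
  shows "alpha_V G act gal bc w Ob = L"
proof -
  interpret group G by (rule G)
  define Gw Gw0 where "Gw = stab_group G act w" and "Gw0 = carrier (identity_component Gw)"
  have Gw0: "Gw0 = {g \<in> carrier G. act g w = w \<and> \<theta> g = 1}" using comp by (simp add: Gw0_def Gw_def)
  have chi1: "\<theta> \<one>\<^bsub>G\<^esub> = 1" using \<theta>(1)[of "\<one>\<^bsub>G\<^esub>" "\<one>\<^bsub>G\<^esub>"] \<theta>(2)[of "\<one>\<^bsub>G\<^esub>"] by simp
  have chi_inv: "\<theta> (inv\<^bsub>G\<^esub> g) * \<theta> g = 1" if "g \<in> carrier G" for g
    using \<theta>(1)[of "inv\<^bsub>G\<^esub> g" g] that chi1 by simp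
  have act_inv: "act (inv\<^bsub>G\<^esub> g) v = u" if "g \<in> carrier G" "v = act g u" for g u v
    using act(1)[of "inv\<^bsub>G\<^esub> g" g u] that act(2) by simp
  have coset: "Gw0 #>\<^bsub>Gw\<^esub> c = \<one>\<^bsub>Gw Mod Gw0\<^esub> \<longleftrightarrow> \<theta> c = 1" if c: "c \<in> carrier G" "act c w = w" for c
  proof -
    have rc: "Gw0 #>\<^bsub>Gw\<^esub> c = {h \<otimes>\<^bsub>G\<^esub> c |h. h \<in> Gw0}"
      by (auto simp: r_coset_def Gw_def stab_group_simps)
    have one: "\<one>\<^bsub>Gw Mod Gw0\<^esub> = Gw0" by (simp add: FactGroup_def)
    show ?thesis
    proof
      assume "Gw0 #>\<^bsub>Gw\<^esub> c = \<one>\<^bsub>Gw Mod Gw0\<^esub>"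
      then have "{h \<otimes>\<^bsub>G\<^esub> c |h. h \<in> Gw0} = Gw0" by (simp add: rc one)
      moreover have "\<one>\<^bsub>G\<^esub> \<in> Gw0" using chi1 act(2) by (simp add: Gw0)
      ultimately have "\<one>\<^bsub>G\<^esub> \<otimes>\<^bsub>G\<^esub> c \<in> Gw0" by blast
      then show "\<theta> c = 1" using c by (simp add: Gw0)
    next
      assume chic: "\<theta> c = 1"
      have "{h \<otimes>\<^bsub>G\<^esub> c |h. h \<in> Gw0} = Gw0"
      proof (rule subset_antisym; rule subsetI)
        fix y assume "y \<in> {h \<otimes>\<^bsub>G\<^esub> c |h. h \<in> Gw0}"
        then show "y \<in> Gw0" using c chic by (auto simp: Gw0 act \<theta>)
      next
        fix y assume y: "y \<in> Gw0"
        have ci: "\<theta> (inv\<^bsub>G\<^esub> c) = 1" using chi_inv[OF c(1)] chic by simp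
        have "y \<otimes>\<^bsub>G\<^esub> inv\<^bsub>G\<^esub> c \<in> Gw0"
          using y c ci act_inv[OF c(1), of w w] by (auto simp: Gw0 act \<theta>)
        moreover have "y = (y \<otimes>\<^bsub>G\<^esub> inv\<^bsub>G\<^esub> c) \<otimes>\<^bsub>G\<^esub> c"
          using y c by (simp add: Gw0 m_assoc)
        ultimately show "y \<in> {h \<otimes>\<^bsub>G\<^esub> c |h. h \<in> Gw0}" by blast
      qed
      then show "Gw0 #>\<^bsub>Gw\<^esub> c = \<one>\<^bsub>Gw Mod Gw0\<^esub>" by (simp add: rc one)
    qed
  qed
  have ff: "fixed_field {\<eta> \<in> Gal. Gw0 #>\<^bsub>Gw\<^esub> (inv\<^bsub>G\<^esub> g \<otimes>\<^bsub>G\<^esub> gal \<eta> g) = \<one>\<^bsub>Gw Mod Gw0\<^esub>} = L"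
    if x: "x \<in> Ob" "g \<in> carrier G" "bc x = act g w" for x g
  proof -
    have "Gw0 #>\<^bsub>Gw\<^esub> (inv\<^bsub>G\<^esub> g \<otimes>\<^bsub>G\<^esub> gal \<eta> g) = \<one>\<^bsub>Gw Mod Gw0\<^esub> \<longleftrightarrow> \<eta> (\<theta> g) = \<theta> g" if \<eta>: "\<eta> \<in> Gal" for \<eta>
    proof -
      let ?c = "inv\<^bsub>G\<^esub> g \<otimes>\<^bsub>G\<^esub> gal \<eta> g"
      have g': "gal \<eta> g \<in> carrier G" "\<theta> (gal \<eta> g) = \<eta> (\<theta> g)" using gal(1)[OF \<eta> x(2)] by auto
      have "act ?c w = w"
        using x g' gal(2)[OF \<eta> x(2,3)] act_inv[OF x(2)] by (simp add: act)
      then have "Gw0 #>\<^bsub>Gw\<^esub> ?c = \<one>\<^bsub>Gw Mod Gw0\<^esub> \<longleftrightarrow> \<theta> ?c = 1"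
        using x g' by (intro coset) auto
      also have "\<theta> ?c = \<theta> (inv\<^bsub>G\<^esub> g) * \<eta> (\<theta> g)" using x g' by (simp add: \<theta>)
      also have "\<dots> = 1 \<longleftrightarrow> \<eta> (\<theta> g) = \<theta> g"
      proof -
        have n: "\<theta> (inv\<^bsub>G\<^esub> g) \<noteq> 0" using chi_inv[OF x(2)] by auto
        have "\<theta> (inv\<^bsub>G\<^esub> g) * \<eta> (\<theta> g) = \<theta> (inv\<^bsub>G\<^esub> g) * \<theta> g \<longleftrightarrow> \<eta> (\<theta> g) = \<theta> g"
          using mult_left_cancel[OF n] .
        then show ?thesis by (simp only: chi_inv[OF x(2)])
      qed
      finally show ?thesis .
    qed
    then have "{\<eta> \<in> Gal. Gw0 #>\<^bsub>Gw\<^esub> (inv\<^bsub>G\<^esub> g \<otimes>\<^bsub>G\<^esub> gal \<eta> g) = \<one>\<^bsub>Gw Mod Gw0\<^esub>} = {\<eta> \<in> Gal. \<eta> (\<theta> g) = \<theta> g}"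
      by blast
    moreover obtain d where "(\<theta> g)\<^sup>2 = to_ac d" using L[OF x] by blast
    ultimately show ?thesis using fixed_field_sqrt[of "\<theta> g" d] L[OF x] by simp
  qed
  show ?thesis
    unfolding alpha_V_def Let_def Gw_def[symmetric] Gw0_def[symmetric]
  proof (rule the_equality)
    show "\<forall>x\<in>Ob. \<forall>g\<in>carrier G. bc x = act g w \<longrightarrow>
      L = fixed_field {\<eta> \<in> Gal. Gw0 #>\<^bsub>Gw\<^esub> (inv\<^bsub>G\<^esub> g \<otimes>\<^bsub>G\<^esub> gal \<eta> g) = \<one>\<^bsub>Gw Mod Gw0\<^esub>}"
      using ff by simp
    fix L' assume *: "\<forall>x\<in>Ob. \<forall>g\<in>carrier G. bc x = act g w \<longrightarrow>
      L' = fixed_field {\<eta> \<in> Gal. Gw0 #>\<^bsub>Gw\<^esub> (inv\<^bsub>G\<^esub> g \<otimes>\<^bsub>G\<^esub> gal \<eta> g) = \<one>\<^bsub>Gw Mod Gw0\<^esub>}"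
    obtain x g where xg: "x \<in> Ob" "g \<in> carrier G" "bc x = act g w" using ex by blast
    show "L' = L" using *[rule_format, OF xg] ff[OF xg] by simp
  qed
qed

lemma orbit_eq:
  assumes "group G"
    and act: "\<And>g h v. g \<in> carrier G \<Longrightarrow> h \<in> carrier G \<Longrightarrow> act (g \<otimes>\<^bsub>G\<^esub> h) v = act g (act h v)"
      "\<And>v. act \<one>\<^bsub>G\<^esub> v = v"
    and "y \<in> orbit G act x"
  shows "orbit G act y = orbit G act x" "x \<in> orbit G act y"
proof -
  interpret group G by fact
  obtain g where g: "g \<in> carrier G" "y = act g x" using assms(4) by (auto simp: orbit_def)
  have x: "x = act (inv\<^bsub>G\<^esub> g) y" using g act(1)[of "inv\<^bsub>G\<^esub> g" g x] act(2) by simp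
  show "x \<in> orbit G act y" using x g by (auto simp: orbit_def)
  show "orbit G act y = orbit G act x"
  proof (rule subset_antisym; rule subsetI)
    fix z assume "z \<in> orbit G act y"
    then obtain h where h: "h \<in> carrier G" "z = act h y" by (auto simp: orbit_def)
    then have "z = act (h \<otimes>\<^bsub>G\<^esub> g) x" using g act(1) by simp
    then show "z \<in> orbit G act x" using h g unfolding orbit_def by blast
  next
    fix z assume "z \<in> orbit G act x"
    then obtain h where h: "h \<in> carrier G" "z = act h x" by (auto simp: orbit_def)
    have "act (h \<otimes>\<^bsub>G\<^esub> inv\<^bsub>G\<^esub> g) y = act h (act (inv\<^bsub>G\<^esub> g) y)"
      using act(1)[of h "inv\<^bsub>G\<^esub> g" y] h g by simp
    then have "z = act (h \<otimes>\<^bsub>G\<^esub> inv\<^bsub>G\<^esub> g) y" by (simp only: h(2) x[symmetric])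
    then show "z \<in> orbit G act y" using h g unfolding orbit_def by blast
  qed
qed

section \<open>Connectedness of the special linear group\<close>

definition entries :: "('a^'n^'m \<Rightarrow> 'a) set" where
  "entries = {\<lambda>A. A $ i $ j |i j. True}"

lemma regular_entry: "(\<lambda>A. A $ i $ j) \<in> regular_funs C entries"
  by (rule regular_funs.coord) (auto simp: entries_def)

lemma regular_sl3:
  assumes "0 \<in> C" "1 \<in> C" "-1 \<in> C"
  shows "(\<lambda>A. sl3 A $ i $ j) \<in> regular_funs C entries"
proof -
  have cof: "(\<lambda>A. cof3 A $ p $ q) \<in> regular_funs C entries" for p q
    using exhaust_3[of p] exhaust_3[of q]
    by (elim disjE; simp add: cof3_def; intro regular_funs_diff[OF assms(3)] regular_funs.mult regular_entry)
  show ?thesis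
    using exhaust_7[of i] exhaust_7[of j] unfolding sl3_def block_def
    by (elim disjE; simp; intro cof regular_entry regular_funs.const assms)
qed

text \<open>Rescaling the first column turns the segment joining two matrices into a rational curve in the
  special linear group.\<close>

lemma sl3_curve:
  fixes A B :: "'a::field_char_0^3^3"
  assumes "det A = 1" "det B = 1"
  obtains D N where "poly D 0 = 1" "poly D 1 = 1" "N 0 = A" "N 1 = B"
    "rational_curve entries D N" "\<And>t. poly D t \<noteq> 0 \<Longrightarrow> det (N t) = 1"
proof -
  define m where "m i j = [:A$i$j, B$i$j - A$i$j:]" for i j
  define D where "D = m 1 1 * m 2 2 * m 3 3 + m 1 2 * m 2 3 * m 3 1 + m 1 3 * m 2 1 * m 3 2
     - m 1 1 * m 2 3 * m 3 2 - m 1 2 * m 2 1 * m 3 3 - m 1 3 * m 2 2 * m 3 1"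
  define N where "N t = (\<chi> i j. if j = 1 then poly (m i j) t * inverse (poly D t) else poly (m i j) t)" for t
  have m0: "poly (m i j) 0 = A$i$j" and m1: "poly (m i j) 1 = B$i$j" for i j
    by (simp_all add: m_def)
  have D0: "poly D 0 = 1" using assms(1) by (simp add: D_def m0 det_3 ac_simps)
  have D1: "poly D 1 = 1" using assms(2) by (simp add: D_def m1 det_3 ac_simps)
  have N0: "N 0 = A" by (simp add: N_def D0 vec_eq_iff m0)
  have N1: "N 1 = B" by (simp add: N_def D1 vec_eq_iff m1)
  have "det (N t) = 1" if "poly D t \<noteq> 0" for t
  proof -
    define e where "e = inverse (poly D t)"
    define n where "n i j = poly (m i j) t" for i j
    have "det (N t) = e * (n 1 1 * n 2 2 * n 3 3 + n 1 2 * n 2 3 * n 3 1 + n 1 3 * n 2 1 * n 3 2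
        - n 1 1 * n 2 3 * n 3 2 - n 1 2 * n 2 1 * n 3 3 - n 1 3 * n 2 2 * n 3 1)"
      by (simp add: det_3 N_def flip: e_def n_def) (simp add: algebra_simps)
    also have "\<dots> = e * poly D t" by (simp add: D_def n_def)
    finally show ?thesis using that by (simp add: e_def)
  qed
  moreover have "rational_curve entries D N"
    unfolding rational_curve_def
  proof
    fix f :: "'a^3^3 \<Rightarrow> 'a" assume "f \<in> entries"
    then obtain i j where f: "f = (\<lambda>A. A $ i $ j)" by (auto simp: entries_def)
    show "\<exists>P n. \<forall>t. poly D t \<noteq> 0 \<longrightarrow> f (N t) * poly D t ^ n = poly P t"
    proof (cases "j = 1")
      case True
      then show ?thesis by (intro exI[of _ "m i j"] exI[of _ "1::nat"]) (simp add: f N_def)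
    next
      case False
      then show ?thesis by (intro exI[of _ "m i j"] exI[of _ "0::nat"]) (simp add: f N_def)
    qed
  qed
  ultimately show ?thesis using that D0 D1 N0 N1 by blast
qed

lemma inverse_det_special: "special g \<Longrightarrow> inverse (det g) = det g" for g :: "'a::field_char_0^7^7"
proof -
  assume "special g"
  then have "det g * det g = 1" using simil_det[of g 1 1] by (simp add: special_def power2_eq_square)
  then show ?thesis by (rule inverse_unique)
qed

text \<open>The tensor has multiplier \<open>1\<close> or \<open>-1\<close> on the stabilizer, according to whether
  the two eigenspaces are preserved or exchanged; this gives the two defining functions.\<close>

lemma stab_evec1_clopen:
  "clopen_part (stab_group G1 (*v) (evec 1 :: 'a::field_char_0^7)) {sl3 A |A. det A = 1}"
proof -
  let ?G = "stab_group G1 (*v) (evec 1 :: 'a^7)"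
  let ?C = "{sl3 A |A :: 'a^3^3. det A = 1}"
  have sub: "?C \<subseteq> carrier ?G"
    by (auto simp: stab_group_simps intro!: special_G1 special_sl3) (simp add: sl3_def block_evec1)
  have reg: "(\<lambda>A. f (sl3 A)) \<in> regular_funs UNIV entries" if f: "f = (\<lambda>g. g $ i $ j) \<or> f = det" for f :: "'a^7^7 \<Rightarrow> 'a" and i j
    using f by (auto intro!: regular_sl3 regular_funs_det)
  have "curve_connected ?G ?C"
    unfolding curve_connected_def
  proof (intro conjI ballI sub)
    fix a b assume "a \<in> ?C" "b \<in> ?C"
    then obtain A B where AB: "a = sl3 A" "det A = 1" "b = sl3 B" "det B = 1" by blast
    obtain D N where D: "poly D 0 = 1" "poly D 1 = 1" "N 0 = A" "N 1 = B"
      and N: "rational_curve entries D N" "\<And>t. poly D t \<noteq> 0 \<Longrightarrow> det (N t) = 1"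
      using sl3_curve[OF AB(2,4)] by blast
    have "rational_curve (coords ?G) D (sl3 \<circ> N)"
      unfolding rational_curve_def
    proof
      fix f assume "f \<in> coords ?G"
      then consider i j where "f = (\<lambda>g. g $ i $ j)" | "f = (\<lambda>g. inverse (det g))"
        by (auto simp: stab_group_simps G1_simps)
      then show "\<exists>P n. \<forall>t. poly D t \<noteq> 0 \<longrightarrow> f ((sl3 \<circ> N) t) * poly D t ^ n = poly P t"
      proof cases
        case 1
        then show ?thesis using rational_curve_regular[OF N(1) reg[of f]] by auto
      next
        case 2
        obtain P n where P: "\<forall>t. poly D t \<noteq> 0 \<longrightarrow> det (sl3 (N t)) * poly D t ^ n = poly P t"
          using rational_curve_regular[OF N(1) reg[of det]] by auto
        have "f ((sl3 \<circ> N) t) = det (sl3 (N t))" if "poly D t \<noteq> 0" for t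
          using inverse_det_special[OF special_sl3[OF N(2)[OF that]]] by (simp add: 2)
        then show ?thesis using P by (intro exI[of _ P] exI[of _ n]) simp
      qed
    qed
    then show "\<exists>D \<gamma>. poly D 0 \<noteq> 0 \<and> poly D 1 \<noteq> 0 \<and> \<gamma> 0 = a \<and> \<gamma> 1 = b \<and>
        rational_curve (coords ?G) D \<gamma> \<and> (\<forall>t. poly D t \<noteq> 0 \<longrightarrow> \<gamma> t \<in> ?C)"
      using D N(2) AB by (intro exI[of _ D] exI[of _ "sl3 \<circ> N"]) auto
  qed
  moreover have "\<one>\<^bsub>?G\<^esub> \<in> ?C"
  proof -
    have "cof3 (mat 1) = (mat 1 :: 'a^3^3)"
      by (rule cof3_unique[symmetric]) (simp_all add: transpose_mat)
    then have "sl3 (mat 1) = (mat 1 :: 'a^7^7)" by (simp add: sl3_def block_one)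
    then have "mat 1 = sl3 (mat 1 :: 'a^3^3) \<and> det (mat 1 :: 'a^3^3) = 1" by simp
    then show ?thesis unfolding stab_group_simps G1_simps by blast
  qed
  moreover have "\<exists>f\<in>regular_funs UNIV (coords ?G). \<exists>h\<in>regular_funs UNIV (coords ?G).
        \<forall>x\<in>carrier ?G. (x \<in> ?C \<longleftrightarrow> f x \<noteq> 0) \<and> (x \<notin> ?C \<longleftrightarrow> h x \<noteq> 0)"
  proof -
    let ?c = "\<lambda>g :: 'a^7^7. wedge3_act g wbar $ 2 $ 3 $ 4"
    have ent: "(\<lambda>g. g $ i $ j) \<in> regular_funs UNIV (coords ?G)" for i j
      by (rule regular_funs.coord) (auto simp: stab_group_simps G1_simps)
    have c: "?c \<in> regular_funs UNIV (coords ?G)"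
      unfolding wedge3_act_def vec_lambda_beta
      by (intro regular_funs_sum regular_funs.mult regular_funs.const ent) auto
    have f: "(\<lambda>g. ?c g + 1) \<in> regular_funs UNIV (coords ?G)" "(\<lambda>g. ?c g + -1) \<in> regular_funs UNIV (coords ?G)"
      by (intro regular_funs.add regular_funs.const c; simp)+
    have val: "(x \<in> ?C \<longleftrightarrow> ?c x + 1 \<noteq> 0) \<and> (x \<notin> ?C \<longleftrightarrow> ?c x + -1 \<noteq> 0)" if x: "x \<in> carrier ?G" for x
    proof -
      have w234: "wbar $ 2 $ 3 $ 4 = (1::'a)" by (simp add: wbar_nth wedge3_nth evec_nth)
      obtain c l where cl: "c \<noteq> 0" "simil x c l" "x *v evec 1 = evec 1"
        using x by (auto simp: stab_group_simps G1_iff)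
      have cx: "?c x = c" using cl(2) w234 by (simp add: simil_def)
      have C1: "?c x = 1" if xC: "x \<in> ?C"
      proof -
        obtain A where "x = sl3 A" "det A = 1" using xC by blast
        then have "simil x 1 1" using special_sl3 by (simp add: special_def)
        then have "?c x = 1 * wbar $ 2 $ 3 $ 4" unfolding simil_def by blast
        then show ?thesis by (simp add: w234)
      qed
      consider "c = 1" | "c = -1" using stabilizer_evec1(2)[OF cl(2,1,3)] by blast
      then show ?thesis
      proof cases
        case 1
        then have "x \<in> ?C" using stabilizer_evec1(3)[OF cl(2,1,3)] by blast
        then show ?thesis using cx 1 by simp
      next
        case 2
        then have "x \<notin> ?C" using C1 cx by auto
        then show ?thesis using cx 2 by simp
      qed
    qed
    show ?thesis by (rule bexI[OF _ f(1)], rule bexI[OF _ f(2)], rule ballI, rule val)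
  qed
  ultimately show ?thesis unfolding clopen_part_def by blast
qed

lemma stab_evec1_component:
  "carrier (identity_component (stab_group G1 (*v) (evec 1 :: 'a::field_char_0^7)))
     = {g \<in> carrier G1. g *v evec 1 = evec 1 \<and> chi g = 1}"
proof -
  have "{sl3 A |A :: 'a^3^3. det A = 1} = {g \<in> carrier G1. g *v evec 1 = evec 1 \<and> chi g = 1}"
  proof (rule subset_antisym; rule subsetI)
    fix g assume "g \<in> {sl3 A |A :: 'a^3^3. det A = 1}"
    then show "g \<in> {g \<in> carrier G1. g *v evec 1 = evec 1 \<and> chi g = 1}"
      using special_sl3 special_G1 chi_special by (auto simp: sl3_def block_evec1)
  next
    fix g assume g: "g \<in> {g \<in> carrier (G1 :: ('a^7^7, 'a) alg_group). g *v evec 1 = evec 1 \<and> chi g = 1}"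
    then obtain c l where cl: "c \<noteq> 0" "simil g c l" by (auto simp: G1_iff)
    then have "c = 1" using g chi_simil[OF cl(2)] stabilizer_evec1(1)[OF cl(2,1)] by auto
    then show "g \<in> {sl3 A |A :: 'a^3^3. det A = 1}"
      using stabilizer_evec1(3)[OF cl(2,1)] g by auto
  qed
  then show ?thesis by (simp add: clopen_part_identity_component[OF stab_evec1_clopen])
qed

section \<open>Orbits of vectors\<close>

lemma G1_act: "g \<in> carrier G1 \<Longrightarrow> h \<in> carrier G1 \<Longrightarrow> (g \<otimes>\<^bsub>G1\<^esub> h) *v v = g *v (h *v v)"
  "\<one>\<^bsub>G1\<^esub> *v v = v" for g h :: "'a::field_char_0^7^7"
  by (simp_all add: G1_simps matrix_vector_mul_assoc)

lemma G1_Delta_square: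
  fixes g :: "'a::field_char_0^7^7"
  assumes "g \<in> carrier G1"
  shows "\<exists>q. q \<noteq> 0 \<and> (\<forall>x. Delta (g *v x) = q\<^sup>2 * Delta x)"
proof -
  obtain c l where cl: "l \<noteq> 0" "simil g c l" using assms by (auto simp: G1_iff)
  have l: "l = (det g / l ^ 3)\<^sup>2" by (rule simil_multiplier_square[OF cl(2,1)])
  have "det g / l ^ 3 \<noteq> 0" using l cl(1) by auto
  moreover have "Delta (g *v x) = (det g / l ^ 3)\<^sup>2 * Delta x" for x
    using simil_Delta[OF cl(2)] l by metis
  ultimately show ?thesis by blast
qed

text \<open>For \<open>x = g e\<^sub>1\<close> the value \<open>\<chi>(g)\<close> is a square root of
  \<open>\<Delta>(x)\<close>.\<close>

lemma alpha1_orbit: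
  fixes x :: "'k::field_char_0^7"
  assumes x: "Delta x \<noteq> 0" and t: "t\<^sup>2 = to_ac (Delta x)"
  shows "alpha1 (orbit G1 (*v) x) = adjoin {t}"
  unfolding alpha1_def
proof (rule alpha_V_eq[where \<theta> = chi])
  show "group (G1 :: ('k alg_closure^7^7, 'k alg_closure) alg_group)" by (rule G1_group)
  fix y :: "'k^7" and g :: "'k alg_closure^7^7"
  assume y: "y \<in> orbit G1 (*v) x" and g: "g \<in> carrier G1" "base_change1 y = g *v evec 1"
  have Db: "Delta (base_change1 y) = to_ac (Delta y)"
    unfolding base_change1_def by (rule map_Delta[OF field_hom_to_ac])
  obtain h where h: "h \<in> carrier G1" "y = h *v x" using y by (auto simp: orbit_def)
  obtain q where q: "q \<noteq> 0" "Delta y = q\<^sup>2 * Delta x" using G1_Delta_square[OF h(1)] h(2) by blast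
  have sq: "(chi g)\<^sup>2 = to_ac (Delta y)" using chi_square[OF g(1)] g(2) Db by simp
  have "(chi g)\<^sup>2 = (to_ac q * t)\<^sup>2" using sq q(2) t by (simp add: power_mult_distrib)
  then have "chi g = to_ac q * t \<or> chi g = to_ac (- q) * t" by (simp add: power2_eq_iff)
  then have "\<exists>r. chi g = to_ac r * t" by blast
  moreover have "chi g \<noteq> 0" "t \<noteq> 0" using chi_nonzero[OF g(1)] t x by auto
  ultimately have "adjoin {t} = adjoin {chi g}" using adjoin_sqrt_eq_iff[OF t sq] by blast
  then show "adjoin {chi g} = adjoin {t} \<and> (chi g)\<^sup>2 \<in> range to_ac" using sq by simp
next
  have "t \<noteq> 0" using t x by auto
  have "Delta (base_change1 x) = to_ac (Delta x)"
    unfolding base_change1_def by (rule map_Delta[OF field_hom_to_ac])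
  then have "linked (t *s evec 1) (base_change1 x)"
    by (intro linkedI) (use t x in \<open>simp_all add: Delta_scale Delta_evec1\<close>)
  then obtain g where g: "special g" "g *v (t *s evec 1) = base_change1 x" by (auto simp: linked_def)
  have "g ** mat t \<in> carrier G1" using special_G1[OF g(1)] scalar_G1[OF \<open>t \<noteq> 0\<close>] G1_mult_closed by blast
  moreover have "base_change1 x = (g ** mat t) *v evec 1" using g(2) by (simp add: mat_mv flip: matrix_vector_mul_assoc)
  moreover have "x \<in> orbit G1 (*v) x"
    unfolding orbit_def using special_G1[OF special_one] by (auto intro!: exI[of _ "mat 1"])
  ultimately show "\<exists>x\<in>orbit G1 (*v) x. \<exists>g\<in>carrier G1. base_change1 x = g *v evec 1" by blast
next
  fix \<eta> :: "'k alg_closure \<Rightarrow> 'k alg_closure" and g :: "'k alg_closure^7^7" and y :: "'k^7"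
  assume \<eta>: "\<eta> \<in> Gal" and g: "g \<in> carrier G1" "base_change1 y = g *v evec 1"
  have "map_matrix \<eta> g *v evec 1 = (\<chi> i. \<eta> ((g *v evec 1) $ i))"
    using map_matrix_mv[OF field_hom_Gal[OF \<eta>], of g "evec 1"] by (simp add: map_evec[OF field_hom_Gal[OF \<eta>]])
  also have "\<dots> = base_change1 y" using \<eta> by (simp flip: g(2)) (simp add: base_change1_def Gal_def)
  finally show "map_matrix \<eta> g *v evec 1 = base_change1 y" .
qed (auto simp: G1_act stab_evec1_component chi_nonzero map_G1 field_hom_Gal, simp add: G1_simps chi_mult)

lemma Vss1_orbit_iff:
  fixes x y :: "'k::field_char_0^7"
  assumes "Delta x \<noteq> 0" "Delta y \<noteq> 0"
  shows "y \<in> orbit G1 (*v) x \<longleftrightarrow> (\<exists>r. Delta y = r\<^sup>2 * Delta x)"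
proof
  assume "y \<in> orbit G1 (*v) x"
  then obtain g where "g \<in> carrier G1" "y = g *v x" by (auto simp: orbit_def)
  then show "\<exists>r. Delta y = r\<^sup>2 * Delta x" using G1_Delta_square by blast
next
  assume "\<exists>r. Delta y = r\<^sup>2 * Delta x"
  then obtain r where r: "Delta y = r\<^sup>2 * Delta x" by blast
  have r0: "r \<noteq> 0" using r assms by auto
  have "linked (r *s x) y" by (rule linkedI) (use r assms r0 in \<open>simp_all add: Delta_scale\<close>)
  then obtain g where g: "special g" "g *v (r *s x) = y" by (auto simp: linked_def)
  have "g ** mat r \<in> carrier G1" using special_G1[OF g(1)] scalar_G1[OF r0] G1_mult_closed by blast
  moreover have "y = (g ** mat r) *v x" using g(2) by (simp add: mat_mv flip: matrix_vector_mul_assoc)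
  ultimately show "y \<in> orbit G1 (*v) x" unfolding orbit_def by blast
qed

lemma Delta_norm_vec1: "Delta (norm_vec1 d) = d" for d :: "'a::field_char_0"
  by (simp add: Delta_def norm_vec1_def)

lemma alpha1_bij: "bij_betw alpha1 (orbits G1 (Vss1 :: ('k::field_char_0 ^ 7) set) (*v)) Ex2"
  unfolding bij_betw_def
proof
  show "inj_on alpha1 (orbits G1 (Vss1 :: ('k ^ 7) set) (*v))"
  proof (rule inj_onI)
    fix P Q :: "('k^7) set"
    assume P: "P \<in> orbits G1 Vss1 (*v)" and Q: "Q \<in> orbits G1 Vss1 (*v)" and eq: "alpha1 P = alpha1 Q"
    obtain x where x: "Delta x \<noteq> 0" "P = orbit G1 (*v) x" using P by (auto simp: orbits_def Vss1_def)
    obtain y where y: "Delta y \<noteq> 0" "Q = orbit G1 (*v) y" using Q by (auto simp: orbits_def Vss1_def)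
    obtain t where t: "t\<^sup>2 = to_ac (Delta x)" using alg_closure_sqrt by blast
    obtain u where u: "u\<^sup>2 = to_ac (Delta y)" using alg_closure_sqrt by blast
    have "adjoin {t} = adjoin {u}"
      using eq alpha1_orbit[OF x(1) t] alpha1_orbit[OF y(1) u] x y by simp
    moreover have "u \<noteq> 0" "t \<noteq> 0" using x y t u by auto
    ultimately obtain r where "u = to_ac r * t" using adjoin_sqrt_eq_iff[OF t u] by blast
    then have "to_ac (Delta y) = to_ac (r\<^sup>2 * Delta x)" using t u by (simp add: power_mult_distrib)
    then have "Delta y = r\<^sup>2 * Delta x" by (simp only: to_ac_eq_iff)
    then have "y \<in> orbit G1 (*v) x" using Vss1_orbit_iff x y by blast
    then show "P = Q" using orbit_eq(1)[OF G1_group G1_act(1) G1_act(2)] x y by auto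
  qed
  show "alpha1 ` orbits G1 (Vss1 :: ('k ^ 7) set) (*v) = Ex2"
  proof (rule subset_antisym; rule subsetI)
    fix E assume "E \<in> alpha1 ` orbits G1 (Vss1 :: ('k ^ 7) set) (*v)"
    then obtain x :: "'k^7" where x: "Delta x \<noteq> 0" "E = alpha1 (orbit G1 (*v) x)" by (auto simp: orbits_def Vss1_def)
    obtain t where t: "t\<^sup>2 = to_ac (Delta x)" using alg_closure_sqrt by blast
    show "E \<in> Ex2" using alpha1_orbit[OF x(1) t] x t unfolding Ex2_eq by blast
  next
    fix E :: "'k alg_closure set" assume "E \<in> Ex2"
    then obtain t d where t: "d \<noteq> 0" "t\<^sup>2 = to_ac d" "E = adjoin {t}" unfolding Ex2_eq by blast
    have "E = alpha1 (orbit G1 (*v) (norm_vec1 d))"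
      using alpha1_orbit[of "norm_vec1 d" t] t by (simp add: Delta_norm_vec1)
    moreover have "norm_vec1 d \<in> Vss1" using t by (simp add: Vss1_def Delta_norm_vec1)
    ultimately show "E \<in> alpha1 ` orbits G1 (Vss1 :: ('k ^ 7) set) (*v)" unfolding orbits_def by blast
  qed
qed

section \<open>Pairs of vectors\<close>

lemma act2_nth: "act2 g x $ i = fst g *v (snd g $ i $ 1 *s x $ 1 + snd g $ i $ 2 *s x $ 2)"
  by (simp add: act2_def linform_def vector_matrix_mult_def axis_def if_distrib[of "\<lambda>x. x * _"]
      if_distrib[of "\<lambda>x. _ * x"] cong: if_cong)

lemma vec2_eq_iff: "x = y \<longleftrightarrow> x $ 1 = y $ 1 \<and> x $ 2 = y $ 2" for x y :: "'a^2"
  by (simp add: vec_eq_iff forall_2)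

lemma act2_mult: "act2 (g ** g', m ** m') x = act2 (g, m) (act2 (g', m') x)"
  by (simp add: vec2_eq_iff act2_nth matrix_matrix_mult_def[of m] sum_2 matrix_vector_right_distrib
      vector_scalar_commute scalar_mult_eq_scaleR vector_add_ldistrib vector_sadd_rdistrib vector_smult_assoc
      flip: matrix_vector_mul_assoc)

lemma act2_one: "act2 (mat 1, mat 1) x = x"
  by (simp add: vec2_eq_iff act2_nth) (simp add: mat_def)

lemma G2_act: "g \<in> carrier G2 \<Longrightarrow> h \<in> carrier G2 \<Longrightarrow> act2 (g \<otimes>\<^bsub>G2\<^esub> h) v = act2 g (act2 h v)"
  "act2 \<one>\<^bsub>G2\<^esub> v = v" for g h :: "('a::field_char_0^7^7) \<times> ('a^2^2)"
  by (cases g; cases h; simp add: G2_simps act2_mult) (simp add: G2_simps act2_one)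

lemma disc_eq: "disc (quad_form x) = (bil (x$1) (x$2))\<^sup>2 - 4 * Delta (x$1) * Delta (x$2)"
  by (simp add: disc_def Let_def quad_form_def linform_def Delta_add)

lemma disc_act2:
  assumes "simil g c l"
  shows "disc (quad_form (act2 (g, m) x)) = (l * det m)\<^sup>2 * disc (quad_form x)"
proof -
  have D: "Delta (a *s u + b *s v) = a\<^sup>2 * Delta u + a * b * bil u v + b\<^sup>2 * Delta v" for a b u v
    by (simp add: Delta_add Delta_scale bil_scale)
  have B: "bil (a *s u + b *s v) (a' *s u + b' *s v)
      = 2 * a * a' * Delta u + (a * b' + a' * b) * bil u v + 2 * b * b' * Delta v" for a b a' b' u v
    by (simp add: bil_add bil_scale bil_self bil_commute[of v u] algebra_simps)
  show ?thesis
    unfolding disc_eq act2_nth fst_conv snd_conv simil_Delta[OF assms] simil_bil[OF assms] D B det_2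
    by (simp add: power2_eq_square algebra_simps)
qed

definition norm_pair :: "'a::field \<Rightarrow> 'a \<Rightarrow> 'a^7^2" where
  "norm_pair d e = vector [norm_vec1 d, norm_vec2 e]"

lemma norm_pair_forms: "Delta (norm_pair d e $ 1) = d" "Delta (norm_pair d e $ 2) = e"
  "bil (norm_pair d e $ 1) (norm_pair d e $ 2) = 0" "bil (norm_pair d e $ 2) (norm_pair d e $ 1) = 0" for d e :: "'a::field_char_0"
  by (simp_all add: norm_pair_def norm_vec1_def norm_vec2_def Delta_def bil_def)

lemma norm_pair_in_orbit:
  fixes x :: "'a::field_char_0^7^2"
  assumes det: "a * d - b * c \<noteq> 0"
    and u: "Delta (a *s x$1 + b *s x$2) = s" "Delta (c *s x$1 + d *s x$2) = t" "s \<noteq> 0" "t \<noteq> 0"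
      "bil (a *s x$1 + b *s x$2) (c *s x$1 + d *s x$2) = 0"
  shows "norm_pair s t \<in> orbit G2 act2 x"
proof -
  let ?m = "vector [vector [a, b], vector [c, d]] :: 'a^2^2"
  obtain g where g: "special g" "g *v (a *s x$1 + b *s x$2) = norm_vec1 s" "g *v (c *s x$1 + d *s x$2) = norm_vec2 t"
    using orthogonal_pair_normal_form[of "a *s x$1 + b *s x$2" "c *s x$1 + d *s x$2"] u by auto
  have "act2 (g, ?m) x = norm_pair s t"
    using g by (simp add: vec2_eq_iff act2_nth norm_pair_def)
  moreover have "(g, ?m) \<in> carrier G2"
    using special_G1[OF g(1)] det by (simp add: G2_simps invertible_det_nz det_2)
  ultimately show ?thesis unfolding orbit_def by (metis (mono_tags, lifting) mem_Collect_eq)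
qed

lemma orbit2_eq: "y \<in> orbit G2 act2 x \<Longrightarrow> orbit G2 act2 y = orbit G2 act2 x"
  for x y :: "'a::field_char_0^7^2"
  by (rule orbit_eq(1)[OF G2_group G2_act])

lemma orbit2_self: "x \<in> orbit G2 act2 x" for x :: "'a::field_char_0^7^2"
proof -
  interpret group "G2 :: (('a^7^7) \<times> ('a^2^2), 'a) alg_group" by (rule G2_group)
  show ?thesis
    unfolding orbit_def by (rule CollectI, rule exI[of _ "\<one>\<^bsub>G2\<^esub>"]) (simp add: G2_act(2))
qed

text \<open>The binary form is diagonalized; its discriminant fixes the product of the diagonal entries up to squares.\<close>

lemma pair_normal_form:
  fixes x :: "'a::field_char_0^7^2"
  assumes disc: "disc (quad_form x) = a * r\<^sup>2" and a: "a \<noteq> 0" and r: "r \<noteq> 0"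
  shows "\<exists>s. s \<noteq> 0 \<and> orbit G2 act2 x = orbit G2 act2 (norm_pair s (- a * s))"
proof -
  define A B C where "A = Delta (x$1)" and "B = bil (x$1) (x$2)" and "C = Delta (x$2)"
  have dd: "B\<^sup>2 - 4 * A * C = a * r\<^sup>2" using disc by (simp add: disc_eq A_def B_def C_def)
  then have nz: "B\<^sup>2 - 4 * A * C \<noteq> 0" using a r by simp
  have D: "Delta (p *s x$1 + q *s x$2) = A * p\<^sup>2 + B * p * q + C * q\<^sup>2" for p q
    by (simp add: Delta_add Delta_scale bil_scale A_def B_def C_def)
  have Bl: "bil (p *s x$1 + q *s x$2) (p' *s x$1 + q' *s x$2)
      = 2 * A * p * p' + B * (p * q' + p' * q) + 2 * C * q * q'" for p q p' q'
    by (simp add: bil_add bil_scale bil_self bil_commute[of "x$2" "x$1"] A_def B_def C_def algebra_simps)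
  have "\<exists>p q. A * p\<^sup>2 + B * p * q + C * q\<^sup>2 \<noteq> 0"
  proof (rule ccontr)
    assume "\<not> ?thesis"
    then have z: "A * p\<^sup>2 + B * p * q + C * q\<^sup>2 = 0" for p q by blast
    have "A = 0" "C = 0" using z[of 1 0] z[of 0 1] by simp_all
    then have "B = 0" using z[of 1 1] by simp
    then show False using nz \<open>A = 0\<close> by simp
  qed
  then obtain p q where pq: "A * p\<^sup>2 + B * p * q + C * q\<^sup>2 \<noteq> 0" by blast
  define s where "s = A * p\<^sup>2 + B * p * q + C * q\<^sup>2"
  have s: "s \<noteq> 0" using pq by (simp add: s_def)
  define b c where "b = - (B * p + 2 * C * q)" and "c = 2 * A * p + B * q"
  have "norm_pair s (- a * s) \<in> orbit G2 act2 x"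
  proof (rule norm_pair_in_orbit)
    have "p * (c / r) - q * (b / r) = 2 * s / r"
      by (simp add: b_def c_def s_def power2_eq_square diff_divide_distrib[symmetric] algebra_simps flip: add_divide_distrib)
    then show "p * (c / r) - q * (b / r) \<noteq> 0" using s r by simp
    show "Delta (p *s x$1 + q *s x$2) = s" by (simp add: D s_def)
    have "r\<^sup>2 * Delta ((b / r) *s x$1 + (c / r) *s x$2) = A * b\<^sup>2 + B * b * c + C * c\<^sup>2"
      using r by (simp add: D field_simps power2_eq_square)
    also have "\<dots> = - (B\<^sup>2 - 4 * A * C) * s"
      by (simp add: b_def c_def s_def power2_eq_square algebra_simps)
    also have "\<dots> = r\<^sup>2 * (- a * s)" by (simp add: dd)
    finally have "r\<^sup>2 * Delta ((b / r) *s x$1 + (c / r) *s x$2) = r\<^sup>2 * (- a * s)" .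
    then show "Delta ((b / r) *s x$1 + (c / r) *s x$2) = - a * s" using r by (subst (asm) mult_left_cancel) auto
    have "r * bil (p *s x$1 + q *s x$2) ((b / r) *s x$1 + (c / r) *s x$2) = 0"
      using r by (simp add: Bl field_simps) (simp add: b_def c_def algebra_simps)
    then show "bil (p *s x$1 + q *s x$2) ((b / r) *s x$1 + (c / r) *s x$2) = 0" using r by simp
  qed (use s a in auto)
  then show ?thesis using orbit2_eq s by metis
qed

text \<open>The form \<open>s(x\<^sup>2 - y\<^sup>2)\<close> represents every value.\<close>

lemma norm_pair_hyperbolic:
  fixes s :: "'a::field_char_0"
  assumes s: "s \<noteq> 0"
  shows "orbit G2 act2 (norm_pair s (- s)) = orbit G2 act2 (norm_pair 1 (- 1))"
proof -
  let ?p = "(1 + 1 / s) / 2" and ?q = "(1 - 1 / s) / 2"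
  have "((1 + e) / 2)\<^sup>2 - ((1 - e) / 2)\<^sup>2 = e" for e :: 'a
    by (simp add: power2_eq_square field_simps)
  then have pq: "?p\<^sup>2 - ?q\<^sup>2 = 1 / s" .
  have "norm_pair 1 (- 1) \<in> orbit G2 act2 (norm_pair s (- s))"
  proof (rule norm_pair_in_orbit)
    show "?p * ?p - ?q * ?q \<noteq> 0" using pq s by (simp add: power2_eq_square)
    have "Delta (?p *s norm_pair s (- s) $ 1 + ?q *s norm_pair s (- s) $ 2) = s * (?p\<^sup>2 - ?q\<^sup>2)"
      by (simp add: Delta_add Delta_scale bil_scale norm_pair_forms algebra_simps)
    then show "Delta (?p *s norm_pair s (- s) $ 1 + ?q *s norm_pair s (- s) $ 2) = 1" unfolding pq using s by simp
    have "Delta (?q *s norm_pair s (- s) $ 1 + ?p *s norm_pair s (- s) $ 2) = - s * (?p\<^sup>2 - ?q\<^sup>2)"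
      by (simp add: Delta_add Delta_scale bil_scale norm_pair_forms algebra_simps)
    then show "Delta (?q *s norm_pair s (- s) $ 1 + ?p *s norm_pair s (- s) $ 2) = - 1" unfolding pq using s by simp
    show "bil (?p *s norm_pair s (- s) $ 1 + ?q *s norm_pair s (- s) $ 2) (?q *s norm_pair s (- s) $ 1 + ?p *s norm_pair s (- s) $ 2) = 0"
      by (simp add: bil_add bil_scale bil_self norm_pair_forms)
  qed simp_all
  then show ?thesis using orbit2_eq by metis
qed

text \<open>By multiplicativity of the norm, multiplication by \<open>p + q\<surd>a\<close> is a change of variables
  of the binary form.\<close>

lemma norm_pair_norm:
  fixes s a :: "'a::field_char_0"
  assumes s: "s \<noteq> 0" and a: "a \<noteq> 0" and n: "p\<^sup>2 - a * q\<^sup>2 \<noteq> 0"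
  shows "orbit G2 act2 (norm_pair (s * (p\<^sup>2 - a * q\<^sup>2)) (- a * (s * (p\<^sup>2 - a * q\<^sup>2)))) = orbit G2 act2 (norm_pair s (- a * s))"
proof -
  let ?x = "norm_pair s (- a * s)"
  have "norm_pair (s * (p\<^sup>2 - a * q\<^sup>2)) (- a * (s * (p\<^sup>2 - a * q\<^sup>2))) \<in> orbit G2 act2 ?x"
  proof (rule norm_pair_in_orbit)
    show "p * p - q * (a * q) \<noteq> 0" using n by (simp add: power2_eq_square algebra_simps)
    show "Delta (p *s ?x $ 1 + q *s ?x $ 2) = s * (p\<^sup>2 - a * q\<^sup>2)"
      by (simp add: Delta_add Delta_scale bil_scale norm_pair_forms algebra_simps)
    show "Delta ((a * q) *s ?x $ 1 + p *s ?x $ 2) = - a * (s * (p\<^sup>2 - a * q\<^sup>2))"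
      by (simp add: Delta_add Delta_scale bil_scale norm_pair_forms power2_eq_square algebra_simps)
    show "bil (p *s ?x $ 1 + q *s ?x $ 2) ((a * q) *s ?x $ 1 + p *s ?x $ 2) = 0"
      by (simp add: bil_add bil_scale bil_self norm_pair_forms algebra_simps)
  qed (use s a n in auto)
  then show ?thesis using orbit2_eq by metis
qed

text \<open>The multiplier of a similitude is a square, so \<open>t\<close> is a value of the form \<open>s(x\<^sup>2
  - a y\<^sup>2)\<close>.\<close>

lemma norm_pair_orbit_norm:
  fixes s t a :: "'a::field_char_0"
  assumes "norm_pair t (- a * t) \<in> orbit G2 act2 (norm_pair s (- a * s))"
  shows "\<exists>p q. t = s * (p\<^sup>2 - a * q\<^sup>2)"
proof -
  obtain g m where gm: "g \<in> carrier G1" "norm_pair t (- a * t) = act2 (g, m) (norm_pair s (- a * s))"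
    using assms by (auto simp: orbit_def G2_simps)
  obtain r where r: "\<And>x. Delta (g *v x) = r\<^sup>2 * Delta x" using G1_Delta_square[OF gm(1)] by blast
  have "t = Delta (act2 (g, m) (norm_pair s (- a * s)) $ 1)"
    using norm_pair_forms(1)[of t "- a * t"] gm(2) by simp
  also have "\<dots> = r\<^sup>2 * ((m$1$1)\<^sup>2 * s + (m$1$2)\<^sup>2 * (- a * s))"
    by (simp add: act2_nth r Delta_add Delta_scale bil_scale norm_pair_forms)
  also have "\<dots> = s * ((r * m$1$1)\<^sup>2 - a * (r * m$1$2)\<^sup>2)"
    by (simp add: power2_eq_square algebra_simps)
  finally show ?thesis by blast
qed

section \<open>The stabilizer of the base pair\<close>

definition base_pair :: "'a::comm_ring_1^7^2" where
  "base_pair = vector [evec 2, evec 5]"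

text \<open>The factor by which the square root of the discriminant of the binary form is multiplied.\<close>

definition chi2 :: "('a::field^7^7) \<times> ('a^2^2) \<Rightarrow> 'a" where
  "chi2 g = Delta (fst g *v evec 1) * det (snd g)"

definition ext3 :: "'a::comm_ring_1^2^2 \<Rightarrow> 'a \<Rightarrow> 'a^3^3" where
  "ext3 B u = vector [vector [u, 0, 0], vector [0, B$1$1, B$1$2], vector [0, B$2$1, B$2$2]]"

lemma det_ext3: "det (ext3 B u) = u * det B"
  by (simp add: ext3_def det_3 det_2 algebra_simps)

text \<open>The elements of the stabilizer in polynomial coordinates \<open>B\<close>, \<open>t\<close> and \<open>u\<close> subject to \<open>det B t u = 1\<close>;
  \<open>t\<close> is the scalar part of the first component.\<close>

definition stab_elem :: "('a::field^2^2) \<times> 'a \<times> 'a \<Rightarrow> ('a^7^7) \<times> ('a^2^2)" where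
  "stab_elem = (\<lambda>(B, t, u). (mat t ** sl3 (ext3 B (t * u)),
      vector [vector [(det B)\<^sup>2 * u, 0], vector [0, u]]))"

lemma chi2_mult: "g \<in> carrier G2 \<Longrightarrow> h \<in> carrier G2 \<Longrightarrow> chi2 (g \<otimes>\<^bsub>G2\<^esub> h) = chi2 g * chi2 h"
  for g h :: "('a::field_char_0^7^7) \<times> ('a^2^2)"
proof (cases g; cases h)
  fix g1 m h1 n assume *: "g \<in> carrier G2" "h \<in> carrier G2" "g = (g1, m)" "h = (h1, n)"
  then obtain c l where "simil g1 c l" by (auto simp: G2_simps G1_iff)
  then have "Delta (g1 *v (h1 *v evec 1)) = Delta (g1 *v evec 1) * Delta (h1 *v evec 1)"
    by (simp add: simil_Delta Delta_evec1)
  then show ?thesis using * by (simp add: G2_simps chi2_def det_mul flip: matrix_vector_mul_assoc)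
qed

lemma chi2_nonzero: "g \<in> carrier G2 \<Longrightarrow> chi2 g \<noteq> 0"
  for g :: "('a::field_char_0^7^7) \<times> ('a^2^2)"
  by (cases g) (auto simp: G2_simps G1_iff chi2_def simil_Delta Delta_evec1 invertible_det_nz)

lemma disc_act2_chi2:
  fixes g :: "('a::field_char_0^7^7) \<times> ('a^2^2)"
  assumes "g \<in> carrier G2"
  shows "disc (quad_form (act2 g x)) = (chi2 g)\<^sup>2 * disc (quad_form x)"
proof (cases g)
  case (Pair g1 m)
  then obtain c l where "simil g1 c l" using assms by (auto simp: G2_simps G1_iff)
  then show ?thesis using disc_act2[of g1 c l m x] by (simp add: Pair chi2_def simil_Delta Delta_evec1)
qed

lemma stab_elem_stabilizes:
  fixes B :: "'a::field_char_0^2^2"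
  assumes "det B * t * u = 1"
  shows "stab_elem (B, t, u) \<in> carrier G2" "act2 (stab_elem (B, t, u)) base_pair = base_pair"
    "chi2 (stab_elem (B, t, u)) = 1" "simil (fst (stab_elem (B, t, u))) (t ^ 3) (t\<^sup>2)"
proof -
  have nz: "t \<noteq> 0" "u \<noteq> 0" "det B \<noteq> 0" using assms by auto
  have d: "det (ext3 B (t * u)) = 1" using assms by (simp add: det_ext3 ac_simps)
  note sp = special_sl3[OF d]
  have sm: "simil (mat t ** sl3 (ext3 B (t * u))) (t ^ 3) (t\<^sup>2)"
    using simil_mult[OF simil_scalar[of t] sp[unfolded special_def]] by simp
  then show sm': "simil (fst (stab_elem (B, t, u))) (t ^ 3) (t\<^sup>2)" by (simp add: stab_elem_def)
  show "stab_elem (B, t, u) \<in> carrier G2"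
    using scalar_G1[OF nz(1)] special_G1[OF sp] nz
    by (simp add: stab_elem_def G2_simps G1_mult_closed invertible_det_nz det_2)
  have c: "cof3 (ext3 B (t * u)) $ 1 $ 1 = det B" "cof3 (ext3 B (t * u)) $ 2 $ 1 = 0" "cof3 (ext3 B (t * u)) $ 3 $ 1 = 0"
    by (simp_all add: cof3_def ext3_def det_2)
  have e: "ext3 B (t * u) $ 1 $ 1 = t * u" "ext3 B (t * u) $ 2 $ 1 = 0" "ext3 B (t * u) $ 3 $ 1 = 0"
    by (simp_all add: ext3_def)
  have s2: "sl3 (ext3 B (t * u)) *v evec 2 = (t * u) *s evec 2"
    and s5: "sl3 (ext3 B (t * u)) *v evec 5 = det B *s evec 5"
    by (simp_all add: sl3_def mv_evec vec7_eq_iff column_def block_def evec_nth c e)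
  have "(det B)\<^sup>2 * u * t * (t * u) = (det B * t * u)\<^sup>2" by (simp add: power2_eq_square)
  then have 1: "(det B)\<^sup>2 * u * t * (t * u) = 1" using assms by simp
  have 2: "u * t * det B = 1" using assms by (simp add: ac_simps)
  show "act2 (stab_elem (B, t, u)) base_pair = base_pair"
    using 1 2 by (simp add: vec2_eq_iff act2_nth stab_elem_def base_pair_def vector_scalar_commute
        mat_mv s2 s5 vector_smult_assoc ac_simps flip: matrix_vector_mul_assoc)
  have "t\<^sup>2 * ((det B)\<^sup>2 * u * u) = (det B * t * u)\<^sup>2" by (simp add: power2_eq_square)
  then show "chi2 (stab_elem (B, t, u)) = 1"
    using assms simil_Delta[OF sm, of "evec 1"]
    by (simp add: chi2_def stab_elem_def Delta_evec1 det_2)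
qed

text \<open>A special matrix scaling \<open>e\<^sub>2\<close> and \<open>e\<^sub>5\<close> fixes \<open>e\<^sub>1\<close>, the contraction of the tensor with the dual covectors.\<close>

lemma special_fix_evec1:
  fixes h :: "'a::field_char_0^7^7"
  assumes h: "special h" and e2: "h *v evec 2 = a *s evec 2" and e5: "h *v evec 5 = b *s evec 5" and ab: "a * b = 1"
  shows "h *v evec 1 = evec 1"
proof -
  have a0: "a \<noteq> 0" "b \<noteq> 0" using ab by auto
  have r2: "h$2$j = (if j = 2 then a else 0)" for j
  proof -
    have "bil (h *v evec j) (b *s evec 5) = bil (evec j) (evec 5)"
      using special_bil[OF h, of "evec j" "evec 5"] by (simp add: e5)
    then have "b * h$2$j = (if j = 2 then 1 else 0)"
      by (auto simp: bil_def evec_nth mv_evec column_def ac_simps split: if_splits)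
    then have "a * (b * h$2$j) = (if j = 2 then a else 0)" by simp
    then show ?thesis by (simp add: ab flip: mult.assoc)
  qed
  have r5: "h$5$j = (if j = 5 then b else 0)" for j
  proof -
    have "bil (h *v evec j) (a *s evec 2) = bil (evec j) (evec 2)"
      using special_bil[OF h, of "evec j" "evec 2"] by (simp add: e2)
    then have "a * h$5$j = (if j = 5 then 1 else 0)"
      by (auto simp: bil_def evec_nth mv_evec column_def ac_simps split: if_splits)
    then have "b * (a * h$5$j) = (if j = 5 then b else 0)" by simp
    then show ?thesis using ab by (simp add: mult.commute[of b a] flip: mult.assoc)
  qed
  have "h$i$1 = evec 1 $ i" for i
  proof -
    have "wedge3_act h wbar $ i $ 2 $ 5 = wbar $ i $ 2 $ 5"
      using h by (simp add: special_def simil_def)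
    moreover have "wedge3_act h wbar $ i $ 2 $ 5 = h$i$1 * (a * b)"
      by (simp add: wact_wbar wedge3_nth column_def r2 r5)
    moreover have "wbar $ i $ 2 $ 5 = (evec 1 :: 'a^7) $ i"
      by (simp add: wbar_nth wedge3_nth evec_nth)
    ultimately show ?thesis using ab by simp
  qed
  then show ?thesis by (simp add: mv_evec column_def vec_eq_iff)
qed

text \<open>The second component of an element of the stabilizer preserves or exchanges the two isotropic lines of the
  binary form of the base pair.\<close>

lemma base_pair_stabilizer:
  fixes g :: "('k::field_char_0 alg_closure^7^7) \<times> ('k alg_closure^2^2)"
  assumes g: "g \<in> carrier G2" and st: "act2 g base_pair = base_pair"
  shows "chi2 g = 1 \<or> chi2 g = -1" "chi2 g = 1 \<Longrightarrow> \<exists>B t u. det B * t * u = 1 \<and> g = stab_elem (B, t, u)"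
proof -
  obtain g1 m where gm: "g = (g1, m)" by fastforce
  have G1: "g1 \<in> carrier G1" using g by (simp add: gm G2_simps)
  obtain c l where cl: "c \<noteq> 0" "l \<noteq> 0" "simil g1 c l" using G1 by (auto simp: G1_iff)
  have E: "g1 *v (m$1$1 *s evec 2 + m$1$2 *s evec 5) = evec 2" "g1 *v (m$2$1 *s evec 2 + m$2$2 *s evec 5) = evec 5"
    using st by (simp_all add: gm vec2_eq_iff act2_nth base_pair_def)
  have "l * (m$1$1 * m$1$2) = 0"
    using simil_Delta[OF cl(3), of "m$1$1 *s evec 2 + m$1$2 *s evec 5"] unfolding E(1)
    by (simp add: Delta_def evec_nth)
  then have z1: "m$1$1 * m$1$2 = 0" using cl by simp
  have "l * (m$2$1 * m$2$2) = 0"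
    using simil_Delta[OF cl(3), of "m$2$1 *s evec 2 + m$2$2 *s evec 5"] unfolding E(2)
    by (simp add: Delta_def evec_nth)
  then have z2: "m$2$1 * m$2$2 = 0" using cl by simp
  have "l * (-4 * (m$1$1 * m$2$2 + m$1$2 * m$2$1)) = -4"
    using simil_bil[OF cl(3), of "m$1$1 *s evec 2 + m$1$2 *s evec 5" "m$2$1 *s evec 2 + m$2$2 *s evec 5"]
    unfolding E by (simp add: bil_def evec_nth algebra_simps)
  then have "-4 * (l * (m$1$1 * m$2$2 + m$1$2 * m$2$1)) = -4 * 1" by (simp add: algebra_simps)
  then have b: "l * (m$1$1 * m$2$2 + m$1$2 * m$2$1) = 1" by (subst (asm) mult_left_cancel) auto
  have ch: "chi2 g = l * (m$1$1 * m$2$2 - m$1$2 * m$2$1)"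
    by (simp add: chi2_def gm simil_Delta[OF cl(3)] Delta_evec1 det_2)
  show "chi2 g = 1 \<or> chi2 g = -1"
  proof (cases "m$1$1 = 0")
    case True
    then have "chi2 g = - (l * (m$1$1 * m$2$2 + m$1$2 * m$2$1))" unfolding ch by simp
    then show ?thesis using b by simp
  next
    case False
    then have "m$1$2 = 0" using z1 by simp
    then have "chi2 g = l * (m$1$1 * m$2$2 + m$1$2 * m$2$1)" unfolding ch by simp
    then show ?thesis using b by simp
  qed
  assume "chi2 g = 1"
  then have "l * (m$1$1 * m$2$2 + m$1$2 * m$2$1) = l * (m$1$1 * m$2$2 - m$1$2 * m$2$1)" using b ch by simp
  then have "m$1$2 * m$2$1 + m$1$2 * m$2$1 = 0" using cl(2) by (simp add: eq_diff_eq add.assoc)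
  then have "2 * (m$1$2 * m$2$1) = 0" by (simp only: mult_2)
  then have z3: "m$1$2 * m$2$1 = 0" by simp
  then have b': "l * (m$1$1 * m$2$2) = 1" using b unfolding z3 by simp
  then have nz: "m$1$1 \<noteq> 0" "m$2$2 \<noteq> 0" by auto
  then have off: "m$1$2 = 0" "m$2$1 = 0" using z1 z2 by auto
  define t where "t = chi g1"
  have tl: "t\<^sup>2 = l" using chi_square[OF G1] simil_Delta[OF cl(3), of "evec 1"] by (simp add: t_def Delta_evec1)
  have t0: "t \<noteq> 0" using tl cl by auto
  have ct: "c = t ^ 3"
    using chi_simil[OF cl(3)] cl(2) tl by (simp add: t_def[symmetric] field_simps power2_eq_square power3_eq_cube)
  define h where "h = mat (inverse t) ** g1"
  have "simil h (inverse t ^ 3 * c) ((inverse t)\<^sup>2 * l)" unfolding h_def by (rule simil_mult[OF simil_scalar cl(3)])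
  then have h: "special h"
    using t0 by (simp add: special_def ct power_inverse flip: tl)
  have g1: "g1 = mat t ** h" using t0 by (simp add: h_def matrix_mul_assoc mat_mult_mat)
  have G2: "g1 *v evec 2 = inverse (m$1$1) *s evec 2"
  proof -
    have "m$1$1 *s (g1 *v evec 2) = evec 2" using E(1) off by (simp add: vector_scalar_commute)
    then have "inverse (m$1$1) *s (m$1$1 *s (g1 *v evec 2)) = inverse (m$1$1) *s evec 2" by simp
    then show ?thesis using nz by (simp add: vector_smult_assoc)
  qed
  have G5: "g1 *v evec 5 = inverse (m$2$2) *s evec 5"
  proof -
    have "m$2$2 *s (g1 *v evec 5) = evec 5" using E(2) off by (simp add: vector_scalar_commute)
    then have "inverse (m$2$2) *s (m$2$2 *s (g1 *v evec 5)) = inverse (m$2$2) *s evec 5" by simp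
    then show ?thesis using nz by (simp add: vector_smult_assoc)
  qed
  define p q where "p = inverse (t * m$1$1)" and "q = inverse (t * m$2$2)"
  have h2: "h *v evec 2 = p *s evec 2" and h5: "h *v evec 5 = q *s evec 5"
    by (simp_all add: h_def p_def q_def mat_mv G2 G5 vector_smult_assoc flip: matrix_vector_mul_assoc)
  have "p * q = inverse (l * (m$1$1 * m$2$2))" by (simp add: p_def q_def power2_eq_square flip: tl)
  then have pq: "p * q = 1" using b' by simp
  have h1: "h *v evec 1 = evec 1" by (rule special_fix_evec1[OF h h2 h5 pq])
  obtain A where A: "det A = 1" "h = sl3 A"
    using stabilizer_evec1(3)[OF h[unfolded special_def] _ h1] by auto
  have col: "A$1$1 = p" "A$2$1 = 0" "A$3$1 = 0" "cof3 A$1$1 = q" "cof3 A$2$1 = 0" "cof3 A$3$1 = 0"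
    using h2 h5 by (simp_all add: A(2) sl3_def mv_evec vec7_eq_iff column_def block_def evec_nth)
  define B :: "'k alg_closure^2^2" where "B = vector [vector [A$2$2, A$2$3], vector [A$3$2, A$3$3]]"
  have dB: "det B = q" using col(4) by (simp add: B_def det_2 cof3_def)
  have q0: "q \<noteq> 0" "p \<noteq> 0" using pq by auto
  have c2: "A$3$2 * A$1$3 = A$3$3 * A$1$2" and c3: "A$1$2 * A$2$3 = A$1$3 * A$2$2"
    using col(5,6) by (simp_all add: cof3_def)
  have "q * A$1$2 = A$2$2 * (A$3$3 * A$1$2) - A$3$2 * (A$1$2 * A$2$3)"
    by (simp add: dB[symmetric] B_def det_2 algebra_simps)
  also have "\<dots> = 0" unfolding c2[symmetric] c3 by (simp add: algebra_simps)
  finally have A12: "A$1$2 = 0" using q0 by simp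
  have "q * A$1$3 = A$3$3 * (A$1$3 * A$2$2) - A$2$3 * (A$3$2 * A$1$3)"
    by (simp add: dB[symmetric] B_def det_2 algebra_simps)
  also have "\<dots> = 0" unfolding c2 c3[symmetric] by (simp add: algebra_simps)
  finally have A13: "A$1$3 = 0" using q0 by simp
  have Ae: "A = ext3 B p" by (simp add: vec_eq_iff forall_3 ext3_def B_def col A12 A13)
  have tu: "t * m$2$2 = p" using pq q0 by (simp add: q_def field_simps)
  have "det B * t * m$2$2 = 1" using tu pq dB by (simp add: ac_simps)
  moreover have "m$1$1 = (det B)\<^sup>2 * m$2$2"
  proof -
    have "t * m$1$1 = q" using pq q0 by (simp add: p_def field_simps)
    also have "\<dots> = q\<^sup>2 * p" using pq by (simp add: power2_eq_square ac_simps)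
    also have "\<dots> = t * ((det B)\<^sup>2 * m$2$2)" by (simp add: dB tu[symmetric] ac_simps)
    finally show ?thesis using t0 by simp
  qed
  then have "m = vector [vector [(det B)\<^sup>2 * m$2$2, 0], vector [0, m$2$2]]"
    by (simp add: vec2_eq_iff off)
  then have "g = stab_elem (B, t, m$2$2)"
    by (simp add: stab_elem_def gm g1 A(2) Ae tu)
  ultimately show "\<exists>B t u. det B * t * u = 1 \<and> g = stab_elem (B, t, u)" by blast
qed

lemma G2_coordsI:
  "f \<in> coords G1 \<Longrightarrow> (\<lambda>g. f (fst g)) \<in> coords G2" "h \<in> coords GL \<Longrightarrow> (\<lambda>g. h (snd g)) \<in> coords G2"
  unfolding G2_simps(4) by blast+

lemma G1_coords: "(\<lambda>g. g $ i $ j) \<in> coords G1" "(\<lambda>g. inverse (det g)) \<in> coords G1"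
  by (auto simp: G1_simps)

lemma GL_coords: "(\<lambda>g. g $ i $ j) \<in> coords GL" "(\<lambda>g. inverse (det g)) \<in> coords GL"
  by (auto simp: GL_simps)

lemmas G2_coords = G2_coordsI(1)[OF G1_coords(1)] G2_coordsI(1)[OF G1_coords(2)]
  G2_coordsI(2)[OF GL_coords(1)] G2_coordsI(2)[OF GL_coords(2)]

definition pcoords :: "(('a^2^2) \<times> 'a \<times> 'a \<Rightarrow> 'a) set" where
  "pcoords = {\<lambda>z. fst z $ i $ j |i j. True} \<union> {\<lambda>z. fst (snd z), \<lambda>z. snd (snd z)}"

lemma stab_pair_clopen:
  "clopen_part (stab_group G2 act2 (base_pair :: 'k::field_char_0 alg_closure^7^2))
     {stab_elem (B, t, u) |B t u. det B * t * u = 1}"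
proof -
  let ?G = "stab_group G2 act2 (base_pair :: 'k alg_closure^7^2)"
  let ?C = "{stab_elem (B, t, u) |B t (u :: 'k alg_closure). det B * t * u = 1}"
  have sub: "?C \<subseteq> carrier ?G"
    using stab_elem_stabilizes(1,2) by (auto simp: stab_group_simps)
  have pc: "(\<lambda>z. fst z $ i $ j) \<in> regular_funs UNIV pcoords" "(\<lambda>z. fst (snd z)) \<in> regular_funs UNIV pcoords"
    "(\<lambda>z. snd (snd z)) \<in> regular_funs UNIV (pcoords :: (('k alg_closure^2^2) \<times> 'k alg_closure \<times> 'k alg_closure \<Rightarrow> 'k alg_closure) set)" for i j
    by (auto intro!: regular_funs.coord simp: pcoords_def)
  have dB: "(\<lambda>z. det (fst z)) \<in> regular_funs UNIV (pcoords :: (('k alg_closure^2^2) \<times> 'k alg_closure \<times> 'k alg_closure \<Rightarrow> 'k alg_closure) set)"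
    by (rule regular_funs_det) (auto intro: pc)
  have ext: "(\<lambda>z. ext3 (fst z) (fst (snd z) * snd (snd z)) $ i $ j) \<in> regular_funs UNIV (pcoords :: (('k alg_closure^2^2) \<times> 'k alg_closure \<times> 'k alg_closure \<Rightarrow> 'k alg_closure) set)" for i j
    using exhaust_3[of i] exhaust_3[of j] unfolding ext3_def
    by (elim disjE; simp; intro regular_funs.mult pc regular_funs.const UNIV_I)
  have sl: "(\<lambda>z. sl3 (ext3 (fst z) (fst (snd z) * snd (snd z))) $ i $ j) \<in> regular_funs UNIV (pcoords :: (('k alg_closure^2^2) \<times> 'k alg_closure \<times> 'k alg_closure \<Rightarrow> 'k alg_closure) set)" for i j
  proof -
    have "\<exists>p\<in>regular_funs UNIV pcoords. \<forall>z\<in>UNIV. (\<lambda>A :: 'k alg_closure^3^3. sl3 A $ i $ j) (ext3 (fst z) (fst (snd z) * snd (snd z))) = p z"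
    proof (rule regular_funs_subst[OF regular_sl3[of UNIV i j], where A = UNIV and
        \<phi> = "\<lambda>z. ext3 (fst z) (fst (snd z) * snd (snd z))"])
      fix c :: "'k alg_closure^3^3 \<Rightarrow> 'k alg_closure" assume "c \<in> entries"
      then obtain i j where "c = (\<lambda>A. A $ i $ j)" by (auto simp: entries_def)
      then show "\<exists>p\<in>regular_funs UNIV pcoords. \<forall>z\<in>UNIV. c (ext3 (fst z) (fst (snd z) * snd (snd z))) = p z"
        by (intro bexI[OF _ ext[of i j]]) simp
    qed auto
    then obtain p :: "('k alg_closure^2^2) \<times> 'k alg_closure \<times> 'k alg_closure \<Rightarrow> 'k alg_closure"
      where "p \<in> regular_funs UNIV pcoords" "(\<lambda>z. sl3 (ext3 (fst z) (fst (snd z) * snd (snd z))) $ i $ j) = p"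
      by (auto simp: fun_eq_iff)
    then show ?thesis by simp
  qed
  have e1: "(\<lambda>z. fst (stab_elem z) $ i $ j) \<in> regular_funs UNIV (pcoords :: (('k alg_closure^2^2) \<times> 'k alg_closure \<times> 'k alg_closure \<Rightarrow> 'k alg_closure) set)" for i j
  proof -
    have "(\<lambda>z :: ('k alg_closure^2^2) \<times> 'k alg_closure \<times> 'k alg_closure. fst (stab_elem z) $ i $ j) = (\<lambda>z. fst (snd z) * sl3 (ext3 (fst z) (fst (snd z) * snd (snd z))) $ i $ j)"
      by (simp add: fun_eq_iff stab_elem_def split_beta matrix_matrix_mult_def mat_def if_distrib[of "\<lambda>x. x * _"] cong: if_cong)
    then show ?thesis by (simp add: regular_funs.mult pc sl)
  qed
  have e2: "(\<lambda>z. snd (stab_elem z) $ i $ j) \<in> regular_funs UNIV (pcoords :: (('k alg_closure^2^2) \<times> 'k alg_closure \<times> 'k alg_closure \<Rightarrow> 'k alg_closure) set)" for i j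
    using exhaust_2[of i] exhaust_2[of j] unfolding stab_elem_def split_beta power2_eq_square
    by (elim disjE; simp; intro regular_funs.mult pc dB regular_funs.const UNIV_I)
  have co: "\<exists>p\<in>regular_funs UNIV pcoords. \<forall>z. det (fst z :: 'k alg_closure^2^2) * fst (snd z) * snd (snd z) = 1 \<longrightarrow> f (stab_elem z) = p z"
    if f: "f \<in> coords ?G" for f
  proof -
    consider i j where "f = (\<lambda>g. fst g $ i $ j)" | "f = (\<lambda>g. inverse (det (fst g)))"
      | i j where "f = (\<lambda>g. snd g $ i $ j)" | "f = (\<lambda>g. inverse (det (snd g)))"
      using f by (auto simp: stab_group_simps G2_simps G1_simps GL_simps)
    then show ?thesis
    proof cases
      case 1
      then show ?thesis by (intro bexI[OF _ e1[of i j]]) simp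
    next
      case 2
      let ?p = "\<lambda>z :: ('k alg_closure^2^2) \<times> 'k alg_closure \<times> 'k alg_closure. det (fst (stab_elem z)) * (det (fst z) * snd (snd z)) ^ 14"
      have pr: "?p \<in> regular_funs UNIV pcoords"
        by (intro regular_funs.mult regular_funs_power regular_funs_det e1 dB pc UNIV_I)
      have pv: "f (stab_elem z) = ?p z" if z: "det (fst z) * fst (snd z) * snd (snd z) = 1"
        for z :: "('k alg_closure^2^2) \<times> 'k alg_closure \<times> 'k alg_closure"
      proof -
        obtain B t u where ztu: "z = (B, t, u)" by (cases z) auto
        have "(det (fst (stab_elem (B, t, u))))\<^sup>2 = (t\<^sup>2) ^ 7"
          using simil_det[OF stab_elem_stabilizes(4)[of B t u]] z by (simp add: ztu)
        then have "det (fst (stab_elem (B, t, u))) * det (fst (stab_elem (B, t, u))) = t ^ 14"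
          by (simp add: power2_eq_square[symmetric] flip: power_mult)
        then have "det (fst (stab_elem (B, t, u))) * (det (fst (stab_elem (B, t, u))) * (det B * u) ^ 14) = (det B * t * u) ^ 14"
          by (simp add: power_mult_distrib mult.assoc[symmetric])
        also have "\<dots> = 1" using z by (simp add: ztu)
        finally have "inverse (det (fst (stab_elem (B, t, u)))) = det (fst (stab_elem (B, t, u))) * (det B * u) ^ 14"
          by (rule inverse_unique)
        then show ?thesis by (simp add: 2 ztu)
      qed
      show ?thesis by (rule bexI[OF _ pr], intro allI impI, rule pv)
    next
      case 3
      then show ?thesis by (intro bexI[OF _ e2[of i j]]) simp
    next
      case 4
      have pv: "f (stab_elem z) = fst (snd z) * fst (snd z)" if z: "det (fst z) * fst (snd z) * snd (snd z) = 1"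
        for z :: "('k alg_closure^2^2) \<times> 'k alg_closure \<times> 'k alg_closure"
      proof -
        obtain B t u where ztu: "z = (B, t, u)" by (cases z) auto
        have "det (snd (stab_elem (B, t, u))) * (t * t) = (det B * t * u) * (det B * t * u)"
          by (simp add: stab_elem_def det_2 power2_eq_square)
        also have "\<dots> = 1" using z by (simp add: ztu)
        finally have "inverse (det (snd (stab_elem (B, t, u)))) = t * t" by (rule inverse_unique)
        then show ?thesis by (simp add: 4 ztu)
      qed
      have pr: "(\<lambda>z :: ('k alg_closure^2^2) \<times> 'k alg_closure \<times> 'k alg_closure. fst (snd z) * fst (snd z)) \<in> regular_funs UNIV pcoords"
        by (intro regular_funs.mult pc)
      show ?thesis by (rule bexI[OF _ pr], intro allI impI, rule pv)
    qed
  qed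
  have "curve_connected ?G ?C"
    unfolding curve_connected_def
  proof (intro conjI ballI sub)
    fix a b assume "a \<in> ?C" "b \<in> ?C"
    then obtain B t u B' t' u' where ab: "a = stab_elem (B, t, u)" "det B * t * u = 1"
      "b = stab_elem (B', t', u')" "det B' * t' * u' = 1" by blast
    define m where "m i j = [:B$i$j, B'$i$j - B$i$j:]" for i j
    have m0: "poly (m i j) 0 = B$i$j" and m1: "poly (m i j) 1 = B'$i$j" for i j by (simp_all add: m_def)
    define T where "T = [:t, t' - t:]"
    have T: "poly T 0 = t" "poly T 1 = t'" by (simp_all add: T_def)
    define D where "D = (m 1 1 * m 2 2 - m 1 2 * m 2 1) * T"
    define N where "N x = ((\<chi> i j. poly (m i j) x) :: 'k alg_closure^2^2, poly T x, inverse (poly D x))" for x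
    have detN: "det (fst (N x)) * fst (snd (N x)) = poly D x" for x
      by (simp add: N_def det_2 D_def)
    have D0: "poly D 0 = det B * t" and D1: "poly D 1 = det B' * t'"
      by (simp_all add: D_def m0 m1 T det_2)
    have nz: "poly D 0 \<noteq> 0" "poly D 1 \<noteq> 0" using ab(2,4) by (auto simp: D0 D1)
    have "inverse (det B * t) = u" "inverse (det B' * t') = u'" using ab(2,4) inverse_unique by blast+
    then have N01: "N 0 = (B, t, u)" "N 1 = (B', t', u')"
      by (simp_all add: N_def D0 D1 m0 m1 T vec_eq_iff)
    have con: "det (fst (N x)) * fst (snd (N x)) * snd (snd (N x)) = 1" if "poly D x \<noteq> 0" for x
      using detN[of x] that by (simp add: N_def)
    have rc: "rational_curve pcoords D N"
      unfolding rational_curve_def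
    proof
      fix f :: "('k alg_closure^2^2) \<times> 'k alg_closure \<times> 'k alg_closure \<Rightarrow> 'k alg_closure" assume "f \<in> pcoords"
      then consider i j where "f = (\<lambda>z. fst z $ i $ j)" | "f = (\<lambda>z. fst (snd z))" | "f = (\<lambda>z. snd (snd z))"
        by (auto simp: pcoords_def)
      then show "\<exists>P n. \<forall>x. poly D x \<noteq> 0 \<longrightarrow> f (N x) * poly D x ^ n = poly P x"
      proof cases
        case 1
        then show ?thesis by - (rule exI[of _ "m i j"], rule exI[of _ 0], simp add: N_def)
      next
        case 2
        then show ?thesis by - (rule exI[of _ T], rule exI[of _ 0], simp add: N_def)
      next
        case 3
        then show ?thesis by - (rule exI[of _ 1], rule exI[of _ 1], simp add: N_def)
      qed
    qed
    have "rational_curve (coords ?G) D (stab_elem \<circ> N)"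
      unfolding rational_curve_def
    proof
      fix f assume "f \<in> coords ?G"
      from co[OF this] obtain p where p: "p \<in> regular_funs UNIV pcoords"
        "\<forall>z. det (fst z) * fst (snd z) * snd (snd z) = 1 \<longrightarrow> f (stab_elem z) = p z" by (rule bexE)
      obtain P n where P: "\<And>x. poly D x \<noteq> 0 \<Longrightarrow> p (N x) * poly D x ^ n = poly P x"
        using rational_curve_regular[OF rc p(1)] by blast
      have "f ((stab_elem \<circ> N) x) * poly D x ^ n = poly P x" if "poly D x \<noteq> 0" for x
        using P[OF that] p(2)[rule_format, OF con[OF that]] by simp
      then show "\<exists>P n. \<forall>x. poly D x \<noteq> 0 \<longrightarrow> f ((stab_elem \<circ> N) x) * poly D x ^ n = poly P x" by blast
    qed
    moreover have "(stab_elem \<circ> N) x \<in> ?C" if "poly D x \<noteq> 0" for x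
    proof -
      obtain B t u where "N x = (B, t, u)" by (cases "N x") auto
      then show ?thesis using con[OF that] by auto
    qed
    ultimately show "\<exists>D \<gamma>. poly D 0 \<noteq> 0 \<and> poly D 1 \<noteq> 0 \<and> \<gamma> 0 = a \<and> \<gamma> 1 = b \<and>
        rational_curve (coords ?G) D \<gamma> \<and> (\<forall>t. poly D t \<noteq> 0 \<longrightarrow> \<gamma> t \<in> ?C)"
      using nz N01 ab(1,3) by (intro exI[of _ D] exI[of _ "stab_elem \<circ> N"]) simp
  qed
  moreover have val: "x \<in> ?C \<longleftrightarrow> chi2 x = 1" "chi2 x = 1 \<or> chi2 x = -1" if "x \<in> carrier ?G" for x
    using that base_pair_stabilizer[of x] stab_elem_stabilizes(3) by (auto simp: stab_group_simps)
  moreover have "\<one>\<^bsub>?G\<^esub> \<in> ?C"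
  proof -
    interpret group "G2 :: (('k alg_closure^7^7) \<times> ('k alg_closure^2^2), 'k alg_closure) alg_group" by (rule G2_group)
    have "\<one>\<^bsub>?G\<^esub> \<in> carrier ?G" using G2_act(2) by (simp add: stab_group_simps)
    moreover have "chi2 \<one>\<^bsub>?G\<^esub> = (1 :: 'k alg_closure)" by (simp add: chi2_def stab_group_simps G2_simps Delta_evec1)
    ultimately show ?thesis using val(1) by blast
  qed
  moreover have "\<exists>f\<in>regular_funs UNIV (coords ?G). \<exists>h\<in>regular_funs UNIV (coords ?G).
        \<forall>x\<in>carrier ?G. (x \<in> ?C \<longleftrightarrow> f x \<noteq> 0) \<and> (x \<notin> ?C \<longleftrightarrow> h x \<noteq> 0)"
  proof -
    have ent: "(\<lambda>g. fst g $ i $ j) \<in> regular_funs UNIV (coords ?G)" for i j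
      by (rule regular_funs.coord) (simp add: stab_group_simps G2_coords)
    have ent2: "(\<lambda>g. snd g $ i $ j) \<in> regular_funs UNIV (coords ?G)" for i j
      by (rule regular_funs.coord) (simp add: stab_group_simps G2_coords)
    have c: "chi2 \<in> regular_funs UNIV (coords ?G)"
      unfolding chi2_def[abs_def] Delta_def mv_evec column_def vec_lambda_beta
      by (intro regular_funs.mult regular_funs_diff regular_funs_power regular_funs.add regular_funs.const regular_funs_det ent ent2 UNIV_I)
    have f: "(\<lambda>g. chi2 g + 1) \<in> regular_funs UNIV (coords ?G)" "(\<lambda>g. chi2 g + -1) \<in> regular_funs UNIV (coords ?G)"
      by (intro regular_funs.add regular_funs.const c UNIV_I)+
    have "(x \<in> ?C \<longleftrightarrow> chi2 x + 1 \<noteq> 0) \<and> (x \<notin> ?C \<longleftrightarrow> chi2 x + -1 \<noteq> 0)" if x: "x \<in> carrier ?G" for x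
      using val[OF x] by auto
    then show ?thesis by (intro bexI[OF _ f(1)] bexI[OF _ f(2)] ballI)
  qed
  ultimately show ?thesis unfolding clopen_part_def by blast
qed

lemma stab_pair_component:
  "carrier (identity_component (stab_group G2 act2 (base_pair :: 'k::field_char_0 alg_closure^7^2)))
     = {g \<in> carrier G2. act2 g base_pair = base_pair \<and> chi2 g = 1}"
proof -
  have "{stab_elem (B, t, u) |B t (u :: 'k alg_closure). det B * t * u = 1}
      = {g \<in> carrier G2. act2 g base_pair = base_pair \<and> chi2 g = 1}"
  proof (rule subset_antisym; rule subsetI)
    fix g assume "g \<in> {stab_elem (B, t, u) |B t (u :: 'k alg_closure). det B * t * u = 1}"
    then show "g \<in> {g \<in> carrier G2. act2 g base_pair = base_pair \<and> chi2 g = 1}"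
      using stab_elem_stabilizes(1-3) by auto
  next
    fix g :: "('k alg_closure^7^7) \<times> ('k alg_closure^2^2)"
    assume "g \<in> {g \<in> carrier G2. act2 g base_pair = base_pair \<and> chi2 g = 1}"
    then have "\<exists>B t u. det B * t * u = 1 \<and> g = stab_elem (B, t, u)"
      by (intro base_pair_stabilizer(2)) auto
    then show "g \<in> {stab_elem (B, t, u) |B t u. det B * t * u = 1}" by auto
  qed
  then show ?thesis by (simp add: clopen_part_identity_component[OF stab_pair_clopen])
qed

section \<open>Orbits of pairs\<close>

lemma map_act2:
  assumes "field_hom \<eta>"
  shows "act2 (map_matrix \<eta> g, map_matrix \<eta> m) (map_matrix \<eta> x) = map_matrix \<eta> (act2 (g, m) x)"
  by (simp add: vec_eq_iff act2_nth matrix_vector_mult_def map_matrix_nth[OF assms]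
      fh_sum[OF assms] fh_mult[OF assms] fh_add[OF assms])

lemma map_matrix_row: "map_matrix \<eta> x $ i = (\<chi> j. \<eta> (x $ i $ j))"
  by (simp add: map_matrix_def)

lemma map_bil:
  assumes "field_hom \<eta>"
  shows "bil (\<chi> i. \<eta> (x $ i)) (\<chi> i. \<eta> (y $ i)) = \<eta> (bil x y)"
  by (simp add: bil_def fh_diff[OF assms] fh_add[OF assms] fh_mult[OF assms] fh_numeral[OF assms])

lemma map_disc:
  assumes "field_hom \<eta>"
  shows "disc (quad_form (map_matrix \<eta> x)) = \<eta> (disc (quad_form x))"
  by (simp add: disc_eq map_matrix_row map_bil[OF assms] map_Delta[OF assms] power2_eq_square
      fh_diff[OF assms] fh_mult[OF assms] fh_numeral[OF assms])

lemma disc_base_pair: "disc (quad_form (base_pair :: 'a::field^7^2)) = 16"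
  by (simp add: disc_eq base_pair_def Delta_def bil_def evec_nth)

lemma base_pair_orbit:
  fixes x :: "'k::field_char_0 alg_closure^7^2"
  assumes "disc (quad_form x) \<noteq> 0"
  shows "x \<in> orbit G2 act2 base_pair"
proof -
  have "orbit G2 act2 y = orbit G2 act2 (norm_pair 1 (- 1))" if "disc (quad_form y) \<noteq> 0"
    for y :: "'k alg_closure^7^2"
  proof -
    obtain r where r: "r\<^sup>2 = disc (quad_form y)" using alg_closure_sqrt by blast
    have "r \<noteq> 0" using r that by auto
    then obtain s where "s \<noteq> 0" "orbit G2 act2 y = orbit G2 act2 (norm_pair s (- 1 * s))"
      using pair_normal_form[of y 1 r] r by auto
    then show ?thesis using norm_pair_hyperbolic[of s] by simp
  qed
  from this[OF assms] this[of base_pair] have "orbit G2 act2 x = orbit G2 act2 base_pair"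
    by (simp add: disc_base_pair)
  then show ?thesis using orbit2_self by blast
qed

text \<open>The discriminant is \<open>16\<close> at the base pair, so the value of \<open>chi2\<close> at a
  transporting element is a square root of the discriminant up to the factor \<open>4\<close>.\<close>

lemma alpha2_orbit:
  fixes x :: "'k::field_char_0^7^2"
  assumes x: "disc (quad_form x) \<noteq> 0" and t: "t\<^sup>2 = to_ac (disc (quad_form x))"
  shows "alpha2 (orbit G2 act2 x) = adjoin {t}"
  unfolding alpha2_def base_pair_def[symmetric]
proof (rule alpha_V_eq[where \<theta> = chi2])
  show "group (G2 :: (('k alg_closure^7^7) \<times> ('k alg_closure^2^2), 'k alg_closure) alg_group)" by (rule G2_group)
  fix y :: "'k^7^2" and g :: "('k alg_closure^7^7) \<times> ('k alg_closure^2^2)"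
  assume y: "y \<in> orbit G2 act2 x" and g: "g \<in> carrier G2" "map_matrix to_ac y = act2 g base_pair"
  obtain h m where h: "h \<in> carrier G1" "y = act2 (h, m) x" using y by (auto simp: orbit_def G2_simps)
  obtain q where q: "disc (quad_form y) = q\<^sup>2 * disc (quad_form x)"
  proof -
    obtain c l where "simil h c l" using h(1) by (auto simp: G1_iff)
    then have "disc (quad_form y) = (l * det m)\<^sup>2 * disc (quad_form x)"
      using disc_act2[of h c l m x] h(2) by simp
    then show ?thesis by (rule that)
  qed
  have "(chi2 g)\<^sup>2 * 16 = to_ac (disc (quad_form y))"
    using disc_act2_chi2[OF g(1), of base_pair] map_disc[OF field_hom_to_ac, of y]
    by (simp add: g(2) disc_base_pair)
  then have "(4 * chi2 g)\<^sup>2 = (to_ac q * t)\<^sup>2" using q t by (simp add: power_mult_distrib ac_simps)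
  then have "4 * chi2 g = to_ac q * t \<or> 4 * chi2 g = - (to_ac q * t)" by (simp only: power2_eq_iff)
  then have "chi2 g = to_ac (q / 4) * t \<or> chi2 g = to_ac (- q / 4) * t"
    by (elim disjE) (simp_all add: field_simps)
  then obtain r where r: "chi2 g = to_ac r * t" by blast
  then have sq: "(chi2 g)\<^sup>2 = to_ac (r\<^sup>2 * disc (quad_form x))" using t by (simp add: power_mult_distrib)
  have "chi2 g \<noteq> 0" "t \<noteq> 0" using chi2_nonzero[OF g(1)] t x by auto
  then have "adjoin {t} = adjoin {chi2 g}" using adjoin_sqrt_eq_iff[OF t sq] r by blast
  moreover have "(chi2 g)\<^sup>2 \<in> range to_ac" unfolding sq by (rule rangeI)
  ultimately show "adjoin {chi2 g} = adjoin {t} \<and> (chi2 g)\<^sup>2 \<in> range to_ac" by simp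
next
  have "disc (quad_form (map_matrix to_ac x)) \<noteq> 0" using x by (simp add: map_disc[OF field_hom_to_ac])
  from base_pair_orbit[OF this] show "\<exists>x\<in>orbit G2 act2 x. \<exists>g\<in>carrier G2. map_matrix to_ac x = act2 g base_pair"
    using orbit2_self[of x] by (auto simp: orbit_def[of _ _ base_pair])
next
  fix \<eta> :: "'k alg_closure \<Rightarrow> 'k alg_closure" and g :: "('k alg_closure^7^7) \<times> ('k alg_closure^2^2)" and y :: "'k^7^2"
  assume \<eta>: "\<eta> \<in> Gal" and g: "g \<in> carrier G2" "map_matrix to_ac y = act2 g base_pair"
  note fh = field_hom_Gal[OF \<eta>]
  have bp: "map_matrix \<eta> base_pair = base_pair"
    by (simp add: vec2_eq_iff map_matrix_row base_pair_def map_evec[OF fh])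
  have "act2 (map_matrix \<eta> (fst g), map_matrix \<eta> (snd g)) base_pair = map_matrix \<eta> (act2 g base_pair)"
    using map_act2[OF fh, of "fst g" "snd g" base_pair] by (simp add: bp)
  also have "\<dots> = map_matrix to_ac y"
    using \<eta> by (simp add: vec_eq_iff map_matrix_row flip: g(2)) (simp add: Gal_def)
  finally show "act2 (map_matrix \<eta> (fst g), map_matrix \<eta> (snd g)) base_pair = map_matrix to_ac y" .
next
  fix \<eta> :: "'k alg_closure \<Rightarrow> 'k alg_closure" and g :: "('k alg_closure^7^7) \<times> ('k alg_closure^2^2)"
  assume \<eta>: "\<eta> \<in> Gal" and g: "g \<in> carrier G2"
  note fh = field_hom_Gal[OF \<eta>]
  have "Delta (map_matrix \<eta> (fst g) *v evec 1) = \<eta> (Delta (fst g *v evec 1))"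
    using map_matrix_mv[OF fh, of "fst g" "evec 1"] by (simp add: map_evec[OF fh] map_Delta[OF fh])
  moreover have "det (map_matrix \<eta> (snd g)) = \<eta> (det (snd g))"
    by (simp add: det_2 map_matrix_row fh_diff[OF fh] fh_mult[OF fh])
  ultimately show "(map_matrix \<eta> (fst g), map_matrix \<eta> (snd g)) \<in> carrier G2
      \<and> chi2 (map_matrix \<eta> (fst g), map_matrix \<eta> (snd g)) = \<eta> (chi2 g)"
    using g map_G1(1)[OF fh, of "fst g"] map_matrix_invertible[OF fh, of "snd g"]
    by (cases g) (simp add: G2_simps chi2_def fh_mult[OF fh])
qed (auto simp: G2_act stab_pair_component chi2_nonzero chi2_mult)

section \<open>Representatives of the orbits of pairs\<close>

definition y_pair :: "'a::comm_ring_1 \<Rightarrow> 'a \<Rightarrow> 'a^7^2" where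
  "y_pair a s = vector [v7 0 0 0 1 0 0 (a * s), v7 0 0 (a * s) 0 0 (- a) 0]"

lemma diag_mv: "(diag d *v x) $ i = d $ i * x $ i" for x :: "'a::comm_ring_1^'n"
  by (simp add: diag_def matrix_vector_mult_def if_distrib[of "\<lambda>x. x * _"] cong: if_cong)

text \<open>The matrix \<open>h\<^sub>0\<close> turns the sum and the difference of the components of
  \<open>w(s)\<close> into sparse vectors, and the diagonal factor makes the result rational.\<close>

lemma w_alpha_y_pair:
  fixes \<alpha> :: "'k::field_char_0 alg_closure"
  assumes \<alpha>: "\<alpha>\<^sup>2 = to_ac a" "\<alpha> \<noteq> 0"
  shows "map_matrix to_ac (y_pair a s) = w_alpha \<alpha> s"
proof -
  have aa: "\<alpha> * \<alpha> = to_ac a" using \<alpha>(1) by (simp add: power2_eq_square)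
  have aa': "\<alpha> * (\<alpha> * z) = to_ac a * z" for z by (simp add: aa flip: mult.assoc)
  define S where "S = to_ac s"
  have h1: "h0 *v (w_s S $ 1 + w_s S $ 2) = v7 0 0 0 1 0 0 S"
    by (simp add: vec7_eq_iff mv7 h0_def w_s_def evec_nth field_simps)
  have h2: "h0 *v (w_s S $ 1 - w_s S $ 2) = v7 0 0 S 0 0 (- 1) 0"
    by (simp add: vec7_eq_iff mv7 h0_def w_s_def evec_nth field_simps)
  have x1: "w_alpha \<alpha> s $ 1 = mat \<alpha> *v (diag (vector [1, \<alpha>, 1, inverse \<alpha>, inverse \<alpha>, 1, \<alpha>]) *v (h0 *v (w_s S $ 1 + w_s S $ 2)))"
    by (simp add: w_alpha_def act2_nth g_alpha_def S_def matrix_vector_mul_assoc matrix_mul_assoc)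
  let ?g = "mat \<alpha> ** diag (vector [1, \<alpha>, 1, inverse \<alpha>, inverse \<alpha>, 1, \<alpha>]) ** h0"
  have e: "\<alpha> *s w_s S $ 1 + (- \<alpha>) *s w_s S $ 2 = \<alpha> *s (w_s S $ 1 - w_s S $ 2)"
    by (simp add: vec_eq_iff algebra_simps)
  have "w_alpha \<alpha> s $ 2 = ?g *v (\<alpha> *s w_s S $ 1 + (- \<alpha>) *s w_s S $ 2)"
    by (simp add: w_alpha_def act2_nth g_alpha_def S_def)
  then have x2: "w_alpha \<alpha> s $ 2 = \<alpha> *s (mat \<alpha> *v (diag (vector [1, \<alpha>, 1, inverse \<alpha>, inverse \<alpha>, 1, \<alpha>]) *v (h0 *v (w_s S $ 1 - w_s S $ 2))))"
    by (simp only: e vector_scalar_commute matrix_vector_mul_assoc matrix_mul_assoc)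
  show ?thesis
    using \<alpha>(2)
    by (simp add: vec2_eq_iff map_matrix_row vec7_eq_iff x1 x2 h1 h2 mat_mv diag_mv y_pair_def aa' aa flip: S_def)
qed

lemma y_pair_orbit:
  fixes a s :: "'a::field_char_0"
  assumes a: "a \<noteq> 0" and s: "s \<noteq> 0"
  shows "disc (quad_form (y_pair a s)) = a * (8 * a * s)\<^sup>2"
    "orbit G2 act2 (y_pair a s) = orbit G2 act2 (norm_pair s (- a * s))"
proof -
  have f: "Delta (y_pair a s $ 1) = - 4 * a * s" "Delta (y_pair a s $ 2) = 4 * a * a * s"
    "bil (y_pair a s $ 1) (y_pair a s $ 2) = 0" "bil (y_pair a s $ 2) (y_pair a s $ 1) = 0"
    by (simp_all add: y_pair_def Delta_def bil_def algebra_simps)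
  show "disc (quad_form (y_pair a s)) = a * (8 * a * s)\<^sup>2"
    by (simp add: disc_eq f power2_eq_square algebra_simps)
  have "norm_pair s (- a * s) \<in> orbit G2 act2 (y_pair a s)"
  proof (rule norm_pair_in_orbit)
    show "0 * 0 - 1 / (2 * a) * (1 / 2) \<noteq> 0" using a by simp
    show "Delta (0 *s y_pair a s $ 1 + (1 / (2 * a)) *s y_pair a s $ 2) = s"
      using a by (simp add: Delta_scale f power2_eq_square)
    show "Delta ((1 / 2) *s y_pair a s $ 1 + 0 *s y_pair a s $ 2) = - a * s"
      by (simp add: Delta_scale f power2_eq_square)
    show "bil (0 *s y_pair a s $ 1 + (1 / (2 * a)) *s y_pair a s $ 2) ((1 / 2) *s y_pair a s $ 1 + 0 *s y_pair a s $ 2) = 0"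
      by (simp add: bil_scale f)
  qed (use a s in auto)
  then show "orbit G2 act2 (y_pair a s) = orbit G2 act2 (norm_pair s (- a * s))"
    using orbit2_eq by metis
qed

lemma split_orbit_singleton:
  "is_singleton {Ob \<in> orbits G2 (Vss2 :: ('k::field_char_0^7^2) set) act2. alpha2 Ob = range to_ac}"
proof -
  let ?P = "norm_pair 1 (- 1) :: 'k^7^2"
  have "{Ob \<in> orbits G2 (Vss2 :: ('k^7^2) set) act2. alpha2 Ob = range to_ac} = {orbit G2 act2 ?P}"
  proof (rule subset_antisym; rule subsetI)
    fix Ob assume "Ob \<in> {Ob \<in> orbits G2 (Vss2 :: ('k^7^2) set) act2. alpha2 Ob = range to_ac}"
    then obtain x :: "'k^7^2" where x: "disc (quad_form x) \<noteq> 0" "Ob = orbit G2 act2 x" "alpha2 Ob = range to_ac"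
      by (auto simp: orbits_def Vss2_def)
    obtain t where t: "t\<^sup>2 = to_ac (disc (quad_form x))" using alg_closure_sqrt by blast
    have "t \<in> range to_ac" using alpha2_orbit[OF x(1) t] x adjoin_props(2)[of t "{t}"] by auto
    then obtain r where r: "t = to_ac r" by blast
    then have "to_ac (disc (quad_form x)) = to_ac (1 * r\<^sup>2)" using t by simp
    then have d: "disc (quad_form x) = 1 * r\<^sup>2" by (simp only: to_ac_eq_iff)
    moreover have "r \<noteq> 0" using d x(1) by auto
    ultimately obtain s where "s \<noteq> 0" "orbit G2 act2 x = orbit G2 act2 (norm_pair s (- 1 * s))"
      using pair_normal_form[of x 1 r] by auto
    then show "Ob \<in> {orbit G2 act2 ?P}" using norm_pair_hyperbolic[of s] x by simp
  next
    fix Ob assume Ob: "Ob \<in> {orbit G2 act2 ?P}"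
    have d: "disc (quad_form ?P) = 4" by (simp add: disc_eq norm_pair_forms)
    have sq: "(to_ac 2)\<^sup>2 = to_ac (disc (quad_form ?P))" by (simp add: d)
    have "alpha2 (orbit G2 act2 ?P) = adjoin {to_ac 2}"
      by (rule alpha2_orbit[OF _ sq]) (simp add: d)
    also have "\<dots> = range to_ac" by (rule adjoin_rational[OF rangeI])
    finally have "alpha2 (orbit G2 act2 ?P) = range to_ac" .
    with Ob have "Ob = orbit G2 act2 ?P" "alpha2 Ob = range to_ac" by simp_all
    moreover have "?P \<in> Vss2" by (simp add: Vss2_def d)
    ultimately show "Ob \<in> {Ob \<in> orbits G2 (Vss2 :: ('k^7^2) set) act2. alpha2 Ob = range to_ac}"
      by (auto simp: orbits_def)
  qed
  then show ?thesis by simp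
qed

section \<open>Classes modulo norms\<close>

lemma norm_group_eq: "norm_group a = {p\<^sup>2 - a * q\<^sup>2 |p q. (p, q) \<noteq> (0, 0)}" for a :: "'k::field"
proof -
  have z: "z \<otimes>\<^bsub>quad_ring a\<^esub> quad_conj z = ((fst z)\<^sup>2 - a * (snd z)\<^sup>2, 0)" for z
    by (cases z) (simp add: quad_ring_def quad_conj_def power2_eq_square algebra_simps)
  show ?thesis unfolding norm_group_def z by force
qed

context
  fixes a :: "'k::field_char_0" and \<alpha> :: "'k alg_closure"
  assumes \<alpha>: "\<alpha> \<notin> range to_ac" "\<alpha>\<^sup>2 = to_ac a"
begin

lemma alpha_nonzero: "\<alpha> \<noteq> 0" "a \<noteq> 0"
proof -
  show "\<alpha> \<noteq> 0" using \<alpha>(1) by (metis range_eqI to_ac_0)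
  then show "a \<noteq> 0" using \<alpha>(2) by auto
qed

lemma norm_nonzero: "(p, q) \<noteq> (0, 0) \<Longrightarrow> p\<^sup>2 - a * q\<^sup>2 \<noteq> 0"
proof
  assume pq: "(p, q) \<noteq> (0, 0)" and z: "p\<^sup>2 - a * q\<^sup>2 = 0"
  have q: "q \<noteq> 0" using pq z by auto
  have "a = (p / q)\<^sup>2" using z q by (simp add: field_simps)
  then have "\<alpha>\<^sup>2 = (to_ac (p / q))\<^sup>2" using \<alpha>(2) by simp
  then have "\<alpha> = to_ac (p / q) \<or> \<alpha> = to_ac (- (p / q))" by (simp only: power2_eq_iff to_ac_minus)
  then show False using \<alpha>(1) by blast
qed

lemma norm_group_mult: "m \<in> norm_group a \<Longrightarrow> n \<in> norm_group a \<Longrightarrow> m * n \<in> norm_group a"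
proof -
  assume "m \<in> norm_group a" "n \<in> norm_group a"
  then obtain p q p' q' where *: "(p, q) \<noteq> (0, 0)" "(p', q') \<noteq> (0, 0)"
    "m = p\<^sup>2 - a * q\<^sup>2" "n = p'\<^sup>2 - a * q'\<^sup>2" unfolding norm_group_eq by blast
  have e: "m * n = (p * p' + a * q * q')\<^sup>2 - a * (p * q' + q * p')\<^sup>2"
    by (simp add: * power2_eq_square algebra_simps)
  moreover have "m * n \<noteq> 0" using norm_nonzero * by simp
  then have "(p * p' + a * q * q', p * q' + q * p') \<noteq> (0, 0)" using e by auto
  ultimately show ?thesis unfolding norm_group_eq by blast
qed

lemma norm_group_inverse: "m \<in> norm_group a \<Longrightarrow> inverse m \<in> norm_group a"
proof -
  assume "m \<in> norm_group a"
  then obtain p q where *: "(p, q) \<noteq> (0, 0)" "m = p\<^sup>2 - a * q\<^sup>2" unfolding norm_group_eq by blast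
  have m: "m \<noteq> 0" using norm_nonzero * by simp
  have "(p / m)\<^sup>2 - a * (q / m)\<^sup>2 = m / m\<^sup>2" by (simp add: * power_divide diff_divide_distrib)
  also have "\<dots> = inverse m" using m by (simp add: power2_eq_square field_simps)
  finally have "inverse m = (p / m)\<^sup>2 - a * (q / m)\<^sup>2" by simp
  moreover have "(p / m, q / m) \<noteq> (0, 0)" using * m by simp
  ultimately show ?thesis unfolding norm_group_eq by blast
qed

lemma norm_group_square: "s \<noteq> 0 \<Longrightarrow> s * s \<in> norm_group a"
  unfolding norm_group_eq by (rule CollectI, rule exI[of _ s], rule exI[of _ 0]) (simp add: power2_eq_square)

lemma norm_group_1: "1 \<in> norm_group a"
  using norm_group_square[of 1] by simp

lemma norm_coset_eq: "norm_coset a s = {n * s |n. n \<in> norm_group a}"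
  by (auto simp: norm_coset_def r_coset_def ring_of_type_algebra_simps)

lemma norm_coset_eq_iff:
  assumes "s \<noteq> 0" "t \<noteq> 0"
  shows "norm_coset a s = norm_coset a t \<longleftrightarrow> t / s \<in> norm_group a"
proof
  assume "norm_coset a s = norm_coset a t"
  moreover have "t \<in> norm_coset a t" using norm_group_1 unfolding norm_coset_eq by force
  ultimately obtain n where "t = n * s" "n \<in> norm_group a" unfolding norm_coset_eq by blast
  then show "t / s \<in> norm_group a" using assms by simp
next
  assume n: "t / s \<in> norm_group a"
  show "norm_coset a s = norm_coset a t"
  proof (rule subset_antisym; rule subsetI)
    fix x assume "x \<in> norm_coset a s"
    then obtain m where m: "x = m * s" "m \<in> norm_group a" unfolding norm_coset_eq by blast
    have "x = (m * inverse (t / s)) * t" using m(1) assms by (simp add: field_simps)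
    then show "x \<in> norm_coset a t"
      unfolding norm_coset_eq using norm_group_mult[OF m(2) norm_group_inverse[OF n]] by (intro CollectI exI conjI)
  next
    fix x assume "x \<in> norm_coset a t"
    then obtain m where m: "x = m * t" "m \<in> norm_group a" unfolding norm_coset_eq by blast
    have "x = (m * (t / s)) * s" using m(1) assms by (simp add: field_simps)
    then show "x \<in> norm_coset a s"
      unfolding norm_coset_eq using norm_group_mult[OF m(2) n] by (intro CollectI exI conjI)
  qed
qed

lemma carrier_norm_quotient: "carrier (norm_quotient a) = {norm_coset a s |s. s \<noteq> 0}"
  by (auto simp: norm_quotient_def FactGroup_def RCOSETS_def norm_coset_def ring_of_type_algebra_simps)

text \<open>The square of every scalar is a norm, so inversion acts trivially on the classes.\<close>

lemma inversion_orbit_coset: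
  assumes s: "s \<noteq> 0"
  shows "inversion_orbit a (norm_coset a s) = {norm_coset a s}"
proof -
  have mult: "norm_coset a u \<otimes>\<^bsub>norm_quotient a\<^esub> norm_coset a v = norm_coset a (u * v)" for u v
  proof -
    have "norm_coset a u \<otimes>\<^bsub>norm_quotient a\<^esub> norm_coset a v = {m * u * (n * v) |m n. m \<in> norm_group a \<and> n \<in> norm_group a}"
      unfolding norm_coset_eq by (auto simp: norm_quotient_def FactGroup_def set_mult_def ring_of_type_algebra_simps)
    also have "\<dots> = norm_coset a (u * v)"
    proof (rule subset_antisym; rule subsetI)
      fix x assume "x \<in> {m * u * (n * v) |m n. m \<in> norm_group a \<and> n \<in> norm_group a}"
      then obtain m n where "x = (m * n) * (u * v)" "m \<in> norm_group a" "n \<in> norm_group a" by (auto simp: ac_simps)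
      then show "x \<in> norm_coset a (u * v)" unfolding norm_coset_eq using norm_group_mult by blast
    next
      fix x assume "x \<in> norm_coset a (u * v)"
      then obtain m where "x = m * u * (1 * v)" "m \<in> norm_group a" by (auto simp: norm_coset_eq ac_simps)
      then show "x \<in> {m * u * (n * v) |m n. m \<in> norm_group a \<and> n \<in> norm_group a}" using norm_group_1 by blast
    qed
    finally show ?thesis .
  qed
  have one: "\<one>\<^bsub>norm_quotient a\<^esub> = norm_coset a 1"
    by (auto simp: norm_quotient_def FactGroup_def norm_coset_eq)
  have "inv\<^bsub>norm_quotient a\<^esub> (norm_coset a s) = norm_coset a s"
    unfolding m_inv_def
  proof (rule the_equality)
    have "norm_coset a (s * s) = norm_coset a 1"
      using norm_coset_eq_iff[of 1 "s * s"] norm_group_square[OF s] s by simp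
    then show "norm_coset a s \<in> carrier (norm_quotient a) \<and>
        norm_coset a s \<otimes>\<^bsub>norm_quotient a\<^esub> norm_coset a s = \<one>\<^bsub>norm_quotient a\<^esub> \<and>
        norm_coset a s \<otimes>\<^bsub>norm_quotient a\<^esub> norm_coset a s = \<one>\<^bsub>norm_quotient a\<^esub>"
      using s by (auto simp: mult one carrier_norm_quotient)
  next
    fix y assume y: "y \<in> carrier (norm_quotient a) \<and>
        norm_coset a s \<otimes>\<^bsub>norm_quotient a\<^esub> y = \<one>\<^bsub>norm_quotient a\<^esub> \<and> y \<otimes>\<^bsub>norm_quotient a\<^esub> norm_coset a s = \<one>\<^bsub>norm_quotient a\<^esub>"
    then obtain u where u: "u \<noteq> 0" "y = norm_coset a u" by (auto simp: carrier_norm_quotient)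
    then have "norm_coset a 1 = norm_coset a (s * u)" using y by (simp add: mult one)
    then have "s * u \<in> norm_group a" using norm_coset_eq_iff[of 1 "s * u"] s u by simp
    then have "(s * u) * inverse (u * u) \<in> norm_group a"
      using norm_group_mult norm_group_inverse norm_group_square[OF u(1)] by blast
    moreover have "(s * u) * inverse (u * u) = s / u" using u by (simp add: field_simps)
    ultimately show "y = norm_coset a s" using norm_coset_eq_iff[of u s] u s by simp
  qed
  then show ?thesis by (simp add: inversion_orbit_def)
qed

lemma y_pair_orbit_eq_iff:
  assumes s: "s \<noteq> 0" and t: "t \<noteq> 0"
  shows "orbit G2 act2 (y_pair a s) = orbit G2 act2 (y_pair a t) \<longleftrightarrow> norm_coset a s = norm_coset a t"
  unfolding y_pair_orbit(2)[OF alpha_nonzero(2) s] y_pair_orbit(2)[OF alpha_nonzero(2) t] norm_coset_eq_iff[OF s t]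
proof
  assume "orbit G2 act2 (norm_pair s (- a * s)) = orbit G2 act2 (norm_pair t (- a * t))"
  then have "norm_pair t (- a * t) \<in> orbit G2 act2 (norm_pair s (- a * s))" using orbit2_self by blast
  then obtain p q where pq: "t = s * (p\<^sup>2 - a * q\<^sup>2)" using norm_pair_orbit_norm by blast
  then have "(p, q) \<noteq> (0, 0)" using t by auto
  moreover have "t / s = p\<^sup>2 - a * q\<^sup>2" using pq s by simp
  ultimately show "t / s \<in> norm_group a" unfolding norm_group_eq by blast
next
  assume "t / s \<in> norm_group a"
  then obtain p q where pq: "t / s = p\<^sup>2 - a * q\<^sup>2" "(p, q) \<noteq> (0, 0)" unfolding norm_group_eq by blast
  then have "t = s * (p\<^sup>2 - a * q\<^sup>2)" using s by (simp add: field_simps)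
  then show "orbit G2 act2 (norm_pair s (- a * s)) = orbit G2 act2 (norm_pair t (- a * t))"
    using norm_pair_norm[OF s alpha_nonzero(2) norm_nonzero[OF pq(2)]] by simp
qed

lemma alpha2_fibre:
  "{Ob \<in> orbits G2 (Vss2 :: ('k^7^2) set) act2. alpha2 Ob = adjoin {\<alpha>}} = {orbit G2 act2 (y_pair a s) |s. s \<noteq> 0}"
proof (rule subset_antisym; rule subsetI)
  fix Ob assume "Ob \<in> {Ob \<in> orbits G2 (Vss2 :: ('k^7^2) set) act2. alpha2 Ob = adjoin {\<alpha>}}"
  then obtain x :: "'k^7^2" where x: "disc (quad_form x) \<noteq> 0" "Ob = orbit G2 act2 x" "alpha2 Ob = adjoin {\<alpha>}"
    by (auto simp: orbits_def Vss2_def)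
  obtain t where t: "t\<^sup>2 = to_ac (disc (quad_form x))" using alg_closure_sqrt by blast
  have t0: "t \<noteq> 0" using t x by auto
  have "adjoin {\<alpha>} = adjoin {t}" using alpha2_orbit[OF x(1) t] x by simp
  then obtain r where r: "t = to_ac r * \<alpha>"
    using adjoin_sqrt_eq_iff[OF \<alpha>(2) t t0 alpha_nonzero(1)] by blast
  then have "to_ac (disc (quad_form x)) = to_ac (a * r\<^sup>2)" using t \<alpha>(2) r by (simp add: power_mult_distrib mult.commute)
  then have d: "disc (quad_form x) = a * r\<^sup>2" by (simp only: to_ac_eq_iff)
  have "r \<noteq> 0" using r t0 by auto
  then obtain s where "s \<noteq> 0" "orbit G2 act2 x = orbit G2 act2 (norm_pair s (- a * s))"
    using pair_normal_form[OF d alpha_nonzero(2)] by blast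
  then show "Ob \<in> {orbit G2 act2 (y_pair a s) |s. s \<noteq> 0}"
    using y_pair_orbit(2)[OF alpha_nonzero(2)] x by auto
next
  fix Ob assume "Ob \<in> {orbit G2 act2 (y_pair a s) |s. s \<noteq> 0}"
  then obtain s where s: "s \<noteq> 0" "Ob = orbit G2 act2 (y_pair a s)" by blast
  note d = y_pair_orbit(1)[OF alpha_nonzero(2) s(1)]
  have nz: "disc (quad_form (y_pair a s)) \<noteq> 0" using s alpha_nonzero by (simp add: d)
  have t: "(to_ac (8 * a * s) * \<alpha>)\<^sup>2 = to_ac (disc (quad_form (y_pair a s)))"
    unfolding d by (simp add: power_mult_distrib \<alpha>(2))
  have "adjoin {\<alpha>} = adjoin {to_ac (8 * a * s) * \<alpha>}"
  proof -
    have nz: "to_ac (8 * a * s) * \<alpha> \<noteq> 0" using s alpha_nonzero by simp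
    show ?thesis using adjoin_sqrt_eq_iff[OF \<alpha>(2) t nz alpha_nonzero(1)] by blast
  qed
  then show "Ob \<in> {Ob \<in> orbits G2 (Vss2 :: ('k^7^2) set) act2. alpha2 Ob = adjoin {\<alpha>}}"
    using alpha2_orbit[OF nz t] nz s by (auto simp: orbits_def Vss2_def)
qed

lemma alpha2_fibre_bij:
  "\<exists>\<phi>. bij_betw \<phi> (inversion_orbit a ` carrier (norm_quotient a))
        {Ob \<in> orbits G2 (Vss2 :: ('k ^ 7 ^ 2) set) act2. alpha2 Ob = adjoin {\<alpha>}} \<and>
     (\<forall>s. s \<noteq> 0 \<longrightarrow> (\<exists>y \<in> Vss2. map_matrix to_ac y = w_alpha \<alpha> s \<and>
        \<phi> (inversion_orbit a (norm_coset a s)) = orbit G2 act2 y))"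
proof -
  define \<phi> where "\<phi> S = orbit G2 act2 (y_pair a (SOME s. s \<noteq> 0 \<and> S = {norm_coset a s}))" for S
  have \<phi>: "\<phi> {norm_coset a s} = orbit G2 act2 (y_pair a s)" if s: "s \<noteq> 0" for s
  proof -
    let ?t = "SOME t. t \<noteq> 0 \<and> {norm_coset a s} = {norm_coset a t}"
    have "?t \<noteq> 0 \<and> {norm_coset a s} = {norm_coset a ?t}"
      by (rule someI[of _ s]) (use s in simp)
    then have t: "?t \<noteq> 0" "norm_coset a s = norm_coset a ?t" by auto
    then have "orbit G2 act2 (y_pair a s) = orbit G2 act2 (y_pair a ?t)"
      using y_pair_orbit_eq_iff[OF s t(1)] by blast
    then show ?thesis by (simp add: \<phi>_def)
  qed
  have dom: "inversion_orbit a ` carrier (norm_quotient a) = {{norm_coset a s} |s. s \<noteq> 0}"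
  proof -
    have "inversion_orbit a ` {norm_coset a s |s. s \<noteq> 0} = {inversion_orbit a (norm_coset a s) |s. s \<noteq> 0}" by blast
    also have "\<dots> = {{norm_coset a s} |s. s \<noteq> 0}"
      by (intro Collect_cong ex_cong1) (auto simp: inversion_orbit_coset)
    finally show ?thesis by (simp only: carrier_norm_quotient)
  qed
  have "bij_betw \<phi> {{norm_coset a s} |s. s \<noteq> 0} {orbit G2 act2 (y_pair a s) |s. s \<noteq> 0}"
    unfolding bij_betw_def
  proof
    show "inj_on \<phi> {{norm_coset a s} |s. s \<noteq> 0}"
      by (rule inj_onI) (auto simp: \<phi> y_pair_orbit_eq_iff)
    show "\<phi> ` {{norm_coset a s} |s. s \<noteq> 0} = {orbit G2 act2 (y_pair a s) |s. s \<noteq> 0}"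
    proof (rule subset_antisym; rule subsetI)
      fix z assume "z \<in> {orbit G2 act2 (y_pair a s) |s. s \<noteq> 0}"
      then obtain s where s: "s \<noteq> 0" "z = orbit G2 act2 (y_pair a s)" by blast
      then have "z = \<phi> {norm_coset a s}" using \<phi> by simp
      then show "z \<in> \<phi> ` {{norm_coset a s} |s. s \<noteq> 0}" using s(1) by blast
    next
      fix z assume "z \<in> \<phi> ` {{norm_coset a s} |s. s \<noteq> 0}"
      then obtain s where "s \<noteq> 0" "z = \<phi> {norm_coset a s}" by blast
      then show "z \<in> {orbit G2 act2 (y_pair a s) |s. s \<noteq> 0}" using \<phi>[of s] by blast
    qed
  qed
  moreover have "y_pair a s \<in> Vss2 \<and> map_matrix to_ac (y_pair a s) = w_alpha \<alpha> s \<and>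
     \<phi> (inversion_orbit a (norm_coset a s)) = orbit G2 act2 (y_pair a s)" if s: "s \<noteq> 0" for s
    using w_alpha_y_pair[OF \<alpha>(2) alpha_nonzero(1)] \<phi>[OF s] inversion_orbit_coset[OF s]
      y_pair_orbit(1)[OF alpha_nonzero(2) s] s alpha_nonzero(2) by (simp add: Vss2_def)
  ultimately show ?thesis unfolding dom alpha2_fibre by (intro exI[of _ \<phi>]) blast
qed

end

section \<open>Matrices over the split quadratic algebra\<close>

lemma quad_ring_simps:
  "carrier (quad_ring b) = UNIV" "\<one>\<^bsub>quad_ring b\<^esub> = (1, 0)" "\<zero>\<^bsub>quad_ring b\<^esub> = (0, 0)"
  "z \<otimes>\<^bsub>quad_ring b\<^esub> w = (fst z * fst w + b * snd z * snd w, fst z * snd w + snd z * fst w)"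
  "z \<oplus>\<^bsub>quad_ring b\<^esub> w = (fst z + fst w, snd z + snd w)"
  by (simp_all add: quad_ring_def split_beta)

lemma quad_ring_cring: "cring (quad_ring b)"
proof (rule cringI)
  show "abelian_group (quad_ring b)"
  proof (rule abelian_groupI)
    show "\<exists>y\<in>carrier (quad_ring b). y \<oplus>\<^bsub>quad_ring b\<^esub> x = \<zero>\<^bsub>quad_ring b\<^esub>" for x
      by (rule bexI[of _ "(- fst x, - snd x)"]) (simp_all add: quad_ring_simps)
  qed (simp_all add: quad_ring_simps algebra_simps)
  show "Group.comm_monoid (quad_ring b)"
    by (rule comm_monoidI) (simp_all add: quad_ring_simps algebra_simps)
qed (simp add: quad_ring_simps algebra_simps)

lemma quad_ring_minus: "\<ominus>\<^bsub>quad_ring b\<^esub> z = (- fst z, - snd z)"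
proof -
  interpret cring "quad_ring b" by (rule quad_ring_cring)
  show ?thesis by (rule minus_equality) (simp_all add: quad_ring_simps)
qed

text \<open>Over a ring containing a square root \<open>\<alpha>\<close> of \<open>b\<close> the quadratic algebra is
  described by its two evaluations, at \<open>\<alpha>\<close> and at \<open>-\<alpha>\<close>; conjugation exchanges
  them.\<close>

definition ev :: "'r::comm_ring_1 \<Rightarrow> 'r \<times> 'r \<Rightarrow> 'r" where
  "ev \<alpha> z = fst z + \<alpha> * snd z"

lemma ev_mult: "\<alpha> * \<alpha> = b \<Longrightarrow> ev \<alpha> (z \<otimes>\<^bsub>quad_ring b\<^esub> w) = ev \<alpha> z * ev \<alpha> w"
  by (auto simp: ev_def quad_ring_simps algebra_simps)

lemma ev_add: "ev \<alpha> (z \<oplus>\<^bsub>quad_ring b\<^esub> w) = ev \<alpha> z + ev \<alpha> w"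
  by (simp add: ev_def quad_ring_simps algebra_simps)

lemma ev_finsum: "finite I \<Longrightarrow> ev \<alpha> (\<Oplus>\<^bsub>quad_ring b\<^esub> i\<in>I. f i) = (\<Sum>i\<in>I. ev \<alpha> (f i))"
proof (induction I rule: finite_induct)
  interpret cring "quad_ring b" by (rule quad_ring_cring)
  {
    case empty
    show ?case by (simp add: ev_def quad_ring_simps)
  next
    case (insert i I)
    then show ?case by (subst finsum_insert) (auto simp: quad_ring_simps(1) ev_add)
  }
qed

lemma ev_finprod:
  assumes "\<alpha> * \<alpha> = b"
  shows "finite I \<Longrightarrow> ev \<alpha> (\<Otimes>\<^bsub>quad_ring b\<^esub> i\<in>I. f i) = (\<Prod>i\<in>I. ev \<alpha> (f i))"
proof (induction I rule: finite_induct)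
  interpret cring "quad_ring b" by (rule quad_ring_cring)
  {
    case empty
    show ?case by (simp add: ev_def quad_ring_simps)
  next
    case (insert i I)
    then show ?case by (subst finprod_insert) (auto simp: quad_ring_simps(1) ev_mult[OF assms])
  }
qed

definition evm :: "'r::comm_ring_1 \<Rightarrow> ('r \<times> 'r)^'n^'m \<Rightarrow> 'r^'n^'m" where
  "evm \<alpha> A = (\<chi> i j. ev \<alpha> (A $ i $ j))"

lemma evm_nth: "evm \<alpha> A $ i $ j = ev \<alpha> (A $ i $ j)"
  by (simp add: evm_def)

lemma evm_mult: "\<alpha> * \<alpha> = b \<Longrightarrow> evm \<alpha> (qmult b A B) = evm \<alpha> A ** evm \<alpha> B"
  by (simp add: vec_eq_iff evm_nth qmult_def ev_finsum ev_mult matrix_matrix_mult_def)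

lemma evm_diag: "evm \<alpha> (qdiag d) = diag (\<chi> i. d i)"
  by (simp add: vec_eq_iff evm_nth qdiag_def diag_def ev_def)

lemma evm_one: "evm \<alpha> (qdiag (\<lambda>_. 1)) = mat 1"
  by (simp add: evm_diag diag_def mat_def vec_eq_iff)

lemma evm_adjoint: "evm \<alpha> (qadjoint A) = transpose (evm (- \<alpha>) A)"
  by (simp add: vec_eq_iff evm_nth qadjoint_def quad_conj_def ev_def transpose_def split_beta)

lemma ev_qdet:
  fixes A :: "('r::comm_ring_1 \<times> 'r)^'n^'n"
  assumes "\<alpha> * \<alpha> = b"
  shows "ev \<alpha> (qdet b A) = det (evm \<alpha> A)"
proof -
  have m: "ev \<alpha> (\<ominus>\<^bsub>quad_ring b\<^esub> z) = - ev \<alpha> z" for z by (simp add: quad_ring_minus ev_def)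
  have "ev \<alpha> (qdet b A) = (\<Sum>p\<in>{p. p permutes (UNIV::'n set)}.
      if evenperm p then (\<Prod>i\<in>UNIV. ev \<alpha> (A $ i $ p i)) else - (\<Prod>i\<in>UNIV. ev \<alpha> (A $ i $ p i)))"
    unfolding qdet_def Let_def
    by (subst ev_finsum) (auto simp: finite_permutations m ev_finprod[OF assms] intro!: sum.cong)
  also have "\<dots> = det (evm \<alpha> A)"
    unfolding det_def by (rule sum.cong) (auto simp: sign_def evm_nth)
  finally show ?thesis .
qed

lemma ev_eqI:
  fixes z w :: "'r::field_char_0 \<times> 'r"
  assumes "\<alpha> \<noteq> 0" "ev \<alpha> z = ev \<alpha> w" "ev (- \<alpha>) z = ev (- \<alpha>) w"
  shows "z = w"
proof -
  have "2 * fst z = ev \<alpha> z + ev (- \<alpha>) z" "2 * fst w = ev \<alpha> w + ev (- \<alpha>) w"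
    "2 * \<alpha> * snd z = ev \<alpha> z - ev (- \<alpha>) z" "2 * \<alpha> * snd w = ev \<alpha> w - ev (- \<alpha>) w"
    by (simp_all add: ev_def)
  then have "2 * fst z = 2 * fst w" "2 * \<alpha> * snd z = 2 * \<alpha> * snd w" using assms(2,3) by simp_all
  then show ?thesis using assms(1) by (simp add: prod_eq_iff)
qed

lemma evm_eqI:
  fixes A B :: "('r::field_char_0 \<times> 'r)^'n^'m"
  assumes "\<alpha> \<noteq> 0" "evm \<alpha> A = evm \<alpha> B" "evm (- \<alpha>) A = evm (- \<alpha>) B"
  shows "A = B"
proof -
  have "A $ i $ j = B $ i $ j" for i j
    by (rule ev_eqI[OF assms(1)]) (use assms(2,3) in \<open>simp_all add: vec_eq_iff evm_nth\<close>)
  then show ?thesis by (simp add: vec_eq_iff)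
qed

definition mkq :: "'r::field \<Rightarrow> 'r^'n^'m \<Rightarrow> 'r^'n^'m \<Rightarrow> ('r \<times> 'r)^'n^'m" where
  "mkq \<alpha> P Q = (\<chi> i j. ((P$i$j + Q$i$j) / 2, (P$i$j - Q$i$j) / (2 * \<alpha>)))"

lemma evm_mkq:
  fixes P Q :: "'r::field_char_0^'n^'m"
  assumes "\<alpha> \<noteq> 0"
  shows "evm \<alpha> (mkq \<alpha> P Q) = P" "evm (- \<alpha>) (mkq \<alpha> P Q) = Q"
  using assms by (simp_all add: vec_eq_iff evm_nth mkq_def ev_def field_simps)

text \<open>The evaluation of the equation at \<open>-\<alpha>\<close> is the transpose of the evaluation at
  \<open>\<alpha>\<close>, so one of the two suffices.\<close>

lemma unitary_eq_iff:
  fixes A :: "('r::field_char_0 \<times> 'r)^'n^'n"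
  assumes b: "\<alpha> * \<alpha> = b" and \<alpha>: "\<alpha> \<noteq> 0"
  shows "qmult b (qmult b A (qdiag d)) (qadjoint A) = qdiag d \<longleftrightarrow>
    evm \<alpha> A ** diag (\<chi> i. d i) ** transpose (evm (- \<alpha>) A) = diag (\<chi> i. d i)"
proof -
  have b': "(- \<alpha>) * (- \<alpha>) = b" using b by simp
  have td: "transpose (diag e) = diag e" for e :: "'r^'n" by (auto simp: transpose_def diag_def vec_eq_iff)
  let ?P = "evm \<alpha> A" and ?Q = "evm (- \<alpha>) A" and ?D = "diag (\<chi> i. d i) :: 'r^'n^'n"
  have 1: "evm \<alpha> (qmult b (qmult b A (qdiag d)) (qadjoint A)) = ?P ** ?D ** transpose ?Q"
    by (simp add: evm_mult[OF b] evm_diag evm_adjoint)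
  have 2: "evm (- \<alpha>) (qmult b (qmult b A (qdiag d)) (qadjoint A)) = transpose (?P ** ?D ** transpose ?Q)"
    by (simp add: evm_mult[OF b'] evm_diag evm_adjoint matrix_transpose_mul td matrix_mul_assoc)
  show ?thesis
  proof
    assume "qmult b (qmult b A (qdiag d)) (qadjoint A) = qdiag d"
    then show "?P ** ?D ** transpose ?Q = ?D" using 1 by (simp add: evm_diag)
  next
    assume *: "?P ** ?D ** transpose ?Q = ?D"
    show "qmult b (qmult b A (qdiag d)) (qadjoint A) = qdiag d"
      by (rule evm_eqI[OF \<alpha>]) (simp_all only: 1 2 * td evm_diag)
  qed
qed

section \<open>A rational form of the special linear group\<close>

text \<open>The columns of \<open>smat a s\<close> are a vector \<open>x\<close> with \<open>\<Delta>(x) = a\<close> and a basis \<open>p\<^sub>i, q\<^sub>i\<close> of its complement such that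
  \<open>p\<^sub>i + \<alpha> q\<^sub>i\<close> spans the eigenspace of multiplication by \<open>x\<close> for \<open>\<alpha>\<^sup>2 = a\<close>; \<open>tmat a s\<close> is the inverse. The hermitian
  form on the complement is \<open>diag(1/s, -s, 1)\<close> in this basis.\<close>

definition smat :: "'a::field \<Rightarrow> 'a \<Rightarrow> 'a^7^7" where
  "smat a s = vector [
     vector [0, 0, 0, 0, 0, 0, -1],
     vector [1, 0, 0, 1, 0, 0, 0],
     vector [0, s/2, 1/2, 0, 0, 0, 0],
     vector [0, 0, 0, 0, -a/4, a/(4 * s), 0],
     vector [-a/4, 0, 0, a/4, 0, 0, 0],
     vector [0, a/2, -a/(2 * s), 0, 0, 0, 0],
     vector [0, 0, 0, 0, s/a, 1/a, 0]]"

definition tmat :: "'a::field \<Rightarrow> 'a \<Rightarrow> 'a^7^7" where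
  "tmat a s = vector [
     vector [0, 1/2, 0, 0, -2/a, 0, 0],
     vector [0, 0, 1/s, 0, 0, 1/a, 0],
     vector [0, 0, 1, 0, 0, -s/a, 0],
     vector [0, 1/2, 0, 0, 2/a, 0, 0],
     vector [0, 0, 0, -2/a, 0, 0, a/(2 * s)],
     vector [0, 0, 0, 2 * s/a, 0, 0, a/2],
     vector [-1, 0, 0, 0, 0, 0, 0]]"

lemma smat_tmat:
  fixes a s :: "'a::field_char_0"
  assumes "a \<noteq> 0" "s \<noteq> 0"
  shows "smat a s ** tmat a s = mat 1" "tmat a s ** smat a s = mat 1"
proof -
  show 1: "smat a s ** tmat a s = mat 1"
    using assms by (simp add: vec_eq_iff forall_7 mm7 smat_def tmat_def mat_def field_simps)
  then show "tmat a s ** smat a s = mat 1" using matrix_left_right_inverse by blast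
qed

text \<open>Multiplication by a matrix over the quadratic algebra in the basis \<open>p\<^sub>i, q\<^sub>i\<close>.\<close>

definition bigm :: "'a::comm_ring_1 \<Rightarrow> ('a \<times> 'a)^3^3 \<Rightarrow> 'a^7^7" where
  "bigm b A = vector [
     vector [1, 0, 0, 0, 0, 0, 0],
     vector [0, fst (A$1$1), fst (A$1$2), fst (A$1$3), snd (A$1$1), snd (A$1$2), snd (A$1$3)],
     vector [0, fst (A$2$1), fst (A$2$2), fst (A$2$3), snd (A$2$1), snd (A$2$2), snd (A$2$3)],
     vector [0, fst (A$3$1), fst (A$3$2), fst (A$3$3), snd (A$3$1), snd (A$3$2), snd (A$3$3)],
     vector [0, b * snd (A$1$1), b * snd (A$1$2), b * snd (A$1$3), fst (A$1$1), fst (A$1$2), fst (A$1$3)],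
     vector [0, b * snd (A$2$1), b * snd (A$2$2), b * snd (A$2$3), fst (A$2$1), fst (A$2$2), fst (A$2$3)],
     vector [0, b * snd (A$3$1), b * snd (A$3$2), b * snd (A$3$3), fst (A$3$1), fst (A$3$2), fst (A$3$3)]]"

text \<open>The columns are \<open>e\<^sub>1\<close>, the eigenvectors \<open>p\<^sub>i + \<alpha> q\<^sub>i\<close>
  and those multiples of \<open>p\<^sub>i - \<alpha> q\<^sub>i\<close> for which \<open>gmat\<close> below is a
  similitude.\<close>

definition nmat :: "'a::field \<Rightarrow> 'a \<Rightarrow> 'a^7^7" where
  "nmat \<alpha> s = vector [
     vector [1, 0, 0, 0, 0, 0, 0],
     vector [0, 1, 0, 0, 1/s, 0, 0],
     vector [0, 0, 1, 0, 0, -s, 0],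
     vector [0, 0, 0, 1, 0, 0, 1],
     vector [0, \<alpha>, 0, 0, -\<alpha>/s, 0, 0],
     vector [0, 0, \<alpha>, 0, 0, \<alpha> * s, 0],
     vector [0, 0, 0, \<alpha>, 0, 0, -\<alpha>]]"

definition gmat :: "'a::field \<Rightarrow> 'a \<Rightarrow> 'a^7^7" where
  "gmat \<alpha> s = vector [
     vector [0, 0, 0, -\<alpha>, 0, 0, \<alpha>],
     vector [1, 0, 0, 1, 0, 0, 1],
     vector [0, s/2, 1/2, 0, 1/2, -s/2, 0],
     vector [0, -(\<alpha> * \<alpha> * \<alpha>)/4, \<alpha> * \<alpha> * \<alpha>/(4 * s), 0, \<alpha> * \<alpha> * \<alpha>/(4 * s), \<alpha> * \<alpha> * \<alpha>/4, 0],
     vector [-(\<alpha> * \<alpha>)/4, 0, 0, \<alpha> * \<alpha>/4, 0, 0, \<alpha> * \<alpha>/4],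
     vector [0, \<alpha> * \<alpha>/2, -(\<alpha> * \<alpha>)/(2 * s), 0, \<alpha> * \<alpha>/(2 * s), \<alpha> * \<alpha>/2, 0],
     vector [0, s/\<alpha>, 1/\<alpha>, 0, -1/\<alpha>, s/\<alpha>, 0]]"

lemma smat_nmat:
  fixes \<alpha> s :: "'a::field_char_0"
  assumes "\<alpha> \<noteq> 0" "s \<noteq> 0"
  shows "smat (\<alpha> * \<alpha>) s ** nmat \<alpha> s = gmat \<alpha> s"
  using assms by (simp add: vec_eq_iff forall_7 mm7 smat_def nmat_def gmat_def field_simps)

lemma simil_gmat:
  fixes \<alpha> s :: "'a::field_char_0"
  assumes "\<alpha> \<noteq> 0" "s \<noteq> 0"
  shows "simil (gmat \<alpha> s) (\<alpha> ^ 3) (\<alpha>\<^sup>2)"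
  unfolding simil_def
proof (intro conjI allI)
  show "Delta (gmat \<alpha> s *v x) = \<alpha>\<^sup>2 * Delta x" for x
    using assms by (simp add: Delta_def mv7 gmat_def power2_eq_square field_simps)
  show "wedge3_act (gmat \<alpha> s) wbar $ i $ j $ k = \<alpha> ^ 3 * wbar $ i $ j $ k" for i j k
    by (rule wact_wbarI; unfold gmat_def vector_7; use assms in \<open>simp add: field_simps power3_eq_cube\<close>)
qed

definition hdiag :: "'a::field \<Rightarrow> 3 \<Rightarrow> 'a" where
  "hdiag s i = (if i = 1 then 1 / s else if i = 2 then - s else 1)"

text \<open>The second evaluation of a unitary matrix of determinant one is the cofactor matrix of the first, up to
  conjugation by the form; so both sides agree on the two eigenspaces.\<close>

lemma bigm_gmat:
  fixes A :: "('a::field_char_0 \<times> 'a)^3^3"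
  assumes \<alpha>: "\<alpha> * \<alpha> = b" "\<alpha> \<noteq> 0" and s: "s \<noteq> 0"
    and det: "det (evm \<alpha> A) = 1"
    and uni: "evm \<alpha> A ** diag (\<chi> i. hdiag s i) ** transpose (evm (- \<alpha>) A) = diag (\<chi> i. hdiag s i)"
  shows "smat b s ** bigm b A ** tmat b s ** gmat \<alpha> s = gmat \<alpha> s ** sl3 (evm \<alpha> A)"
proof -
  define D :: "'a^3^3" where "D = (\<chi> i j. evm (- \<alpha>) A $ i $ j * hdiag s j / hdiag s i)"
  have hn: "hdiag s i \<noteq> 0" for i using s by (simp add: hdiag_def)
  have "(evm \<alpha> A ** transpose D) $ i $ k = (if i = k then 1 else 0)" for i k
  proof -
    have "(evm \<alpha> A ** diag (\<chi> i. hdiag s i) ** transpose (evm (- \<alpha>) A)) $ i $ k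
        = (evm \<alpha> A ** transpose D) $ i $ k * hdiag s k"
      using hn by (simp add: matrix_matrix_mult_def transpose_def diag_def D_def sum_3
          if_distrib[of "\<lambda>x. _ * x"] forall_3 distrib_right cong: if_cong)
    then show ?thesis unfolding uni using hn by (auto simp: diag_def split: if_splits)
  qed
  then have "evm \<alpha> A ** transpose D = mat 1" by (simp add: vec_eq_iff mat_def)
  then have D: "D = cof3 (evm \<alpha> A)" by (rule cof3_unique[OF _ det])
  have N: "bigm b A ** nmat \<alpha> s = nmat \<alpha> s ** block (evm \<alpha> A) D"
    using s by (simp add: vec_eq_iff forall_7 mm7 bigm_def nmat_def block_def D_def evm_nth ev_def hdiag_def
        field_simps \<alpha>(1)[symmetric])
  have b: "b \<noteq> 0" using \<alpha> by auto
  have g: "gmat \<alpha> s = smat b s ** nmat \<alpha> s" using smat_nmat[OF \<alpha>(2) s] \<alpha>(1) by simp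
  have "smat b s ** bigm b A ** tmat b s ** gmat \<alpha> s = smat b s ** (bigm b A ** ((tmat b s ** smat b s) ** nmat \<alpha> s))"
    by (simp only: g matrix_mul_assoc)
  also have "\<dots> = gmat \<alpha> s ** block (evm \<alpha> A) D"
    by (simp add: smat_tmat[OF b s] N g matrix_mul_assoc)
  finally show ?thesis by (simp add: D sl3_def)
qed

text \<open>The second evaluation of a unitary matrix is determined by the first, so over the closure the first one
  may be an arbitrary matrix of determinant one.\<close>

lemma unitary_partner:
  fixes P :: "'a::field_char_0^3^3"
  assumes P: "det P = 1" and s: "s \<noteq> 0"
  shows "\<exists>Q. P ** diag (\<chi> i. hdiag s i) ** transpose Q = diag (\<chi> i. hdiag s i)"
proof -
  have hn: "hdiag s i \<noteq> 0" for i using s by (simp add: hdiag_def)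
  define Q :: "'a^3^3" where "Q = (\<chi> i j. hdiag s i * cof3 P $ i $ j / hdiag s j)"
  have "(P ** diag (\<chi> i. hdiag s i) ** transpose Q) $ i $ k = (P ** transpose (cof3 P)) $ i $ k * hdiag s k" for i k
    using hn by (simp add: matrix_matrix_mult_def transpose_def diag_def Q_def sum_3
        if_distrib[of "\<lambda>x. _ * x"] forall_3 distrib_left distrib_right ac_simps cong: if_cong)
  then have "P ** diag (\<chi> i. hdiag s i) ** transpose Q = diag (\<chi> i. hdiag s i)"
    by (auto simp: vec_eq_iff cof3_mult P mat_def diag_def)
  then show ?thesis by blast
qed

lemma sl3_mult:
  fixes A B :: "'a::field_char_0^3^3"
  assumes "det A = 1" "det B = 1"
  shows "sl3 A ** sl3 B = sl3 (A ** B)"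
proof -
  have "A ** B ** transpose (cof3 A ** cof3 B) = A ** (B ** transpose (cof3 B)) ** transpose (cof3 A)"
    by (simp add: matrix_transpose_mul matrix_mul_assoc)
  also have "\<dots> = mat 1" by (simp add: cof3_mult assms)
  finally have "cof3 A ** cof3 B = cof3 (A ** B)"
    by (rule cof3_unique) (simp add: det_mul assms)
  then show ?thesis by (simp add: sl3_def block_mult)
qed

subsection \<open>Regular maps given by matrices\<close>

lemma regular_mm:
  fixes M :: "'g \<Rightarrow> 'a::comm_ring_1^'n^'m" and N :: "'g \<Rightarrow> 'a^'p^'n"
  assumes "0 \<in> C" "\<And>i j. (\<lambda>x. M x $ i $ j) \<in> regular_funs C S" "\<And>i j. (\<lambda>x. N x $ i $ j) \<in> regular_funs C S"
  shows "(\<lambda>x. (M x ** N x) $ i $ j) \<in> regular_funs C S"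
  unfolding matrix_matrix_mult_def vec_lambda_beta
  by (intro regular_funs_sum regular_funs.mult assms) auto

lemma regular_bigm:
  assumes "0 \<in> C" "1 \<in> C" "b \<in> C"
    and "\<And>i j. (\<lambda>x. fst (A x $ i $ j)) \<in> regular_funs C S" "\<And>i j. (\<lambda>x. snd (A x $ i $ j)) \<in> regular_funs C S"
  shows "(\<lambda>x. bigm b (A x) $ i $ j) \<in> regular_funs C S"
  using exhaust_7[of i] exhaust_7[of j] unfolding bigm_def
  by (elim disjE; simp; intro regular_funs.mult regular_funs.const assms)

lemma k_isomorphic_by_inverse:
  assumes F: "\<And>x. x \<in> carrier U \<Longrightarrow> F x \<in> carrier V" "\<And>y. y \<in> carrier V \<Longrightarrow> \<exists>x\<in>carrier U. y = F x"
    and inv: "\<And>x. x \<in> carrier U \<Longrightarrow> H (F x) = x"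
    and mult: "\<And>x y. x \<in> carrier U \<Longrightarrow> y \<in> carrier U \<Longrightarrow> x \<otimes>\<^bsub>U\<^esub> y \<in> carrier U \<and> F (x \<otimes>\<^bsub>U\<^esub> y) = F x \<otimes>\<^bsub>V\<^esub> F y"
    and reg: "k_regular_map U V F" "k_regular_map V U H"
  shows "k_isomorphic V U"
proof (rule k_isomorphicI[where h = F])
  show "H \<in> iso V U"
    unfolding iso_def hom_def
  proof (intro CollectI conjI Pi_I ballI)
    show "H y \<in> carrier U" if "y \<in> carrier V" for y
    proof -
      obtain x where "x \<in> carrier U" "y = F x" using F(2)[OF \<open>y \<in> carrier V\<close>] by blast
      then show ?thesis using inv by simp
    qed
    show "H (y \<otimes>\<^bsub>V\<^esub> z) = H y \<otimes>\<^bsub>U\<^esub> H z" if yz: "y \<in> carrier V" "z \<in> carrier V" for y z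
    proof -
      obtain x x' where x: "x \<in> carrier U" "y = F x" "x' \<in> carrier U" "z = F x'"
        using F(2)[OF yz(1)] F(2)[OF yz(2)] by blast
      have "H (F x \<otimes>\<^bsub>V\<^esub> F x') = H (F (x \<otimes>\<^bsub>U\<^esub> x'))" using mult[OF x(1,3)] by simp
      also have "\<dots> = x \<otimes>\<^bsub>U\<^esub> x'" by (rule inv) (use mult[OF x(1,3)] in blast)
      finally show ?thesis using x inv by simp
    qed
    show "bij_betw H (carrier V) (carrier U)"
    proof (rule bij_betw_byWitness[where f' = F])
      show "\<forall>y\<in>carrier V. F (H y) = y"
      proof
        fix y assume "y \<in> carrier V"
        then obtain x where "x \<in> carrier U" "y = F x" using F(2) by blast
        then show "F (H y) = y" using inv by simp
      qed
      show "H ` carrier V \<subseteq> carrier U"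
      proof (rule image_subsetI)
        fix y assume "y \<in> carrier V"
        then obtain x where "x \<in> carrier U" "y = F x" using F(2) by blast
        then show "H y \<in> carrier U" using inv by simp
      qed
    qed (use inv F(1) in auto)
  qed
  show "F (H y) = y" if "y \<in> carrier V" for y
  proof -
    obtain x where "x \<in> carrier U" "y = F x" using F(2)[OF \<open>y \<in> carrier V\<close>] by blast
    then show ?thesis using inv by simp
  qed
qed (rule reg)+

section \<open>Conjugates of stabilizers\<close>

lemma G1_inverse_closed: "g \<in> carrier G1 \<Longrightarrow> g ** gi = mat 1 \<Longrightarrow> gi \<in> carrier G1 \<and> gi ** g = mat 1"
  for g gi :: "'a::field_char_0^7^7"
proof -
  assume g: "g \<in> carrier G1" and gi: "g ** gi = mat 1"
  obtain h where h: "h \<in> carrier G1" "g ** h = mat 1" "h ** g = mat 1" using G1_inverse[OF g] by blast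
  have "h ** g ** gi = h" using gi by (simp flip: matrix_mul_assoc)
  then show ?thesis using h by simp
qed

lemma matrix_mul_cancel: "A ** B = mat 1 \<Longrightarrow> C ** A ** B = C" "A ** B = mat 1 \<Longrightarrow> A ** (B ** D) = D"
  for A B C D :: "'a::comm_ring_1^'n^'n"
  by (simp flip: matrix_mul_assoc) (simp add: matrix_mul_assoc)

lemma det_conj: "g ** gi = mat 1 \<Longrightarrow> det (g ** z ** gi) = det z" for g z gi :: "'a::comm_ring_1^'n^'n"
proof -
  assume "g ** gi = mat 1"
  then have "det g * det gi = 1" by (simp flip: det_mul)
  then show ?thesis by (simp add: det_mul ac_simps) (simp add: mult.assoc[symmetric])
qed

lemma conj_conj: "g ** gi = mat 1 \<Longrightarrow> gi ** g = mat 1 \<Longrightarrow> gi ** (g ** z ** gi) ** g = z"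
  for g z gi :: "'a::comm_ring_1^'n^'n"
  by (simp add: matrix_mul_assoc matrix_mul_cancel)

lemma conj_mult: "gi ** g = mat 1 \<Longrightarrow> (g ** x ** gi) ** (g ** y ** gi) = g ** (x ** y) ** gi"
  for g x y gi :: "'a::comm_ring_1^'n^'n"
  by (simp add: matrix_mul_assoc matrix_mul_cancel)

lemma stab1_conj_component:
  fixes g gi :: "'a::field_char_0^7^7"
  assumes g: "g \<in> carrier G1" and gi: "g ** gi = mat 1" and x: "x = g *v evec 1"
  shows "identity_component (stab_group G1 (*v) x)
    = (stab_group G1 (*v) x)\<lparr>carrier := {g ** sl3 P ** gi |P. det P = 1}\<rparr>"
proof -
  let ?E = "stab_group G1 (*v) (evec 1 :: 'a^7)" and ?X = "stab_group G1 (*v) x"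
  have i: "gi \<in> carrier G1" "gi ** g = mat 1" using G1_inverse_closed[OF g gi] by auto
  have xe: "gi *v x = evec 1" by (simp add: x matrix_vector_mul_assoc i)
  have co: "\<exists>p\<in>regular_funs UNIV (coords (stab_group G1 (*v) y)). \<forall>z\<in>A. c (u ** z ** v) = p z"
    if uv: "u ** v = mat 1" and c: "c \<in> coords (stab_group G1 (*v) y')" for u v :: "'a^7^7" and c y y' A
  proof -
    have ent: "(\<lambda>z. z $ i $ j) \<in> regular_funs UNIV (coords (stab_group G1 (*v) y))" for i j
      by (rule regular_funs.coord) (simp add: stab_group_simps G1_coords)
    consider i j where "c = (\<lambda>z. z $ i $ j)" | "c = (\<lambda>z. inverse (det z))"
      using c by (auto simp: stab_group_simps G1_simps)
    then show ?thesis
    proof cases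
      case 1
      have "(\<lambda>z. (u ** z ** v) $ i $ j) \<in> regular_funs UNIV (coords (stab_group G1 (*v) y))"
        by (intro regular_mm regular_funs.const UNIV_I ent)
      then show ?thesis by (rule bexI[rotated]) (simp add: 1)
    next
      case 2
      have "(\<lambda>z. inverse (det z)) \<in> regular_funs UNIV (coords (stab_group G1 (*v) y))"
        by (rule regular_funs.coord) (simp add: stab_group_simps G1_coords)
      then show ?thesis by (rule bexI[rotated]) (simp add: 2 det_conj[OF uv])
    qed
  qed
  have "clopen_part ?X ((\<lambda>z. g ** z ** gi) ` {sl3 P |P. det P = 1})"
  proof (rule clopen_part_transport[OF stab_evec1_clopen, where \<psi> = "\<lambda>z. gi ** z ** g"])
    show "(\<lambda>z. g ** z ** gi) ` carrier ?E \<subseteq> carrier ?X"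
      by (auto simp: stab_group_simps xe simp flip: x matrix_vector_mul_assoc intro!: G1_mult_closed g i)
    show "(\<lambda>z. gi ** z ** g) ` carrier ?X \<subseteq> carrier ?E"
      by (auto simp: stab_group_simps xe simp flip: x matrix_vector_mul_assoc intro!: G1_mult_closed g i)
    show "g ** \<one>\<^bsub>?E\<^esub> ** gi = \<one>\<^bsub>?X\<^esub>" by (simp add: stab_group_simps G1_simps gi)
    show "\<exists>p\<in>regular_funs UNIV (coords ?E). \<forall>z\<in>carrier ?E. c (g ** z ** gi) = p z" if "c \<in> coords ?X" for c
      by (rule co[OF gi that])
    show "\<exists>p\<in>regular_funs UNIV (coords ?X). \<forall>z\<in>carrier ?X. c (gi ** z ** g) = p z" if "c \<in> coords ?E" for c
      by (rule co[OF i(2) that])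
  qed (simp_all add: conj_conj gi i)
  moreover have "(\<lambda>z. g ** z ** gi) ` {sl3 P |P. det P = 1} = {g ** sl3 P ** gi |P. det P = 1}" by blast
  ultimately show ?thesis by (simp add: clopen_part_identity_component)
qed

section \<open>The rational frame at a point over the base field\<close>

lemma smat_map: "map_matrix to_ac (smat a s) = smat (to_ac a) (to_ac s)" "map_matrix to_ac (tmat a s) = tmat (to_ac a) (to_ac s)"
  for a s :: "'k::field_char_0"
  by (simp_all add: vec_eq_iff forall_7 map_matrix_nth[OF field_hom_to_ac] smat_def tmat_def)

definition unbig :: "'a^7^7 \<Rightarrow> ('a \<times> 'a)^3^3" where
  "unbig M = (\<chi> i j. (M $ (vector [2, 3, 4] $ i) $ (vector [2, 3, 4] $ j), M $ (vector [2, 3, 4] $ i) $ (vector [5, 6, 7] $ j)))"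

lemma unbig_bigm: "unbig (bigm b A) = A"
  by (simp add: vec_eq_iff forall_3 unbig_def bigm_def)

context
  fixes a s :: "'k::field_char_0" and \<alpha> :: "'k alg_closure" and h hi :: "'k^7^7" and gi :: "'k alg_closure^7^7"
  assumes \<alpha>: "\<alpha> \<noteq> 0" "\<alpha>\<^sup>2 = to_ac a" and s: "s \<noteq> 0" and h: "h \<in> carrier G1" "h ** hi = mat 1"
    and gi: "map_matrix to_ac h ** gmat \<alpha> (to_ac s) ** gi = mat 1"
begin

abbreviation (input) "fr \<equiv> map_matrix to_ac (h ** smat a s) :: 'k alg_closure^7^7"
abbreviation (input) "fri \<equiv> map_matrix to_ac (tmat a s ** hi) :: 'k alg_closure^7^7"
abbreviation (input) "gg \<equiv> map_matrix to_ac h ** gmat \<alpha> (to_ac s)"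

lemma frame_scalars: "\<alpha> * \<alpha> = to_ac a" "to_ac a \<noteq> 0" "to_ac s \<noteq> 0" "a \<noteq> 0"
  using \<alpha> s by (auto simp: power2_eq_square)

lemma frame_inverse: "fr ** fri = mat 1" "fri ** fr = mat 1"
proof -
  have "h ** smat a s ** (tmat a s ** hi) = mat 1"
    using smat_tmat(1)[OF frame_scalars(4) s] h(2) by (simp add: matrix_mul_assoc matrix_mul_cancel)
  then show "fr ** fri = mat 1"
    by (simp add: map_matrix_one[OF field_hom_to_ac] flip: map_matrix_mult[OF field_hom_to_ac])
  then show "fri ** fr = mat 1" using matrix_left_right_inverse by blast
qed

lemma frame_g: "gg \<in> carrier G1" "gi \<in> carrier G1" "gi ** gg = mat 1"
proof -
  have "gmat \<alpha> (to_ac s) \<in> carrier G1"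
    unfolding G1_iff using simil_gmat[OF \<alpha>(1) frame_scalars(3)] \<alpha>(1)
    by - (rule exI[of _ "\<alpha> ^ 3"], rule exI[of _ "\<alpha>\<^sup>2"], simp)
  then show 1: "gg \<in> carrier G1" by (rule G1_mult_closed[OF map_G1(1)[OF field_hom_to_ac h(1)]])
  show "gi \<in> carrier G1" "gi ** gg = mat 1" using G1_inverse_closed[OF 1 gi] by auto
qed

text \<open>The conjugate of \<open>SL(3)\<close> in terms of matrices over the base field.\<close>

lemma frame_bigm:
  assumes "det (evm \<alpha> A) = 1"
    and "evm \<alpha> A ** diag (\<chi> i. hdiag (to_ac s) i) ** transpose (evm (- \<alpha>) A) = diag (\<chi> i. hdiag (to_ac s) i)"
  shows "gg ** sl3 (evm \<alpha> A) ** gi = fr ** bigm (to_ac a) A ** fri"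
proof -
  let ?h = "map_matrix to_ac h :: 'k alg_closure^7^7" and ?hi = "map_matrix to_ac hi :: 'k alg_closure^7^7"
  have hh: "?h ** ?hi = mat 1"
    using h(2) by (simp add: map_matrix_one[OF field_hom_to_ac] flip: map_matrix_mult[OF field_hom_to_ac])
  then have hh': "?hi ** ?h = mat 1" using matrix_left_right_inverse by blast
  have "?hi ** (?h ** (gmat \<alpha> (to_ac s) ** gi)) = ?hi" using gi by (simp add: matrix_mul_assoc)
  then have e: "gmat \<alpha> (to_ac s) ** gi = ?hi" using hh' by (simp add: matrix_mul_assoc)
  have "gg ** sl3 (evm \<alpha> A) ** gi = ?h ** (gmat \<alpha> (to_ac s) ** sl3 (evm \<alpha> A)) ** gi"
    by (simp add: matrix_mul_assoc)
  also have "\<dots> = ?h ** (smat (to_ac a) (to_ac s) ** bigm (to_ac a) A ** tmat (to_ac a) (to_ac s)) ** (gmat \<alpha> (to_ac s) ** gi)"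
    by (simp only: bigm_gmat[OF frame_scalars(1) \<alpha>(1) frame_scalars(3) assms, symmetric] matrix_mul_assoc)
  also have "\<dots> = fr ** bigm (to_ac a) A ** fri"
    by (simp only: e map_matrix_mult[OF field_hom_to_ac] smat_map matrix_mul_assoc)
  finally show ?thesis .
qed

lemma frame_unbig: "unbig (fri ** (fr ** bigm (to_ac a) A ** fri) ** fr) = A"
  by (simp add: conj_conj[OF frame_inverse] unbig_bigm)

lemma frame_partner:
  fixes P :: "'k alg_closure^3^3"
  assumes "det P = 1"
  obtains A where "evm \<alpha> A = P"
    "evm \<alpha> A ** diag (\<chi> i. hdiag (to_ac s) i) ** transpose (evm (- \<alpha>) A) = diag (\<chi> i. hdiag (to_ac s) i)"
proof -
  obtain Q where "P ** diag (\<chi> i. hdiag (to_ac s) i) ** transpose Q = diag (\<chi> i. hdiag (to_ac s) i)"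
    using unitary_partner[OF assms frame_scalars(3)] by blast
  then show ?thesis using that[of "mkq \<alpha> P Q"] by (simp add: evm_mkq[OF \<alpha>(1)])
qed

lemma frame_regular:
  assumes "\<And>i j. (\<lambda>x. fst (A x $ i $ j)) \<in> regular_funs (range to_ac) S"
    and "\<And>i j. (\<lambda>x. snd (A x $ i $ j)) \<in> regular_funs (range to_ac) S"
  shows "(\<lambda>x. (fr ** bigm (to_ac a) (A x) ** fri) $ i $ j) \<in> regular_funs (range to_ac) S"
  by (intro regular_mm regular_bigm assms range_to_ac_consts regular_funs.const)
    (simp_all add: map_matrix_nth[OF field_hom_to_ac])

lemma frame_regular_inverse:
  assumes "\<And>i j. (\<lambda>x. M x $ i $ j) \<in> regular_funs (range to_ac) S"
  shows "(\<lambda>x. (fri ** M x ** fr) $ i $ j) \<in> regular_funs (range to_ac) S"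
  by (intro regular_mm assms range_to_ac_consts regular_funs.const)
    (simp_all add: map_matrix_nth[OF field_hom_to_ac])

end

section \<open>Stabilizers of vectors are special unitary groups\<close>

text \<open>The reordering of a basis that carries the form \<open>diag(1, 1, -1)\<close> to \<open>diag(-1, 1, 1)\<close>.\<close>

definition rot3 :: "'a^3^3 \<Rightarrow> 'a^3^3" where
  "rot3 A = (\<chi> i j. A $ (vector [3, 1, 2] $ i) $ (vector [3, 1, 2] $ j))"

definition unrot3 :: "'a^3^3 \<Rightarrow> 'a^3^3" where
  "unrot3 A = (\<chi> i j. A $ (vector [2, 3, 1] $ i) $ (vector [2, 3, 1] $ j))"

lemma rot3_inverse: "rot3 (unrot3 A) = A" "unrot3 (rot3 A) = A"
  by (simp_all add: vec_eq_iff forall_3 rot3_def unrot3_def)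

lemma rot3_mult: "rot3 (A ** B) = rot3 A ** rot3 B" for A :: "'a::comm_ring_1^3^3"
  by (simp add: vec_eq_iff forall_3 rot3_def matrix_matrix_mult_def sum_3 add_ac)

lemma rot3_eq_iff: "rot3 A = rot3 B \<longleftrightarrow> A = B"
  by (metis rot3_inverse(2))

lemma det_rot3: "det (rot3 A) = det A" for A :: "'a::comm_ring_1^3^3"
  by (simp add: det_3 rot3_def algebra_simps)

lemma evm_rot3: "evm \<alpha> (rot3 A) = rot3 (evm \<alpha> A)"
  by (simp add: vec_eq_iff rot3_def evm_nth)

lemma transpose_rot3: "transpose (rot3 A) = rot3 (transpose A)"
  by (simp add: vec_eq_iff rot3_def transpose_def)

lemma hdiag_rot3: "diag (\<chi> i. hdiag (-1) i) = rot3 (diag (\<chi> i. if i = 3 then -1 else 1) :: 'a::field_char_0^3^3)"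
  by (simp add: vec_eq_iff forall_3 rot3_def diag_def hdiag_def)

text \<open>The second determinant condition follows from the unitarity equation.\<close>

lemma SU21_iff:
  fixes A :: "('r::field_char_0 \<times> 'r)^3^3"
  assumes b: "\<alpha> * \<alpha> = b" and \<alpha>: "\<alpha> \<noteq> 0"
  shows "A \<in> carrier (SU21 b) \<longleftrightarrow> det (evm \<alpha> (rot3 A)) = 1 \<and>
    evm \<alpha> (rot3 A) ** diag (\<chi> i. hdiag (-1) i) ** transpose (evm (- \<alpha>) (rot3 A)) = diag (\<chi> i. hdiag (-1) i)"
proof -
  let ?P = "evm \<alpha> A" and ?Q = "evm (- \<alpha>) A" and ?D = "diag (\<chi> i. if i = 3 then -1 else 1) :: 'r^3^3"
  have b': "(- \<alpha>) * (- \<alpha>) = b" using b by simp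
  have uni: "qmult b (qmult b A (qdiag (\<lambda>i. if i = 3 then -1 else 1))) (qadjoint A) = qdiag (\<lambda>i. if i = 3 then -1 else 1)
      \<longleftrightarrow> ?P ** ?D ** transpose ?Q = ?D" by (rule unitary_eq_iff[OF b \<alpha>])
  have det: "qdet b A = \<one>\<^bsub>quad_ring b\<^esub> \<longleftrightarrow> det ?P = 1" if u: "?P ** ?D ** transpose ?Q = ?D"
  proof
    assume *: "qdet b A = \<one>\<^bsub>quad_ring b\<^esub>"
    have "ev \<alpha> (qdet b A) = 1" unfolding * by (simp add: quad_ring_simps ev_def)
    then show "det ?P = 1" by (simp add: ev_qdet[OF b])
  next
    assume P: "det ?P = 1"
    have "det ?P * det ?D * det ?Q = det ?D" using arg_cong[OF u, of det] by (simp add: det_mul)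
    moreover have "det ?D = -1" by (simp add: det_3 diag_def)
    ultimately have Q: "det ?Q = 1" using P by simp
    have "ev \<alpha> (qdet b A) = ev \<alpha> (1, 0)" by (simp add: ev_qdet[OF b] P) (simp add: ev_def)
    moreover have "ev (- \<alpha>) (qdet b A) = ev (- \<alpha>) (1, 0)" by (simp add: ev_qdet[OF b'] Q) (simp add: ev_def)
    ultimately show "qdet b A = \<one>\<^bsub>quad_ring b\<^esub>" using ev_eqI[OF \<alpha>] by (simp add: quad_ring_simps)
  qed
  have "A \<in> carrier (SU21 b) \<longleftrightarrow> det ?P = 1 \<and> ?P ** ?D ** transpose ?Q = ?D"
    using det uni by (auto simp: SU21_def Let_def)
  then show ?thesis
    by (simp only: evm_rot3 transpose_rot3 hdiag_rot3 det_rot3 rot3_mult[symmetric] rot3_eq_iff)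
qed

lemma gmat_evec1: "gmat \<alpha> s *v evec 1 = norm_vec1 (\<alpha>\<^sup>2)" for \<alpha> s :: "'a::field_char_0"
  by (simp add: vec7_eq_iff mv_evec column_def gmat_def norm_vec1_def power2_eq_square)

text \<open>Since \<open>\<Delta>(x)\<close> is \<open>a\<close> up to squares, \<open>x\<close> is carried by
  \<open>G\<^sub>1(k)\<close> to the first column of \<open>gmat\<close>. In the rational frame for \<open>s =
  -1\<close> both the isomorphism and its inverse are linear in the matrix entries.\<close>

lemma stabilizer_SU21:
  fixes x :: "'k::field_char_0^7"
  assumes x: "Delta x \<noteq> 0" and \<alpha>: "\<alpha> \<notin> range to_ac" "\<alpha>\<^sup>2 = to_ac a"
    and Ob: "alpha1 (orbit G1 (*v) x) = adjoin {\<alpha>}"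
  shows "k_isomorphic (identity_component (stab_group G1 (*v) (base_change1 x))) (SU21 (to_ac a))"
proof -
  note \<alpha>0 = alpha_nonzero[OF \<alpha>]
  let ?b = "to_ac a"
  obtain t where t: "t\<^sup>2 = to_ac (Delta x)" using alg_closure_sqrt by blast
  have t0: "t \<noteq> 0" using t x by auto
  have "adjoin {\<alpha>} = adjoin {t}" using alpha1_orbit[OF x t] Ob by simp
  then obtain r where r: "t = to_ac r * \<alpha>" using adjoin_sqrt_eq_iff[OF \<alpha>(2) t t0 \<alpha>0(1)] by blast
  then have "to_ac (Delta x) = to_ac (r\<^sup>2 * a)" using t \<alpha>(2) by (simp add: power_mult_distrib)
  then have "Delta x = r\<^sup>2 * Delta (norm_vec1 a)" by (simp only: to_ac_eq_iff Delta_norm_vec1)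
  then have "x \<in> orbit G1 (*v) (norm_vec1 a)" using Vss1_orbit_iff[of "norm_vec1 a" x] x \<alpha>0(2) Delta_norm_vec1 by metis
  then obtain h where h: "h \<in> carrier G1" "x = h *v norm_vec1 a" by (auto simp: orbit_def)
  obtain hi where hi: "h ** hi = mat 1" using G1_inverse[OF h(1)] by blast
  let ?h = "map_matrix to_ac h :: 'k alg_closure^7^7"
  define s :: 'k where "s = -1"
  have s: "s \<noteq> 0" and S: "to_ac s = -1" by (simp_all add: s_def)
  have gm: "gmat \<alpha> (to_ac s) \<in> carrier G1"
    unfolding G1_iff using simil_gmat[OF \<alpha>0(1), of "to_ac s"] \<alpha>0(1) s
    by - (rule exI[of _ "\<alpha> ^ 3"], rule exI[of _ "\<alpha>\<^sup>2"], simp)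
  obtain gi where gi: "?h ** gmat \<alpha> (to_ac s) ** gi = mat 1"
    using G1_inverse[OF G1_mult_closed[OF map_G1(1)[OF field_hom_to_ac h(1)] gm]] by blast
  note fr = \<alpha>0(1) \<alpha>(2) s h(1) hi gi
  let ?g = "?h ** gmat \<alpha> (to_ac s)"
  let ?fr = "map_matrix to_ac (h ** smat a s) :: 'k alg_closure^7^7"
    and ?fri = "map_matrix to_ac (tmat a s ** hi) :: 'k alg_closure^7^7"
  have aa: "\<alpha> * \<alpha> = ?b" using \<alpha>(2) by (simp add: power2_eq_square)
  have "base_change1 x = ?g *v evec 1"
  proof -
    have "norm_vec1 ?b = (\<chi> i. to_ac (norm_vec1 a $ i))"
      by (simp add: vec7_eq_iff norm_vec1_def)
    then have "?h *v norm_vec1 ?b = base_change1 x"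
      using map_matrix_mv[OF field_hom_to_ac, of h "norm_vec1 a"] by (simp add: h(2) base_change1_def)
    then show ?thesis by (simp add: gmat_evec1 \<alpha>(2) flip: matrix_vector_mul_assoc)
  qed
  note comp = stab1_conj_component[OF frame_g(1)[OF fr] gi this]
  let ?V = "identity_component (stab_group G1 (*v) (base_change1 x))" and ?U = "SU21 ?b"
  have V: "carrier ?V = {?g ** sl3 P ** gi |P. det P = 1}" "monoid.mult ?V = (**)" "coords ?V = coords G1"
    by (simp_all add: comp stab_group_simps G1_simps(1))
  have U: "monoid.mult ?U = qmult ?b" "coords ?U = qcoords" by (simp_all add: SU21_def Let_def)
  note iff = SU21_iff[OF aa \<alpha>0(1)]
  define F where "F A = ?fr ** bigm ?b (rot3 A) ** ?fri" for A
  define H where "H y = unrot3 (unbig (?fri ** y ** ?fr))" for y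
  have F: "F A = ?g ** sl3 (evm \<alpha> (rot3 A)) ** gi" if "A \<in> carrier ?U" for A
    unfolding F_def by (rule frame_bigm[OF fr, symmetric]) (use that in \<open>simp_all add: iff S\<close>)
  have giF: "gi ** ?g = mat 1" by (rule frame_g(3)[OF fr])
  have mult: "qmult ?b A B \<in> carrier ?U \<and> F (qmult ?b A B) = F A ** F B"
    if A: "A \<in> carrier ?U" and B: "B \<in> carrier ?U" for A B
  proof -
    have e: "evm \<alpha> (rot3 (qmult ?b A B)) = evm \<alpha> (rot3 A) ** evm \<alpha> (rot3 B)"
      "evm (- \<alpha>) (rot3 (qmult ?b A B)) = evm (- \<alpha>) (rot3 A) ** evm (- \<alpha>) (rot3 B)"
      using aa by (simp_all add: evm_rot3 evm_mult rot3_mult)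
    let ?P = "evm \<alpha> (rot3 A)" and ?P' = "evm \<alpha> (rot3 B)" and ?D = "diag (\<chi> i. hdiag (-1) i) :: 'k alg_closure^3^3"
    have "?P ** ?P' ** ?D ** transpose (evm (- \<alpha>) (rot3 A) ** evm (- \<alpha>) (rot3 B))
        = ?P ** (?P' ** ?D ** transpose (evm (- \<alpha>) (rot3 B))) ** transpose (evm (- \<alpha>) (rot3 A))"
      by (simp add: matrix_transpose_mul matrix_mul_assoc)
    also have "\<dots> = ?D" using A B by (simp only: iff)
    finally have in_U: "qmult ?b A B \<in> carrier ?U" using A B unfolding iff e by (simp add: det_mul)
    have "F (qmult ?b A B) = ?g ** (sl3 ?P ** sl3 ?P') ** gi"
      using A B by (simp only: F[OF in_U] e) (simp add: sl3_mult iff)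
    then show ?thesis using in_U by (simp only: conj_mult[OF giF, symmetric] F[OF A] F[OF B])
  qed
  have HF: "H (F A) = A" for A
    by (simp only: H_def F_def frame_unbig[OF fr] rot3_inverse)
  have dF: "inverse (det (F A)) = det (F A)" if "A \<in> carrier ?U" for A
    using that by (simp only: F det_conj[OF gi]) (simp add: iff inverse_det_special special_sl3)
  have regF: "(\<lambda>A. F A $ i $ j) \<in> regular_funs (range to_ac) (qcoords :: (('k alg_closure \<times> 'k alg_closure)^3^3 \<Rightarrow> 'k alg_closure) set)" for i j
    unfolding F_def by (rule frame_regular[OF fr]; rule regular_funs.coord; auto simp: rot3_def qcoords_def)
  show ?thesis
  proof (rule k_isomorphic_by_inverse[where U = ?U and F = F and H = H])
    show "F A \<in> carrier ?V" if "A \<in> carrier ?U" for A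
      using that by (auto simp: V(1) F iff)
    show "\<exists>A\<in>carrier ?U. y = F A" if y: "y \<in> carrier ?V" for y
    proof -
      obtain P where P: "y = ?g ** sl3 P ** gi" "det P = 1" using y V(1) by auto
      obtain A where A: "evm \<alpha> A = P"
        "evm \<alpha> A ** diag (\<chi> i. hdiag (to_ac s) i) ** transpose (evm (- \<alpha>) A) = diag (\<chi> i. hdiag (to_ac s) i)"
        using frame_partner[OF fr P(2)] by blast
      have "unrot3 A \<in> carrier ?U" using A P(2) by (simp add: iff rot3_inverse S)
      moreover have "F (unrot3 A) = y" using F[OF calculation] A(1) P(1) by (simp add: rot3_inverse)
      ultimately show ?thesis by blast
    qed
    show "H (F A) = A" for A by (rule HF)
    show "A \<otimes>\<^bsub>?U\<^esub> B \<in> carrier ?U \<and> F (A \<otimes>\<^bsub>?U\<^esub> B) = F A \<otimes>\<^bsub>?V\<^esub> F B"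
      if "A \<in> carrier ?U" "B \<in> carrier ?U" for A B
      using mult[OF that] by (simp only: U V)
    show "k_regular_map ?U ?V F"
      unfolding k_regular_map_def
    proof
      fix c assume "c \<in> coords ?V"
      then consider i j where "c = (\<lambda>z. z $ i $ j)" | "c = (\<lambda>z. inverse (det z))" unfolding V(3) by (auto simp: G1_simps)
      then show "\<exists>p\<in>regular_funs (range to_ac) (coords ?U). \<forall>A\<in>carrier ?U. c (F A) = p A"
      proof cases
        case 1
        show ?thesis unfolding U(2) by (rule bexI[OF _ regF[of i j]]) (simp add: 1)
      next
        case 2
        have "(\<lambda>A. det (F A)) \<in> regular_funs (range to_ac) qcoords"
          by (rule regular_funs_det) (rule range_to_ac_consts regF)+
        then show ?thesis unfolding U(2) by (rule bexI[rotated]) (simp add: 2 dF)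
      qed
    qed
    show "k_regular_map ?V ?U H"
      unfolding k_regular_map_def
    proof
      have ent: "(\<lambda>y. (?fri ** y ** ?fr) $ i $ j) \<in> regular_funs (range to_ac) (coords G1)" for i j
        by (rule frame_regular_inverse[OF fr]) (rule regular_funs.coord, rule G1_coords)
      fix c assume "c \<in> coords ?U"
      then consider i j where "c = (\<lambda>A. fst (A $ i $ j))" | i j where "c = (\<lambda>A. snd (A $ i $ j))"
        unfolding U(2) by (auto simp: qcoords_def)
      then show "\<exists>p\<in>regular_funs (range to_ac) (coords ?V). \<forall>y\<in>carrier ?V. c (H y) = p y"
      proof cases
        case 1
        show ?thesis unfolding V(3)
          by (rule bexI[OF _ ent[of "vector [2, 3, 4] $ (vector [2, 3, 1] $ i :: 3)" "vector [2, 3, 4] $ (vector [2, 3, 1] $ j :: 3)"]]) (simp add: 1 H_def unrot3_def unbig_def)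
      next
        case 2
        show ?thesis unfolding V(3)
          by (rule bexI[OF _ ent[of "vector [2, 3, 4] $ (vector [2, 3, 1] $ i :: 3)" "vector [5, 6, 7] $ (vector [2, 3, 1] $ j :: 3)"]]) (simp add: 2 H_def unrot3_def unbig_def)
      qed
    qed
  qed
qed

section \<open>Binary unitary groups\<close>

definition qd2 :: "'r::comm_ring_1 \<Rightarrow> ('r \<times> 'r)^2^2 \<Rightarrow> 'r \<times> 'r" where
  "qd2 b A =
    (fst (A$1$1) * fst (A$2$2) + b * snd (A$1$1) * snd (A$2$2) - fst (A$1$2) * fst (A$2$1) - b * snd (A$1$2) * snd (A$2$1),
     fst (A$1$1) * snd (A$2$2) + snd (A$1$1) * fst (A$2$2) - fst (A$1$2) * snd (A$2$1) - snd (A$1$2) * fst (A$2$1))"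

lemma ev_qd2: "ev \<alpha> (qd2 (\<alpha> * \<alpha>) A) = det (evm \<alpha> A)"
  by (simp add: ev_def qd2_def det_2 evm_nth algebra_simps)

text \<open>The corner entry is the one that gives a bordered unitary matrix the determinant one.\<close>

definition ext3q :: "'r::comm_ring_1 \<Rightarrow> ('r \<times> 'r)^2^2 \<Rightarrow> ('r \<times> 'r)^3^3" where
  "ext3q b A = vector [vector [quad_conj (qd2 b A), (0, 0), (0, 0)],
     vector [(0, 0), A$1$1, A$1$2], vector [(0, 0), A$2$1, A$2$2]]"

lemma evm_ext3q:
  assumes "\<alpha> * \<alpha> = b"
  shows "evm \<alpha> (ext3q b A) = ext3 (evm \<alpha> A) (det (evm (- \<alpha>) A))"
proof -
  have c: "ev \<alpha> (quad_conj z) = ev (- \<alpha>) z" for z by (simp add: ev_def quad_conj_def split_beta)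
  have "ev (- \<alpha>) (qd2 b A) = det (evm (- \<alpha>) A)" using ev_qd2[of "- \<alpha>" A] assms by simp
  then show ?thesis
    by (simp add: vec_eq_iff forall_3 evm_nth ext3q_def ext3_def c) (simp add: ev_def)
qed

lemma regular_ext3q:
  fixes b :: "'a::comm_ring_1"
  assumes "0 \<in> C" "-1 \<in> C" "b \<in> C"
  shows "(\<lambda>A. fst (qd2 b A)) \<in> regular_funs C qcoords" "(\<lambda>A. snd (qd2 b A)) \<in> regular_funs C qcoords"
    "(\<lambda>A. fst (ext3q b A $ i $ j)) \<in> regular_funs C qcoords" "(\<lambda>A. snd (ext3q b A $ i $ j)) \<in> regular_funs C qcoords"
proof -
  have q: "(\<lambda>A. fst (A $ i $ j)) \<in> regular_funs C qcoords" "(\<lambda>A. snd (A $ i $ j)) \<in> regular_funs C qcoords"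
    for i j :: 2 by (rule regular_funs.coord; auto simp: qcoords_def)+
  show d: "(\<lambda>A. fst (qd2 b A)) \<in> regular_funs C qcoords" "(\<lambda>A. snd (qd2 b A)) \<in> regular_funs C qcoords"
    unfolding qd2_def fst_conv snd_conv
    by (intro regular_funs_diff regular_funs.add regular_funs.mult regular_funs.const assms q)+
  have d': "(\<lambda>A. - snd (qd2 b A)) \<in> regular_funs C qcoords" by (rule regular_funs_uminus[OF assms(2) d(2)])
  show "(\<lambda>A. fst (ext3q b A $ i $ j)) \<in> regular_funs C qcoords" "(\<lambda>A. snd (ext3q b A $ i $ j)) \<in> regular_funs C qcoords"
    using exhaust_3[of i] exhaust_3[of j] unfolding ext3q_def quad_conj_def split_beta
    by (elim disjE; simp; intro d d' q regular_funs.const assms)+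
qed

definition dg :: "'a::zero \<Rightarrow> 'a \<Rightarrow> 'a^2^2" where
  "dg p q = vector [vector [p, 0], vector [0, q]]"

lemma dg_mult: "dg p q ** dg p' q' = dg (p * p') (q * q')" for p :: "'a::comm_ring_1"
  by (simp add: vec_eq_iff forall_2 dg_def matrix_matrix_mult_def sum_2)

lemma dg_inverse: "s \<noteq> 0 \<Longrightarrow> dg (- s) 1 ** dg (- inverse s) 1 = mat 1" for s :: "'a::field"
  by (simp add: vec_eq_iff forall_2 dg_def matrix_matrix_mult_def sum_2 mat_def)

lemma det_dg: "det (dg p q) = p * q" for p :: "'a::comm_ring_1"
  by (simp add: det_2 dg_def)

lemma unitary2_det:
  fixes P Q :: "'a::field^2^2"
  assumes "P ** dg (- s) 1 ** transpose Q = dg (- s) 1" "s \<noteq> 0"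
  shows "det P * det Q = 1"
  using arg_cong[OF assms(1), of det] assms(2) by (simp add: det_mul det_dg)

lemma unitary2_partner:
  fixes P :: "'a::field^2^2"
  assumes P: "det P \<noteq> 0" and s: "s \<noteq> 0"
  shows "\<exists>Q. P ** dg (- s) 1 ** transpose Q = dg (- s) 1"
proof -
  obtain R where R: "P ** R = mat 1" using P by (auto simp: invertible_det_nz[symmetric] invertible_def)
  have "P ** dg (- s) 1 ** (dg (- inverse s) 1 ** R ** dg (- s) 1) = dg (- s) 1"
    by (simp add: matrix_mul_assoc matrix_mul_cancel(1)[OF dg_inverse[OF s]] R)
  then show ?thesis by (metis transpose_transpose)
qed

lemma unitary2_mult:
  fixes P Q P' Q' :: "'a::comm_ring_1^2^2"
  assumes "P ** D ** transpose Q = D" "P' ** D ** transpose Q' = D"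
  shows "P ** P' ** D ** transpose (Q ** Q') = D"
proof -
  have "P ** P' ** D ** transpose (Q ** Q') = P ** (P' ** D ** transpose Q') ** transpose Q"
    by (simp add: matrix_transpose_mul matrix_mul_assoc)
  then show ?thesis by (simp add: assms)
qed

lemma unitary_group_iff:
  fixes A :: "('r::field_char_0 \<times> 'r)^2^2"
  assumes b: "\<alpha> * \<alpha> = b" and \<alpha>: "\<alpha> \<noteq> 0" and s: "s \<noteq> 0"
  shows "A \<in> carrier (unitary_group b (qdiag (\<lambda>i. if i = 1 then - s else 1))) \<longleftrightarrow>
    evm \<alpha> A ** dg (- s) 1 ** transpose (evm (- \<alpha>) A) = dg (- s) 1"
proof -
  have b': "(- \<alpha>) * (- \<alpha>) = b" using b by simp
  have d: "diag (\<chi> i. if i = 1 then - s else 1) = (dg (- s) 1 :: 'r^2^2)"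
    by (simp add: vec_eq_iff forall_2 diag_def dg_def)
  have uni: "qmult b (qmult b A (qdiag (\<lambda>i. if i = 1 then - s else 1))) (qadjoint A) = qdiag (\<lambda>i. if i = 1 then - s else 1)
      \<longleftrightarrow> evm \<alpha> A ** dg (- s) 1 ** transpose (evm (- \<alpha>) A) = dg (- s) 1"
    using unitary_eq_iff[OF b \<alpha>, of A "\<lambda>i. if i = 1 then - s else 1"] by (simp only: d)
  have "\<exists>B. qmult b A B = qdiag (\<lambda>_. 1) \<and> qmult b B A = qdiag (\<lambda>_. 1)"
    if u: "evm \<alpha> A ** dg (- s) 1 ** transpose (evm (- \<alpha>) A) = dg (- s) 1"
  proof -
    have "det (evm \<alpha> A) \<noteq> 0" "det (evm (- \<alpha>) A) \<noteq> 0" using unitary2_det[OF u s] by auto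
    then have "invertible (evm \<alpha> A)" "invertible (evm (- \<alpha>) A)" by (simp_all only: invertible_det_nz not_False_eq_True)
    then obtain P Q where PQ: "evm \<alpha> A ** P = mat 1" "P ** evm \<alpha> A = mat 1" "evm (- \<alpha>) A ** Q = mat 1" "Q ** evm (- \<alpha>) A = mat 1"
      unfolding invertible_def by blast
    have "qmult b A (mkq \<alpha> P Q) = qdiag (\<lambda>_. 1)"
      by (rule evm_eqI[OF \<alpha>]) (simp_all only: evm_mult[OF b] evm_mult[OF b'] evm_mkq[OF \<alpha>] evm_one PQ)
    moreover have "qmult b (mkq \<alpha> P Q) A = qdiag (\<lambda>_. 1)"
      by (rule evm_eqI[OF \<alpha>]) (simp_all only: evm_mult[OF b] evm_mult[OF b'] evm_mkq[OF \<alpha>] evm_one PQ)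
    ultimately show ?thesis by blast
  qed
  then show ?thesis using uni by (auto simp: unitary_group_def)
qed

lemma ext3_mult: "ext3 P p ** ext3 Q q = ext3 (P ** Q) (p * q)" for P Q :: "'a::comm_ring_1^2^2"
  by (simp add: vec_eq_iff forall_3 ext3_def matrix_matrix_mult_def sum_3 sum_2)

lemma ext3_unitary:
  fixes P Q :: "'a::field_char_0^2^2"
  assumes u: "P ** dg (- s) 1 ** transpose Q = dg (- s) 1" and s: "s \<noteq> 0"
  shows "ext3 P (det Q) ** diag (\<chi> i. hdiag s i) ** transpose (ext3 Q (det P)) = diag (\<chi> i. hdiag s i)"
proof -
  have d: "diag (\<chi> i. hdiag s i) = ext3 (dg (- s) 1) (1 / s)"
    by (simp add: vec_eq_iff forall_3 diag_def hdiag_def ext3_def dg_def)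
  have t: "transpose (ext3 Q (det P)) = ext3 (transpose Q) (det P)"
    by (simp add: vec_eq_iff forall_3 ext3_def transpose_def)
  have "det Q * (1 / s) * det P = 1 / s" using unitary2_det[OF u s] by (simp add: mult.commute)
  then show ?thesis by (simp only: d t ext3_mult u)
qed

section \<open>The frame of a pair\<close>

definition nmat2 :: "'a::field \<Rightarrow> 'a \<Rightarrow> 'a^2^2" where
  "nmat2 \<alpha> s = vector [vector [1 / 2, s / 2], vector [1 / (2 * \<alpha>), - s / (2 * \<alpha>)]]"

text \<open>Multiplication by the determinant in the basis \<open>1, \<alpha>\<close>; it has the eigenvalues \<open>det\<close> of the two
  evaluations, with eigenvectors the columns of \<open>nmat2\<close>.\<close>

definition rmat :: "'a::comm_ring_1 \<Rightarrow> ('a \<times> 'a)^2^2 \<Rightarrow> 'a^2^2" where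
  "rmat b A = vector [vector [fst (qd2 b A), b * snd (qd2 b A)], vector [snd (qd2 b A), fst (qd2 b A)]]"

lemma rmat_nmat2:
  fixes \<alpha> s :: "'a::field_char_0"
  assumes "\<alpha> * \<alpha> = b" "\<alpha> \<noteq> 0"
  shows "rmat b A ** nmat2 \<alpha> s = nmat2 \<alpha> s ** dg (det (evm \<alpha> A)) (det (evm (- \<alpha>) A))"
    "det (rmat b A) = det (evm \<alpha> A) * det (evm (- \<alpha>) A)"
proof -
  have e: "det (evm \<alpha> A) = fst (qd2 b A) + \<alpha> * snd (qd2 b A)" "det (evm (- \<alpha>) A) = fst (qd2 b A) - \<alpha> * snd (qd2 b A)"
    using ev_qd2[of \<alpha> A] ev_qd2[of "- \<alpha>" A] assms(1) by (simp_all add: ev_def)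
  show "rmat b A ** nmat2 \<alpha> s = nmat2 \<alpha> s ** dg (det (evm \<alpha> A)) (det (evm (- \<alpha>) A))"
    unfolding e rmat_def using assms(2)
    by (simp add: vec_eq_iff forall_2 nmat2_def dg_def matrix_matrix_mult_def sum_2 field_simps assms(1)[symmetric])
  show "det (rmat b A) = det (evm \<alpha> A) * det (evm (- \<alpha>) A)"
    unfolding e rmat_def by (simp add: det_2 assms(1)[symmetric] algebra_simps)
qed

text \<open>The image of the base pair under \<open>gmat\<close> and \<open>nmat2\<close>, which is rational although
  these matrices are not.\<close>

definition frame_pair :: "'a::field \<Rightarrow> 'a \<Rightarrow> 'a^7^2" where
  "frame_pair a s = vector [v7 0 0 (s / 2) 0 0 (a / 2) 0, v7 0 0 0 (- a / 4) 0 0 (s / a)]"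

lemma frame_pair_base:
  fixes \<alpha> s :: "'a::field_char_0"
  assumes "\<alpha> \<noteq> 0" "s \<noteq> 0"
  shows "act2 (gmat \<alpha> s, nmat2 \<alpha> s) base_pair = frame_pair (\<alpha> * \<alpha>) s"
  using assms
  by (simp add: vec2_eq_iff act2_nth vec7_eq_iff mv7 base_pair_def evec_nth gmat_def nmat2_def frame_pair_def field_simps)

lemma frame_pair_orbit:
  fixes a s :: "'a::field_char_0"
  assumes "a \<noteq> 0" "s \<noteq> 0"
  shows "orbit G2 act2 (frame_pair a s) = orbit G2 act2 (norm_pair s (- a * s))"
proof -
  have f: "Delta (frame_pair a s $ 1) = - a * s" "Delta (frame_pair a s $ 2) = s"
    "bil (frame_pair a s $ 2) (frame_pair a s $ 1) = 0"
    using assms(1) by (simp_all add: frame_pair_def Delta_def bil_def)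
  have "norm_pair s (- a * s) \<in> orbit G2 act2 (frame_pair a s)"
    by (rule norm_pair_in_orbit[where a = 0 and b = 1 and c = 1 and d = 0]) (use assms in \<open>simp_all add: f\<close>)
  then show ?thesis using orbit2_eq by metis
qed

lemma stab2_conj_component:
  fixes g1 gi1 :: "'k::field_char_0 alg_closure^7^7" and g2 gi2 :: "'k alg_closure^2^2"
  assumes g: "g1 \<in> carrier G1" "g1 ** gi1 = mat 1" "g2 ** gi2 = mat 1" and x: "x = act2 (g1, g2) base_pair"
  shows "identity_component (stab_group G2 act2 x)
    = (stab_group G2 act2 x)\<lparr>carrier :=
        {(g1 ** fst (stab_elem (B, t, u)) ** gi1, g2 ** snd (stab_elem (B, t, u)) ** gi2) |B t u. det B * t * u = 1}\<rparr>"
proof -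
  let ?E = "stab_group G2 act2 (base_pair :: 'k alg_closure^7^2)" and ?X = "stab_group G2 act2 x"
  let ?C = "{stab_elem (B, t, u) |B t (u :: 'k alg_closure). det B * t * u = 1}"
  let ?f = "\<lambda>z. (g1 ** fst z ** gi1, g2 ** snd z ** gi2)" and ?h = "\<lambda>z. (gi1 ** fst z ** g1, gi2 ** snd z ** g2)"
  have i: "gi1 \<in> carrier G1" "gi1 ** g1 = mat 1" "gi2 ** g2 = mat 1"
    using G1_inverse_closed[OF g(1,2)] g(3) matrix_left_right_inverse by auto
  have inv: "invertible g2" "invertible gi2" using g(3) i(3) unfolding invertible_def by blast+
  have xe: "act2 (gi1, gi2) x = base_pair" by (simp add: x i act2_one flip: act2_mult)
  have co: "\<exists>p\<in>regular_funs UNIV (coords (stab_group G2 act2 y)). \<forall>z\<in>S. c (u ** fst z ** v, u' ** snd z ** v') = p z"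
    if uv: "u ** v = mat 1" "u' ** v' = mat 1" and c: "c \<in> coords (stab_group G2 act2 y')"
    for u v :: "'k alg_closure^7^7" and u' v' :: "'k alg_closure^2^2" and c y y' S
  proof -
    have ent: "(\<lambda>z. fst z $ i $ j) \<in> regular_funs UNIV (coords (stab_group G2 act2 y))"
      "(\<lambda>z. snd z $ k $ l) \<in> regular_funs UNIV (coords (stab_group G2 act2 y))"
      "(\<lambda>z. inverse (det (fst z))) \<in> regular_funs UNIV (coords (stab_group G2 act2 y))"
      "(\<lambda>z. inverse (det (snd z))) \<in> regular_funs UNIV (coords (stab_group G2 act2 y))" for i j k l
      by (rule regular_funs.coord; simp add: stab_group_simps G2_coords)+
    consider i j where "c = (\<lambda>z. fst z $ i $ j)" | "c = (\<lambda>z. inverse (det (fst z)))"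
      | i j where "c = (\<lambda>z. snd z $ i $ j)" | "c = (\<lambda>z. inverse (det (snd z)))"
      using c by (auto simp: stab_group_simps G2_simps G1_simps GL_simps)
    then show ?thesis
    proof cases
      case 1
      have "(\<lambda>z. (u ** fst z ** v) $ i $ j) \<in> regular_funs UNIV (coords (stab_group G2 act2 y))"
        by (intro regular_mm regular_funs.const UNIV_I ent)
      then show ?thesis by (rule bexI[rotated]) (simp add: 1)
    next
      case 2
      show ?thesis by (rule bexI[OF _ ent(3)]) (simp add: 2 det_conj[OF uv(1)])
    next
      case 3
      have "(\<lambda>z. (u' ** snd z ** v') $ i $ j) \<in> regular_funs UNIV (coords (stab_group G2 act2 y))"
        by (intro regular_mm regular_funs.const UNIV_I ent)
      then show ?thesis by (rule bexI[rotated]) (simp add: 3)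
    next
      case 4
      show ?thesis by (rule bexI[OF _ ent(4)]) (simp add: 4 det_conj[OF uv(2)])
    qed
  qed
  have "clopen_part ?X (?f ` ?C)"
  proof (rule clopen_part_transport[OF stab_pair_clopen, where \<psi> = ?h])
    show "?f ` carrier ?E \<subseteq> carrier ?X"
      by (auto simp: stab_group_simps G2_simps act2_mult xe simp flip: x intro!: G1_mult_closed invertible_mult g i inv)
    show "?h ` carrier ?X \<subseteq> carrier ?E"
      by (auto simp: stab_group_simps G2_simps act2_mult xe simp flip: x intro!: G1_mult_closed invertible_mult g i inv)
    show "?f \<one>\<^bsub>?E\<^esub> = \<one>\<^bsub>?X\<^esub>" by (simp add: stab_group_simps G2_simps g)
    show "\<exists>p\<in>regular_funs UNIV (coords ?E). \<forall>z\<in>carrier ?E. c (?f z) = p z" if "c \<in> coords ?X" for c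
      by (rule co[OF g(2,3) that])
    show "\<exists>p\<in>regular_funs UNIV (coords ?X). \<forall>z\<in>carrier ?X. c (?h z) = p z" if "c \<in> coords ?E" for c
      by (rule co[OF i(2,3) that])
  qed (simp_all add: conj_conj g i)
  moreover have "?f ` ?C = {(g1 ** fst (stab_elem (B, t, u)) ** gi1, g2 ** snd (stab_elem (B, t, u)) ** gi2) |B t u. det B * t * u = 1}"
    by blast
  ultimately show ?thesis by (simp add: clopen_part_identity_component)
qed

section \<open>Normalization of the multiplier\<close>

lemma mat_mult_nth: "(mat t ** g) $ i $ j = t * g $ i $ j" for g :: "'a::comm_ring_1^'n^'n"
  by (simp add: matrix_matrix_mult_def mat_def if_distrib[of "\<lambda>x. x * _"] cong: if_cong)

definition inv_chi :: "'a::field^7^7 \<Rightarrow> 'a" where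
  "inv_chi g = wedge3_act g wbar $ 2 $ 3 $ 4 * Delta (g *v evec 1) ^ 12 * inverse (det g) ^ 4"

text \<open>With \<open>c\<close> and \<open>l\<close> the multipliers of the trivector and of the quadratic form, \<open>c\<^sup>2 = l\<^sup>3\<close> and
  \<open>det\<^sup>2 = l\<^sup>7\<close>, so that the inverse of the character \<open>c/l\<close> is a polynomial in the coordinates.\<close>

lemma inv_chi:
  fixes g :: "'k::field_char_0 alg_closure^7^7"
  assumes "g \<in> carrier G1"
  shows "inv_chi g = inverse (chi g)"
proof -
  obtain c l where cl: "c \<noteq> 0" "l \<noteq> 0" "simil g c l" using assms by (auto simp: G1_iff)
  have w: "wbar $ 2 $ 3 $ 4 = (1 :: 'k alg_closure)" by (simp add: wbar_nth wedge3_nth evec_nth)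
  have c: "wedge3_act g wbar $ 2 $ 3 $ 4 = c" using cl(3) w by (simp add: simil_def)
  have D: "Delta (g *v evec 1) = l" using simil_Delta[OF cl(3), of "evec 1"] by (simp add: Delta_evec1)
  have "(c / l)\<^sup>2 = l" using chi_square[OF assms] chi_simil[OF cl(3)] D by simp
  then have cc: "c * c = l * l * l" using cl(2) by (simp add: power2_eq_square field_simps)
  have d: "(det g)\<^sup>2 = l ^ 7" by (rule simil_det[OF cl(3)])
  have "det g ^ 4 = ((det g)\<^sup>2)\<^sup>2" by simp
  also have "\<dots> = l ^ 14" by (simp add: d)
  finally have "inverse (det g) ^ 4 = inverse (l ^ 14)" by (simp only: power_inverse)
  then have "inv_chi g = c * l ^ 12 * inverse (l ^ 14)" by (simp add: inv_chi_def c D)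
  also have "\<dots> = c / (l * l)" using cl(2) by (simp add: field_simps eval_nat_numeral)
  also have "\<dots> = l / c" using cc cl(1,2) by (simp add: field_simps)
  finally show ?thesis by (simp add: chi_simil[OF cl(3)])
qed

text \<open>The representative of the class modulo scalars at which \<open>\<chi>\<close> is one.\<close>

definition nrm :: "'a::field^7^7 \<Rightarrow> 'a^7^7" where
  "nrm g = mat (inv_chi g) ** g"

lemma nrm_scale:
  fixes g :: "'k::field_char_0 alg_closure^7^7"
  assumes "t \<noteq> 0" "g \<in> carrier G1"
  shows "nrm (mat t ** g) = nrm g"
proof -
  have t: "mat t \<in> carrier G1" by (rule scalar_G1[OF assms(1)])
  have "inv_chi (mat t ** g) = inverse t * inv_chi g"
    by (simp add: inv_chi[OF G1_mult_closed[OF t assms(2)]] inv_chi[OF assms(2)] chi_mult[OF t assms(2)] chi_scalar[OF assms(1)])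
  then show ?thesis using assms(1) by (simp add: vec_eq_iff nrm_def mat_mult_nth)
qed

lemma nrm_conj_special:
  fixes g gi z :: "'k::field_char_0 alg_closure^7^7"
  assumes "g \<in> carrier G1" "g ** gi = mat 1" "special z"
  shows "nrm (g ** z ** gi) = g ** z ** gi"
proof -
  note i = G1_inverse_closed[OF assms(1,2)]
  have z: "z \<in> carrier G1" by (rule special_G1[OF assms(3)])
  have "chi g * chi gi = chi (g ** gi)" by (rule chi_mult[OF assms(1), symmetric]) (use i in simp)
  also have "\<dots> = 1" by (simp add: assms(2) chi_special[OF special_one])
  finally have "chi g * chi gi = 1" .
  then have "chi (g ** z ** gi) = 1"
    using i z assms(1) by (simp add: chi_mult G1_mult_closed chi_special[OF assms(3)])
  then have "inv_chi (g ** z ** gi) = 1" using i z assms(1) by (simp add: inv_chi G1_mult_closed)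
  then show ?thesis by (simp add: nrm_def)
qed

lemma regular_nrm: "(\<lambda>z. nrm (fst z) $ i $ j) \<in> regular_funs (range (to_ac :: 'k::field_char_0 \<Rightarrow> _)) (coords G2)"
proof -
  let ?R = "range (to_ac :: 'k \<Rightarrow> 'k alg_closure)"
  have ent: "(\<lambda>z. fst z $ i $ j) \<in> regular_funs ?R (coords G2)"
    "(\<lambda>z. inverse (det (fst z))) \<in> regular_funs ?R (coords G2)" for i j
    by (rule regular_funs.coord; rule G2_coords)+
  have cw: "(wbar $ p $ q $ r :: 'k alg_closure) \<in> ?R" for p q r
    using rangeI[of to_ac "wbar $ p $ q $ r :: 'k"] by (simp add: map_wbar[OF field_hom_to_ac])
  have c4: "4 \<in> ?R" by (rule range_eqI[of _ _ 4]) simp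
  have c: "(\<lambda>z. wedge3_act (fst z) wbar $ 2 $ 3 $ 4) \<in> regular_funs ?R (coords G2)"
    unfolding wedge3_act_def vec_lambda_beta
    by (intro regular_funs_sum regular_funs.mult regular_funs.const cw ent range_to_ac_consts finite)
  have D: "(\<lambda>z. Delta (fst z *v evec 1)) \<in> regular_funs ?R (coords G2)"
    unfolding Delta_def mv_evec column_def vec_lambda_beta
    by (intro regular_funs.mult regular_funs_diff regular_funs_power regular_funs.add regular_funs.const ent c4 range_to_ac_consts)
  show ?thesis
    unfolding nrm_def mat_mult_nth inv_chi_def
    by (intro regular_funs.mult regular_funs_power c D ent range_to_ac_consts)
qed

section \<open>Stabilizers of pairs modulo the kernel are unitary groups\<close>

text \<open>The cosets of the kernel of the action.\<close>

definition scalar_class :: "('a::field^7^7) \<times> ('a^2^2) \<Rightarrow> (('a^7^7) \<times> ('a^2^2)) set" where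
  "scalar_class z = {(mat (inverse t) ** fst z, mat t ** snd z) |t. t \<noteq> 0}"

lemma mat_mult_mat_left: "mat s ** (mat t ** g) = mat (s * t) ** g" for g :: "'a::comm_ring_1^'n^'n"
  by (simp add: matrix_mul_assoc mat_mult_mat)

lemma scalar_class_shift:
  assumes t: "t \<noteq> 0"
  shows "scalar_class (mat t ** p, mat (inverse t) ** q) = scalar_class (p, q)"
proof (rule subset_antisym; rule subsetI)
  fix z assume "z \<in> scalar_class (mat t ** p, mat (inverse t) ** q)"
  then obtain r where "r \<noteq> 0" "z = (mat (inverse r * t) ** p, mat (r * inverse t) ** q)"
    by (auto simp: scalar_class_def mat_mult_mat_left)
  then show "z \<in> scalar_class (p, q)"
    unfolding scalar_class_def using t by (intro CollectI exI[of _ "r * inverse t"]) simp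
next
  fix z assume "z \<in> scalar_class (p, q)"
  then obtain r where "r \<noteq> 0" "z = (mat (inverse r) ** p, mat r ** q)" by (auto simp: scalar_class_def)
  then show "z \<in> scalar_class (mat t ** p, mat (inverse t) ** q)"
    unfolding scalar_class_def using t
    by (intro CollectI exI[of _ "r * t"]) (simp add: mat_mult_mat_left mult.assoc)
qed

text \<open>Scalar matrices are central, so the cosets multiply like their representatives.\<close>

lemma scalar_class_mult:
  "{(fst u ** fst v, snd u ** snd v) |u v. u \<in> scalar_class z \<and> v \<in> scalar_class z'}
    = scalar_class (fst z ** fst z', snd z ** snd z')"
proof -
  have e: "mat s ** p ** (mat t ** q) = mat (s * t) ** (p ** q)" for s t and p q :: "'c::comm_ring_1^'n^'n"
  proof -
    have "mat s ** p ** (mat t ** q) = mat s ** (p ** mat t) ** q" by (simp add: matrix_mul_assoc)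
    also have "\<dots> = mat s ** (mat t ** p) ** q" by (simp add: mat_mult_commute)
    finally show ?thesis by (simp add: matrix_mul_assoc mat_mult_mat)
  qed
  show ?thesis
  proof (rule subset_antisym; rule subsetI)
    fix w assume "w \<in> {(fst u ** fst v, snd u ** snd v) |u v. u \<in> scalar_class z \<and> v \<in> scalar_class z'}"
    then obtain s t where st: "s \<noteq> 0" "t \<noteq> 0"
      "w = (mat (inverse s * inverse t) ** (fst z ** fst z'), mat (s * t) ** (snd z ** snd z'))"
      by (auto simp: scalar_class_def e)
    then show "w \<in> scalar_class (fst z ** fst z', snd z ** snd z')"
      unfolding scalar_class_def by (intro CollectI exI[of _ "s * t"]) simp
  next
    fix w assume "w \<in> scalar_class (fst z ** fst z', snd z ** snd z')"
    then obtain t where t: "t \<noteq> 0" "w = (mat (inverse t) ** (fst z ** fst z'), mat t ** (snd z ** snd z'))"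
      by (auto simp: scalar_class_def)
    have "(mat (inverse t) ** fst z, mat t ** snd z) \<in> scalar_class z" using t(1) by (auto simp: scalar_class_def)
    moreover have "z' \<in> scalar_class z'"
      unfolding scalar_class_def by (intro CollectI exI[of _ 1]) simp
    moreover have "w = (fst (mat (inverse t) ** fst z, mat t ** snd z) ** fst z', snd (mat (inverse t) ** fst z, mat t ** snd z) ** snd z')"
      by (simp add: t(2) matrix_mul_assoc)
    ultimately show "w \<in> {(fst u ** fst v, snd u ** snd v) |u v. u \<in> scalar_class z \<and> v \<in> scalar_class z'}" by blast
  qed
qed

lemma conj_scalar: "g ** (mat t ** z) ** gi = mat t ** (g ** z ** gi)" for g z gi :: "'a::comm_ring_1^'n^'n"
proof -
  have "g ** (mat t ** z) ** gi = (g ** mat t) ** z ** gi" by (simp add: matrix_mul_assoc)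
  then show ?thesis by (simp add: mat_mult_commute[of t g, symmetric] matrix_mul_assoc)
qed

definition unext3 :: "'a^3^3 \<Rightarrow> 'a^2^2" where
  "unext3 A = (\<chi> i j. A $ (vector [2, 3] $ i) $ (vector [2, 3] $ j))"

lemma unext3_ext3q: "unext3 (ext3q b A) = A"
  by (simp add: vec_eq_iff forall_2 unext3_def ext3q_def)

text \<open>Modulo the kernel the scalar part \<open>t\<close> of an element of the identity component is normalized
  to one. What remains is the block \<open>B\<close>, which in the rational frame becomes an arbitrary unitary matrix.
  The inverse map reads it off after division by the character \<open>\<chi>\<close>, which is constant on cosets.\<close>

lemma stabilizer_unitary:
  fixes x :: "'k::field_char_0^7^2"
  assumes \<alpha>: "\<alpha> \<notin> range to_ac" "\<alpha>\<^sup>2 = to_ac a" and s: "s \<noteq> 0" and cor: "corresponds \<alpha> x s"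
  shows "k_isomorphic
      (quotient_group (identity_component (stab_group G2 act2 (map_matrix to_ac x))) Ttilde)
      (unitary_group (to_ac a) (qdiag (\<lambda>i. if i = 1 then - to_ac s else 1)))"
proof -
  note \<alpha>0 = alpha_nonzero[OF \<alpha>]
  let ?b = "to_ac a" and ?s = "to_ac s" and ?m = "map_matrix to_ac"
  have aa: "\<alpha> * \<alpha> = ?b" "(- \<alpha>) * (- \<alpha>) = ?b" using \<alpha>(2) by (simp_all add: power2_eq_square)
  have S: "?s \<noteq> 0" using s by simp
  obtain h m where hm: "h \<in> carrier G1" "invertible m" "x = act2 (h, m) (frame_pair a s)"
  proof -
    obtain y where y: "map_matrix to_ac y = w_alpha \<alpha> s" "x \<in> orbit G2 act2 y"
      using cor unfolding corresponds_def by blast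
    have "map_matrix to_ac y = map_matrix to_ac (y_pair a s)"
      using y(1) w_alpha_y_pair[OF \<alpha>(2) \<alpha>0(1)] by simp
    then have "y = y_pair a s" by (simp add: vec_eq_iff map_matrix_nth[OF field_hom_to_ac])
    then have "x \<in> orbit G2 act2 (frame_pair a s)"
      using y(2) y_pair_orbit(2)[OF \<alpha>0(2) s] frame_pair_orbit[OF \<alpha>0(2) s] by simp
    then show ?thesis using that by (auto simp: orbit_def G2_simps)
  qed
  obtain hi where hi: "h ** hi = mat 1" using G1_inverse[OF hm(1)] by blast
  obtain mi where mi: "m ** mi = mat 1" "mi ** m = mat 1" using hm(2) by (auto simp: invertible_def)
  let ?h = "?m h :: 'k alg_closure^7^7" and ?n = "?m m :: 'k alg_closure^2^2" and ?ni = "?m mi :: 'k alg_closure^2^2"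
  have nn: "?n ** ?ni = mat 1" "?ni ** ?n = mat 1"
    using mi by (simp_all add: map_matrix_one[OF field_hom_to_ac] flip: map_matrix_mult[OF field_hom_to_ac])
  have gm: "gmat \<alpha> ?s \<in> carrier G1"
    unfolding G1_iff using simil_gmat[OF \<alpha>0(1) S] \<alpha>0(1)
    by - (rule exI[of _ "\<alpha> ^ 3"], rule exI[of _ "\<alpha>\<^sup>2"], simp)
  obtain gi where gi: "?h ** gmat \<alpha> ?s ** gi = mat 1"
    using G1_inverse[OF G1_mult_closed[OF map_G1(1)[OF field_hom_to_ac hm(1)] gm]] by blast
  note fr = \<alpha>0(1) \<alpha>(2) s hm(1) hi gi
  let ?g = "?h ** gmat \<alpha> ?s" and ?g2 = "?n ** nmat2 \<alpha> ?s"
  let ?fr = "?m (h ** smat a s) :: 'k alg_closure^7^7" and ?fri = "?m (tmat a s ** hi) :: 'k alg_closure^7^7"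
  have "det (nmat2 \<alpha> ?s) \<noteq> 0" using \<alpha>0(1) S by (simp add: det_2 nmat2_def)
  then obtain ki where ki: "nmat2 \<alpha> ?s ** ki = mat 1" by (auto simp: invertible_det_nz[symmetric] invertible_def)
  let ?gi2 = "ki ** ?ni"
  have g2: "?g2 ** ?gi2 = mat 1" by (simp add: matrix_mul_assoc matrix_mul_cancel(1)[OF ki] nn)
  have gi2: "?gi2 ** ?g2 = mat 1" using g2 matrix_left_right_inverse by blast
  have giF: "gi ** ?g = mat 1" and gG: "?g \<in> carrier G1" and giG: "gi \<in> carrier G1" by (rule frame_g[OF fr])+
  have x: "?m x = act2 (?g, ?g2) base_pair"
  proof -
    have "?m (frame_pair a s) = frame_pair ?b ?s"
      by (simp add: vec2_eq_iff map_matrix_row vec7_eq_iff frame_pair_def)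
    then show ?thesis
      using map_act2[OF field_hom_to_ac, of h m "frame_pair a s"] frame_pair_base[OF \<alpha>0(1) S]
      by (simp add: hm(3) aa(1) act2_mult)
  qed
  let ?\<Gamma> = "{(?g ** fst (stab_elem (B, t, u)) ** gi, ?g2 ** snd (stab_elem (B, t, u)) ** ?gi2) |B t u. det B * t * u = 1}"
  let ?W = "identity_component (stab_group G2 act2 (?m x))"
  let ?V = "quotient_group ?W Ttilde" and ?U = "unitary_group ?b (qdiag (\<lambda>i. if i = 1 then - ?s else 1))"
  have W: "carrier ?W = ?\<Gamma>" "monoid.mult ?W = (\<lambda>(p, q) (p', q'). (p ** p', q ** q'))" "coords ?W = coords G2"
    by (simp_all add: stab2_conj_component[OF gG gi g2 x] stab_group_simps G2_simps(1))
  have coset: "Ttilde #>\<^bsub>?W\<^esub> z = scalar_class z" for z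
    by (auto simp: r_coset_def Ttilde_def scalar_class_def W(2) split_beta)
  have V: "carrier ?V = {scalar_class z |z. z \<in> ?\<Gamma>}"
    "coords ?V = {F. \<exists>p\<in>regular_funs (range to_ac) (coords G2). \<forall>z\<in>?\<Gamma>. F (scalar_class z) = p z}"
    "C \<otimes>\<^bsub>?V\<^esub> D = {(fst u ** fst v, snd u ** snd v) |u v. u \<in> C \<and> v \<in> D}" for C D
  proof -
    have "carrier ?V = {scalar_class z |z. z \<in> carrier ?W}"
      by (auto simp: quotient_group_def FactGroup_def RCOSETS_def coset)
    then show "carrier ?V = {scalar_class z |z. z \<in> ?\<Gamma>}" by (simp only: W(1))
    have "coords ?V = {F. \<exists>p\<in>regular_funs (range to_ac) (coords G2). \<forall>z\<in>carrier ?W. F (scalar_class z) = p z}"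
      by (simp add: quotient_group_def coset W(3))
    then show "coords ?V = {F. \<exists>p\<in>regular_funs (range to_ac) (coords G2). \<forall>z\<in>?\<Gamma>. F (scalar_class z) = p z}"
      by (simp only: W(1))
    have "C \<otimes>\<^bsub>?V\<^esub> D = (\<Union>u\<in>C. \<Union>v\<in>D. {(fst u ** fst v, snd u ** snd v)})"
      by (simp add: quotient_group_def FactGroup_def set_mult_def W(2) split_beta)
    then show "C \<otimes>\<^bsub>?V\<^esub> D = {(fst u ** fst v, snd u ** snd v) |u v. u \<in> C \<and> v \<in> D}" by blast
  qed
  have U: "monoid.mult ?U = qmult ?b" "coords ?U = qcoords" by (simp_all add: unitary_group_def)
  note iff = unitary_group_iff[OF aa(1) \<alpha>0(1) S]
  have \<Gamma>1: "fst z \<in> carrier G1" if z: "z \<in> ?\<Gamma>" for z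
  proof -
    obtain B t u where "det B * t * u = 1" "fst z = ?g ** fst (stab_elem (B, t, u)) ** gi" using z by auto
    then show ?thesis using stab_elem_stabilizes(1)[of B t u] gG giG
      by (cases "stab_elem (B, t, u)") (auto simp: G2_simps intro!: G1_mult_closed)
  qed
  define \<sigma> where "\<sigma> A = (?fr ** bigm ?b (ext3q ?b A) ** ?fri, ?n ** rmat ?b A ** ?ni)" for A
  define F where "F A = scalar_class (\<sigma> A)" for A
  define Lam where "Lam z = unext3 (unbig (?fri ** nrm (fst z) ** ?fr))" for z :: "('k alg_closure^7^7) \<times> ('k alg_closure^2^2)"
  define H where "H Z = Lam (SOME z. z \<in> Z)" for Z
  have dets: "det (evm \<alpha> A) * det (evm (- \<alpha>) A) = 1" if "A \<in> carrier ?U" for A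
    using that unitary2_det[OF _ S] unfolding iff by blast
  have \<sigma>: "\<sigma> A = (?g ** sl3 (ext3 (evm \<alpha> A) (det (evm (- \<alpha>) A))) ** gi, ?g2 ** dg (det (evm \<alpha> A)) (det (evm (- \<alpha>) A)) ** ?gi2)"
    if A: "A \<in> carrier ?U" for A
  proof -
    let ?P = "evm \<alpha> A" and ?Q = "evm (- \<alpha>) A"
    have u: "?P ** dg (- ?s) 1 ** transpose ?Q = dg (- ?s) 1" using A by (simp only: iff)
    have e: "evm \<alpha> (ext3q ?b A) = ext3 ?P (det ?Q)" by (rule evm_ext3q[OF aa(1)])
    have e': "evm (- \<alpha>) (ext3q ?b A) = ext3 ?Q (det ?P)" using evm_ext3q[OF aa(2)] by simp
    have "?g ** sl3 (ext3 ?P (det ?Q)) ** gi = ?fr ** bigm ?b (ext3q ?b A) ** ?fri"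
      using frame_bigm[OF fr, of "ext3q ?b A"] ext3_unitary[OF u S] dets[OF A] by (simp add: e e' det_ext3 mult.commute)
    moreover have "?g2 ** dg (det ?P) (det ?Q) ** ?gi2 = ?n ** (rmat ?b A ** nmat2 \<alpha> ?s) ** ki ** ?ni"
      by (simp only: rmat_nmat2(1)[OF aa(1) \<alpha>0(1)] matrix_mul_assoc)
    then have "?g2 ** dg (det ?P) (det ?Q) ** ?gi2 = ?n ** rmat ?b A ** ?ni"
      by (simp add: matrix_mul_assoc matrix_mul_cancel(1)[OF ki])
    ultimately show ?thesis by (simp add: \<sigma>_def)
  qed
  have stab: "stab_elem (P, 1, q) = (sl3 (ext3 P q), dg (det P) q)" if "det P * q = 1" for P and q :: "'k alg_closure"
  proof -
    have "(det P)\<^sup>2 * q = det P" using that by (simp add: power2_eq_square mult.assoc)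
    then show ?thesis by (simp add: stab_elem_def dg_def)
  qed
  have \<sigma>\<Gamma>: "\<sigma> A \<in> ?\<Gamma>" if A: "A \<in> carrier ?U" for A
  proof -
    have d: "det (evm \<alpha> A) * 1 * det (evm (- \<alpha>) A) = 1" using dets[OF A] by simp
    have "\<sigma> A = (?g ** fst (stab_elem (evm \<alpha> A, 1, det (evm (- \<alpha>) A))) ** gi, ?g2 ** snd (stab_elem (evm \<alpha> A, 1, det (evm (- \<alpha>) A))) ** ?gi2)"
      using \<sigma>[OF A] stab[OF dets[OF A]] by simp
    then show ?thesis using d by blast
  qed
  have surj: "\<exists>A\<in>carrier ?U. scalar_class z = F A" if z: "z \<in> ?\<Gamma>" for z
  proof -
    obtain B t u where B: "det B * t * u = 1"
      "z = (?g ** fst (stab_elem (B, t, u)) ** gi, ?g2 ** snd (stab_elem (B, t, u)) ** ?gi2)" using z by blast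
    have t0: "t \<noteq> 0" and "det B \<noteq> 0" using B(1) by auto
    then obtain Q where Q: "B ** dg (- ?s) 1 ** transpose Q = dg (- ?s) 1" using unitary2_partner[OF _ S] by blast
    let ?A = "mkq \<alpha> B Q"
    have A: "?A \<in> carrier ?U" unfolding iff by (simp add: evm_mkq[OF \<alpha>0(1)] Q)
    have "det B * det Q = det B * (t * u)" using unitary2_det[OF Q S] B(1) by (simp add: mult.assoc)
    then have dQ: "det Q = t * u" using \<open>det B \<noteq> 0\<close> by simp
    have f1: "fst (stab_elem (B, t, u)) = mat t ** sl3 (ext3 B (det Q))" by (simp add: stab_elem_def dQ)
    have "det B * (t * u) = 1" using B(1) by (simp add: mult.assoc)
    then have "inverse t = det B * u" by (intro inverse_unique) (simp add: ac_simps)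
    then have f2: "snd (stab_elem (B, t, u)) = mat (inverse t) ** dg (det B) (det Q)"
      using t0 by (simp add: vec_eq_iff forall_2 mat_mult_nth stab_elem_def dg_def dQ power2_eq_square)
        (metis \<open>inverse t = det B * u\<close> field_class.field_inverse mult.assoc mult.commute mult_1)
    have "z = (mat t ** fst (\<sigma> ?A), mat (inverse t) ** snd (\<sigma> ?A))"
      by (simp only: B(2) f1 f2 conj_scalar \<sigma>[OF A] evm_mkq[OF \<alpha>0(1)] fst_conv snd_conv)
    then have "scalar_class z = F ?A" using scalar_class_shift[OF t0, of "fst (\<sigma> ?A)" "snd (\<sigma> ?A)"] by (simp add: F_def)
    then show ?thesis using A by blast
  qed
  have Lam: "Lam y = Lam z" if z: "z \<in> ?\<Gamma>" and y: "y \<in> scalar_class z" for y z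
  proof -
    obtain t where t: "t \<noteq> 0" "fst y = mat (inverse t) ** fst z" using y by (auto simp: scalar_class_def)
    have "nrm (fst y) = nrm (fst z)" unfolding t(2) by (rule nrm_scale[OF _ \<Gamma>1[OF z]]) (use t(1) in simp)
    then show ?thesis by (simp add: Lam_def)
  qed
  have self: "z \<in> scalar_class z" for z :: "('k alg_closure^7^7) \<times> ('k alg_closure^2^2)"
    unfolding scalar_class_def by (intro CollectI exI[of _ 1]) simp
  have HL: "H (scalar_class z) = Lam z" if z: "z \<in> ?\<Gamma>" for z
    unfolding H_def by (rule Lam[OF z], rule someI[of "\<lambda>y. y \<in> scalar_class z" z], rule self)
  have HF: "H (F A) = A" if A: "A \<in> carrier ?U" for A
  proof -
    have "special (sl3 (ext3 (evm \<alpha> A) (det (evm (- \<alpha>) A))))"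
      by (rule special_sl3) (use dets[OF A] in \<open>simp add: det_ext3 mult.commute\<close>)
    from nrm_conj_special[OF gG gi this] have "nrm (fst (\<sigma> A)) = fst (\<sigma> A)" by (simp add: \<sigma>[OF A])
    then have "Lam (\<sigma> A) = unext3 (unbig (?fri ** (?fr ** bigm ?b (ext3q ?b A) ** ?fri) ** ?fr))"
      by (simp add: Lam_def) (simp add: \<sigma>_def)
    also have "\<dots> = A" by (simp only: frame_unbig[OF fr] unext3_ext3q)
    finally show ?thesis by (simp add: F_def HL[OF \<sigma>\<Gamma>[OF A]])
  qed
  have mult: "qmult ?b A B \<in> carrier ?U \<and> F (qmult ?b A B) = F A \<otimes>\<^bsub>?V\<^esub> F B"
    if A: "A \<in> carrier ?U" and B: "B \<in> carrier ?U" for A B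
  proof -
    have e: "evm \<alpha> (qmult ?b A B) = evm \<alpha> A ** evm \<alpha> B" "evm (- \<alpha>) (qmult ?b A B) = evm (- \<alpha>) A ** evm (- \<alpha>) B"
      by (rule evm_mult[OF aa(1)], rule evm_mult[OF aa(2)])
    have in_U: "qmult ?b A B \<in> carrier ?U"
      using A B unfolding iff e by (rule unitary2_mult)
    let ?E = "\<lambda>A. ext3 (evm \<alpha> A) (det (evm (- \<alpha>) A))"
    have dE: "det (?E A) = 1" "det (?E B) = 1" using dets[OF A] dets[OF B] by (simp_all add: det_ext3 mult.commute)
    have "fst (\<sigma> (qmult ?b A B)) = ?g ** (sl3 (?E A) ** sl3 (?E B)) ** gi"
      by (simp only: \<sigma>[OF in_U] e det_mul sl3_mult[OF dE] ext3_mult fst_conv)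
    also have "\<dots> = fst (\<sigma> A) ** fst (\<sigma> B)" by (simp only: conj_mult[OF giF, symmetric] \<sigma>[OF A] \<sigma>[OF B] fst_conv)
    finally have 1: "fst (\<sigma> (qmult ?b A B)) = fst (\<sigma> A) ** fst (\<sigma> B)" .
    have "snd (\<sigma> (qmult ?b A B)) = ?g2 ** (dg (det (evm \<alpha> A)) (det (evm (- \<alpha>) A)) ** dg (det (evm \<alpha> B)) (det (evm (- \<alpha>) B))) ** ?gi2"
      by (simp only: \<sigma>[OF in_U] e det_mul dg_mult snd_conv)
    also have "\<dots> = snd (\<sigma> A) ** snd (\<sigma> B)" by (simp only: conj_mult[OF gi2, symmetric] \<sigma>[OF A] \<sigma>[OF B] snd_conv)
    finally have "\<sigma> (qmult ?b A B) = (fst (\<sigma> A) ** fst (\<sigma> B), snd (\<sigma> A) ** snd (\<sigma> B))" using 1 by (simp add: prod_eq_iff)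
    then show ?thesis using in_U by (simp only: F_def V(3) scalar_class_mult)
  qed
  have reg1: "(\<lambda>A. fst (\<sigma> A) $ i $ j) \<in> regular_funs (range to_ac) (qcoords :: (('k alg_closure \<times> 'k alg_closure)^2^2 \<Rightarrow> 'k alg_closure) set)" for i j
    unfolding \<sigma>_def fst_conv by (rule frame_regular[OF fr]; rule regular_ext3q; simp add: range_to_ac_consts)
  have regr: "(\<lambda>A. rmat ?b A $ i $ j) \<in> regular_funs (range to_ac) (qcoords :: (('k alg_closure \<times> 'k alg_closure)^2^2 \<Rightarrow> 'k alg_closure) set)" for i j
    using exhaust_2[of i] exhaust_2[of j] unfolding rmat_def
    by (elim disjE; simp; intro regular_funs.mult regular_funs.const regular_ext3q range_to_ac_consts rangeI)
  have reg2: "(\<lambda>A. snd (\<sigma> A) $ i $ j) \<in> regular_funs (range to_ac) (qcoords :: (('k alg_closure \<times> 'k alg_closure)^2^2 \<Rightarrow> 'k alg_closure) set)" for i j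
    unfolding \<sigma>_def snd_conv
    by (intro regular_mm regr regular_funs.const range_to_ac_consts) (simp_all add: map_matrix_nth[OF field_hom_to_ac])
  have d1: "inverse (det (fst (\<sigma> A))) = det (fst (\<sigma> A))" and d2: "inverse (det (snd (\<sigma> A))) = 1" if A: "A \<in> carrier ?U" for A
  proof -
    have "special (sl3 (ext3 (evm \<alpha> A) (det (evm (- \<alpha>) A))))"
      by (rule special_sl3) (use dets[OF A] in \<open>simp add: det_ext3 mult.commute\<close>)
    then show "inverse (det (fst (\<sigma> A))) = det (fst (\<sigma> A))"
      by (simp only: \<sigma>[OF A] fst_conv det_conj[OF gi] inverse_det_special)
    show "inverse (det (snd (\<sigma> A))) = 1"
      by (simp only: \<sigma>[OF A] snd_conv det_conj[OF g2] det_dg dets[OF A] inverse_1)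
  qed
  have co: "\<exists>p\<in>regular_funs (range to_ac) (coords ?U). \<forall>A\<in>carrier ?U. c (\<sigma> A) = p A" if c: "c \<in> coords G2" for c
  proof -
    consider i j where "c = (\<lambda>z. fst z $ i $ j)" | "c = (\<lambda>z. inverse (det (fst z)))"
      | i j where "c = (\<lambda>z. snd z $ i $ j)" | "c = (\<lambda>z. inverse (det (snd z)))"
      using c by (auto simp: G2_simps G1_simps GL_simps)
    then show ?thesis
    proof cases
      case 1
      show ?thesis unfolding U(2) by (rule bexI[OF _ reg1[of i j]]) (simp add: 1)
    next
      case 2
      have "(\<lambda>A. det (fst (\<sigma> A))) \<in> regular_funs (range to_ac) qcoords"
        by (rule regular_funs_det) (rule range_to_ac_consts reg1)+
      then show ?thesis unfolding U(2) by (rule bexI[rotated]) (simp add: 2 d1)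
    next
      case 3
      show ?thesis unfolding U(2) by (rule bexI[OF _ reg2[of i j]]) (simp add: 3)
    next
      case 4
      show ?thesis by (rule bexI[OF _ regular_funs.const[OF range_to_ac_consts(2)]]) (simp add: 4 d2)
    qed
  qed
  show ?thesis
  proof (rule k_isomorphic_by_inverse[where U = ?U and F = F and H = H])
    show "F A \<in> carrier ?V" if "A \<in> carrier ?U" for A
      unfolding V(1) F_def using \<sigma>\<Gamma>[OF that] by blast
    show "\<exists>A\<in>carrier ?U. Z = F A" if Z: "Z \<in> carrier ?V" for Z
    proof -
      obtain z where "z \<in> ?\<Gamma>" "Z = scalar_class z" using Z unfolding V(1) by blast
      then show ?thesis using surj by simp
    qed
    show "H (F A) = A" if "A \<in> carrier ?U" for A by (rule HF[OF that])
    show "A \<otimes>\<^bsub>?U\<^esub> B \<in> carrier ?U \<and> F (A \<otimes>\<^bsub>?U\<^esub> B) = F A \<otimes>\<^bsub>?V\<^esub> F B"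
      if "A \<in> carrier ?U" "B \<in> carrier ?U" for A B
      using mult[OF that] by (simp only: U)
    show "k_regular_map ?U ?V F"
      unfolding k_regular_map_def
    proof
      fix c assume "c \<in> coords ?V"
      then obtain p where p: "p \<in> regular_funs (range to_ac) (coords G2)" "\<forall>z\<in>?\<Gamma>. c (scalar_class z) = p z"
        unfolding V(2) by blast
      have "\<exists>q\<in>regular_funs (range to_ac) (coords ?U). \<forall>A\<in>carrier ?U. p (\<sigma> A) = q A"
        by (rule regular_funs_subst[OF p(1) co])
      then obtain q where q: "q \<in> regular_funs (range to_ac) (coords ?U)" "\<forall>A\<in>carrier ?U. p (\<sigma> A) = q A" by blast
      show "\<exists>q\<in>regular_funs (range to_ac) (coords ?U). \<forall>A\<in>carrier ?U. c (F A) = q A"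
      proof (rule bexI[OF _ q(1)], rule ballI)
        fix A assume A: "A \<in> carrier ?U"
        have "c (F A) = p (\<sigma> A)" unfolding F_def by (rule bspec[OF p(2) \<sigma>\<Gamma>[OF A]])
        also have "\<dots> = q A" by (rule bspec[OF q(2) A])
        finally show "c (F A) = q A" .
      qed
    qed
    show "k_regular_map ?V ?U H"
      unfolding k_regular_map_def
    proof
      have ent: "(\<lambda>z. (?fri ** nrm (fst z) ** ?fr) $ i $ j) \<in> regular_funs (range to_ac) (coords G2)" for i j
        by (rule frame_regular_inverse[OF fr]) (rule regular_nrm)
      fix c assume "c \<in> coords ?U"
      then obtain i j where "c = (\<lambda>A. fst (A $ i $ j)) \<or> c = (\<lambda>A. snd (A $ i $ j))"
        unfolding U(2) by (auto simp: qcoords_def)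
      then have "\<exists>k l. \<forall>z. c (Lam z) = (?fri ** nrm (fst z) ** ?fr) $ k $ l"
      proof (elim disjE)
        assume c: "c = (\<lambda>A. fst (A $ i $ j))"
        show ?thesis
          by (rule exI[of _ "vector [2, 3, 4] $ (vector [2, 3] $ i :: 3)"], rule exI[of _ "vector [2, 3, 4] $ (vector [2, 3] $ j :: 3)"])
            (simp add: c Lam_def unext3_def unbig_def)
      next
        assume c: "c = (\<lambda>A. snd (A $ i $ j))"
        show ?thesis
          by (rule exI[of _ "vector [2, 3, 4] $ (vector [2, 3] $ i :: 3)"], rule exI[of _ "vector [5, 6, 7] $ (vector [2, 3] $ j :: 3)"])
            (simp add: c Lam_def unext3_def unbig_def)
      qed
      then obtain k l where kl: "\<And>z. c (Lam z) = (?fri ** nrm (fst z) ** ?fr) $ k $ l" by blast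
      have "(\<lambda>Z. c (H Z)) \<in> coords ?V"
        unfolding V(2)
      proof (rule CollectI, rule bexI[OF _ ent[of k l]], rule ballI)
        fix z assume "z \<in> ?\<Gamma>"
        then show "c (H (scalar_class z)) = (?fri ** nrm (fst z) ** ?fr) $ k $ l" by (simp only: HL kl)
      qed
      then show "\<exists>p\<in>regular_funs (range to_ac) (coords ?V). \<forall>Z\<in>carrier ?V. c (H Z) = p Z"
        by (intro bexI[OF _ regular_funs.coord]) simp_all
    qed
  qed
qed

section \<open>The classification\<close>

theorem mainTheorem1:
  shows
    "(bij_betw alpha1 (orbits G1 (Vss1 :: ('k::field_char_0 ^ 7) set) (*v)) Ex2 \<and>
      (\<forall>x \<in> (Vss1 :: ('k ^ 7) set). \<forall>\<alpha> :: 'k alg_closure. \<forall>a :: 'k.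
         \<alpha> \<notin> range to_ac \<and> \<alpha>\<^sup>2 = to_ac a \<and> alpha1 (orbit G1 (*v) x) = adjoin {\<alpha>} \<longrightarrow>
         k_isomorphic (identity_component (stab_group G1 (*v) (base_change1 x)))
                      (SU21 (to_ac a)))) \<and>
     (is_singleton {Ob \<in> orbits G2 (Vss2 :: ('k ^ 7 ^ 2) set) act2. alpha2 Ob = range to_ac} \<and>
      (\<forall>\<alpha> :: 'k alg_closure. \<forall>a :: 'k. \<alpha> \<notin> range to_ac \<and> \<alpha>\<^sup>2 = to_ac a \<longrightarrow>
         (\<exists>\<phi>. bij_betw \<phi> (inversion_orbit a ` carrier (norm_quotient a))
                 {Ob \<in> orbits G2 (Vss2 :: ('k ^ 7 ^ 2) set) act2. alpha2 Ob = adjoin {\<alpha>}} \<and>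
              (\<forall>s. s \<noteq> 0 \<longrightarrow>
                 (\<exists>y \<in> Vss2. map_matrix to_ac y = w_alpha \<alpha> s \<and>
                    \<phi> (inversion_orbit a (norm_coset a s)) = orbit G2 act2 y))) \<and>
         (\<forall>x \<in> (Vss2 :: ('k ^ 7 ^ 2) set). \<forall>s. s \<noteq> 0 \<and> corresponds \<alpha> x s \<longrightarrow>
            k_isomorphic
              (quotient_group (identity_component (stab_group G2 act2 (map_matrix to_ac x))) Ttilde)
              (unitary_group (to_ac a) (qdiag (\<lambda>i. if i = 1 then - to_ac s else 1))))))"
proof (intro conjI ballI allI impI)
  show "bij_betw alpha1 (orbits G1 (Vss1 :: ('k ^ 7) set) (*v)) Ex2" by (rule alpha1_bij)
next
  fix x :: "'k ^ 7" and \<alpha> :: "'k alg_closure" and a :: 'k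
  assume "x \<in> Vss1" "\<alpha> \<notin> range to_ac \<and> \<alpha>\<^sup>2 = to_ac a \<and> alpha1 (orbit G1 (*v) x) = adjoin {\<alpha>}"
  then show "k_isomorphic (identity_component (stab_group G1 (*v) (base_change1 x))) (SU21 (to_ac a))"
    by (intro stabilizer_SU21[of x \<alpha> a]) (simp_all add: Vss1_def)
next
  show "is_singleton {Ob \<in> orbits G2 (Vss2 :: ('k ^ 7 ^ 2) set) act2. alpha2 Ob = range to_ac}"
    by (rule split_orbit_singleton)
next
  fix \<alpha> :: "'k alg_closure" and a :: 'k
  assume "\<alpha> \<notin> range to_ac \<and> \<alpha>\<^sup>2 = to_ac a"
  then show "\<exists>\<phi>. bij_betw \<phi> (inversion_orbit a ` carrier (norm_quotient a))
                 {Ob \<in> orbits G2 (Vss2 :: ('k ^ 7 ^ 2) set) act2. alpha2 Ob = adjoin {\<alpha>}} \<and>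
              (\<forall>s. s \<noteq> 0 \<longrightarrow>
                 (\<exists>y \<in> Vss2. map_matrix to_ac y = w_alpha \<alpha> s \<and>
                    \<phi> (inversion_orbit a (norm_coset a s)) = orbit G2 act2 y))"
    by (intro alpha2_fibre_bij) simp_all
next
  fix \<alpha> :: "'k alg_closure" and a :: 'k and x :: "'k ^ 7 ^ 2" and s :: 'k
  assume "\<alpha> \<notin> range to_ac \<and> \<alpha>\<^sup>2 = to_ac a" "s \<noteq> 0 \<and> corresponds \<alpha> x s"
  then show "k_isomorphic
      (quotient_group (identity_component (stab_group G2 act2 (map_matrix to_ac x))) Ttilde)
      (unitary_group (to_ac a) (qdiag (\<lambda>i. if i = 1 then - to_ac s else 1)))"
    by (intro stabilizer_unitary[where \<alpha> = \<alpha>]) simp_all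
qed

end
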